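(* Let $f$ be a rational map of $\widehat{\mathbb{C}}$ with $\deg f\ge 2$ and with disconnected Julia set. Suppose that each full wandering Julia component of $f$ contains at most one critical value of $f$. Then for any wandering Julia component $K$ of $f$, $\widehat{\mathbb{C}}\setminus f^n(K)$ has at most two connected components for all sufficiently large $n\ge 0$.
   Context: A Julia component of a rational map $f$ is a connected component of its Julia set $J_f$. For a Julia component $K$, each $f^n(K)$ is again a Julia component. $K$ is eventually periodic if its forward orbit $\{f^n(K)\}_{n\ge 0}$ consists of finitely many components, and wandering otherwise. A compact set in $\widehat{\mathbb{C}}$ is full if its complement in $\widehat{\mathbb{C}}$ is connected. Critical values are counted as points, without multiplicity. *)

theory Defs
  imports "HOL-Analysis.Analysis" "HOL-Computational_Algebra.Polynomial"
begin

datatype riemann_sphere = Fin complex | Infty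

text \<open>Stereographic projection onto the unit sphere of \<^typ>\<open>complex \<times> real\<close>; the chordal
  metric on the Riemann sphere is the Euclidean distance of the images.\<close>

fun stereo :: "riemann_sphere \<Rightarrow> complex \<times> real" where
  "stereo (Fin z) =
     (of_real (2 / ((cmod z)\<^sup>2 + 1)) * z, ((cmod z)\<^sup>2 - 1) / ((cmod z)\<^sup>2 + 1))"
| "stereo Infty = (0, 1)"

lemma stereo_snd_inject:
  assumes "(a - 1) / (a + 1) = (b - 1) / (b + 1)" "a \<ge> 0" "b \<ge> (0::real)"
  shows "a = b"
proof -
  have "a + 1 \<noteq> 0" "b + 1 \<noteq> 0"
    using assms by auto
  then have "(a - 1) * (b + 1) = (b - 1) * (a + 1)"
    using assms(1) by (simp add: frac_eq_eq)
  then show ?thesis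
    by (simp add: algebra_simps)
qed

lemma stereo_snd_neq_1:
  assumes "a \<ge> (0::real)"
  shows "(a - 1) / (a + 1) \<noteq> 1"
proof -
  have "a + 1 \<noteq> 0"
    using assms by linarith
  then show ?thesis
    by (simp add: divide_eq_eq)
qed

lemma stereo_Fin_inject:
  assumes "stereo (Fin z) = stereo (Fin w)"
  shows "z = w"
proof -
  define c where "c = 2 / ((cmod w)\<^sup>2 + 1)"
  have "(cmod z)\<^sup>2 = (cmod w)\<^sup>2"
    using assms unfolding stereo.simps prod.inject
    by (elim conjE) (rule stereo_snd_inject, assumption, rule zero_le_power2, rule zero_le_power2)
  then have "of_real c * z = of_real c * w"
    using assms unfolding stereo.simps prod.inject c_def
    by (elim conjE) (erule subst, assumption)
  moreover have "(cmod w)\<^sup>2 + 1 \<noteq> 0"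
    using zero_le_power2[of "cmod w"] by linarith
  then have "c \<noteq> 0"
    by (simp add: c_def)
  ultimately show ?thesis
    by simp
qed

lemma stereo_Fin_neq_Infty: "stereo (Fin z) \<noteq> stereo Infty"
  unfolding stereo.simps prod.inject
  using stereo_snd_neq_1[OF zero_le_power2] by blast

lemma inj_stereo: "inj stereo"
proof (rule injI)
  fix x y assume "stereo x = stereo y"
  then show "x = y"
    by (cases x; cases y)
      (auto dest: stereo_Fin_inject simp del: stereo.simps
        simp: stereo_Fin_neq_Infty stereo_Fin_neq_Infty[symmetric])
qed

instantiation riemann_sphere :: metric_space
begin

definition dist_riemann_sphere_def:
  "dist x y = dist (stereo x) (stereo y)"

definition uniformity_riemann_sphere_def [code del]:
  "(uniformity :: (riemann_sphere \<times> riemann_sphere) filter) =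
     (INF e\<in>{0<..}. principal {(x, y). dist x y < e})"

definition open_riemann_sphere_def [code del]:
  "open (U :: riemann_sphere set) \<longleftrightarrow>
     (\<forall>x\<in>U. eventually (\<lambda>(x', y). x' = x \<longrightarrow> y \<in> U) uniformity)"

instance
proof
  fix x y z :: riemann_sphere
  show "(dist x y = 0) = (x = y)"
    using inj_stereo by (auto simp: dist_riemann_sphere_def inj_eq)
  show "dist x y \<le> dist x z + dist y z"
    unfolding dist_riemann_sphere_def by (rule dist_triangle2)
qed (simp_all add: uniformity_riemann_sphere_def open_riemann_sphere_def)

end

text \<open>The map \<open>p / q\<close>, for coprime \<open>p\<close> and \<open>q\<close>. With \<open>d = max (degree p) (degree q)\<close>, its value at
  infinity is the quotient of the coefficients of degree \<open>d\<close>, which do not both vanish.\<close>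

fun rational_map :: "complex poly \<Rightarrow> complex poly \<Rightarrow> riemann_sphere \<Rightarrow> riemann_sphere" where
  "rational_map p q (Fin z) = (if poly q z = 0 then Infty else Fin (poly p z / poly q z))"
| "rational_map p q Infty =
     (let d = max (degree p) (degree q)
      in if coeff q d = 0 then Infty else Fin (coeff p d / coeff q d))"

definition rational_map_of_degree :: "(riemann_sphere \<Rightarrow> riemann_sphere) \<Rightarrow> nat \<Rightarrow> bool" where
  "rational_map_of_degree f d \<longleftrightarrow>
     (\<exists>p q. coprime p q \<and> d = max (degree p) (degree q) \<and> f = rational_map p q)"

definition normal_on ::
  "riemann_sphere set \<Rightarrow> (riemann_sphere \<Rightarrow> riemann_sphere) set \<Rightarrow> bool" where
  "normal_on U F \<longleftrightarrow>
     (\<forall>g::nat \<Rightarrow> riemann_sphere \<Rightarrow> riemann_sphere. range g \<subseteq> F \<longrightarrow>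
        (\<exists>r h. strict_mono (r :: nat \<Rightarrow> nat) \<and>
           (\<forall>K. compact K \<and> K \<subseteq> U \<longrightarrow> uniform_limit K (g \<circ> r) h sequentially)))"

definition fatou_set :: "(riemann_sphere \<Rightarrow> riemann_sphere) \<Rightarrow> riemann_sphere set" where
  "fatou_set f = \<Union> {U. open U \<and> normal_on U (range (\<lambda>n. f ^^ n))}"

definition julia_set :: "(riemann_sphere \<Rightarrow> riemann_sphere) \<Rightarrow> riemann_sphere set" where
  "julia_set f = - fatou_set f"

definition julia_component :: "(riemann_sphere \<Rightarrow> riemann_sphere) \<Rightarrow> riemann_sphere set \<Rightarrow> bool" where
  "julia_component f K \<longleftrightarrow> K \<in> components (julia_set f)"

definition eventually_periodic ::
  "(riemann_sphere \<Rightarrow> riemann_sphere) \<Rightarrow> riemann_sphere set \<Rightarrow> bool" where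
  "eventually_periodic f K \<longleftrightarrow> finite (range (\<lambda>n. (f ^^ n) ` K))"

definition wandering_julia_component ::
  "(riemann_sphere \<Rightarrow> riemann_sphere) \<Rightarrow> riemann_sphere set \<Rightarrow> bool" where
  "wandering_julia_component f K \<longleftrightarrow> julia_component f K \<and> \<not> eventually_periodic f K"

definition full :: "riemann_sphere set \<Rightarrow> bool" where
  "full K \<longleftrightarrow> compact K \<and> connected (- K)"

text \<open>\<open>coordinate a\<close> is the local coordinate \<open>z\<close> near a finite point \<open>a\<close> and \<open>1 / z\<close> near
  \<^const>\<open>Infty\<close>, and \<open>parametrization a\<close> is its inverse. The value of a coordinate at its pole is
  irrelevant, as the pole is bounded away from \<open>a\<close>.\<close>

fun coordinate :: "riemann_sphere \<Rightarrow> riemann_sphere \<Rightarrow> complex" where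
  "coordinate (Fin a) (Fin z) = z"
| "coordinate (Fin a) Infty = undefined"
| "coordinate Infty (Fin z) = (if z = 0 then undefined else 1 / z)"
| "coordinate Infty Infty = 0"

fun parametrization :: "riemann_sphere \<Rightarrow> complex \<Rightarrow> riemann_sphere" where
  "parametrization (Fin a) w = Fin w"
| "parametrization Infty w = (if w = 0 then Infty else Fin (1 / w))"

definition critical_point ::
  "(riemann_sphere \<Rightarrow> riemann_sphere) \<Rightarrow> riemann_sphere \<Rightarrow> bool" where
  "critical_point f c \<longleftrightarrow>
     ((\<lambda>w. coordinate (f c) (f (parametrization c w))) has_field_derivative 0)
       (at (coordinate c c))"

definition critical_value ::
  "(riemann_sphere \<Rightarrow> riemann_sphere) \<Rightarrow> riemann_sphere \<Rightarrow> bool" where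
  "critical_value f v \<longleftrightarrow> (\<exists>c. critical_point f c \<and> v = f c)"

end

theory Submission
  imports Defs "HOL-Complex_Analysis.Complex_Analysis"
    "HOL-Computational_Algebra.Fundamental_Theorem_Algebra" "HOL-Library.Ramsey"
begin

text \<open>
  Suppose that all the images \<open>K n\<close> of a wandering component have at least three complementary discs.
  Boundary behaviour makes \<open>f\<close> induce a map from the discs of \<open>K n\<close> to those of \<open>K (n + 1)\<close>. A disc
  whose orbit avoided the critical values would contain a wandering domain, so every orbit of discs
  meets critical values again and again; but as the \<open>K n\<close> are disjoint, at most two discs of \<open>K n\<close>
  meet a given finite set for large \<open>n\<close>. Hence long stretches occur during which the complement of one
  disc contains at most one critical value and is pulled back as a branched disc. Either these
  pull-backs produce a wandering domain, or they nest down to a full wandering Julia component that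
  contains two critical values.

  Wandering domains with univalent iterates are excluded without quasiconformal surgery: place weights
  at more points of the domain than there are critical points to control, carry them along the grand
  orbit by the squares of the derivatives, and take the Cauchy transform \<open>u\<close>. Finitely many linear
  conditions on the weights give \<open>u (f z) = f' z * u z\<close>. As \<open>u\<close> is bounded off the grand orbit while the
  iterates have unbounded derivatives near the Julia set, \<open>u\<close> vanishes there, and this forces the
  weights to vanish although a nonzero choice exists.\<close>

section \<open>Topology of the sphere\<close>

text \<open>The topological obstacle is that the image of a complementary disc may be much larger
  than a disc, even the whole sphere, so only behaviour near the boundary is transported. Exact
  images are available for the complements of pulled-back discs, and the chains therefore follow
  complements. A map of degree at least 2 has two critical values. At the end of a chain the
  complement contains none, so it cannot cover the sphere together with another one that contains at
  most one; only disjoint or nested positions remain. In the analytic part the squared derivative of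
  a branch is comparable with the area of the disc it parametrises. These discs are disjoint and
  bounded, so their areas are summable, and the Cauchy transform converges even where its poles
  accumulate. The relation for \<open>u\<close> says that \<open>u\<close> is an invariant vector
  field. A point of the wandering domain is put at infinity to keep the rest bounded; the price is a
  pole of order up to three at its image \<open>b\<close>, since the numerator needed for decay is a
  cube. This explains three linear conditions besides one for each zero of the Wronskian of
  \<open>p\<close> and \<open>q\<close>.\<close>

fun fin :: "riemann_sphere => complex" where
 "fin (Fin z) = z"
| "fin Infty = 0"

fun iota :: "riemann_sphere => riemann_sphere" where
 "iota (Fin z) = (if z = 0 then Infty else Fin (1 / z))"
| "iota Infty = Fin 0"

lemma Fin_fin: "x ~= Infty ==> Fin (fin x) = x" by (cases x) auto

lemma range_Fin: "range Fin = - {Infty}" by (auto intro: riemann_sphere.exhaust)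

lemma inj_Fin: "inj Fin" by (simp add: inj_def)

lemma iota_iota [simp]: "iota (iota x) = x" by (cases x) auto

lemma tendsto_stereo_iff: "(F \<longlongrightarrow> l) net \<longleftrightarrow> ((%x. stereo (F x)) \<longlongrightarrow> stereo l) net"
 by (simp add: tendsto_iff dist_riemann_sphere_def)

lemma continuous_on_stereo_iff:
 "continuous_on S F \<longleftrightarrow> continuous_on S (%x. stereo (F x))"
 unfolding continuous_on_def tendsto_stereo_iff ..

lemma continuous_on_stereo: "continuous_on S stereo"
 using continuous_on_stereo_iff[of S id] by (simp add: o_def id_def continuous_on_id)

lemma sq_add_one_neq_0: "(cmod z)\<^sup>2 + 1 ~= 0" "of_real ((cmod z)\<^sup>2 + 1) ~= (0::complex)"
proof -
 show "(cmod z)\<^sup>2 + 1 ~= 0" using zero_le_power2[of "cmod z"] by linarith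
 thus "of_real ((cmod z)\<^sup>2 + 1) ~= (0::complex)" using of_real_eq_0_iff by blast
qed

lemma continuous_on_Fin: "continuous_on S Fin" unfolding continuous_on_stereo_iff stereo.simps
 by (intro continuous_intros) (use sq_add_one_neq_0 in auto)

text \<open>Inverse stereographic projection. It also holds at \<open>Infty\<close>, where division
  by zero makes the right side 0, the default value of \<open>fin Infty\<close>.\<close>

lemma fin_stereo: "fin x = of_real (1 / (1 - snd (stereo x))) * fst (stereo x)"
proof (cases x)
 case (Fin z)
 define s where "s = (cmod z)\<^sup>2 + 1"
 have s: "s ~= 0" using sq_add_one_neq_0 s_def by simp
 have "1 - ((cmod z)\<^sup>2 - 1) / s = 2 / s" using s unfolding s_def by (simp add: field_simps)
 hence "1 / (1 - ((cmod z)\<^sup>2 - 1) / s) * (2 / s) = 1" using s by simp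
 hence "of_real (1 / (1 - ((cmod z)\<^sup>2 - 1) / s)) * (of_real (2 / s) * z) = z"
  by (metis mult.assoc mult_1 of_real_1 of_real_mult)
 thus ?thesis by (simp add: Fin s_def)
qed auto

lemma snd_stereo_eq_1: "snd (stereo x) = 1 \<longleftrightarrow> x = Infty"
 using stereo_snd_neq_1[OF zero_le_power2] by (cases x) auto

lemma continuous_on_fin: "continuous_on (- {Infty}) fin" unfolding fin_stereo
 by (intro continuous_intros continuous_on_stereo) (auto simp: snd_stereo_eq_1)

text \<open>Inversion is the restriction of a linear isometry of
  \<open>complex \<times> real\<close>; hence it preserves the chordal distance.\<close>

lemma stereo_iota: "stereo (iota x) = (cnj (fst (stereo x)), - snd (stereo x))"
proof (cases x)
 case (Fin z)
 show ?thesis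
 proof (cases "z = 0")
  case False
  define a where "a = (cmod z)\<^sup>2"
  have a: "a > 0" using False a_def by simp
  have zz: "z * cnj z = of_real a" unfolding a_def by (simp add: complex_norm_square[symmetric])
  have 1: "(1 / a - 1) / (1 / a + 1) = - ((a - 1) / (a + 1))" using a by (simp add: divide_simps)
  have 2: "2 / (1 / a + 1) = 2 / (a + 1) * a" using a by (simp add: field_simps)
  have "of_real (2 / (1 / a + 1)) * (1 / z) = of_real (2 / (a + 1)) * cnj z"
   using zz[symmetric] False unfolding 2 by (simp add: field_simps)
  thus ?thesis using 1 False by (simp add: Fin a_def norm_divide power_divide)
 qed (simp add: Fin)
qed auto

lemma dist_iota [simp]: "dist (iota x) (iota y) = dist x y"
 by (simp add: dist_riemann_sphere_def stereo_iota dist_prod_def dist_norm power2_commute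
   flip: complex_cnj_diff)

lemma continuous_on_iota: "continuous_on S iota" unfolding continuous_on_iff by force

lemma norm_stereo: "norm (stereo x) = 1"
proof (cases x)
 case (Fin z)
 define a where "a = (cmod z)\<^sup>2"
 have a: "a + 1 > 0" unfolding a_def by (simp add: add_nonneg_pos)
 have "(norm (stereo x))\<^sup>2 = (cmod (of_real (2 / (a + 1)) * z))\<^sup>2 + ((a - 1) / (a + 1))\<^sup>2"
  by (simp add: Fin a_def norm_prod_def power_divide)
 also have "(cmod (of_real (2 / (a + 1)) * z))\<^sup>2 = (2 / (a + 1))\<^sup>2 * a"
  by (simp only: norm_mult norm_of_real power_mult_distrib power2_abs a_def)
 also have "(2 / (a + 1))\<^sup>2 * a + ((a - 1) / (a + 1))\<^sup>2 = (4 * a + (a - 1)\<^sup>2) / (a + 1)\<^sup>2"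
  by (simp add: power_divide add_divide_distrib)
 also have "4 * a + (a - 1)\<^sup>2 = (a + 1)\<^sup>2" by (simp add: power2_eq_square algebra_simps)
 finally have "(norm (stereo x))\<^sup>2 = 1\<^sup>2" using a by simp
 thus ?thesis using norm_ge_zero power2_eq_iff_nonneg zero_le_one by blast
qed (simp add: norm_prod_def)

lemma range_stereo: "range stereo = sphere 0 1"
proof
 show "sphere 0 1 \<subseteq> range stereo"
 proof
  fix p :: "complex \<times> real" assume p: "p \<in> sphere 0 1"
  obtain w t where wt: "p = (w, t)" by fastforce
  have eq: "(cmod w)\<^sup>2 + t\<^sup>2 = 1" using p by (simp add: wt norm_prod_def)
  show "p \<in> range stereo"
  proof (cases "t = 1")
   case True
   hence "p = stereo Infty" using eq wt by simp
   thus ?thesis by blast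
  next
   case False
   have "t <= 1" using eq by (smt (verit) one_less_power pos2 zero_le_power2)
   hence t: "1 - t > 0" using False by simp
   \<comment> \<open>Obtained by solving \<open>stereo (Fin z) = (w, t)\<close> for
     \<open>z\<close>.\<close>
   define z where "z = of_real (1 / (1 - t)) * w"
   have "(cmod z)\<^sup>2 = (1 - t\<^sup>2) / (1 - t)\<^sup>2"
    using eq t by (simp only: z_def norm_mult norm_of_real power_mult_distrib power2_abs)
     (simp add: field_simps power2_eq_square)
   also have "... = (1 + t) / (1 - t)"
    using t by (simp add: divide_simps power2_eq_square) (simp add: algebra_simps)
   finally have z: "(cmod z)\<^sup>2 = (1 + t) / (1 - t)" .
   have "(cmod z)\<^sup>2 + 1 = 2 / (1 - t)" "((cmod z)\<^sup>2 - 1) / ((cmod z)\<^sup>2 + 1) = t"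
    unfolding z using t by (simp_all add: divide_simps)
   hence "stereo (Fin z) = p" using t by (simp add: wt z_def flip: of_real_mult of_real_divide)
   thus ?thesis by blast
  qed
 qed
qed (auto simp: norm_stereo)

definition unstereo :: "complex \<times> real => riemann_sphere" where
 "unstereo = inv stereo"

lemma unstereo_stereo [simp]: "unstereo (stereo x) = x" by (simp add: unstereo_def inj_stereo)

lemma continuous_on_unstereo: "continuous_on (sphere 0 1) unstereo"
 unfolding range_stereo[symmetric] continuous_on_iff by (auto simp: dist_riemann_sphere_def)

lemma homeomorphism_stereo: "homeomorphism UNIV (sphere 0 1) stereo unstereo"
 using continuous_on_unstereo continuous_on_stereo
 by (intro homeomorphismI) (auto simp: norm_stereo simp flip: range_stereo)

lemma compact_UNIV_sphere: "compact (UNIV :: riemann_sphere set)"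
proof -
 have "unstereo ` sphere 0 1 = UNIV" using homeomorphism_stereo by (simp add: homeomorphism_def)
 thus ?thesis using compact_continuous_image[OF continuous_on_unstereo] by (metis compact_sphere)
qed

lemma compact_sphere_iff: "compact (S :: riemann_sphere set) \<longleftrightarrow> closed S"
 using compact_UNIV_sphere closed_Int_compact compact_imp_closed by (metis inf_top_right)

lemma open_Fin_image: "open S ==> open (Fin ` S)"
proof -
 assume "open S"
 hence "open (- {Infty} Int fin -` S)" using continuous_open_preimage[OF continuous_on_fin] by blast
 moreover have "- {Infty} Int fin -` S = Fin ` S" using Fin_fin by (auto simp: image_iff) (metis)+
 ultimately show ?thesis by simp
qed

lemma iota_image: "iota ` S = iota -` S" by (auto simp: image_iff) (metis iota_iota)

lemma open_iota_image: "open S ==> open (iota ` S)"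
 unfolding iota_image using continuous_on_iota open_vimage continuous_on_eq_continuous_at by blast

lemma connected_UNIV_sphere: "connected (UNIV :: riemann_sphere set)"
proof -
 have c: "connected (range Fin)"
  by (intro connected_continuous_image continuous_on_Fin connected_UNIV)
 have "range Fin Un iota ` range Fin = UNIV"
 proof -
  have "x \<in> range Fin Un iota ` range Fin" for x
   by (cases x) (auto intro!: image_eqI[of Infty iota "Fin 0"])
  thus ?thesis by blast
 qed
 moreover have "Fin 1 \<in> range Fin Int iota ` range Fin"
  by (auto simp: image_iff intro!: exI[of _ 1])
 ultimately show ?thesis
  using connected_Un[OF c connected_continuous_image[OF continuous_on_iota c]] by (metis empty_iff)
qed

text \<open>Both charts are injections of the whole plane, so local questions on the sphere reduce
  to plane analysis without treating \<open>Infty\<close> apart.\<close>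

definition charts :: "(complex => riemann_sphere) set" where
 "charts = {Fin, iota o Fin}"

lemma chart_props:
 assumes "h \<in> charts"
 shows "continuous_on S h" "inj h" "open A ==> open (h ` A)"
proof -
 show "continuous_on S h" using assms continuous_on_Fin continuous_on_iota unfolding charts_def
  by (auto intro!: continuous_on_compose)
 show "inj h" using assms inj_Fin inj_on_inverseI[of UNIV iota iota] unfolding charts_def
  by (auto intro!: inj_compose)
 show "open A ==> open (h ` A)"
  using assms open_Fin_image[of A] open_iota_image[of "Fin ` A"] unfolding charts_def
  by (auto simp only: image_comp[symmetric] insert_iff empty_iff)
qed

lemma chart_at:
 obtains h z where "h \<in> charts" "h z = x"
proof (cases x)
 case (Fin z)
 thus ?thesis using that[of Fin z] by (simp add: charts_def)
next
 case Infty
 thus ?thesis using that[of "iota o Fin" 0] by (simp add: charts_def)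
qed

lemma chart_cball_subset:
 assumes "h \<in> charts" "open U" "h z \<in> U"
 obtains r where "r > 0" "h ` cball z r \<subseteq> U"
proof -
 have "open (h -` U)" using assms chart_props(1) continuous_open_vimage by (metis open_vimage)
 then obtain r where "r > 0" "cball z r \<subseteq> h -` U"
  using assms by (meson open_contains_cball vimageI)
 thus ?thesis using that by blast
qed

section \<open>Local connectedness and complementary components\<close>

lemma connected_nbhd:
 assumes "open U" "(x :: riemann_sphere) \<in> U"
 obtains V where "open V" "connected V" "x \<in> V" "V \<subseteq> U"
proof -
 obtain h z where h: "h \<in> charts" "h z = x" by (rule chart_at)
 then obtain r where r: "r > 0" "h ` cball z r \<subseteq> U"
  using chart_cball_subset assms by metis
 show ?thesis
 proof (rule that)
  show "open (h ` ball z r)" using chart_props h by blast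
  show "connected (h ` ball z r)" using chart_props(1) h connected_continuous_image by blast
  show "x \<in> h ` ball z r" using h r by force
  show "h ` ball z r \<subseteq> U" using r by force
 qed
qed

lemma open_component_sphere:
 assumes "open U" "D \<in> components (U :: riemann_sphere set)"
 shows "open D" unfolding open_subopen[of D]
proof
 fix x assume x: "x \<in> D"
 hence "x \<in> U" using assms(2) in_components_subset by blast
 then obtain V where V: "open V" "connected V" "x \<in> V" "V \<subseteq> U"
  using connected_nbhd assms(1) by metis
 hence "V \<subseteq> D" using assms x components_maximal by blast
 thus "EX T. open T & x \<in> T & T \<subseteq> D" using V by blast
qed

lemma clopen_sphere:
 assumes "open (S :: riemann_sphere set)" "closed S"
 shows "S = {} | S = UNIV" using connected_UNIV_sphere assms unfolding connected_clopen by simp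

text \<open>A punctured disc around \<open>e\<close> is connected, so it lies on one side of any
  separation of \<open>S - {e}\<close>. Adding the full disc to that side would separate
  \<open>S\<close>.\<close>

lemma connected_delete_interior_point:
 assumes S: "connected S" and e: "(e :: riemann_sphere) \<in> interior S"
 shows "connected (S - {e})"
proof (rule connectedI)
 fix A B assume AB: "open A" "open B" "A Int (S - {e}) ~= {}" "B Int (S - {e}) ~= {}"
  "A Int B Int (S - {e}) = {}" "S - {e} \<subseteq> A Un B"
 obtain h z where h: "h \<in> charts" "h z = e" by (rule chart_at)
 then obtain r where r: "r > 0" "h ` cball z r \<subseteq> interior S"
  using chart_cball_subset e by (metis open_interior)
 define P where "P = h ` (ball z r - {z})"
 have PS: "P \<subseteq> S - {e}"
  using r(2) interior_subset[of S] ball_subset_cball[of z r] chart_props(2)[OF h(1)] h(2)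
  unfolding P_def by (fastforce dest: injD)
 have P: "connected P"
  unfolding P_def using chart_props(1)[OF h(1)] connected_punctured_ball[of z r]
  by (intro connected_continuous_image) auto
 have *: False if AB: "open A" "open B" "A Int (S - {e}) ~= {}" "B Int (S - {e}) ~= {}"
  "A Int B Int (S - {e}) = {}" "S - {e} \<subseteq> A Un B" "P \<subseteq> A" for A B
 proof -
  let ?A = "A Un h ` ball z r"
  let ?B = "B - {e}"
  have "h ` ball z r \<subseteq> insert e P" unfolding P_def using h by auto
  hence 1: "?A Int ?B Int S = {}" using AB by blast
  have "e \<in> h ` ball z r" using h r by force
  hence 2: "S \<subseteq> ?A Un ?B" using AB by blast
  have 3: "open ?A" "open ?B" using AB chart_props(3)[OF h(1)] by auto
  have 4: "?A Int S ~= {}" "?B Int S ~= {}" using AB by auto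
  show False using connectedD[OF S 3 1 2] 4 by simp
 qed
 have "P \<subseteq> A | P \<subseteq> B"
 proof -
  have "A Int B Int P = {}" "P \<subseteq> A Un B" using AB(5,6) PS by auto
  hence "A Int P = {} | B Int P = {}" using connectedD[OF P AB(1,2)] by simp
  thus ?thesis using `P \<subseteq> A Un B` by auto
 qed
 thus False
 proof
  assume "P \<subseteq> A"
  thus False using *[OF AB] by simp
 next
  assume "P \<subseteq> B"
  thus False using *[OF AB(2,1,4,3)] AB(5,6) by (metis Int_commute Un_commute)
 qed
qed

text \<open>A frontier point off \<open>K\<close> would have a connected neighbourhood off
  \<open>K\<close> that meets \<open>D\<close> and so belongs to it. An empty frontier would make
  \<open>D\<close> clopen, which the nonempty \<open>K\<close> forbids.\<close>

lemma complement_component: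
 assumes K: "closed K" "K ~= {}" and D: "D \<in> components (- K :: riemann_sphere set)"
 shows "open D" "connected D" "D ~= {}" "D Int K = {}" "frontier D \<subseteq> K" "frontier D ~= {}"
proof -
 show 1: "open D" using open_component_sphere K D by (meson open_Compl)
 show "connected D" "D ~= {}" "D Int K = {}"
  using D in_components_connected in_components_nonempty in_components_subset by blast+
 show "frontier D \<subseteq> K"
 proof
  fix x assume x: "x \<in> frontier D"
  show "x \<in> K"
  proof (rule ccontr)
   assume "x ~: K"
   then obtain V where V: "open V" "connected V" "x \<in> V" "V \<subseteq> - K"
    using connected_nbhd[of "- K" x] K by auto
   have "V Int D ~= {}" using x V 1 by (auto simp: frontier_def closure_iff_nhds_not_empty)
   hence "V \<subseteq> D" using D V components_maximal by blast
   thus False using x V 1 by (auto simp: frontier_def interior_open)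
  qed
 qed
 show "frontier D ~= {}"
 proof
  assume "frontier D = {}"
  hence "closed D" using 1 by (simp add: frontier_def interior_open closure_subset_eq)
  thus False using clopen_sphere[OF 1] `D ~= {}` `D Int K = {}` K by auto
 qed
qed

lemma connected_component_Un:
 assumes K: "closed K" "K ~= {}" "connected K" and D: "D \<in> components (- K :: riemann_sphere set)"
 shows "connected (D Un K)"
proof -
 note cc = complement_component[OF K(1,2) D]
 obtain x where x: "x \<in> frontier D" using cc by blast
 have "connected (closure D)" using cc connected_imp_connected_closure by blast
 moreover have "x \<in> closure D Int K" using x cc by (auto simp: frontier_def)
 ultimately have "connected (closure D Un K)" using K connected_Un by blast
 moreover have "closure D Un K = D Un K" using cc closure_Un_frontier[of D] by blast
 ultimately show ?thesis by simp
qed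

text \<open>The complement of \<open>D\<close> is the union of \<open>K\<close> and the sets
  \<open>E Un K\<close> for the other components \<open>E\<close>: connected sets that all contain
  \<open>K\<close>.\<close>

lemma connected_complement_component_sphere:
 assumes K: "closed K" "K ~= {}" "connected K" and D: "D \<in> components (- K :: riemann_sphere set)"
 shows "connected (- D)"
proof -
 have eq: "- D = \<Union> ((%E. E Un K) ` (components (- K) - {D}) Un {K})"
 proof -
  have "D Int K = {}" using in_components_subset[OF D] by blast
  hence 1: "x ~: D" if "x \<in> E Un K" "E \<in> components (- K)" "E ~= D" for x E
   using that components_nonoverlap[OF D that(2)] by auto
  have 2: "x \<in> \<Union> ((%E. E Un K) ` (components (- K) - {D}) Un {K})" if "x ~: D" for x
  proof (cases "x \<in> K")
   case False
   hence "x \<in> \<Union> (components (- K))" by simp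
   then obtain E where "E \<in> components (- K)" "x \<in> E" by blast
   thus ?thesis using that by (intro UnionI[of "E Un K"]) auto
  qed auto
  show ?thesis
  proof (intro set_eqI iffI)
   fix x assume "x \<in> \<Union> ((%E. E Un K) ` (components (- K) - {D}) Un {K})"
   then consider "x \<in> K" | E where "E \<in> components (- K)" "E ~= D" "x \<in> E Un K"
    by (auto simp del: Union_components split: if_splits)
   thus "x \<in> - D" using 1 `D Int K = {}` by cases auto
  qed (use 2 in simp)
 qed
 show ?thesis unfolding eq
 proof (rule connected_Union)
  show "connected s" if "s \<in> (%E. E Un K) ` (components (- K) - {D}) Un {K}" for s
   using that connected_component_Un K by auto
  show "\<Inter> ((%E. E Un K) ` (components (- K) - {D}) Un {K}) ~= {}" using K by auto
 qed
qed

lemma connected_delete_finite: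
 assumes "connected S" "open (S :: riemann_sphere set)" "finite A"
 shows "connected (S - A)" using assms(3)
proof (induction A)
 case (insert a A)
 have o: "open (S - A)" using assms(2) finite_imp_closed[OF insert.hyps(1)] by blast
 show ?case
 proof (cases "a \<in> S - A")
  case True
  hence "connected ((S - A) - {a})"
   using connected_delete_interior_point[OF insert.IH] interior_open[OF o] by simp
  thus ?thesis by (simp add: Diff_insert[of S a A])
 next
  case False
  hence "S - insert a A = S - A" by auto
  thus ?thesis using insert by simp
 qed
qed (use assms in simp)

section \<open>Rational maps\<close>

text \<open>Degree read projectively: \<open>p\<close> and \<open>q\<close> have formal degree
  \<open>d\<close> and no common zero, infinity included. This form is visibly stable under
  exchanging \<open>p\<close> and \<open>q\<close> and under Moebius changes of variable.\<close>

definition ratl :: "complex poly => complex poly => nat => bool" where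
 "ratl p q d \<longleftrightarrow> degree p <= d & degree q <= d & (coeff p d ~= 0 | coeff q d ~= 0) &
   (ALL z. ~ (poly p z = 0 & poly q z = 0))"

lemma ratl_max: "ratl p q d ==> max (degree p) (degree q) = d"
 unfolding ratl_def using le_degree by (metis max.absorb1 max.absorb2 le_antisym)

lemma coprime_iff_no_common_root:
 fixes p q :: "complex poly"
 shows "coprime p q \<longleftrightarrow> (ALL z. ~ (poly p z = 0 & poly q z = 0))"
proof
 assume c: "coprime p q"
 show "ALL z. ~ (poly p z = 0 & poly q z = 0)"
 proof (intro allI notI)
  fix z assume "poly p z = 0 & poly q z = 0"
  hence "[:-z, 1:] dvd p" "[:-z, 1:] dvd q" by (simp_all add: poly_eq_0_iff_dvd)
  hence "is_unit [:-z, 1:]" using c coprime_common_divisor by blast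
  thus False by (simp add: is_unit_poly_iff)
 qed
next
 assume n: "ALL z. ~ (poly p z = 0 & poly q z = 0)"
 show "coprime p q"
 proof (rule coprimeI)
  fix r assume r: "r dvd p" "r dvd q"
  show "is_unit r"
  proof (rule ccontr)
   assume nu: "~ is_unit r"
   have "EX z. poly r z = 0"
   proof (cases "r = 0")
    case False
    hence "degree r > 0" using nu by (simp add: is_unit_iff_degree)
    thus ?thesis using alg_closed_imp_poly_has_root by blast
   qed auto
   thus False using n r by (auto elim!: dvdE)
  qed
 qed
qed

lemma rational_map_of_degree_iff:
 "rational_map_of_degree f d \<longleftrightarrow> (EX p q. ratl p q d & f = rational_map p q)"
proof
 assume "rational_map_of_degree f d"
 then obtain p q where pq: "coprime p q" "d = max (degree p) (degree q)" "f = rational_map p q"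
  unfolding rational_map_of_degree_def by blast
 hence nr: "ALL z. ~ (poly p z = 0 & poly q z = 0)" using coprime_iff_no_common_root by blast
 have "coeff p d ~= 0 | coeff q d ~= 0"
 proof (cases "degree p >= degree q")
  case True
  hence d: "d = degree p" using pq by simp
  show ?thesis
  proof (cases "p = 0")
   case True
   hence "degree q = 0" "q ~= 0" using d `degree p >= degree q` nr by auto
   thus ?thesis using d True by (metis degree_0 leading_coeff_0_iff)
  qed (use d in auto)
 next
  case False
  hence "d = degree q" "q ~= 0" using pq by auto
  thus ?thesis by auto
 qed
 hence "ratl p q d" unfolding ratl_def using pq nr by auto
 thus "EX p q. ratl p q d & f = rational_map p q" using pq by blast
next
 assume "EX p q. ratl p q d & f = rational_map p q"
 then obtain p q where pq: "ratl p q d" "f = rational_map p q" by blast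
 thus "rational_map_of_degree f d" unfolding rational_map_of_degree_def
  using ratl_max[OF pq(1)] coprime_iff_no_common_root[of p q] pq by (auto simp: ratl_def)
qed

lemma rational_map_Infty:
 "ratl p q d ==> rational_map p q Infty = (if coeff q d = 0 then Infty else Fin (coeff p d / coeff q d))"
 using ratl_max[of p q d] by (simp add: Let_def)

declare rational_map.simps(2) [simp del]

subsection \<open>Moebius transformations\<close>

fun aff :: "complex => complex => riemann_sphere => riemann_sphere" where
 "aff k b (Fin z) = Fin (k * z + b)"
| "aff k b Infty = Infty"

text \<open>Only generators are recorded, so that facts about Moebius maps follow by induction,
  without matrices.\<close>

inductive mob :: "(riemann_sphere => riemann_sphere) => bool" where
 mob_id: "mob id"
| mob_iota: "mob A ==> mob (iota o A)"
| mob_aff: "k ~= 0 ==> mob A ==> mob (aff k b o A)"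

lemma mob_comp:
 assumes "mob A" "mob B"
 shows "mob (A o B)" using assms(1)
 by (induction rule: mob.induct) (simp_all only: id_comp assms(2) comp_assoc mob_iota mob_aff simp_thms)

lemma mob_gen: "mob iota" "k ~= 0 ==> mob (aff k b)"
 by (fact mob_iota[OF mob_id, unfolded comp_id]) (fact mob_aff[OF _ mob_id, unfolded comp_id])

lemma aff_aff: "k ~= 0 ==> aff k b o aff (1 / k) (- b / k) = id" "k ~= 0 ==> aff (1 / k) (- b / k) o aff k b = id"
proof -
 assume k: "k ~= 0"
 have "aff k b (aff (1 / k) (- b / k) x) = x" "aff (1 / k) (- b / k) (aff k b x) = x" for x
  using k by (cases x; simp add: field_simps)+
 thus "aff k b o aff (1 / k) (- b / k) = id" "aff (1 / k) (- b / k) o aff k b = id" by auto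
qed

lemma mob_inverse: "mob A ==> EX B. mob B & A o B = id & B o A = id"
proof (induction rule: mob.induct)
 case mob_id
 thus ?case using mob.mob_id by (intro exI[of _ id]) (simp only: id_comp simp_thms)
next
 case (mob_iota A)
 then obtain B where B: "mob B" "A o B = id" "B o A = id" by blast
 have "iota o iota = id" by auto
 hence "iota o A o (B o iota) = id" "B o iota o (iota o A) = id"
  using B by (metis comp_assoc comp_id)+
 thus ?case using B mob_comp mob_gen by blast
next
 case (mob_aff k A b)
 then obtain B where B: "mob B" "A o B = id" "B o A = id" by blast
 have "aff k b o A o (B o aff (1 / k) (- b / k)) = id" "B o aff (1 / k) (- b / k) o (aff k b o A) = id"
  using B aff_aff[OF mob_aff(1)] by (metis comp_assoc comp_id)+
 moreover have "1 / k ~= 0" using mob_aff by simp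
 ultimately show ?case using B mob_comp mob_gen by blast
qed

lemma mob_bij: "mob A ==> bij A" using mob_inverse o_bij by metis

lemma mob_to_Infty:
 obtains A where "mob A" "A x = Infty"
proof (cases x)
 case (Fin b)
 have "mob (iota o aff 1 (- b))" using mob_iota mob_gen by simp
 moreover have "(iota o aff 1 (- b)) x = Infty" using Fin by simp
 ultimately show ?thesis using that by blast
qed (use mob_id that in auto)

lemma mob_from_Infty:
 obtains A where "mob A" "A Infty = x"
proof -
 obtain B where B: "mob B" "B x = Infty" by (rule mob_to_Infty)
 then obtain A where "mob A" "A o B = id" using mob_inverse by blast
 thus ?thesis using that B by (metis comp_apply id_apply)
qed

lemma mob_to_0:
 obtains A where "mob A" "A x = Fin 0"
proof -
 obtain B where "mob B" "B x = Infty" by (rule mob_to_Infty)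
 hence "mob (iota o B)" "(iota o B) x = Fin 0" using mob_iota by auto
 thus ?thesis using that by blast
qed

lemma mob_three_points:
 assumes "x ~= y" "y ~= z" "x ~= z"
 obtains A where "mob A" "A x = Fin 0" "A y = Fin 1" "A z = Infty"
proof -
 obtain B where B: "mob B" "B z = Infty" by (rule mob_to_Infty)
 hence inj: "inj B" using mob_bij bij_is_inj by blast
 then obtain a b where ab: "B x = Fin a" "B y = Fin b"
  using assms B by (metis injD riemann_sphere.exhaust)
 hence ne: "b - a ~= 0" using assms inj by (metis injD right_minus_eq)
 define k where "k = 1 / (b - a)"
 have "mob (aff k (- a * k) o B)" using mob_aff[OF _ B(1)] ne k_def by simp
 moreover have "(aff k (- a * k) o B) x = Fin 0" "(aff k (- a * k) o B) z = Infty"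
  using ab B by simp_all
 moreover have "k * b - a * k = 1" using ne unfolding k_def by (simp add: divide_simps)
 hence "(aff k (- a * k) o B) y = Fin 1" using ab by simp
 ultimately show ?thesis using that by blast
qed

text \<open>The polynomial \<open>z ^ d * p (1 / z)\<close>, a reflection with respect to a formal
  degree \<open>d\<close> that may exceed \<open>degree p\<close>.\<close>

definition revp :: "nat => complex poly => complex poly" where
 "revp d p = monom 1 (d - degree p) * reflect_poly p"

lemma revp_props:
 assumes "degree p <= d"
 shows "degree (revp d p) <= d" "z ~= 0 ==> poly (revp d p) z = z ^ d * poly p (1 / z)"
  "poly (revp d p) 0 = coeff p d" "coeff (revp d p) d = poly p 0"
proof -
 show "degree (revp d p) <= d"
 proof -
  have "degree (revp d p) <= (d - degree p) + degree p"
   unfolding revp_def using degree_mult_le[of "monom 1 (d - degree p)" "reflect_poly p"]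
    degree_reflect_poly_le[of p] degree_monom_le[of "1::complex" "d - degree p"] by linarith
  thus ?thesis using assms by simp
 qed
 show "poly (revp d p) z = z ^ d * poly p (1 / z)" if "z ~= 0"
 proof -
  have "z ^ (d - degree p) * z ^ degree p = z ^ d" using assms by (simp flip: power_add)
  thus ?thesis using that by (simp add: revp_def poly_monom poly_reflect_poly_nz inverse_eq_divide
     flip: mult.assoc)
 qed
 show "poly (revp d p) 0 = coeff p d"
 proof (cases "degree p = d")
  case False
  thus ?thesis using assms by (simp add: revp_def poly_monom coeff_eq_0 zero_power)
 qed (simp add: revp_def poly_monom poly_0_coeff_0)
 show "coeff (revp d p) d = poly p 0"
  using assms by (simp add: revp_def coeff_monom_mult coeff_reflect_poly poly_0_coeff_0)
qed

text \<open>Generator cases of the Moebius invariance of the degree. Composition with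
  \<open>iota\<close> exchanges numerator and denominator on the left and reverses both polynomials
  on the right.\<close>

lemma rational_mob_gens:
 assumes "rational_map_of_degree f d"
 shows "rational_map_of_degree (iota o f) d" "rational_map_of_degree (f o iota) d"
  "k ~= 0 ==> rational_map_of_degree (aff k b o f) d" "k ~= 0 ==> rational_map_of_degree (f o aff k b) d"
proof -
 obtain p q where pq: "ratl p q d" "f = rational_map p q"
  using assms rational_map_of_degree_iff by blast
 note r = pq(1)[unfolded ratl_def]
 have dp: "degree p <= d" "degree q <= d" using r by auto
 show "rational_map_of_degree (iota o f) d"
 proof -
  have 1: "ratl q p d" using r unfolding ratl_def by auto
  have "(iota o f) x = rational_map q p x" for x
   using r by (cases x) (auto simp: pq(2) rational_map_Infty[OF pq(1)] rational_map_Infty[OF 1])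
  thus ?thesis unfolding rational_map_of_degree_iff using 1 by (metis ext)
 qed
 show "rational_map_of_degree (f o iota) d"
 proof -
  have 1: "ratl (revp d p) (revp d q) d" unfolding ratl_def
  proof (intro conjI allI)
   show "degree (revp d p) <= d" "degree (revp d q) <= d" using revp_props dp by auto
   show "coeff (revp d p) d ~= 0 | coeff (revp d q) d ~= 0" using revp_props dp r by simp
   fix z show "~ (poly (revp d p) z = 0 & poly (revp d q) z = 0)"
    using r by (cases "z = 0") (auto simp: revp_props dp)
  qed
  have "(f o iota) x = rational_map (revp d p) (revp d q) x" for x
  proof (cases x)
   case (Fin z)
   thus ?thesis by (cases "z = 0") (auto simp: pq(2) rational_map_Infty[OF pq(1)] revp_props dp)
  next
   case Infty
   thus ?thesis by (auto simp: pq(2) rational_map_Infty[OF 1] revp_props dp)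
  qed
  thus ?thesis unfolding rational_map_of_degree_iff using 1 by (metis ext)
 qed
 show "rational_map_of_degree (aff k b o f) d" if k: "k ~= 0"
 proof -
  have 1: "ratl (smult k p + smult b q) q d" unfolding ratl_def using r k
   by (auto intro!: degree_add_le order.trans[OF degree_smult_le])
  have "(aff k b o f) x = rational_map (smult k p + smult b q) q x" for x
   by (cases x) (auto simp: pq(2) rational_map_Infty[OF pq(1)] rational_map_Infty[OF 1] add_divide_distrib)
  thus ?thesis unfolding rational_map_of_degree_iff using 1 by (metis ext)
 qed
 show "rational_map_of_degree (f o aff k b) d" if k: "k ~= 0"
 proof -
  let ?a = "[:b, k:]"
  have c: "coeff (pcompose s ?a) d = coeff s d * k ^ d" if "degree s <= d" for s
  proof (cases "degree s = d")
   case True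
   thus ?thesis using lead_coeff_comp[of ?a s] k by (simp add: degree_pcompose)
  next
   case False
   thus ?thesis using that k by (simp add: coeff_eq_0 degree_pcompose)
  qed
  have 1: "ratl (pcompose p ?a) (pcompose q ?a) d"
   unfolding ratl_def using r k c dp by (auto simp: degree_pcompose poly_pcompose)
  have "(f o aff k b) x = rational_map (pcompose p ?a) (pcompose q ?a) x" for x
   using k by (cases x) (auto simp: pq(2) rational_map_Infty[OF pq(1)] rational_map_Infty[OF 1] c dp
     poly_pcompose algebra_simps)
  thus ?thesis unfolding rational_map_of_degree_iff using 1 by (metis ext)
 qed
qed

lemma rational_mob_post: "mob A ==> rational_map_of_degree f d ==> rational_map_of_degree (A o f) d"
 by (induction rule: mob.induct) (auto simp: o_assoc[symmetric] intro: rational_mob_gens)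

lemma rational_mob_pre: "mob A ==> rational_map_of_degree f d ==> rational_map_of_degree (f o A) d"
proof (induction arbitrary: f rule: mob.induct)
 case (mob_iota A)
 thus ?case using rational_mob_gens(2) by (metis o_assoc)
next
 case (mob_aff k A b)
 thus ?case using rational_mob_gens(4) by (metis o_assoc)
qed auto

lemma rational_id: "rational_map_of_degree id 1"
proof -
 have r: "ratl [:0, 1:] 1 1" by (auto simp: ratl_def)
 have "id x = rational_map [:0, 1:] 1 x" for x by (cases x) (auto simp: rational_map_Infty[OF r])
 thus ?thesis using r rational_map_of_degree_iff by (metis ext)
qed

lemma mob_rational: "mob A ==> rational_map_of_degree A 1"
 using rational_mob_post[OF _ rational_id] by simp

subsection \<open>Holomorphic maps into the sphere\<close>

text \<open>Holomorphy into the sphere: on small balls the map or its inversion is an ordinary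
  holomorphic function, so plane theorems apply there.\<close>

definition sholo :: "(complex => riemann_sphere) => complex set => bool" where
 "sholo F S \<longleftrightarrow> open S & (ALL z:S. EX r>0. EX phi. phi holomorphic_on ball z r &
   ((ALL w:ball z r. F w = Fin (phi w)) | (ALL w:ball z r. F w = iota (Fin (phi w)))))"

lemma sholo_chart:
 assumes "h \<in> charts" "open S"
 shows "sholo h S"
proof -
 have "(%z. z) holomorphic_on ball z 1" for z :: complex by (rule holomorphic_on_ident)
 moreover have "(ALL w. h w = Fin w) | (ALL w. h w = iota (Fin w))"
  using assms(1) unfolding charts_def by (auto simp del: iota.simps)
 ultimately show ?thesis unfolding sholo_def using assms(2) zero_less_one by blast
qed

lemma sholo_Fin_comp:
 assumes "phi holomorphic_on S" "open S"
 shows "sholo (%z. Fin (phi z)) S" unfolding sholo_def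
proof (intro conjI ballI)
 fix z assume "z \<in> S"
 then obtain r where "r > 0" "ball z r \<subseteq> S" using assms openE by metis
 thus "EX r>0. EX psi. psi holomorphic_on ball z r &
   ((ALL w:ball z r. Fin (phi w) = Fin (psi w)) | (ALL w:ball z r. Fin (phi w) = iota (Fin (psi w))))"
  using assms holomorphic_on_subset by blast
qed (use assms in simp)

lemma sholo_continuous: "sholo F S ==> continuous_on S F"
proof -
 assume F: "sholo F S"
 have "isCont F z" if "z \<in> S" for z
 proof -
  obtain r phi where r: "r > 0" "phi holomorphic_on ball z r"
   "(ALL w:ball z r. F w = Fin (phi w)) | (ALL w:ball z r. F w = iota (Fin (phi w)))"
   using bspec[OF conjunct2[OF F[unfolded sholo_def]] `z \<in> S`] by blast
  have c: "continuous_on (ball z r) (Fin o phi)" "continuous_on (ball z r) (iota o (Fin o phi))"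
   using holomorphic_on_imp_continuous_on[OF r(2)]
   by (intro continuous_on_compose continuous_on_Fin continuous_on_iota; assumption)+
  have "continuous_on (ball z r) F" using r(3)
  proof
   assume "ALL w:ball z r. F w = Fin (phi w)"
   thus ?thesis using continuous_on_eq[OF c(1)] by simp
  next
   assume "ALL w:ball z r. F w = iota (Fin (phi w))"
   thus ?thesis using continuous_on_eq[OF c(2)] by (simp del: iota.simps)
  qed
  thus ?thesis using r(1) by (simp add: continuous_on_eq_continuous_at)
 qed
 thus ?thesis by (simp add: continuous_at_imp_continuous_on)
qed

lemma sholo_rational_comp:
 assumes f: "rational_map_of_degree f d" and F: "sholo F S"
 shows "sholo (%z. f (F z)) S" unfolding sholo_def
proof (intro conjI ballI)
 show "open S" using F unfolding sholo_def by blast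
 fix z assume z: "z \<in> S"
 have *: "EX r>0. EX psi. psi holomorphic_on ball z r &
   ((ALL w:ball z r. f (Fin (phi w)) = Fin (psi w)) | (ALL w:ball z r. f (Fin (phi w)) = iota (Fin (psi w))))"
  if f: "rational_map_of_degree f d" and r: "r > 0" "phi holomorphic_on ball z r" for f r phi
 proof -
  obtain p q where pq: "ratl p q d" "f = rational_map p q"
   using f rational_map_of_degree_iff by blast
  have hol: "(%w. poly s (phi w)) holomorphic_on ball z r" for s
   using r(2) by (intro holomorphic_intros)
  have near: "EX e>0. e <= r & (ALL w:ball z e. poly s (phi w) ~= 0)" if "poly s (phi z) ~= 0" for s
  proof -
   have "continuous_on (ball z r) (%w. poly s (phi w))"
    using hol holomorphic_on_imp_continuous_on by blast
   hence "EX e>0. ALL y. dist z y < e --> poly s (phi y) ~= 0"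
    by (rule continuous_on_open_avoid[OF _ open_ball]) (use r(1) that in auto)
   then obtain e where e: "e > 0" "ALL y. dist z y < e --> poly s (phi y) ~= 0" by blast
   thus ?thesis by (intro exI[of _ "min e r"]) (use r in auto)
  qed
  show ?thesis
  proof (cases "poly q (phi z) = 0")
   case False
   then obtain e where e: "e > 0" "e <= r" "ALL w:ball z e. poly q (phi w) ~= 0" using near by blast
   have "(%w. poly p (phi w) / poly q (phi w)) holomorphic_on ball z e"
    using e by (intro holomorphic_on_divide holomorphic_on_subset[OF hol]) auto
   thus ?thesis using e by (intro exI[of _ e] conjI exI) (auto simp: pq(2))
  next
   case True
   hence "poly p (phi z) ~= 0" using pq(1) unfolding ratl_def by blast
   then obtain e where e: "e > 0" "e <= r" "ALL w:ball z e. poly p (phi w) ~= 0" using near by blast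
   have "(%w. poly q (phi w) / poly p (phi w)) holomorphic_on ball z e"
    using e by (intro holomorphic_on_divide holomorphic_on_subset[OF hol]) auto
   thus ?thesis
    using e by (intro exI[of _ e] conjI exI[of _ "%w. poly q (phi w) / poly p (phi w)"] disjI2)
     (auto simp: pq(2))
  qed
 qed
 obtain r phi where r: "r > 0" "phi holomorphic_on ball z r"
  "(ALL w:ball z r. F w = Fin (phi w)) | (ALL w:ball z r. F w = iota (Fin (phi w)))"
  using F z unfolding sholo_def by meson
 \<comment> \<open>Where \<open>F\<close> is given through the chart at infinity, \<open>f\<close>
   is replaced by \<open>f o iota\<close>, again rational of degree \<open>d\<close>, and the finite
   case applies.\<close>
 define g where "g = (if ALL w:ball z r. F w = Fin (phi w) then f else f o iota)"
 have g: "rational_map_of_degree g d" unfolding g_def using f rational_mob_gens(2) by simp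
 have gF: "f (F w) = g (Fin (phi w))" if "w \<in> ball z r" for w
  using r(3) that unfolding g_def by (auto simp del: iota.simps)
 obtain e psi where e: "e > 0" "psi holomorphic_on ball z e"
  "(ALL w:ball z e. g (Fin (phi w)) = Fin (psi w)) | (ALL w:ball z e. g (Fin (phi w)) = iota (Fin (psi w)))"
  using *[OF g r(1,2)] by blast
 have "psi holomorphic_on ball z (min e r)" using e(2) by (rule holomorphic_on_subset) auto
 thus "EX r>0. EX psi. psi holomorphic_on ball z r &
   ((ALL w:ball z r. f (F w) = Fin (psi w)) | (ALL w:ball z r. f (F w) = iota (Fin (psi w))))"
  using e r(1) gF by (intro exI[of _ "min e r"] conjI exI[of _ psi]) (auto simp del: iota.simps)
qed

lemma sholo_funpow:
 assumes f: "rational_map_of_degree f d" and F: "sholo F S"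
 shows "sholo (%z. (f ^^ n) (F z)) S"
proof (induction n)
 case (Suc n)
 thus ?case using sholo_rational_comp[OF f Suc] by simp
qed (use F in simp)

lemma sholo_finite_rep:
 assumes F: "sholo F S" and z: "z \<in> S" and nI: "F z ~= Infty"
 obtains r phi where "r > 0" "ball z r \<subseteq> S" "phi holomorphic_on ball z r" "!!w. w \<in> ball z r ==> F w = Fin (phi w)"
proof -
 obtain r phi where r: "r > 0" "phi holomorphic_on ball z r"
  "(ALL w:ball z r. F w = Fin (phi w)) | (ALL w:ball z r. F w = iota (Fin (phi w)))"
  using F z unfolding sholo_def by meson
 obtain s where s: "s > 0" "ball z s \<subseteq> S" using F z openE unfolding sholo_def by metis
 from r(3) show ?thesis
 proof
  assume a: "ALL w:ball z r. F w = Fin (phi w)"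
  show ?thesis by (rule that[of "min r s" phi])
    (use a s r(1) in "auto intro: holomorphic_on_subset[OF r(2)]")
 next
  assume a: "ALL w:ball z r. F w = iota (Fin (phi w))"
  have "phi z ~= 0" using nI a r(1) by auto
  hence "EX e>0. ALL y. dist z y < e --> phi y ~= 0"
   by (intro continuous_on_open_avoid[OF holomorphic_on_imp_continuous_on[OF r(2)] open_ball])
    (use r(1) in auto)
  then obtain e where e: "e > 0" "ALL y. dist z y < e --> phi y ~= 0" by blast
  have "(%w. 1 / phi w) holomorphic_on ball z (min (min r s) e)"
   using e by (intro holomorphic_on_divide holomorphic_on_subset[OF r(2)] holomorphic_intros) auto
  thus ?thesis by (intro that[of "min (min r s) e" "%w. 1 / phi w"]) (use a e s r(1) in auto)
 qed
qed

lemma sholo_iota: "sholo F S ==> sholo (%z. iota (F z)) S"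
 using sholo_rational_comp[OF mob_rational[OF mob_gen(1)]] .

lemma sholo_finite_holomorphic:
 assumes F: "sholo F S" and fin: "!!z. z \<in> S ==> F z ~= Infty"
 shows "(%z. fin (F z)) holomorphic_on S"
proof -
 have "(%z. fin (F z)) field_differentiable (at z)" if z: "z \<in> S" for z
 proof -
  obtain r phi where r: "r > 0" "phi holomorphic_on ball z r" "!!w. w \<in> ball z r ==> F w = Fin (phi w)"
   using sholo_finite_rep[OF F z fin[OF z]] by metis
  hence "(%z. fin (F z)) holomorphic_on ball z r"
   by (metis (no_types, lifting) fin.simps(1) holomorphic_cong)
  thus ?thesis using r(1) by (simp add: holomorphic_on_open field_differentiable_def)
 qed
 thus ?thesis
  using F unfolding sholo_def holomorphic_on_def by (simp add: field_differentiable_at_within)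
qed

subsection \<open>Fibers, continuity and openness\<close>

lemma rational_continuous:
 assumes "rational_map_of_degree f d"
 shows "continuous_on S f"
proof -
 have "open (f -` V)" if V: "open V" for V
 proof -
  have 1: "open (h ` ((%z. f (h z)) -` V))" if h: "h \<in> charts" for h
   using sholo_continuous[OF sholo_rational_comp[OF assms sholo_chart[OF h open_UNIV]]] V
    chart_props(3)[OF h] by (simp add: continuous_on_open_vimage)
  have "f -` V = (\<Union>h\<in>charts. h ` ((%z. f (h z)) -` V))"
  proof (intro equalityI subsetI)
   fix x assume "x \<in> f -` V"
   moreover obtain h z where "h \<in> charts" "h z = x" by (rule chart_at)
   ultimately show "x \<in> (\<Union>h\<in>charts. h ` ((%z. f (h z)) -` V))" by blast
  qed auto
  thus ?thesis using 1 by (metis (no_types, lifting) open_UN)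
 qed
 hence "continuous_on UNIV f" by (simp add: continuous_on_open_vimage)
 thus ?thesis using continuous_on_subset by blast
qed

text \<open>The fibre over 0 consists of the roots of \<open>p\<close>, and of infinity exactly when
  the coefficient of degree \<open>d\<close> of \<open>p\<close> vanishes; this drop of the degree
  pays for the extra point.\<close>

lemma finite_fiber_0:
 assumes r: "ratl p q d" and d: "d >= 1"
 shows "finite (rational_map p q -` {Fin 0})" "card (rational_map p q -` {Fin 0}) <= d"
  "rational_map p q -` {Fin 0} ~= {}"
proof -
 note r' = r[unfolded ratl_def]
 have p0: "p ~= 0"
 proof
  assume p: "p = 0"
  hence "ALL z. poly q z ~= 0" using r' by simp
  hence "degree q = 0" using alg_closed_imp_poly_has_root by blast
  hence "coeff q d = 0" using d by (simp add: coeff_eq_0)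
  thus False using r' p by simp
 qed
 define Z where "Z = {z. poly p z = 0}"
 have Z: "finite Z" "card Z <= degree p"
  unfolding Z_def using poly_roots_finite[OF p0] card_poly_roots_bound[OF p0] by auto
 define I where "I = (if coeff p d = 0 then {Infty} else {})"
 have eq: "rational_map p q -` {Fin 0} = Fin ` Z Un I"
 proof (intro set_eqI iffI)
  fix x assume x: "x \<in> rational_map p q -` {Fin 0}"
  thus "x \<in> Fin ` Z Un I"
   by (cases x) (auto simp: Z_def I_def rational_map_Infty[OF r] split: if_splits)
 next
  fix x assume x: "x \<in> Fin ` Z Un I"
  thus "x \<in> rational_map p q -` {Fin 0}"
   using r' by (cases x) (auto simp: Z_def I_def rational_map_Infty[OF r] split: if_splits)
 qed
 have cardZ: "card (Fin ` Z) = card Z" by (simp add: card_image inj_Fin inj_on_subset[OF inj_Fin])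
 show "finite (rational_map p q -` {Fin 0})" unfolding eq using Z by (simp add: I_def)
 show "card (rational_map p q -` {Fin 0}) <= d"
 proof (cases "coeff p d = 0")
  case True
  hence "degree p ~= d" using p0 by auto
  hence "degree p < d" using r' by simp
  moreover have "card (Fin ` Z Un I) <= card Z + 1"
   using card_Un_le[of "Fin ` Z" I] cardZ True by (simp add: I_def)
  ultimately show ?thesis unfolding eq using Z by linarith
 next
  case False
  thus ?thesis unfolding eq using Z r' cardZ by (simp add: I_def)
 qed
 show "rational_map p q -` {Fin 0} ~= {}"
 proof (cases "coeff p d = 0")
  case False
  hence "degree p > 0" using d le_degree[of p d] by simp
  hence "Z ~= {}" unfolding Z_def using alg_closed_imp_poly_has_root by blast
  thus ?thesis unfolding eq by simp
 qed (simp add: eq I_def)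
qed

lemma rational_fiber:
 assumes f: "rational_map_of_degree f d" and d: "d >= 1"
 shows "finite (f -` {y})" "card (f -` {y}) <= d" "f -` {y} ~= {}"
proof -
 obtain A where A: "mob A" "A y = Fin 0" by (rule mob_to_0)
 then obtain p q where pq: "ratl p q d" "A o f = rational_map p q"
  using rational_mob_post[OF A(1) f] rational_map_of_degree_iff by blast
 have "A w = Fin 0 \<longleftrightarrow> w = y" for w
  using mob_bij[OF A(1)] A(2) by (metis bij_is_inj injD)
 hence "f -` {y} = (A o f) -` {Fin 0}" by auto
 thus "finite (f -` {y})" "card (f -` {y}) <= d" "f -` {y} ~= {}"
  using finite_fiber_0[OF pq(1) d] pq(2) by simp_all
qed

lemma rational_surj:
 assumes "rational_map_of_degree f d" "d >= 1"
 shows "surj f"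
proof -
 have "EX x. y = f x" for y using rational_fiber(3)[OF assms, of y] by auto
 thus ?thesis unfolding surj_def by blast
qed

section \<open>Infinite open sets and the open mapping property\<close>

lemma infinite_chart_ball:
 assumes "h \<in> charts" "r > 0"
 shows "infinite (h ` ball z r)"
proof
 assume "finite (h ` ball z r)"
 hence "finite (ball z r)"
  using finite_imageD inj_on_subset[OF chart_props(2)[OF assms(1)]] by blast
 thus False using assms(2) uncountable_ball[of r z] countable_finite by blast
qed

lemma infinite_UNIV_sphere: "infinite (UNIV :: riemann_sphere set)"
 using infinite_chart_ball[of Fin 1 0] finite_subset[OF subset_UNIV] by (auto simp: charts_def)

lemma infinite_open_sphere:
 assumes "open (U :: riemann_sphere set)" "U ~= {}"
 shows "infinite U"
proof -
 obtain x where x: "x \<in> U" using assms by blast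
 obtain h z where h: "h \<in> charts" "h z = x" by (rule chart_at)
 then obtain r where r: "r > 0" "h ` cball z r \<subseteq> U" using chart_cball_subset assms x by metis
 hence "h ` ball z r \<subseteq> U" by force
 thus ?thesis using infinite_chart_ball[OF h(1) r(1)] finite_subset by blast
qed

text \<open>The plane open mapping theorem in the two target charts; finite fibres exclude local
  constancy.\<close>

lemma rational_open_chart:
 assumes f: "rational_map_of_degree f d" and d: "d >= 1" and h: "h \<in> charts" and T: "open T"
 shows "open ((%z. f (h z)) ` T)" unfolding open_subopen[of "(%z. f (h z)) ` T"]
proof
 fix x assume "x \<in> (%z. f (h z)) ` T"
 then obtain z where z: "z \<in> T" "x = f (h z)" by blast
 obtain r phi where r: "r > 0" "phi holomorphic_on ball z r"
  "(ALL w:ball z r. f (h w) = Fin (phi w)) | (ALL w:ball z r. f (h w) = iota (Fin (phi w)))"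
  using sholo_rational_comp[OF f sholo_chart[OF h T]] z unfolding sholo_def by meson
 obtain s where s: "s > 0" "ball z s \<subseteq> T" using T z openE by metis
 have nc: "~ phi constant_on ball z r"
 proof
  assume "phi constant_on ball z r"
  then obtain c where c: "ALL w:ball z r. phi w = c" unfolding constant_on_def by blast
  hence "EX y. ALL w:ball z r. f (h w) = y" using r(3) by auto
  then obtain y where "h ` ball z r \<subseteq> f -` {y}" by blast
  thus False using infinite_chart_ball[OF h r(1)] rational_fiber(1)[OF f d] finite_subset by blast
 qed
 let ?B = "ball z (min r s)"
 have o: "open (phi ` ?B)"
  by (rule open_mapping_thm[OF r(2) open_ball connected_ball open_ball _ nc]) auto
 have "(%z. f (h z)) ` ?B = Fin ` phi ` ?B | (%z. f (h z)) ` ?B = iota ` Fin ` phi ` ?B" using r(3)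
 proof
  assume a: "ALL w:ball z r. f (h w) = Fin (phi w)"
  have "(%z. f (h z)) ` ?B = (%z. Fin (phi z)) ` ?B" by (rule image_cong) (use a in auto)
  thus ?thesis by (simp add: image_image)
 next
  assume a: "ALL w:ball z r. f (h w) = iota (Fin (phi w))"
  have "(%z. f (h z)) ` ?B = (%z. iota (Fin (phi z))) ` ?B" by (rule image_cong) (use a in auto)
  thus ?thesis by (simp add: image_image del: iota.simps)
 qed
 hence "open ((%z. f (h z)) ` ?B)" using open_Fin_image[OF o] open_iota_image by metis
 moreover have "x \<in> (%z. f (h z)) ` ?B" using z r s by auto
 moreover have "(%z. f (h z)) ` ?B \<subseteq> (%z. f (h z)) ` T" using s by auto
 ultimately show "EX T'. open T' & x \<in> T' & T' \<subseteq> (%z. f (h z)) ` T" by blast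
qed

lemma rational_open:
 assumes f: "rational_map_of_degree f d" and d: "d >= 1" and U: "open U"
 shows "open (f ` U)"
proof -
 have "f ` U = (\<Union>h\<in>charts. (%z. f (h z)) ` (h -` U))"
 proof (intro equalityI subsetI)
  fix y assume "y \<in> f ` U"
  then obtain x where x: "x \<in> U" "y = f x" by blast
  obtain h z where "h \<in> charts" "h z = x" by (rule chart_at)
  thus "y \<in> (\<Union>h\<in>charts. (%z. f (h z)) ` (h -` U))" using x by blast
 qed auto
 moreover have "open ((%z. f (h z)) ` (h -` U))" if "h \<in> charts" for h
  using rational_open_chart[OF f d that] open_vimage[OF U chart_props(1)[OF that]] by blast
 ultimately show ?thesis by (metis (no_types, lifting) open_UN)
qed

subsection \<open>Critical points\<close>

text \<open>Local injectivity replaces the nonzero derivative: it needs no coordinates and is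
  clearly invariant under Moebius maps on both sides.\<close>

definition lif :: "(riemann_sphere => riemann_sphere) => riemann_sphere => bool" where
 "lif f x \<longleftrightarrow> (EX U. open U & x \<in> U & inj_on f U)"

lemma lif_chart:
 assumes h: "h \<in> charts" and r: "r > 0"
  and F: "(ALL w:ball z r. f (h w) = Fin (phi w)) | (ALL w:ball z r. f (h w) = iota (Fin (phi w)))"
  and hol: "phi holomorphic_on ball z r"
 shows "lif f (h z) \<longleftrightarrow> deriv phi z ~= 0"
proof -
 have inj_iff: "inj_on phi S \<longleftrightarrow> inj_on f (h ` S)" if "S \<subseteq> ball z r" for S
 proof -
  have "f (h a) = f (h b) \<longleftrightarrow> phi a = phi b" if "a \<in> S" "b \<in> S" for a b
  proof -
   have "a \<in> ball z r" "b \<in> ball z r" using that `S \<subseteq> ball z r` by auto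
   thus ?thesis using F by (metis iota_iota riemann_sphere.inject)
  qed
  moreover have "h a = h b \<longleftrightarrow> a = b" for a b using chart_props(2)[OF h] by (simp add: inj_eq)
  ultimately show ?thesis unfolding inj_on_def by blast
 qed
 show ?thesis
 proof
  assume "lif f (h z)"
  then obtain U where U: "open U" "h z \<in> U" "inj_on f U" unfolding lif_def by blast
  then obtain s where s: "s > 0" "h ` cball z s \<subseteq> U" using chart_cball_subset[OF h U(1,2)] by blast
  let ?B = "ball z (min r s)"
  have "h ` ?B \<subseteq> U" using s by force
  hence "inj_on f (h ` ?B)" using inj_on_subset[OF U(3)] by blast
  hence "inj_on phi ?B" using inj_iff[of ?B] by (simp add: subset_ball)
  moreover have "phi holomorphic_on ?B" by (rule holomorphic_on_subset[OF hol]) auto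
  ultimately show "deriv phi z ~= 0"
   using holomorphic_injective_imp_regular[of phi ?B z] r s by auto
 next
  assume "deriv phi z ~= 0"
  then obtain s where s: "s > 0" "ball z s \<subseteq> ball z r" "inj_on phi (ball z s)"
   using has_complex_derivative_locally_injective[OF hol, of z] r by auto
  hence "inj_on f (h ` ball z s)" using inj_iff by blast
  moreover have "open (h ` ball z s)" using chart_props(3)[OF h] by simp
  moreover have "h z \<in> h ` ball z s" using s(1) by simp
  ultimately show "lif f (h z)" unfolding lif_def by blast
 qed
qed

lemma critical_point_iff:
 assumes f: "rational_map_of_degree f d"
 shows "critical_point f c \<longleftrightarrow> ~ lif f c"
proof -
 define h where "h = parametrization c"
 have h: "h \<in> charts" unfolding h_def charts_def by (cases c) (auto simp: fun_eq_iff)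
 have hc: "h (coordinate c c) = c" unfolding h_def by (cases c) auto
 define z where "z = coordinate c c"
 have sh: "sholo (%w. f (h w)) UNIV" using sholo_rational_comp[OF f sholo_chart[OF h open_UNIV]] .
 \<comment> \<open>On a small ball \<open>f o h\<close> stays away from the pole of the coordinate
   at \<open>f c\<close>, so the arbitrary value there does not enter.\<close>
 obtain r phi where r: "r > 0" "phi holomorphic_on ball z r"
  "(ALL w:ball z r. f (h w) = Fin (phi w)) | (ALL w:ball z r. f (h w) = iota (Fin (phi w)))"
  "ALL w:ball z r. coordinate (f c) (f (h w)) = phi w"
 proof (cases "f c")
  case (Fin a)
  then obtain r phi where "r > 0" "phi holomorphic_on ball z r" "!!w. w \<in> ball z r ==> f (h w) = Fin (phi w)"
   using sholo_finite_rep[OF sh, of z] hc unfolding z_def by auto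
  thus ?thesis using that[of r phi] Fin by simp
 next
  case Infty
  then obtain r phi where r: "r > 0" "phi holomorphic_on ball z r" "!!w. w \<in> ball z r ==> iota (f (h w)) = Fin (phi w)"
   using sholo_finite_rep[OF sholo_iota[OF sh], of z] hc unfolding z_def by auto
  hence eq: "f (h w) = iota (Fin (phi w))" if "w \<in> ball z r" for w
   using that by (metis iota_iota)
  thus ?thesis using that[OF r(1,2)] Infty by auto
 qed
 have "critical_point f c \<longleftrightarrow> ((%w. coordinate (f c) (f (h w))) has_field_derivative 0) (at z)"
  by (simp add: critical_point_def h_def z_def)
 also have "... \<longleftrightarrow> (phi has_field_derivative 0) (at z)"
  using r(1,4) by (intro DERIV_cong_ev) (auto simp: eventually_nhds intro!: exI[of _ "ball z r"])
 also have "... \<longleftrightarrow> deriv phi z = 0"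
  using holomorphic_derivI[OF r(2), of z] r(1) DERIV_imp_deriv by fastforce
 also have "... \<longleftrightarrow> ~ lif f c"
  using lif_chart[OF h r(1,3,2)] hc unfolding z_def by simp
 finally show ?thesis .
qed

lemma lif_mob:
 assumes "mob A" "mob B"
 shows "lif (A o f o B) x \<longleftrightarrow> lif f (B x)"
proof -
 have A: "bij A" and B: "bij B" using assms mob_bij by auto
 have Bo: "open (B ` U)" if "open U" for U using rational_open[OF mob_rational[OF assms(2)] _ that] by simp
 have Bc: "open (B -` U)" if "open U" for U
  using rational_continuous[OF mob_rational[OF assms(2)], of UNIV] that by (simp add: continuous_on_open_vimage)
 have iff: "inj_on (A o f o B) U \<longleftrightarrow> inj_on f (B ` U)" for U
  using A B unfolding inj_on_def by (auto simp: bij_def inj_eq)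
 show ?thesis
 proof
  assume "lif (A o f o B) x"
  thus "lif f (B x)" unfolding lif_def using iff Bo by blast
 next
  assume "lif f (B x)"
  then obtain U where U: "open U" "B x \<in> U" "inj_on f U" unfolding lif_def by blast
  have "B ` (B -` U) = U" using B by (simp add: bij_is_surj)
  thus "lif (A o f o B) x" unfolding lif_def using U Bc iff by (metis vimageI)
 qed
qed

lemma poly_nz_nbhd:
 fixes q :: "complex poly"
 assumes "poly q z ~= 0"
 shows "EX r>0. ALL w:ball z r. poly q w ~= 0"
proof -
 have "continuous_on UNIV (poly q)" by (intro continuous_intros)
 hence "EX r>0. ALL y. dist z y < r --> poly q y ~= 0"
  by (rule continuous_on_open_avoid[OF _ open_UNIV]) (use assms in auto)
 then obtain r where "r > 0" "ALL y. dist z y < r --> poly q y ~= 0" by blast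
 thus ?thesis by (intro exI[of _ r]) auto
qed

text \<open>The finite critical points off the poles are zeros of the Wronskian \<open>W\<close>. If
  \<open>W\<close> vanished identically, \<open>p / q\<close> would be locally constant, against the
  finiteness of fibres.\<close>

lemma finite_not_lif:
 assumes f: "rational_map_of_degree f d" and d: "d >= 1"
 shows "finite {x. ~ lif f x}"
proof -
 obtain p q where pq: "ratl p q d" "f = rational_map p q"
  using f rational_map_of_degree_iff by blast
 define W where "W = pderiv p * q - p * pderiv q"
 have der: "((%w. poly p w / poly q w) has_field_derivative (poly W z / (poly q z)\<^sup>2)) (at z)"
  if "poly q z ~= 0" for z using that unfolding W_def power2_eq_square
  by (auto intro!: derivative_eq_intros)
 have q0: "q ~= 0"
 proof
  assume "q = 0"
  hence "f (Fin z) = Infty" for z by (simp add: pq)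
  hence "range Fin \<subseteq> f -` {Infty}" by blast
  thus False using rational_fiber(1)[OF f d, of Infty] finite_subset range_Fin infinite_UNIV_sphere
   by (metis finite_compl finite.emptyI finite_insert)
 qed
 have lifW: "lif f (Fin z) \<longleftrightarrow> poly W z ~= 0" if qz: "poly q z ~= 0" for z
 proof -
  obtain r where r: "r > 0" "ALL w:ball z r. poly q w ~= 0" using poly_nz_nbhd[OF qz] by blast
  have "(%w. poly p w / poly q w) holomorphic_on ball z r"
   using r by (intro holomorphic_intros) auto
  hence "lif f (Fin z) \<longleftrightarrow> deriv (%w. poly p w / poly q w) z ~= 0"
   using lif_chart[of Fin r z f "%w. poly p w / poly q w"] r by (auto simp: charts_def pq)
  thus ?thesis using DERIV_imp_deriv[OF der[OF qz]] qz by simp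
 qed
 have W0: "W ~= 0"
 proof
  assume W0: "W = 0"
  obtain z where z: "poly q z ~= 0" using q0 poly_all_0_iff_0 by blast
  obtain r where r: "r > 0" "ALL w:ball z r. poly q w ~= 0" using poly_nz_nbhd[OF z] by blast
  have "(%w. poly p w / poly q w) constant_on ball z r"
  proof (rule has_field_derivative_0_imp_constant_on)
   show "((%w. poly p w / poly q w) has_field_derivative 0) (at w)" if "w \<in> ball z r" for w
    using der[of w] r that W0 by simp
  qed (auto simp: r)
  then obtain c where "ALL w:ball z r. poly p w / poly q w = c" unfolding constant_on_def by blast
  hence "Fin ` ball z r \<subseteq> f -` {Fin c}" using r by (auto simp: pq)
  thus False using infinite_chart_ball[of Fin r z] r(1) rational_fiber(1)[OF f d] finite_subset
   unfolding charts_def by blast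
 qed
 have "{x. ~ lif f x} \<subseteq> insert Infty (Fin ` ({z. poly q z = 0} Un {z. poly W z = 0}))"
 proof
  fix x assume x: "x \<in> {x. ~ lif f x}"
  show "x \<in> insert Infty (Fin ` ({z. poly q z = 0} Un {z. poly W z = 0}))"
   using x lifW by (cases x) auto
 qed
 moreover have "finite ..." using poly_roots_finite[OF q0] poly_roots_finite[OF W0]
  by (intro finite.insertI finite_imageI finite_UnI)
 ultimately show ?thesis using finite_subset by blast
qed

definition crit_values :: "(riemann_sphere => riemann_sphere) => riemann_sphere set" where
 "crit_values f = f ` {x. ~ lif f x}"

lemma critical_value_iff:
 "rational_map_of_degree f d ==> critical_value f v \<longleftrightarrow> v \<in> crit_values f"
 unfolding critical_value_def crit_values_def using critical_point_iff by auto

lemma finite_crit_values: "rational_map_of_degree f d ==> d >= 1 ==> finite (crit_values f)"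
 unfolding crit_values_def using finite_not_lif by blast

text \<open>Moebius maps move \<open>y\<close> to 0 and a point outside the fibre to infinity. The
  fibre becomes the root set of a polynomial of degree exactly \<open>d\<close>, and a double root
  would be a critical point over \<open>y\<close>.\<close>

lemma card_regular_fiber:
 assumes f: "rational_map_of_degree f d" and d: "d >= 1" and y: "y ~: crit_values f"
 shows "card (f -` {y}) = d"
proof -
 obtain A where A: "mob A" "A y = Fin 0" by (rule mob_to_0)
 obtain x0 where x0: "f x0 ~= y"
 proof -
  have "f -` {y} ~= UNIV" using rational_fiber(1)[OF f d, of y] infinite_UNIV_sphere by metis
  thus ?thesis using that by blast
 qed
 obtain B where B: "mob B" "B Infty = x0" by (rule mob_from_Infty)
 have "rational_map_of_degree (A o f o B) d"
  by (intro rational_mob_pre[OF B(1)] rational_mob_post[OF A(1)] f)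
 then obtain p q where pq: "ratl p q d" "A o f o B = rational_map p q"
  using rational_map_of_degree_iff by blast
 note r' = pq(1)[unfolded ratl_def]
 have Aeq: "A w = Fin 0 \<longleftrightarrow> w = y" for w
  using mob_bij[OF A(1)] A(2) by (metis bij_is_inj injD)
 have "rational_map p q Infty ~= Fin 0" using Aeq x0 B by (simp flip: pq(2))
 hence cp: "coeff p d ~= 0" using r' by (auto simp: rational_map_Infty[OF pq(1)])
 hence deg: "degree p = d" using r' le_degree by (metis le_antisym)
 have fib: "rational_map p q (Fin z) = Fin 0 \<longleftrightarrow> poly p z = 0" for z using r' by auto
 have "rsquarefree p" unfolding rsquarefree_roots
 proof (intro allI notI)
  fix z assume z: "poly p z = 0 & poly (pderiv p) z = 0"
  hence qz: "poly q z ~= 0" using r' by blast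
  obtain r where r: "r > 0" "ALL w:ball z r. poly q w ~= 0" using poly_nz_nbhd[OF qz] by blast
  have "(%w. poly p w / poly q w) holomorphic_on ball z r"
   using r by (intro holomorphic_intros) auto
  hence "lif (rational_map p q) (Fin z) \<longleftrightarrow> deriv (%w. poly p w / poly q w) z ~= 0"
   using lif_chart[of Fin r z "rational_map p q" "%w. poly p w / poly q w"] r by (auto simp: charts_def)
  moreover have "((%w. poly p w / poly q w) has_field_derivative 0) (at z)"
   using qz z by (auto intro!: derivative_eq_intros)
  ultimately have "~ lif (rational_map p q) (Fin z)" using DERIV_imp_deriv by blast
  hence "~ lif f (B (Fin z))" using lif_mob[OF A(1) B(1)] pq(2) by metis
  moreover have "f (B (Fin z)) = y" using fib[of z] z Aeq by (simp flip: pq(2))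
  ultimately show False using y unfolding crit_values_def by blast
 qed
 hence "smult (lead_coeff p) (\<Prod>z|poly p z = 0. [:-z, 1:]) = p"
  by (rule complex_poly_decompose_rsquarefree)
 moreover have "degree (\<Prod>z|poly p z = 0. [:-z, 1:]) = card {z. poly p z = 0}"
  by (subst degree_prod_eq_sum_degree) auto
 ultimately have card: "card {z. poly p z = 0} = d" using deg cp by (metis degree_smult_eq)
 have "f -` {y} = B ` Fin ` {z. poly p z = 0}"
 proof (intro set_eqI iffI)
  fix x assume x: "x \<in> f -` {y}"
  obtain w where w: "x = B w" using mob_bij[OF B(1)] by (metis bij_pointE)
  hence "w ~= Infty" using x x0 B by auto
  then obtain z where z: "w = Fin z" by (cases w) auto
  have "rational_map p q (Fin z) = Fin 0" using x w z A by (simp flip: pq(2))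
  thus "x \<in> B ` Fin ` {z. poly p z = 0}" using w z fib by blast
 next
  fix x assume "x \<in> B ` Fin ` {z. poly p z = 0}"
  then obtain z where "x = B (Fin z)" "poly p z = 0" by blast
  thus "x \<in> f -` {y}" using fib[of z] Aeq by (simp flip: pq(2))
 qed
 moreover have "inj B" using mob_bij[OF B(1)] bij_is_inj by blast
 ultimately show ?thesis using card inj_Fin by (simp add: card_image inj_on_subset[of _ UNIV])
qed

subsection \<open>Coverings and lifts\<close>

text \<open>Around the \<open>d\<close> preimages of \<open>y\<close> there are disjoint
  neighbourhoods of injectivity, and \<open>T\<close> is the intersection of their images. Nothing
  else lies over \<open>T\<close>, since a further point would give a fibre of \<open>d + 1\<close>
  points.\<close>

lemma evenly_covered:
 assumes f: "rational_map_of_degree f d" and d: "d >= 1" and y: "y ~: crit_values f"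
 obtains T U where "open T" "y \<in> T" "!!x. x \<in> f -` {y} ==> open (U x) & x \<in> U x & inj_on f (U x) & f ` U x = T"
  "!!x x'. x \<in> f -` {y} ==> x' \<in> f -` {y} ==> x ~= x' ==> U x Int U x' = {}"
  "f -` T = (\<Union>x\<in>f -` {y}. U x)"
proof -
 define P where "P = f -` {y}"
 have P: "finite P" "card P = d" "P ~= {}"
  unfolding P_def using rational_fiber[OF f d] card_regular_fiber[OF f d y] by auto
 have "EX N. open N & x \<in> N & inj_on f N" if "x \<in> P" for x
  using y that unfolding P_def crit_values_def lif_def by blast
 then obtain N where N: "!!x. x \<in> P ==> open (N x) & x \<in> N x & inj_on f (N x)" by metis
 \<comment> \<open>Half the mutual distances of the preimages; the element 1 keeps the set nonempty
   when there is only one preimage.\<close>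
 define E where "E = insert 1 ((%(x, x'). dist x x' / 2) ` {(x, x') \<in> P \<times> P. x ~= x'})"
 have E: "finite E" "E ~= {}" "!!e. e \<in> E ==> e > 0"
 proof -
  have "finite {(x, x') \<in> P \<times> P. x ~= x'}"
   by (rule finite_subset[of _ "P \<times> P"]) (use P in auto)
  thus "finite E" unfolding E_def by blast
 qed (auto simp: E_def)
 define e where "e = Min E"
 have e: "e > 0" using E by (simp add: e_def)
 have dj: "ball x e Int ball x' e = {}" if "x \<in> P" "x' \<in> P" "x ~= x'" for x x'
 proof -
  have "dist x x' / 2 \<in> E" using that unfolding E_def by force
  hence "e <= dist x x' / 2" unfolding e_def by (rule Min_le[OF E(1)])
  hence "~ (dist x z < e & dist x' z < e)" for z using dist_triangle2[of x x' z] by linarith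
  thus ?thesis by auto
 qed
 define M where "M x = N x Int ball x e" for x
 define T where "T = (\<Inter>x\<in>P. f ` M x)"
 define U where "U x = M x Int f -` T" for x
 have M: "open (M x)" "x \<in> M x" "inj_on f (M x)" if "x \<in> P" for x
  using N[OF that] e unfolding M_def by (auto intro: inj_on_subset)
 have oT: "open T" unfolding T_def using P M rational_open[OF f d] by (intro open_INT) auto
 have yT: "y \<in> T" unfolding T_def using M(2) by (force simp: P_def)
 have fU: "f ` U x = T" if xP: "x \<in> P" for x
 proof (intro equalityI subsetI)
  fix t assume t: "t \<in> T"
  then obtain m where "m \<in> M x" "t = f m" using xP unfolding T_def by blast
  thus "t \<in> f ` U x" using t unfolding U_def by blast
 qed (auto simp: U_def)
 have Udj: "U x Int U x' = {}" if "x \<in> P" "x' \<in> P" "x ~= x'" for x x'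
  using dj[OF that] unfolding U_def M_def by blast
 show ?thesis
 proof (rule that[OF oT yT, of U])
  fix x assume "x \<in> f -` {y}"
  hence x: "x \<in> P" by (simp add: P_def)
  have "open (f -` T)"
   using rational_continuous[OF f, of UNIV] oT by (simp add: continuous_on_open_vimage)
  thus "open (U x) & x \<in> U x & inj_on f (U x) & f ` U x = T"
   using M[OF x] fU[OF x] x yT unfolding U_def P_def by (auto intro: inj_on_subset)
 next
  show "U x Int U x' = {}" if "x \<in> f -` {y}" "x' \<in> f -` {y}" "x ~= x'" for x x'
   using Udj that unfolding P_def by blast
 next
  show "f -` T = (\<Union>x\<in>f -` {y}. U x)"
  proof (intro equalityI subsetI)
   fix w assume w: "w \<in> f -` T"
   show "w \<in> (\<Union>x\<in>f -` {y}. U x)"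
   proof (rule ccontr)
    assume nw: "w ~: (\<Union>x\<in>f -` {y}. U x)"
    have "EX u:U x. f u = f w" if "x \<in> P" for x using fU[OF that] w by (metis image_iff vimageE)
    then obtain u where u: "!!x. x \<in> P ==> u x \<in> U x & f (u x) = f w" by metis
    have "inj_on u P" using u Udj unfolding inj_on_def by (metis disjoint_iff)
    hence "card (u ` P) = d" using P by (simp add: card_image)
    moreover have "w ~: u ` P" using nw u unfolding P_def by blast
    ultimately have "card (insert w (u ` P)) = Suc d" using P by simp
    moreover have "insert w (u ` P) \<subseteq> f -` {f w}" using u by auto
    ultimately show False
     using rational_fiber(1,2)[OF f d, of "f w"] card_mono by (metis not_less_eq_eq)
   qed
  qed (auto simp: U_def)
 qed
qed

lemma openin_stereo_image:
 assumes "open U" "U \<subseteq> A"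
 shows "openin (top_of_set (stereo ` A)) (stereo ` U)"
proof -
 have "homeomorphism A (stereo ` A) stereo unstereo"
  by (rule homeomorphism_of_subsets[OF homeomorphism_stereo]) (use norm_stereo in auto)
 thus ?thesis
  using homeomorphism_imp_open_map assms by (metis openin_open_eq open_subset openin_open_Int inf.absorb_iff2)
qed

text \<open>Transported by \<open>stereo\<close> into a Euclidean space, the setting of the lifting
  theorem for covering spaces.\<close>

lemma covering_rational:
 assumes f: "rational_map_of_degree f d" and d: "d >= 1"
 shows "covering_space (stereo ` (f -` (- crit_values f))) (stereo o f o unstereo) (stereo ` (- crit_values f))"
proof
 define A where "A = f -` (- crit_values f)"
 define B where "B = - crit_values f"
 have cf: "continuous_on S f" for S using rational_continuous[OF f] .
 have oB: "open B" unfolding B_def using finite_crit_values[OF f d] finite_imp_closed by blast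
 have cu: "continuous_on (stereo ` S) unstereo" for S
  by (rule continuous_on_subset[OF continuous_on_unstereo]) (use norm_stereo in auto)
 show "continuous_on (stereo ` (f -` (- crit_values f))) (stereo o f o unstereo)"
  by (intro continuous_on_compose cu continuous_on_stereo cf)
 have fA: "f ` A = B" unfolding A_def B_def using rational_surj[OF f d] by (simp add: surj_image_vimage_eq)
 thus "(stereo o f o unstereo) ` stereo ` (f -` (- crit_values f)) = stereo ` (- crit_values f)"
  unfolding A_def[symmetric] B_def[symmetric] by (auto simp: image_image image_comp)
 fix s assume "s \<in> stereo ` (- crit_values f)"
 then obtain y where y: "y ~: crit_values f" "s = stereo y" by blast
 obtain T0 U0 where TU0: "open T0" "y \<in> T0" "!!x. x \<in> f -` {y} ==> open (U0 x) & x \<in> U0 x & inj_on f (U0 x) & f ` U0 x = T0"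
  "!!x x'. x \<in> f -` {y} ==> x' \<in> f -` {y} ==> x ~= x' ==> U0 x Int U0 x' = {}"
  "f -` T0 = (\<Union>x\<in>f -` {y}. U0 x)" using evenly_covered[OF f d y(1)] by metis
 define T where "T = T0 Int B"
 define U where "U x = U0 x Int f -` B" for x
 have T: "open T" "y \<in> T" "T \<subseteq> B" unfolding T_def using TU0 oB y by (auto simp: B_def)
 have ofB: "open (f -` B)" using cf[of UNIV] oB by (simp add: continuous_on_open_vimage)
 have U: "open (U x)" "inj_on f (U x)" "f ` U x = T" "U x \<subseteq> A" if "x \<in> f -` {y}" for x
  using TU0(3)[OF that] ofB unfolding U_def T_def A_def B_def by (auto intro: inj_on_subset)
 have Udj: "U x Int U x' = {}" if "x \<in> f -` {y}" "x' \<in> f -` {y}" "x ~= x'" for x x'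
  using TU0(4)[OF that] unfolding U_def by blast
 have fT: "f -` T = (\<Union>x\<in>f -` {y}. U x)" using TU0(5) unfolding T_def U_def by blast
 define v where "v = (%x. stereo ` U x) ` (f -` {y})"
 show "EX T. s \<in> T & openin (top_of_set (stereo ` (- crit_values f))) T &
    (EX v. \<Union> v = stereo ` (f -` (- crit_values f)) Int (stereo o f o unstereo) -` T &
      (ALL u:v. openin (top_of_set (stereo ` (f -` (- crit_values f)))) u) &
      pairwise disjnt v & (ALL u:v. EX q. homeomorphism u T (stereo o f o unstereo) q))"
  unfolding A_def[symmetric] unfolding B_def[symmetric]
 proof (intro exI[of _ "stereo ` T"] conjI exI[of _ v] ballI)
  show "s \<in> stereo ` T" using T y by blast
  show "openin (top_of_set (stereo ` B)) (stereo ` T)" using openin_stereo_image T by blast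
  have "\<Union> v = stereo ` (f -` T)" unfolding fT v_def by blast
  moreover have "f -` T \<subseteq> A" using T(3) unfolding A_def B_def by blast
  moreover have mem: "(stereo o f o unstereo) (stereo w) \<in> stereo ` T \<longleftrightarrow> w \<in> f -` T" for w
   by (simp add: inj_image_mem_iff[OF inj_stereo])
  have "stereo ` A Int (stereo o f o unstereo) -` stereo ` T = stereo ` (A Int f -` T)"
  proof (intro equalityI subsetI)
   fix s assume "s \<in> stereo ` A Int (stereo o f o unstereo) -` stereo ` T"
   then obtain w where "w \<in> A" "s = stereo w" "(stereo o f o unstereo) (stereo w) \<in> stereo ` T" by blast
   thus "s \<in> stereo ` (A Int f -` T)" unfolding mem by blast
  next
   fix s assume "s \<in> stereo ` (A Int f -` T)"
   then obtain w where "w \<in> A" "s = stereo w" "w \<in> f -` T" by blast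
   thus "s \<in> stereo ` A Int (stereo o f o unstereo) -` stereo ` T" using mem[of w] by simp
  qed
  ultimately show "\<Union> v = stereo ` A Int (stereo o f o unstereo) -` stereo ` T"
   by (simp add: Int_absorb1)
  show "openin (top_of_set (stereo ` A)) u" if uv: "u \<in> v" for u
  proof -
   obtain x where x: "x \<in> f -` {y}" "u = stereo ` U x" using uv unfolding v_def by blast
   show ?thesis unfolding x(2) by (rule openin_stereo_image[OF U(1)[OF x(1)] U(4)[OF x(1)]])
  qed
  have "disjnt (stereo ` U x) (stereo ` U x')" if "x \<in> f -` {y}" "x' \<in> f -` {y}" "x ~= x'" for x x'
   using Udj[OF that] image_Int[OF inj_stereo, of "U x" "U x'"] unfolding disjnt_def by simp
  thus "pairwise disjnt v" unfolding v_def by (intro pairwiseI) blast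
  fix u assume "u \<in> v"
  then obtain x where x: "x \<in> f -` {y}" "u = stereo ` U x" unfolding v_def by blast
  note Ux = U[OF x(1)]
  show "EX q. homeomorphism u (stereo ` T) (stereo o f o unstereo) q"
  proof -
   have 1: "homeomorphism (stereo ` U x) (U x) unstereo stereo"
   proof (rule homeomorphism_of_subsets[OF homeomorphism_symD[OF homeomorphism_stereo]])
    show "stereo ` U x \<subseteq> sphere 0 1" using range_stereo by blast
   qed (simp_all add: image_image)
   have 3: "homeomorphism T (stereo ` T) stereo unstereo"
    by (rule homeomorphism_of_subsets[OF homeomorphism_stereo]) (use norm_stereo in auto)
   have op: "openin (top_of_set T) (f ` V)" if "openin (top_of_set (U x)) V" for V
   proof -
    have "open V" using that Ux(1) openin_open_eq by blast
    hence "open (f ` V)" using rational_open[OF f d] by blast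
    moreover have "f ` V \<subseteq> T" using that Ux(3) openin_subset by fastforce
    ultimately show ?thesis by (simp add: open_subset)
   qed
   obtain g where 2: "homeomorphism (U x) T f g"
    by (rule homeomorphism_injective_open_map[OF cf Ux(3,2) op])
   have "homeomorphism (stereo ` U x) (stereo ` T) (stereo o (f o unstereo)) ((stereo o g) o unstereo)"
    by (rule homeomorphism_compose[OF homeomorphism_compose[OF 1 2] 3])
   thus ?thesis using x(2) by (auto simp: o_assoc)
  qed
 qed
qed

lemma lift_exists:
 fixes g :: "complex => riemann_sphere"
 assumes f: "rational_map_of_degree f d" and d: "d >= 1"
  and W: "convex W" and z: "z \<in> W" and g: "continuous_on W g" "g ` W Int crit_values f = {}"
  and x: "f x = g z"
 obtains h where "continuous_on W h" "h z = x" "!!w. w \<in> W ==> f (h w) = g w"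
proof -
 have a: "stereo x \<in> stereo ` (f -` (- crit_values f))" using x z g by auto
 have sc: "simply_connected W" using W convex_imp_simply_connected by blast
 have lc: "locally path_connected W" using W convex_imp_locally_path_connected by blast
 have cg: "continuous_on W (stereo o g)" using g by (simp add: continuous_on_stereo_iff o_def)
 have im: "stereo o g \<in> W \<rightarrow> stereo ` (- crit_values f)" using g(2) by fastforce
 have eq: "(stereo o g) z = (stereo o f o unstereo) (stereo x)" using x by simp
 obtain k where k: "continuous_on W k" "k \<in> W \<rightarrow> stereo ` (f -` (- crit_values f))" "k z = stereo x"
  "!!y. y \<in> W ==> (stereo o f o unstereo) (k y) = (stereo o g) y"
  using covering_space_lift_strong[OF covering_rational[OF f d] a z sc lc cg im eq] by metis
 have ks: "EX u. k w = stereo u" if "w \<in> W" for w using k(2) that by (auto simp: Pi_iff)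
 show ?thesis
 proof (rule that[of "unstereo o k"])
  show "continuous_on W (unstereo o k)"
   by (intro continuous_on_compose k(1) continuous_on_subset[OF continuous_on_unstereo])
    (use ks norm_stereo in force)
  show "(unstereo o k) z = x" using k(3) by simp
  show "f ((unstereo o k) w) = g w" if "w \<in> W" for w
   using k(4)[OF that] inj_stereo by (simp add: inj_eq)
 qed
qed

text \<open>The coincidence set is closed, and local injectivity of \<open>f\<close> along
  \<open>h1\<close> makes it open.\<close>

lemma lift_unique:
 fixes h1 h2 :: "'a :: topological_space => riemann_sphere"
 assumes S: "connected S" and h: "continuous_on S h1" "continuous_on S h2"
  and eq: "!!w. w \<in> S ==> f (h1 w) = f (h2 w)" and lif: "!!w. w \<in> S ==> lif f (h1 w)"
  and z: "z \<in> S" "h1 z = h2 z" and w: "w \<in> S"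
 shows "h1 w = h2 w"
proof -
 define E where "E = {w \<in> S. h1 w = h2 w}"
 have 1: "closedin (top_of_set S) E"
 proof -
  have "continuous_on S (%w. dist (h1 w) (h2 w))" using h by (intro continuous_intros)
  hence "closedin (top_of_set S) (S Int (%w. dist (h1 w) (h2 w)) -` {0})"
   by (rule continuous_closedin_preimage) simp
  moreover have "S Int (%w. dist (h1 w) (h2 w)) -` {0} = E" unfolding E_def by auto
  ultimately show ?thesis by simp
 qed
 have 2: "openin (top_of_set S) E" unfolding openin_subopen[of _ E]
 proof
  fix a assume a: "a \<in> E"
  hence aS: "a \<in> S" by (simp add: E_def)
  obtain U where U: "open U" "h1 a \<in> U" "inj_on f U" using lif[OF aS] unfolding lif_def by blast
  define V where "V = (S Int h1 -` U) Int (S Int h2 -` U)"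
  have "openin (top_of_set S) V"
   unfolding V_def using U h by (intro openin_Int continuous_openin_preimage_gen)
  moreover have "a \<in> V" using a U unfolding V_def E_def by auto
  moreover have "V \<subseteq> E" using U(3) eq unfolding V_def E_def inj_on_def by blast
  ultimately show "EX T. openin (top_of_set S) T & a \<in> T & T \<subseteq> E" by blast
 qed
 have "E = S" using S 1 2 z unfolding connected_clopen E_def by blast
 thus ?thesis using w unfolding E_def by blast
qed

lemma lift_open_image:
 fixes h g :: "complex => riemann_sphere"
 assumes h: "continuous_on S h" and S: "open S" and eq: "!!w. w \<in> S ==> f (h w) = g w"
  and lif: "!!w. w \<in> S ==> lif f (h w)" and f: "continuous_on UNIV f"
  and g: "!!T. open T ==> T \<subseteq> S ==> open (g ` T)" and T: "open T" "T \<subseteq> S"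
 shows "open (h ` T)" unfolding open_subopen[of "h ` T"]
proof
 fix x assume "x \<in> h ` T"
 then obtain z where z: "z \<in> T" "x = h z" by blast
 then obtain N where N: "open N" "h z \<in> N" "inj_on f N" using lif T unfolding lif_def by blast
 have "open (T Int h -` N)"
  using continuous_open_preimage[OF continuous_on_subset[OF h T(2)] T(1) N(1)] .
 then obtain r where r: "r > 0" "ball z r \<subseteq> T Int h -` N" using z N openE by (metis IntI vimageI)
 have "h ` ball z r = N Int f -` (g ` ball z r)"
 proof (intro equalityI subsetI)
  fix w assume "w \<in> N Int f -` (g ` ball z r)"
  then obtain z' where z': "w \<in> N" "z' \<in> ball z r" "f w = g z'" by blast
  hence "z' \<in> T" "h z' \<in> N" using r by auto
  hence "h z' \<in> N" "f (h z') = g z'" using eq T by auto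
  hence "w = h z'" using N(3) z' by (metis inj_onD)
  thus "w \<in> h ` ball z r" using z' by blast
 qed (use r eq T in auto)
 moreover have "open (f -` (g ` ball z r))"
  using f g[of "ball z r"] r T by (simp add: continuous_on_open_vimage subset_iff)
 ultimately have "open (h ` ball z r)" using N(1) by auto
 thus "EX T'. open T' & x \<in> T' & T' \<subseteq> h ` T" using z r by (intro exI[of _ "h ` ball z r"]) auto
qed

text \<open>A map with at most one critical value would be a covering of the simply connected complement of
 that value by the connected complement of a finite set.\<close>

lemma two_crit_values:
 assumes f: "rational_map_of_degree f d" and d: "d >= 2"
 shows "~ crit_values f \<subseteq> {v}"
proof
 assume CV: "crit_values f \<subseteq> {v}"
 have d1: "d >= 1" using d by simp
 obtain B where B: "mob B" "B Infty = v" by (rule mob_from_Infty)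
 have bijB: "bij B" using mob_bij B by blast
 \<comment> \<open>With infinity sent to \<open>v\<close>, \<open>g\<close> parametrises the
   complement of \<open>v\<close> by the plane, so all its lifts exist globally.\<close>
 define g where "g = B o Fin"
 have gv: "g z ~= v" for z using bijB B(2) unfolding g_def by (metis bij_is_inj comp_apply injD riemann_sphere.distinct(1))
 have gc: "continuous_on UNIV g" unfolding g_def
  by (intro continuous_on_compose continuous_on_Fin rational_continuous[OF mob_rational[OF B(1)]])
 have go: "open (g ` T)" if "open T" for T unfolding g_def image_comp[symmetric]
  by (intro rational_open[OF mob_rational[OF B(1)]] open_Fin_image that) simp
 have gs: "EX z. y = g z" if "y ~= v" for y
 proof -
  obtain w where "y = B w" using bijB by (metis bij_pointE)
  thus ?thesis using that B(2) Fin_fin[of w] unfolding g_def by (metis comp_apply)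
 qed
 have ginj: "inj g" unfolding g_def using inj_compose bijB bij_is_inj inj_Fin by blast
 have gav: "g ` UNIV Int crit_values f = {}" using gv CV by blast
 define P where "P = f -` {g 0}"
 have "g 0 ~: crit_values f" using gav by blast
 hence P: "finite P" "card P = d"
  unfolding P_def using rational_fiber[OF f d1] card_regular_fiber[OF f d1, of "g 0"] by simp_all
 have "EX h. continuous_on UNIV h & h 0 = x & (ALL w. f (h w) = g w)" if "x \<in> P" for x
 proof -
  have "f x = g 0" using that by (simp add: P_def)
  then obtain h where "continuous_on UNIV h" "h 0 = x" "!!w. w \<in> UNIV ==> f (h w) = g w"
   using lift_exists[OF f d1 convex_UNIV UNIV_I gc gav] by metis
  thus ?thesis by blast
 qed
 then obtain h where h: "!!x. x \<in> P ==> continuous_on UNIV (h x)" "!!x. x \<in> P ==> h x 0 = x"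
  "!!x w. x \<in> P ==> f (h x w) = g w" by metis
 have lifh: "lif f (h x w)" if "x \<in> P" for x w
  using h(3)[OF that] gav unfolding crit_values_def by (metis (mono_tags, lifting) disjoint_iff image_eqI mem_Collect_eq rangeI)
 have oh: "open (range (h x))" if "x \<in> P" for x
  using lift_open_image[OF h(1)[OF that] open_UNIV h(3)[OF that] lifh[OF that] rational_continuous[OF f] go] by auto
 have dj: "x = x'" if "x \<in> P" "x' \<in> P" "h x z = h x' z'" for x x' z z'
 proof -
  have "z = z'" using that h(3) ginj by (metis injD)
  hence "h x 0 = h x' 0"
   using lift_unique[OF connected_UNIV h(1)[OF that(1)] h(1)[OF that(2)], of f z 0] h(3) lifh that by auto
  thus ?thesis using h(2) that by metis
 qed
 have cov: "f -` (- {v}) = (\<Union>x\<in>P. range (h x))"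
 proof (intro equalityI subsetI)
  fix w assume "w \<in> f -` (- {v})"
  then obtain z where z: "f w = g z" using gs by auto
  obtain k where k: "continuous_on UNIV k" "k z = w" "!!w. w \<in> UNIV ==> f (k w) = g w"
   using lift_exists[OF f d1 convex_UNIV UNIV_I gc gav z] by metis
  have "k 0 \<in> P" using k(3) by (simp add: P_def)
  moreover have "k z = h (k 0) z"
   using lift_unique[OF connected_UNIV h(1)[OF `k 0 \<in> P`] k(1), of f 0 z] h(2,3)[OF `k 0 \<in> P`] lifh[OF `k 0 \<in> P`] k(3)
   by auto
  ultimately show "w \<in> (\<Union>x\<in>P. range (h x))" using k(2) by (metis UN_I rangeI)
 next
  fix w assume "w \<in> (\<Union>x\<in>P. range (h x))"
  then obtain x z where "x \<in> P" "w = h x z" by blast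
  thus "w \<in> f -` (- {v})" using h(3)[of x z] gv[of z] by simp
 qed
 have "f -` (- {v}) = UNIV - f -` {v}" by blast
 hence conn: "connected (f -` (- {v}))"
  using connected_delete_finite[OF connected_UNIV_sphere open_UNIV rational_fiber(1)[OF f d1]] by metis
 obtain x where x: "x \<in> P" using P d by fastforce
 have "card (P - {x}) ~= 0" using P x d by simp
 then obtain x' where x': "x' \<in> P" "x' ~= x" by (metis Diff_iff card.empty ex_in_conv singletonI)
 have "range (h x) Int (\<Union>y\<in>P-{x}. range (h y)) Int f -` (- {v}) = {}" using dj x by blast
 moreover have "f -` (- {v}) \<subseteq> range (h x) Un (\<Union>y\<in>P-{x}. range (h y))" using cov by blast
 moreover have "open (range (h x))" "open (\<Union>y\<in>P-{x}. range (h y))" using oh x by auto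
 ultimately have "range (h x) Int f -` (- {v}) = {} | (\<Union>y\<in>P-{x}. range (h y)) Int f -` (- {v}) = {}"
  using connectedD[OF conn] by metis
 moreover have "h x 0 \<in> range (h x) Int f -` (- {v})" using cov x by blast
 moreover have "h x' 0 \<in> (\<Union>y\<in>P-{x}. range (h y)) Int f -` (- {v})" using cov x' by blast
 ultimately show False by blast
qed

subsection \<open>Components of preimages\<close>

lemma components_stereo:
 assumes "C \<in> components X"
 shows "stereo ` C \<in> components (stereo ` X)"
proof -
 have C: "C ~= {}" "C \<subseteq> X" "connected C" "!!D. D ~= {} ==> C \<subseteq> D ==> D \<subseteq> X ==> connected D ==> D = C"
  using assms unfolding in_components_maximal by auto
 show ?thesis unfolding in_components_maximal
 proof (intro conjI allI impI)
  show "connected (stereo ` C)" using C(3) connected_continuous_image continuous_on_stereo by blast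
  fix D assume D: "D ~= {} & stereo ` C \<subseteq> D & D \<subseteq> stereo ` X & connected D"
  have "D \<subseteq> sphere 0 1" using D norm_stereo by force
  hence "connected (unstereo ` D)"
   using D connected_continuous_image continuous_on_subset[OF continuous_on_unstereo] by blast
  moreover have "unstereo ` D = stereo -` D"
  proof (intro equalityI subsetI)
   fix x assume "x \<in> stereo -` D"
   thus "x \<in> unstereo ` D" by (intro image_eqI[of _ _ "stereo x"]) auto
  next
   fix x assume "x \<in> unstereo ` D"
   then obtain s where "s \<in> D" "x = unstereo s" by blast
   thus "x \<in> stereo -` D" using D by auto
  qed
  moreover have "C \<subseteq> stereo -` D" using D by blast
  moreover have "stereo -` D \<subseteq> X"
  proof
   fix x assume "x \<in> stereo -` D"
   hence "stereo x \<in> stereo ` X" using D by blast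
   thus "x \<in> X" by (simp add: inj_image_mem_iff[OF inj_stereo])
  qed
  ultimately have "unstereo ` D = C" using C(4) D by (metis image_is_empty)
  moreover have "stereo ` unstereo ` D = D"
  proof -
   have "stereo (unstereo s) = s" if "s \<in> D" for s using that D by auto
   thus ?thesis by (simp add: image_image)
  qed
  ultimately show "D = stereo ` C" by simp
 qed (use C in auto)
qed

text \<open>Sura-Bura: in a compact set a component is the intersection of its clopen
  neighbourhoods, so one of them avoids \<open>A\<close>.\<close>

lemma component_clopen_avoiding:
 assumes X: "closed (X :: riemann_sphere set)" and C: "C \<in> components X" and A: "finite A" "A Int C = {}"
 obtains K where "C \<subseteq> K" "K \<subseteq> X" "A Int K = {}" "openin (top_of_set X) K" "closed K"
proof -
 have cX: "compact (stereo ` X)"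
  using X compact_sphere_iff compact_continuous_image continuous_on_stereo by blast
 have C': "stereo ` C \<in> components (stereo ` X)" using components_stereo[OF C] .
 have cC: "compact (stereo ` C)" using compact_components[OF cX C'] .
 have "open (- stereo ` A)" using A finite_imp_closed by blast
 moreover have "stereo ` C \<subseteq> - stereo ` A"
  using A image_Int[OF inj_stereo, of A C] by auto
 ultimately obtain K' where K': "openin (top_of_set (stereo ` X)) K'" "compact K'" "stereo ` C \<subseteq> K'" "K' \<subseteq> - stereo ` A"
  using Sura_Bura_clopen_subset[OF closed_imp_locally_compact[OF compact_imp_closed[OF cX]] C' cC] by metis
 obtain O' where O': "open O'" "K' = stereo ` X Int O'" using K'(1) by (auto simp: openin_open)
 define K where "K = stereo -` K'"
 have K: "K = X Int stereo -` O'" unfolding K_def O'(2) using inj_stereo by (auto dest: injD)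
 show ?thesis
 proof (rule that[of K])
  show "C \<subseteq> K" using K' unfolding K_def by blast
  show "K \<subseteq> X" using K by blast
  show "A Int K = {}" using K' unfolding K_def by blast
  have "open (stereo -` O')"
   using continuous_on_stereo[of UNIV] O'(1) by (simp add: continuous_on_open_vimage)
  thus "openin (top_of_set X) K" unfolding K by (simp add: openin_open_Int)
  show "closed K" unfolding K_def using continuous_on_stereo[of UNIV] compact_imp_closed[OF K'(2)]
   by (simp add: continuous_on_closed_vimage)
 qed
qed

text \<open>If \<open>C\<close> missed the fibre of \<open>y\<close>, so would a clopen
  neighbourhood \<open>K\<close> of \<open>C\<close> in the preimage of \<open>L\<close>. The image
  of \<open>K\<close> is open in \<open>L\<close> because \<open>f\<close> is open, and closed by
  compactness, so it would be all of \<open>L\<close>.\<close>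

lemma component_preimage_onto:
 assumes f: "rational_map_of_degree f d" and d: "d >= 1" and L: "closed L" "connected L"
  and C: "C \<in> components (f -` L)"
 shows "f ` C = L"
proof
 show "f ` C \<subseteq> L" using in_components_subset[OF C] by blast
 show "L \<subseteq> f ` C"
 proof
  fix y assume y: "y \<in> L"
  show "y \<in> f ` C"
  proof (rule ccontr)
   assume ny: "y ~: f ` C"
   have cL: "closed (f -` L)"
    using rational_continuous[OF f, of UNIV] L by (simp add: continuous_on_closed_vimage)
   have "f -` {y} Int C = {}" using ny by blast
   then obtain K where K: "C \<subseteq> K" "K \<subseteq> f -` L" "f -` {y} Int K = {}" "openin (top_of_set (f -` L)) K" "closed K"
    using component_clopen_avoiding[OF cL C rational_fiber(1)[OF f d]] by metis
   obtain G where G: "open G" "K = f -` L Int G" using K(4) by (auto simp: openin_open)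
   have "f ` K = L Int f ` G" unfolding G(2) by blast
   hence "openin (top_of_set L) (f ` K)"
    using rational_open[OF f d G(1)] by (simp add: openin_open_Int)
   moreover have "closed (f ` K)"
    using K(5) compact_sphere_iff compact_continuous_image[OF rational_continuous[OF f]] by blast
   hence "closedin (top_of_set L) (f ` K)"
    using K(2) by (simp add: closed_subset image_subset_iff_subset_vimage)
   moreover have "f ` K ~= {}" using K(1) in_components_nonempty[OF C] by blast
   ultimately have "f ` K = L" using L(2) unfolding connected_clopen by blast
   thus False using y K(3) by blast
  qed
 qed
qed

lemma connected_nest_sphere:
 fixes S :: "nat => riemann_sphere set"
 assumes S: "!!n. closed (S n)" "!!n. connected (S n)" and nest: "!!m n. m <= n ==> S n \<subseteq> S m"
 shows "connected (\<Inter>n. S n)"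
proof -
 have "connected (\<Inter> (range (%n. stereo ` S n)))"
 proof (rule connected_nest)
  show "compact (stereo ` S n)" for n
   using S compact_sphere_iff compact_continuous_image continuous_on_stereo by blast
  show "connected (stereo ` S n)" for n
   using S connected_continuous_image continuous_on_stereo by blast
  show "m <= n ==> stereo ` S n \<subseteq> stereo ` S m" for m n using nest by blast
 qed
 moreover have "\<Inter> (range (%n. stereo ` S n)) \<subseteq> sphere 0 1" using norm_stereo by force
 ultimately have "connected (unstereo ` \<Inter> (range (%n. stereo ` S n)))"
  using connected_continuous_image continuous_on_subset[OF continuous_on_unstereo] by blast
 moreover have "(\<Inter>n. stereo ` S n) = stereo ` (\<Inter>n. S n)"
  by (rule image_INT[OF inj_stereo, symmetric, of UNIV]) auto
 ultimately show ?thesis by (simp add: image_image)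
qed

section \<open>Fatou and Julia sets\<close>

lemma continuous_on_funpow_sphere:
 fixes f :: "riemann_sphere => riemann_sphere"
 assumes "continuous_on UNIV f"
 shows "continuous_on S (f ^^ n)"
proof -
 have "continuous_on UNIV (f ^^ n)"
 proof (induction n)
  case (Suc n)
  thus ?case using assms continuous_on_compose continuous_on_subset by (metis funpow.simps(2) subset_UNIV)
 qed (simp add: continuous_on_id' id_def)
 thus ?thesis using continuous_on_subset by blast
qed

lemma uniform_continuity_sphere:
 fixes A :: "riemann_sphere => 'a :: metric_space"
 assumes "continuous_on UNIV A" "e > 0"
 shows "EX d>0. ALL x y. dist x y < d --> dist (A x) (A y) < e"
proof -
 have "uniformly_continuous_on UNIV A"
  by (rule compact_uniformly_continuous[OF assms(1) compact_UNIV_sphere])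
 thus ?thesis by (rule uniformly_continuous_onE[OF _ assms(2)]) auto
qed

text \<open>Equicontinuity of the iterates at one point. The Fatou set is handled through it,
  because it passes easily along \<open>f\<close> in both directions.\<close>

definition eq_at :: "(riemann_sphere => riemann_sphere) => riemann_sphere => bool" where
 "eq_at f z \<longleftrightarrow> (ALL eps>0. EX dl>0. ALL n x. dist x z < dl --> dist ((f ^^ n) x) ((f ^^ n) z) < eps)"

text \<open>Arzela-Ascoli for the maps read in \<open>complex \<times> real\<close>; the limits stay
  on the closed unit sphere and can be read back.\<close>

lemma normal_on_ball_if_eq_at:
 assumes "cball z r \<subseteq> U" "!!w. w \<in> U ==> eq_at f w"
 shows "normal_on (ball z r) (range (%n. f ^^ n))" unfolding normal_on_def
proof (intro allI impI)
 fix g :: "nat => riemann_sphere => riemann_sphere"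
 assume g: "range g \<subseteq> range (%n. f ^^ n)"
 define S where "S = stereo ` cball z r"
 have cS: "compact S"
  unfolding S_def using compact_continuous_image[OF continuous_on_stereo] compact_sphere_iff by blast
 define F where "F i p = stereo (g i (unstereo p))" for i p
 have M: "norm (F n x) <= 1" for n x by (simp add: F_def norm_stereo)
 have eqc: "EX d>0. ALL n y. y \<in> S & norm (p - y) < d --> norm (F n p - F n y) < e"
  if p: "p \<in> S" and e: "e > 0" for p e
 proof -
  obtain x where x: "x \<in> cball z r" "p = stereo x" using p unfolding S_def by blast
  then obtain d where d: "d > 0" "ALL n y. dist y x < d --> dist ((f ^^ n) y) ((f ^^ n) x) < e"
   using assms e unfolding eq_at_def by (meson subsetD)
  have "norm (F n p - F n y) < e" if y: "y \<in> S" "norm (p - y) < d" for n y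
  proof -
   obtain y' where y': "y = stereo y'" using y unfolding S_def by blast
   have "dist y' x < d" using y(2) unfolding x(2) y' by (simp add: dist_riemann_sphere_def dist_norm norm_minus_commute)
   moreover obtain m where "g n = f ^^ m" using g by blast
   ultimately have "dist (g n y') (g n x) < e" using d by simp
   thus ?thesis unfolding x(2) y' F_def by (simp add: dist_riemann_sphere_def dist_norm norm_minus_commute)
  qed
  thus ?thesis using d(1) by blast
 qed
 obtain G k where G: "strict_mono (k :: nat => nat)"
  "!!e. 0 < e ==> EX N. ALL n x. n >= N & x \<in> S --> norm (F (k n) x - G x) < e"
 proof (rule Arzela_Ascoli[OF cS M])
  show "EX d>0. ALL n y. y \<in> S & norm (x - y) < d --> norm (F n x - F n y) < e" if "x \<in> S" "e > 0" for x e
   using eqc that by simp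
 qed (rule that, assumption, assumption)
 define h where "h x = unstereo (G (stereo x))" for x
 have Gs: "stereo (h x) = G (stereo x)" if x: "x \<in> cball z r" for x
 proof -
  have xS: "stereo x \<in> S" using x unfolding S_def by blast
  have lim: "(%n. F (k n) (stereo x)) \<longlonglongrightarrow> G (stereo x)" unfolding LIMSEQ_iff
  proof (intro allI impI)
   fix e :: real assume "e > 0"
   thus "EX N. ALL n>=N. norm (F (k n) (stereo x) - G (stereo x)) < e" using G(2)[of e] xS by meson
  qed
  have "F (k n) (stereo x) \<in> sphere 0 1" for n by (simp add: F_def norm_stereo)
  hence "G (stereo x) \<in> range stereo"
   unfolding range_stereo by (rule closed_sequentially[OF closed_sphere _ lim])
  then obtain y where "G (stereo x) = stereo y" by blast
  thus ?thesis unfolding h_def by simp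
 qed
 show "EX r' h. strict_mono (r' :: nat => nat) & (ALL K. compact K & K \<subseteq> ball z r --> uniform_limit K (g o r') h sequentially)"
 proof (intro exI conjI allI impI)
  show "strict_mono k" by (rule G)
  fix K assume K: "compact K & K \<subseteq> ball z r"
  show "uniform_limit K (g o k) h sequentially"
  proof (rule uniform_limitI)
   fix e :: real assume "e > 0"
   then obtain N where N: "ALL n x. n >= N & x \<in> S --> norm (F (k n) x - G x) < e" using G(2) by blast
   have "dist ((g o k) n x) (h x) < e" if n: "n >= N" and x: "x \<in> K" for n x
   proof -
    have xr: "x \<in> cball z r" using x K by auto
    hence "norm (F (k n) (stereo x) - G (stereo x)) < e" using N n unfolding S_def by blast
    thus ?thesis using Gs[OF xr] by (simp add: F_def dist_riemann_sphere_def dist_norm)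
   qed
   thus "\<forall>\<^sub>F n in sequentially. ALL x:K. dist ((g o k) n x) (h x) < e"
    by (intro eventually_sequentiallyI) blast
  qed
 qed
qed

text \<open>Otherwise points tending to \<open>w\<close> are separated from \<open>w\<close> by
  \<open>e\<close> under suitable iterates. A uniform limit of a subsequence near \<open>w\<close>
  would be continuous at \<open>w\<close>, against a three-term estimate.\<close>

lemma eq_at_if_normal:
 assumes f: "continuous_on UNIV f" and U: "open U" "w \<in> U" "normal_on U (range (%n. f ^^ n))"
 shows "eq_at f w"
proof (rule ccontr)
 assume "~ eq_at f w"
 then obtain e where e: "e > 0" "ALL d>0. EX n x. dist x w < d & dist ((f ^^ n) x) ((f ^^ n) w) >= e"
  unfolding eq_at_def by (meson not_le_imp_less)
 have "EX n x. dist x w < 1 / real (Suc i) & dist ((f ^^ n) x) ((f ^^ n) w) >= e" for i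
  using e(2) by (metis of_nat_0_less_iff zero_less_Suc zero_less_divide_1_iff)
 then obtain n x where nx: "!!i. dist (x i) w < 1 / real (Suc i)" "!!i. dist ((f ^^ n i) (x i)) ((f ^^ n i) w) >= e"
  by metis
 define g where "g i = f ^^ n i" for i
 have "range g \<subseteq> range (%n. f ^^ n)" unfolding g_def by blast
 then obtain r h where r: "strict_mono (r :: nat => nat)" "!!K. compact K ==> K \<subseteq> U ==> uniform_limit K (g o r) h sequentially"
  using U(3) unfolding normal_on_def by meson
 obtain s where s: "s > 0" "cball w s \<subseteq> U" using U open_contains_cball by metis
 have ul: "uniform_limit (cball w s) (g o r) h sequentially"
  using r(2) s compact_sphere_iff by blast
 have "continuous_on (cball w s) h"
  by (rule uniform_limit_theorem[OF _ ul]) (auto simp: g_def continuous_on_funpow_sphere[OF f])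
 then obtain d where d: "d > 0" "!!y. y \<in> cball w s ==> dist y w < d ==> dist (h y) (h w) < e / 3"
  using e(1) s(1) unfolding continuous_on_iff by (metis centre_in_cball divide_pos_pos less_eq_real_def zero_less_numeral)
 obtain N1 where N1: "!!i y. i >= N1 ==> y \<in> cball w s ==> dist (g (r i) y) (h y) < e / 3"
 proof -
  have "\<forall>\<^sub>F n in sequentially. ALL y:cball w s. dist ((g o r) n y) (h y) < e / 3"
   using uniform_limitD[OF ul, of "e / 3"] e(1) by simp
  then obtain N where "ALL n>=N. ALL y:cball w s. dist ((g o r) n y) (h y) < e / 3"
   unfolding eventually_sequentially by blast
  thus ?thesis using that[of N] by simp
 qed
 obtain N2 :: nat where N2: "1 / real (Suc N2) < min d s"
  using d(1) s(1) reals_Archimedean[of "min d s"] by (auto simp: inverse_eq_divide)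
 define i where "i = max N1 N2"
 have "r i >= N2" using seq_suble[OF r(1), of i] unfolding i_def by linarith
 hence "1 / real (Suc (r i)) <= 1 / real (Suc N2)" by (simp add: frac_le)
 hence xd: "dist (x (r i)) w < min d s" using nx(1)[of "r i"] N2 by linarith
 hence xs: "x (r i) \<in> cball w s" by (simp add: dist_commute)
 have "dist (g (r i) (x (r i))) (h (x (r i))) < e / 3" "dist (g (r i) w) (h w) < e / 3"
  using N1[of i] xs s(1) unfolding i_def by auto
 moreover have "dist (h (x (r i))) (h w) < e / 3" using d(2) xs xd by simp
 ultimately have "dist (g (r i) (x (r i))) (g (r i) w) < e"
  using dist_triangle[of "g (r i) (x (r i))" "g (r i) w" "h (x (r i))"]
   dist_triangle[of "h (x (r i))" "g (r i) w" "h w"] dist_commute[of "h w" "g (r i) w"] by linarith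
 thus False using nx(2)[of "r i"] unfolding g_def by simp
qed

lemma fatou_iff:
 assumes f: "continuous_on UNIV f"
 shows "z \<in> fatou_set f \<longleftrightarrow> (EX U. open U & z \<in> U & (ALL w:U. eq_at f w))"
proof
 assume "z \<in> fatou_set f"
 thus "EX U. open U & z \<in> U & (ALL w:U. eq_at f w)"
  unfolding fatou_set_def using eq_at_if_normal[OF f] by blast
next
 assume "EX U. open U & z \<in> U & (ALL w:U. eq_at f w)"
 then obtain U where U: "open U" "z \<in> U" "!!w. w \<in> U ==> eq_at f w" by blast
 then obtain r where r: "r > 0" "cball z r \<subseteq> U" using open_contains_cball by metis
 have "normal_on (ball z r) (range (%n. f ^^ n))" by (rule normal_on_ball_if_eq_at[OF r(2) U(3)])
 thus "z \<in> fatou_set f" unfolding fatou_set_def using r(1) by (intro UnionI[of "ball z r"]) auto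
qed

lemma open_fatou: "open (fatou_set f)" unfolding fatou_set_def by blast

lemma closed_julia: "closed (julia_set f)" unfolding julia_set_def using open_fatou by blast

lemma eq_at_pre:
 assumes f: "continuous_on UNIV f" and e: "eq_at f (f z)"
 shows "eq_at f z" unfolding eq_at_def
proof (intro allI impI)
 fix e :: real assume e0: "e > 0"
 then obtain d where d: "d > 0" "ALL n x. dist x (f z) < d --> dist ((f ^^ n) x) ((f ^^ n) (f z)) < e"
  using e unfolding eq_at_def by blast
 obtain d' where d': "d' > 0" "!!x. dist x z < d' ==> dist (f x) (f z) < d"
  using f d(1) unfolding continuous_on_iff by blast
 have "dist ((f ^^ n) x) ((f ^^ n) z) < e" if "dist x z < min d' e" for n x
 proof (cases n)
  case (Suc m)
  thus ?thesis using d(2) d'(2)[of x] that by (simp add: funpow_swap1)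
 qed (use that in simp)
 thus "EX dl>0. ALL n x. dist x z < dl --> dist ((f ^^ n) x) ((f ^^ n) z) < e"
  using d' e0 by (intro exI[of _ "min d' e"]) auto
qed

lemma eq_at_post:
 assumes f: "!!U. open U ==> open (f ` U)" and e: "eq_at f z"
 shows "eq_at f (f z)" unfolding eq_at_def
proof (intro allI impI)
 fix e :: real assume e0: "e > 0"
 then obtain d where d: "d > 0" "ALL n x. dist x z < d --> dist ((f ^^ n) x) ((f ^^ n) z) < e"
  using e unfolding eq_at_def by blast
 have "open (f ` ball z d)" "f z \<in> f ` ball z d" using f d(1) by auto
 then obtain d' where d': "d' > 0" "ball (f z) d' \<subseteq> f ` ball z d" using openE by metis
 have "dist ((f ^^ n) y) ((f ^^ n) (f z)) < e" if "dist y (f z) < d'" for n y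
 proof -
  have "y \<in> ball (f z) d'" using that by (simp add: dist_commute)
  then obtain x where x: "y = f x" "dist x z < d" using d'(2) by (auto simp: dist_commute)
  hence "dist ((f ^^ Suc n) x) ((f ^^ Suc n) z) < e" using d by blast
  thus ?thesis using x by (simp add: funpow_swap1)
 qed
 thus "EX dl>0. ALL n x. dist x (f z) < dl --> dist ((f ^^ n) x) ((f ^^ n) (f z)) < e"
  using d' by blast
qed

lemma fatou_invariant:
 assumes f: "rational_map_of_degree f d" "d >= 1"
 shows "f z \<in> fatou_set f \<longleftrightarrow> z \<in> fatou_set f"
proof -
 note c = rational_continuous[OF f(1), of UNIV]
 show ?thesis
 proof
  assume "f z \<in> fatou_set f"
  then obtain U where U: "open U" "f z \<in> U" "ALL w:U. eq_at f w" using fatou_iff[OF c] by blast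
  have "open (f -` U)" using c U(1) by (simp add: continuous_on_open_vimage)
  thus "z \<in> fatou_set f" unfolding fatou_iff[OF c]
   using U eq_at_pre[OF c] by (intro exI[of _ "f -` U"]) auto
 next
  assume "z \<in> fatou_set f"
  then obtain U where U: "open U" "z \<in> U" "ALL w:U. eq_at f w" using fatou_iff[OF c] by blast
  have "open (f ` U)" using rational_open[OF f] U(1) by blast
  thus "f z \<in> fatou_set f" unfolding fatou_iff[OF c]
   using U eq_at_post[OF rational_open[OF f]] by (intro exI[of _ "f ` U"]) auto
 qed
qed

lemma julia_invariant:
 assumes f: "rational_map_of_degree f d" "d >= 1"
 shows "f z \<in> julia_set f \<longleftrightarrow> z \<in> julia_set f"
 unfolding julia_set_def using fatou_invariant[OF f] by simp

lemma julia_funpow_invariant: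
 assumes f: "rational_map_of_degree f d" "d >= 1"
 shows "(f ^^ n) z \<in> julia_set f \<longleftrightarrow> z \<in> julia_set f"
 by (induction n) (auto simp: julia_invariant[OF f])

text \<open>One \<open>dl\<close> serves all base points of the ball, so equicontinuity holds on an
  open set, as \<open>fatou_iff\<close> demands.\<close>

lemma fatou_chartI:
 assumes f: "continuous_on UNIV f" and h: "h \<in> charts" and r: "r > 0"
  and e: "!!eps. eps > 0 ==> EX dl>0. ALL n u v. u \<in> ball z r --> v \<in> ball z r --> dist u v < dl -->
    dist ((f ^^ n) (h u)) ((f ^^ n) (h v)) < eps"
 shows "h z \<in> fatou_set f" unfolding fatou_iff[OF f]
proof (intro exI[of _ "h ` ball z r"] conjI ballI)
 show "open (h ` ball z r)" using chart_props(3)[OF h] by simp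
 show "h z \<in> h ` ball z r" using r by simp
 fix w assume "w \<in> h ` ball z r"
 then obtain v where v: "v \<in> ball z r" "w = h v" by blast
 show "eq_at f w" unfolding eq_at_def
 proof (intro allI impI)
  fix e :: real assume "e > 0"
  then obtain d where d: "d > 0" "ALL n u v. u \<in> ball z r --> v \<in> ball z r --> dist u v < d -->
    dist ((f ^^ n) (h u)) ((f ^^ n) (h v)) < e" using e by blast
  have "open (h ` (ball z r Int ball v d))" by (intro chart_props(3)[OF h] open_Int open_ball)
  moreover have "w \<in> h ` (ball z r Int ball v d)" using v d by simp
  ultimately obtain d' where d': "d' > 0" "ball w d' \<subseteq> h ` (ball z r Int ball v d)" using openE by metis
  have "dist ((f ^^ n) x) ((f ^^ n) w) < e" if "dist x w < d'" for n x
  proof -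
   have "x \<in> ball w d'" using that by (simp add: dist_commute)
   then obtain u where "x = h u" "u \<in> ball z r" "dist u v < d" using d'(2) by (auto simp: dist_commute)
   thus ?thesis using d(2) v by blast
  qed
  thus "EX dl>0. ALL n x. dist x w < dl --> dist ((f ^^ n) x) ((f ^^ n) w) < e" using d'(1) by blast
 qed
qed

lemma fatou_conjugate:
 assumes f: "continuous_on UNIV f" and A: "continuous_on UNIV A" and B: "continuous_on UNIV B"
  and AB: "A o B = id" "B o A = id"
 shows "z \<in> fatou_set (A o f o B) \<longleftrightarrow> B z \<in> fatou_set f"
proof -
 have ABx: "A (B x) = x" "B (A x) = x" for x using AB by (auto simp: fun_eq_iff)
 have "((A o f o B) ^^ n) x = A ((f ^^ n) (B x))" for n x by (induction n) (auto simp: ABx)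
 hence pw: "(A o f o B) ^^ n = A o f ^^ n o B" for n by auto
 have pw': "(f ^^ n) = B o ((A o f o B) ^^ n) o A" for n unfolding pw by (auto simp: ABx)
 have *: "eq_at (A o f o B) w" if ea: "eq_at f (B w)" and cA: "continuous_on UNIV A"
  and cB: "continuous_on UNIV B" and pw: "!!n. (A o f o B) ^^ n = A o f ^^ n o B" for A B f w
  unfolding eq_at_def pw
 proof (intro allI impI)
  fix e :: real assume "e > 0"
  then obtain e' where e': "e' > 0" "!!x y. dist x y < e' ==> dist (A x) (A y) < e"
   using uniform_continuity_sphere[OF cA] by metis
  obtain d where d: "d > 0" "ALL n x. dist x (B w) < d --> dist ((f ^^ n) x) ((f ^^ n) (B w)) < e'"
   using ea e'(1) unfolding eq_at_def by blast
  obtain d' where "d' > 0" "!!x. dist x w < d' ==> dist (B x) (B w) < d"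
   using cB d(1) unfolding continuous_on_iff by blast
  thus "EX dl>0. ALL n x. dist x w < dl --> dist ((A o f ^^ n o B) x) ((A o f ^^ n o B) w) < e"
   using d(2) e'(2) by (intro exI[of _ d']) simp
 qed
 have cg: "continuous_on UNIV (A o f o B)"
  using f A B continuous_on_compose continuous_on_subset by (metis subset_UNIV)
 have eqv: "eq_at (A o f o B) w \<longleftrightarrow> eq_at f (B w)" for w
 proof
  assume "eq_at f (B w)"
  thus "eq_at (A o f o B) w" using * A B pw by blast
 next
  have f_eq: "B o (A o f o B) o A = f" by (auto simp: ABx)
  assume "eq_at (A o f o B) w"
  thus "eq_at f (B w)" using *[of "A o f o B" A "B w" B] A B pw' unfolding f_eq by (simp add: ABx)
 qed
 show ?thesis unfolding fatou_iff[OF f] fatou_iff[OF cg] eqv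
 proof
  assume "EX U. open U & z \<in> U & (ALL w:U. eq_at f (B w))"
  then obtain U where U: "open U" "z \<in> U" "ALL w:U. eq_at f (B w)" by blast
  have "open (A -` U)" using A U(1) by (simp add: continuous_on_open_vimage)
  thus "EX U. open U & B z \<in> U & (ALL w:U. eq_at f w)"
   using U by (intro exI[of _ "A -` U"]) (metis ABx vimageE vimageI2)
 next
  assume "EX U. open U & B z \<in> U & (ALL w:U. eq_at f w)"
  then obtain U where U: "open U" "B z \<in> U" "ALL w:U. eq_at f w" by blast
  have "open (B -` U)" using B U(1) by (simp add: continuous_on_open_vimage)
  thus "EX U. open U & z \<in> U & (ALL w:U. eq_at f (B w))"
   using U by (intro exI[of _ "B -` U"]) auto
 qed
qed

subsection \<open>Superattracting points\<close>

lemma chart_power_orbit: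
 assumes "!!w. w \<in> ball z r ==> (f ^^ q) (h w) = h (phi w) & cmod (phi w - z) <= cmod (w - z) / 2"
  and "w \<in> ball z r"
 shows "EX u. cmod (u - z) <= r / 2 ^ k & (f ^^ (q * k)) (h w) = h u & u \<in> ball z r"
proof (induction k)
 case 0
 thus ?case using assms(2) by (intro exI[of _ w]) (auto simp: dist_norm norm_minus_commute)
next
 case (Suc k)
 then obtain u where u: "cmod (u - z) <= r / 2 ^ k" "(f ^^ (q * k)) (h w) = h u" "u \<in> ball z r" by blast
 have p: "(f ^^ q) (h u) = h (phi u)" "cmod (phi u - z) <= cmod (u - z) / 2" using assms(1)[OF u(3)] by auto
 have "(f ^^ (q * Suc k)) (h w) = (f ^^ q) ((f ^^ (q * k)) (h w))" by (simp add: funpow_add)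
 moreover have "cmod (u - z) < r" using u(3) by (simp add: dist_norm norm_minus_commute)
 hence "cmod (phi u - z) < r" using p(2) norm_ge_zero[of "phi u - z"] by linarith
 moreover have "cmod (phi u - z) <= r / 2 ^ Suc k" using p(2) u(1) by simp
 ultimately show ?case
  using p(1) u(2) by (intro exI[of _ "phi u"]) (simp add: dist_norm norm_minus_commute)
qed

text \<open>The return map has derivative 0 at the periodic point, so in a chart it at least halves
  distances to it on a small ball. Late iterates are then close to the finite cycle, and the
  finitely many early ones are uniformly continuous.\<close>

lemma superattracting_fatou:
 assumes f: "rational_map_of_degree f d" and q: "q >= 1" and per: "(f ^^ q) x = x" and crit: "~ lif f x"
 shows "x \<in> fatou_set f"
proof -
 note c = rational_continuous[OF f, of UNIV]
 have nl: "~ lif (f ^^ q) x"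
 proof
  assume "lif (f ^^ q) x"
  then obtain U where U: "open U" "x \<in> U" "inj_on (f ^^ q) U" unfolding lif_def by blast
  have "f ^^ q = f ^^ (q - 1) o f" using q by (metis Suc_diff_1 funpow_Suc_right less_eq_Suc_le One_nat_def)
  hence "inj_on f U" using U(3) by (metis inj_on_imageI2)
  thus False using crit U unfolding lif_def by blast
 qed
 obtain h z where h: "h \<in> charts" "h z = x" by (rule chart_at)
 have sh: "sholo (%w. (f ^^ q) (h w)) UNIV" using sholo_funpow[OF f sholo_chart[OF h(1) open_UNIV]] .
 have "EX r>0. EX phi. phi holomorphic_on ball z r & (ALL w:ball z r. (f ^^ q) (h w) = h (phi w))"
  using h(1) unfolding charts_def
 proof (elim insertE)
  assume hF: "h = Fin"
  hence "(f ^^ q) (h z) ~= Infty" using per h(2) by auto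
  thus ?thesis using sholo_finite_rep[OF sh, of z] hF by (metis UNIV_I)
 next
  assume hF: "h = iota o Fin"
  have "(f ^^ q) (h z) = iota (Fin z)" using per h(2) hF by (simp del: iota.simps)
  hence "iota ((f ^^ q) (h z)) ~= Infty" by (simp del: iota.simps)
  then obtain r phi where r: "r > 0" "phi holomorphic_on ball z r" "!!w. w \<in> ball z r ==> iota ((f ^^ q) (h w)) = Fin (phi w)"
   using sholo_finite_rep[OF sholo_iota[OF sh], of z] by (metis UNIV_I)
  hence "(f ^^ q) (h w) = h (phi w)" if "w \<in> ball z r" for w
   using that hF by (metis comp_apply iota_iota)
  thus ?thesis using r by blast
 qed simp
 then obtain r phi where r: "r > 0" "phi holomorphic_on ball z r" "!!w. w \<in> ball z r ==> (f ^^ q) (h w) = h (phi w)" by blast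
 have phiz: "phi z = z" using r(3)[of z] r(1) per h(2) chart_props(2)[OF h(1)] by (metis centre_in_ball injD)
 have "(ALL w:ball z r. (f ^^ q) (h w) = Fin (phi w)) | (ALL w:ball z r. (f ^^ q) (h w) = iota (Fin (phi w)))"
  using r(3) h(1) unfolding charts_def by auto
 hence "deriv phi z = 0" using lif_chart[OF h(1) r(1) _ r(2), of "f ^^ q"] nl h(2) by auto
 hence "(phi has_field_derivative 0) (at z)" using holomorphic_derivI[OF r(2), of z] r(1) by auto
 hence "(phi has_derivative (%h. 0)) (at z)" by (simp add: has_field_derivative_def lambda_zero)
 then obtain s where s: "s > 0" "!!w. norm (w - z) < s ==> norm (phi w - phi z) <= 1 / 2 * norm (w - z)"
  unfolding has_derivative_at_alt by (metis half_gt_zero_iff zero_less_one diff_zero)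
 define rho where "rho = min r s"
 have rho: "rho > 0" using r s by (simp add: rho_def)
 have contr: "(f ^^ q) (h w) = h (phi w) & cmod (phi w - z) <= cmod (w - z) / 2" if "w \<in> ball z rho" for w
  using that r(3) s(2)[of w] phiz by (auto simp: rho_def dist_norm norm_minus_commute)
 have "h z \<in> fatou_set f"
 proof (rule fatou_chartI[OF c h(1) rho])
  fix e :: real assume e: "e > 0"
  have ch: "continuous_on UNIV (%w. (f ^^ n) (h w))" for n
   using sholo_continuous[OF sholo_funpow[OF f sholo_chart[OF h(1) open_UNIV]]] .
  have "EX eta>0. ALL u. dist u z < eta --> dist ((f ^^ n) (h u)) ((f ^^ n) (h z)) < e / 2" for n
   using ch[of n] e unfolding continuous_on_iff by (metis UNIV_I half_gt_zero_iff)
  then obtain eta where eta: "!!n. eta n > 0" "!!n u. dist u z < eta n ==> dist ((f ^^ n) (h u)) ((f ^^ n) (h z)) < e / 2"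
   by metis
  define eta0 where "eta0 = Min (eta ` {..<q})"
  have eta0: "eta0 > 0" "!!s. s < q ==> eta0 <= eta s" unfolding eta0_def using q eta(1)
   by (auto simp: Min_gr_iff lessThan_empty_iff)
  \<comment> \<open>After \<open>k0\<close> periods the ball has shrunk below \<open>eta0\<close>, a
    radius that suits every residue modulo \<open>q\<close>.\<close>
  obtain k0 where k0: "rho / 2 ^ k0 < eta0"
  proof -
   obtain k where "(1/2 :: real) ^ k < eta0 / rho" using real_arch_pow_inv[of "eta0 / rho" "1/2"] eta0 rho by auto
   thus ?thesis using that[of k] rho by (simp add: field_simps power_divide)
  qed
  have "EX dl>0. ALL u:cball z rho. ALL v:cball z rho. dist u v < dl --> dist ((f ^^ n) (h u)) ((f ^^ n) (h v)) < e" for n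
  proof -
   have "uniformly_continuous_on (cball z rho) (%w. (f ^^ n) (h w))"
    by (rule compact_uniformly_continuous[OF continuous_on_subset[OF ch[of n]] compact_cball]) simp
   thus ?thesis by (rule uniformly_continuous_onE[OF _ e]) (metis dist_commute)
  qed
  then obtain dl where dl: "!!n. dl n > 0" "!!n u v. u \<in> cball z rho ==> v \<in> cball z rho ==> dist u v < dl n ==> dist ((f ^^ n) (h u)) ((f ^^ n) (h v)) < e"
   by metis
  define dl0 where "dl0 = Min (insert 1 (dl ` {..<q * k0}))"
  have dl0: "dl0 > 0" "!!n. n < q * k0 ==> dl0 <= dl n" unfolding dl0_def using dl(1) by auto
  have "dist ((f ^^ n) (h u)) ((f ^^ n) (h v)) < e"
   if u: "u \<in> ball z rho" and v: "v \<in> ball z rho" and uv: "dist u v < dl0" for n u v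
  proof (cases "n < q * k0")
   case True
   thus ?thesis using dl(2)[of u v n] dl0(2) u v uv by force
  next
   case False
   define s where "s = (n - q * k0) mod q"
   define k where "k = k0 + (n - q * k0) div q"
   have n: "n = s + q * k" "s < q" "k >= k0"
   proof -
    have "n - q * k0 = s + q * ((n - q * k0) div q)" unfolding s_def by simp
    thus "n = s + q * k" using False unfolding k_def by (simp add: algebra_simps)
   qed (use q in "auto simp: s_def k_def")
   have close: "dist ((f ^^ n) (h w)) ((f ^^ s) (h z)) < e / 2" if w: "w \<in> ball z rho" for w
   proof -
    obtain y where y: "cmod (y - z) <= rho / 2 ^ k" "(f ^^ (q * k)) (h w) = h y"
     using chart_power_orbit[of z rho q f h phi w k] contr w by blast
    have "rho / 2 ^ k <= rho / 2 ^ k0" using n(3) rho by (simp add: frac_le power_increasing)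
    hence "dist y z < eta s" using y(1) k0 eta0(2)[OF n(2)] by (simp add: dist_norm)
    thus ?thesis using eta(2) y(2) unfolding n(1) by (simp add: funpow_add)
   qed
   show ?thesis
    using close[OF u] close[OF v] dist_triangle2[of "(f ^^ n) (h u)" "(f ^^ n) (h v)" "(f ^^ s) (h z)"] by linarith
  qed
  thus "EX dl>0. ALL n u v. u \<in> ball z rho --> v \<in> ball z rho --> dist u v < dl -->
    dist ((f ^^ n) (h u)) ((f ^^ n) (h v)) < e" using dl0(1) by blast
 qed
 thus ?thesis using h(2) by simp
qed

subsection \<open>Montel's theorem\<close>

lemma dist_Fin: "(dist (Fin z) (Fin w))\<^sup>2 = 4 * (cmod (z - w))\<^sup>2 / (((cmod z)\<^sup>2 + 1) * ((cmod w)\<^sup>2 + 1))"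
proof -
 define a b where "a = (cmod z)\<^sup>2" and "b = (cmod w)\<^sup>2"
 have ab: "a + 1 > 0" "b + 1 > 0" unfolding a_def b_def by (simp_all add: add_nonneg_pos)
 have s: "stereo (Fin z) = ((2 / (a + 1)) *\<^sub>R z, (a - 1) / (a + 1))"
  "stereo (Fin w) = ((2 / (b + 1)) *\<^sub>R w, (b - 1) / (b + 1))"
  by (simp_all add: a_def b_def scaleR_conv_of_real)
 have i: "2 * (z \<bullet> w) = a + b - (cmod (z - w))\<^sup>2"
  unfolding a_def b_def power2_norm_eq_inner by (simp add: inner_diff_left inner_diff_right inner_commute)
 have "(dist (Fin z) (Fin w))\<^sup>2 = (norm (stereo (Fin z) - stereo (Fin w)))\<^sup>2"
  by (simp only: dist_riemann_sphere_def dist_norm)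
 also have "... = (norm (stereo (Fin z)))\<^sup>2 + (norm (stereo (Fin w)))\<^sup>2 - 2 * (stereo (Fin z) \<bullet> stereo (Fin w))"
  by (simp only: power2_norm_eq_inner inner_diff_left inner_diff_right
    inner_commute[of "stereo (Fin w)" "stereo (Fin z)"])
 also have "... = 2 - 2 * (stereo (Fin z) \<bullet> stereo (Fin w))" by (simp only: norm_stereo) simp
 also have "stereo (Fin z) \<bullet> stereo (Fin w) = (4 * (z \<bullet> w) + (a - 1) * (b - 1)) / ((a + 1) * (b + 1))"
  unfolding s inner_Pair by (simp add: add_divide_distrib)
 also have "4 * (z \<bullet> w) = 2 * (a + b - (cmod (z - w))\<^sup>2)" using i by simp
 also have "2 - 2 * ((2 * (a + b - (cmod (z - w))\<^sup>2) + (a - 1) * (b - 1)) / ((a + 1) * (b + 1)))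
   = 4 * (cmod (z - w))\<^sup>2 / ((a + 1) * (b + 1))"
  using ab by (simp add: divide_simps) (simp add: algebra_simps)
 finally show ?thesis unfolding a_def b_def .
qed

lemma dist_Fin_le: "dist (Fin z) (Fin w) <= 2 * cmod (z - w)"
proof -
 have "1 * 1 <= ((cmod z)\<^sup>2 + 1) * ((cmod w)\<^sup>2 + 1)" by (intro mult_mono) auto
 hence "4 * (cmod (z - w))\<^sup>2 / (((cmod z)\<^sup>2 + 1) * ((cmod w)\<^sup>2 + 1)) <= 4 * (cmod (z - w))\<^sup>2 / 1"
  by (intro divide_left_mono) auto
 hence "(dist (Fin z) (Fin w))\<^sup>2 <= (2 * cmod (z - w))\<^sup>2"
  unfolding dist_Fin by (simp add: power_mult_distrib)
 thus ?thesis by (rule power2_le_imp_le) simp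
qed

text \<open>Schottky's bound for functions omitting 0 and 1, with modulus at most 1 at the centre of
  the unit disc, on the disc of radius 1/2.\<close>

definition schottky_const :: real where
 "schottky_const = exp (pi * exp (pi * (2 + 2 * 1 + 12 * (1/2) / (1 - 1/2))))"

text \<open>Rescaling from radius \<open>r / 2\<close> bounds \<open>f\<close> on radius
  \<open>r / 4\<close>; Cauchy's estimate on circles of radius \<open>r / 8\<close> then bounds the
  derivative on radius \<open>r / 8\<close>.\<close>

lemma schottky_lipschitz_aux:
 assumes hol: "f holomorphic_on ball z r" and r: "r > 0" and om: "!!w. w \<in> ball z r ==> f w ~= 0 & f w ~= 1"
  and f0: "cmod (f z) <= 1" and uv: "u \<in> ball z (r / 8)" "v \<in> ball z (r / 8)"
 shows "cmod (f u - f v) <= (8 * schottky_const / r) * cmod (u - v)"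
proof -
 define g where "g ze = f (z + of_real (r / 2) * ze)" for ze
 have mem: "z + of_real (r / 2) * ze \<in> ball z r" if "ze \<in> cball 0 1" for ze
 proof -
  have "cmod (of_real (r / 2) * ze) <= r / 2" using that r by (simp add: norm_mult)
  thus ?thesis using r by (simp add: dist_norm)
 qed
 have "g holomorphic_on cball 0 1" unfolding g_def
  by (rule holomorphic_on_compose_gen[OF _ hol, unfolded o_def]) (use mem in "auto intro!: holomorphic_intros")
 hence gb: "cmod (g ze) <= schottky_const" if "cmod ze <= 1 / 2" for ze unfolding schottky_const_def
  by (rule Schottky) (use f0 om mem that in "auto simp: g_def")
 have fb: "cmod (f w) <= schottky_const" if "cmod (w - z) <= r / 4" for w
 proof -
  have "g ((w - z) / of_real (r / 2)) = f w" unfolding g_def using r by (simp add: field_simps)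
  moreover have eq: "cmod ((w - z) / of_real (r / 2)) = cmod (w - z) / (r / 2)"
   using r by (simp only: norm_divide norm_of_real abs_of_pos half_gt_zero)
  have "cmod ((w - z) / of_real (r / 2)) <= 1 / 2"
   unfolding eq using that r by (simp add: field_simps)
  ultimately show ?thesis using gb by metis
 qed
 have db: "cmod (deriv f w) <= 8 * schottky_const / r" if w: "w \<in> ball z (r / 8)" for w
 proof -
  have sub: "cball w (r / 8) \<subseteq> ball z r"
   using w r by (intro subsetI) (simp, smt (verit) dist_triangle dist_commute)
  have "cmod ((deriv ^^ 1) f w) <= fact 1 * schottky_const / (r / 8) ^ 1"
  proof (rule Cauchy_inequality)
   show "f holomorphic_on ball w (r / 8)" using holomorphic_on_subset[OF hol] sub ball_subset_cball by blast
   show "continuous_on (cball w (r / 8)) f"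
    using continuous_on_subset[OF holomorphic_on_imp_continuous_on[OF hol] sub] .
   fix x assume "cmod (w - x) = r / 8"
   hence "cmod (x - z) <= r / 4"
    using w norm_triangle_ineq4[of "z - w" "x - w"] by (simp add: dist_norm norm_minus_commute)
   thus "cmod (f x) <= schottky_const" by (rule fb)
  qed (use r in auto)
  thus ?thesis by (simp add: field_simps)
 qed
 show ?thesis
 proof (rule field_differentiable_bound[OF convex_ball[of z "r / 8"] _ db uv])
  fix w assume w: "w \<in> ball z (r / 8)"
  hence "w \<in> ball z r" using r by auto
  thus "(f has_field_derivative deriv f w) (at w within ball z (r / 8))"
   using holomorphic_derivI[OF hol open_ball] has_field_derivative_at_within by blast
 qed
qed

text \<open>If the value at the centre is large, \<open>1 / f\<close> omits the same values and has
  the same chordal distances. The factor 16 is 8 times the Lipschitz constant 2 of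
  \<open>Fin\<close>.\<close>

lemma schottky_lipschitz:
 assumes hol: "f holomorphic_on ball z r" and r: "r > 0" and om: "!!w. w \<in> ball z r ==> f w ~= 0 & f w ~= 1"
  and uv: "u \<in> ball z (r / 8)" "v \<in> ball z (r / 8)"
 shows "dist (Fin (f u)) (Fin (f v)) <= (16 * schottky_const / r) * dist u v"
proof (cases "cmod (f z) <= 1")
 case True
 thus ?thesis
  using schottky_lipschitz_aux[OF hol r om True uv] dist_Fin_le[of "f u" "f v"] by (simp add: dist_norm)
next
 case False
 have nz: "f w ~= 0" if "w \<in> ball z r" for w using om that by blast
 have hol': "(%w. 1 / f w) holomorphic_on ball z r"
  by (intro holomorphic_on_divide hol holomorphic_on_const) (use om in blast)
 have "cmod (1 / f z) <= 1" using False by (auto simp: norm_divide divide_le_eq_1)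
 moreover have "1 / f w ~= 0 & 1 / f w ~= 1" if "w \<in> ball z r" for w using om[OF that] by (simp add: divide_eq_1_iff)
 ultimately have 1: "cmod (1 / f u - 1 / f v) <= (8 * schottky_const / r) * cmod (u - v)"
  using schottky_lipschitz_aux[OF hol' r _ _ uv] by blast
 have "u \<in> ball z r" "v \<in> ball z r" using uv r by auto
 hence "f u ~= 0" "f v ~= 0" using om by auto
 hence "dist (Fin (f u)) (Fin (f v)) = dist (Fin (1 / f u)) (Fin (1 / f v))"
  using dist_iota[of "Fin (f u)" "Fin (f v)"] by simp
 thus ?thesis using 1 dist_Fin_le[of "1 / f u" "1 / f v"] by (simp add: dist_norm)
qed

text \<open>The omitted triple may change with the iterate as long as finitely many triples occur:
  each is moved to 0, 1 and infinity by its own Moebius map, and the finitely many inverse maps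
  share a modulus of continuity.\<close>

theorem montel_three_points:
 assumes f: "rational_map_of_degree f d" and Q: "open Q" and TT: "finite TT" "!!t. t \<in> TT ==> card t = 3"
  and om: "!!n. EX t:TT. (f ^^ n) ` Q Int t = {}"
 shows "Q \<subseteq> fatou_set f"
proof
 fix x assume x: "x \<in> Q"
 obtain h z where h: "h \<in> charts" "h z = x" by (rule chart_at)
 obtain r where r: "r > 0" "h ` cball z r \<subseteq> Q" using chart_cball_subset[OF h(1) Q] h(2) x by blast
 have "EX A B. mob A & mob B & B o A = id & {Fin 0, Fin 1, Infty} \<subseteq> A ` t" if t: "t \<in> TT" for t
 proof -
  obtain a b c where abc: "t = {a, b, c}" "a ~= b" "b ~= c" "a ~= c"
   using TT(2)[OF t] by (metis card_3_iff)
  then obtain A where A: "mob A" "A a = Fin 0" "A b = Fin 1" "A c = Infty" using mob_three_points by metis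
  then obtain B where "mob B" "B o A = id" using mob_inverse by blast
  thus ?thesis using A abc by (intro exI[of _ A] exI[of _ B]) auto
 qed
 then obtain A B where AB: "!!t. t \<in> TT ==> mob (A t)" "!!t. t \<in> TT ==> mob (B t)" "!!t. t \<in> TT ==> B t o A t = id"
  "!!t. t \<in> TT ==> {Fin 0, Fin 1, Infty} \<subseteq> A t ` t" by metis
 have "h z \<in> fatou_set f"
 proof (rule fatou_chartI[OF rational_continuous[OF f] h(1), of "r / 8"])
  show "r / 8 > 0" using r by simp
  fix e :: real assume e: "e > 0"
  have "EX eta>0. ALL p q. dist p q < eta --> dist (B t p) (B t q) < e" if "t \<in> TT" for t
   using uniform_continuity_sphere[OF rational_continuous[OF mob_rational[OF AB(2)[OF that]]] e] by metis
  then obtain eta where eta: "!!t. t \<in> TT ==> eta t > 0" "!!t p q. t \<in> TT ==> dist p q < eta t ==> dist (B t p) (B t q) < e"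
   by metis
  define eta0 where "eta0 = Min (insert 1 (eta ` TT))"
  have eta0: "eta0 > 0" "!!t. t \<in> TT ==> eta0 <= eta t" unfolding eta0_def using eta(1) TT(1) by auto
  define C where "C = 16 * schottky_const / r"
  have C: "C > 0" unfolding C_def schottky_const_def using r by simp
  have "dist ((f ^^ n) (h u)) ((f ^^ n) (h v)) < e"
   if u: "u \<in> ball z (r / 8)" and v: "v \<in> ball z (r / 8)" and uv: "dist u v < eta0 / C" for n u v
  proof -
   obtain t where t: "t \<in> TT" "(f ^^ n) ` Q Int t = {}" using om by blast
   define G where "G w = A t ((f ^^ n) (h w))" for w
   have sG: "sholo G (ball z r)"
    unfolding G_def by (intro sholo_rational_comp[OF mob_rational[OF AB(1)[OF t(1)]]] sholo_funpow[OF f] sholo_chart[OF h(1) open_ball])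
   have Gn: "G w ~: {Fin 0, Fin 1, Infty}" if w: "w \<in> ball z r" for w
   proof
    assume "G w \<in> {Fin 0, Fin 1, Infty}"
    then obtain s where s: "s \<in> t" "A t s = G w" using AB(4)[OF t(1)] by (metis (no_types, lifting) imageE subsetD)
    hence "s = (f ^^ n) (h w)" unfolding G_def using mob_bij[OF AB(1)[OF t(1)]] by (metis bij_is_inj injD)
    moreover have "h w \<in> Q" using w r by force
    ultimately show False using t(2) s(1) by blast
   qed
   have hol: "(%w. fin (G w)) holomorphic_on ball z r"
    by (rule sholo_finite_holomorphic[OF sG]) (use Gn in auto)
   have GF: "Fin (fin (G w)) = G w" if "w \<in> ball z r" for w using Gn[OF that] Fin_fin by auto
   have "u \<in> ball z r" "v \<in> ball z r" using u v r by auto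
   hence "dist (G u) (G v) <= C * dist u v"
    using schottky_lipschitz[OF hol r(1) _ u v] Gn GF unfolding C_def by (metis insertI1 insertI2)
   also have "... < eta0" using uv C by (simp add: field_simps)
   finally have "dist (B t (G u)) (B t (G v)) < e" using eta(2)[OF t(1)] eta0(2)[OF t(1)] by simp
   moreover have "B t (G w) = (f ^^ n) (h w)" for w
    unfolding G_def using AB(3)[OF t(1)] by (metis comp_apply id_apply)
   ultimately show ?thesis by simp
  qed
  thus "EX dl>0. ALL n u v. u \<in> ball z (r / 8) --> v \<in> ball z (r / 8) --> dist u v < dl -->
    dist ((f ^^ n) (h u)) ((f ^^ n) (h v)) < e" using eta0(1) C by (intro exI[of _ "eta0 / C"]) auto
 qed
 thus "x \<in> fatou_set f" using h(2) by simp
qed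

subsection \<open>Backward orbits of critical values\<close>

lemma rational_funpow_fiber:
 assumes f: "rational_map_of_degree f d" and d: "d >= 1"
 shows "finite ((f ^^ n) -` {y})" "(f ^^ n) -` {y} ~= {}"
proof -
 have "finite ((f ^^ n) -` {y}) & (f ^^ n) -` {y} ~= {}"
 proof (induction n)
  case (Suc n)
  have eq: "(f ^^ Suc n) -` {y} = (\<Union>x\<in>(f ^^ n) -` {y}. f -` {x})"
   unfolding funpow_Suc_right by auto
  show ?case unfolding eq using Suc rational_fiber[OF f d] by auto
 qed auto
 thus "finite ((f ^^ n) -` {y})" "(f ^^ n) -` {y} ~= {}" by auto
qed

text \<open>If all iterated preimages of \<open>v\<close> had at most two points, their numbers
  would stabilise and every fibre met late would be a single point, hence critical as the degree is
  at least 2. A backward orbit among finitely many critical points is periodic, so superattracting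
  and in the Fatou set.\<close>

lemma backward_orbit_julia:
 assumes f: "rational_map_of_degree f d" and d: "d >= 2" and v: "v \<in> julia_set f"
 shows "EX n. card ((f ^^ n) -` {v}) >= 3"
proof (rule ccontr)
 assume "~ ?thesis"
 hence le2: "card ((f ^^ n) -` {v}) <= 2" for n by (metis not_less_eq_eq numeral_2_eq_2 numeral_3_eq_3)
 have d1: "d >= 1" using d by simp
 define A where "A n = (f ^^ n) -` {v}" for n
 have A: "finite (A n)" "A n ~= {}" "A (Suc n) = f -` A n" "f ` A (Suc n) = A n" for n
 proof -
  show 1: "A (Suc n) = f -` A n" unfolding A_def funpow_Suc_right by auto
  show "f ` A (Suc n) = A n" unfolding 1 using rational_surj[OF f d1] by (simp add: surj_image_vimage_eq)
 qed (use rational_funpow_fiber[OF f d1] in "auto simp: A_def")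
 have mono: "card (A n) <= card (A (Suc n))" for n
  using card_image_le[OF A(1)[of "Suc n"], of f] A(4) by simp
 define M where "M = Max (range (%n. card (A n)))"
 have fin: "finite (range (%n. card (A n)))"
  by (rule finite_subset[of _ "{..2}"]) (use le2 in "auto simp: A_def")
 then obtain n0 where n0: "card (A n0) = M" using Max_in[OF fin] unfolding M_def by (metis (no_types, lifting) UNIV_I empty_iff imageE image_eqI)
 have const: "card (A n) = M" if "n >= n0" for n
 proof (rule antisym)
  show "card (A n) <= M" unfolding M_def using fin by simp
  show "M <= card (A n)" using lift_Suc_mono_le[of "%n. card (A n)", OF mono that] n0 by simp
 qed
 have crit: "~ lif f x" if x: "x \<in> A (Suc n)" and n: "n >= n0" for x n
 proof -
  have "card (f ` A (Suc n)) = card (A (Suc n))" using A(4) const n by simp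
  hence inj: "inj_on f (A (Suc n))" using A(1) eq_card_imp_inj_on by blast
  have fx: "f x \<in> A n" using x A(3) by blast
  have "f -` {f x} \<subseteq> A (Suc n)" using fx A(3) by blast
  hence sing: "f -` {f x} = {x}" using inj x unfolding inj_on_def by auto
  hence "card (f -` {f x}) ~= d" using d by simp
  hence "f x \<in> crit_values f" using card_regular_fiber[OF f d1] by blast
  then obtain c where "~ lif f c" "f c = f x" unfolding crit_values_def by auto
  thus ?thesis using sing by auto
 qed
 obtain y0 where y0: "y0 \<in> A (Suc n0)" using A(2) by blast
 have "EX x. f x = y" for y using rational_surj[OF f d1] by (metis surjD)
 then obtain g where g: "!!y. f (g y) = y" by metis
 define y where "y k = (g ^^ k) y0" for k
 have yA: "y k \<in> A (Suc n0 + k)" for k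
 proof (induction k)
  case (Suc k)
  thus ?case using A(3)[of "Suc n0 + k"] g by (simp add: y_def)
 qed (use y0 in "simp add: y_def")
 have ycrit: "~ lif f (y k)" for k using crit[OF yA[of k, unfolded add_Suc]] by simp
 have "finite (range y)" using finite_subset[OF _ finite_not_lif[OF f d1]] ycrit by blast
 then obtain i j where ij: "i < j" "y i = y j"
  using infinite_UNIV_nat finite_imageD[of y UNIV] unfolding inj_on_def by (metis linorder_neqE_nat)
 have fy: "(f ^^ m) (y (k + m)) = y k" for k m
 proof (induction m)
  case (Suc m)
  have "f (y (k + Suc m)) = y (k + m)" by (simp add: y_def g)
  thus ?case using Suc by (simp add: funpow_swap1)
 qed simp
 have "(f ^^ (j - i)) (y j) = y j" using fy[of "j - i" i] ij by simp
 moreover have "j - i >= 1" using ij by simp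
 ultimately have "y j \<in> fatou_set f" using superattracting_fatou[OF f _ _ ycrit] by blast
 moreover have "(f ^^ (Suc n0 + j)) (y j) = v" using yA[of j] by (simp add: A_def del: funpow.simps)
 ultimately show False using v julia_funpow_invariant[OF f d1, of "Suc n0 + j" "y j"] unfolding julia_set_def by simp
qed

text \<open>Prepares Montel's theorem for sets that avoid a disc containing a critical value
  \<open>v\<close>. As \<open>N v\<close> is connected and meets the Julia set at most in
  \<open>v\<close>, a disc bounded by a Julia component contains all of \<open>N v\<close> once it
  contains \<open>v\<close>; and a set whose image under \<open>f ^^ m\<close> misses
  \<open>N v\<close> misses \<open>t v\<close>.\<close>

lemma omitted_triples:
 assumes f: "rational_map_of_degree f d" and d: "d >= 2"
 obtains m t N where "!!v. v \<in> crit_values f ==> v \<in> N v & connected (N v) & N v Int julia_set f \<subseteq> {v} &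
   card (t v) = 3 & (f ^^ m) ` t v \<subseteq> N v"
proof -
 have d1: "d >= 1" using d by simp
 have "EX n. ALL m>=n. card ((f ^^ m) -` {v}) >= 3" if v: "v \<in> julia_set f" for v
 proof -
  obtain n where n: "card ((f ^^ n) -` {v}) >= 3" using backward_orbit_julia[OF f d v] by blast
  have "card ((f ^^ m) -` {v}) >= 3" if m: "m >= n" for m using m
  proof (induction m rule: dec_induct)
   case (step m)
   have "f ` ((f ^^ Suc m) -` {v}) = (f ^^ m) -` {v}"
    unfolding funpow_Suc_right vimage_comp[symmetric] using rational_surj[OF f d1] by (simp add: surj_image_vimage_eq)
   hence "card ((f ^^ m) -` {v}) <= card ((f ^^ Suc m) -` {v})"
    using card_image_le[OF rational_funpow_fiber(1)[OF f d1, of "Suc m" v], of f] by simp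
   thus ?case using step.IH by linarith
  qed (use n in simp)
  thus ?thesis by blast
 qed
 then obtain n where n: "!!v m. v \<in> julia_set f ==> m >= n v ==> card ((f ^^ m) -` {v}) >= 3" by metis
 define m where "m = Max (insert 0 (n ` crit_values f))"
 have m: "n v <= m" if "v \<in> crit_values f" for v
  unfolding m_def using finite_crit_values[OF f d1] that by simp
 have "EX N t. v \<in> N & connected N & N Int julia_set f \<subseteq> {v} & card t = 3 & (f ^^ m) ` t \<subseteq> N"
  if v: "v \<in> crit_values f" for v
 proof (cases "v \<in> julia_set f")
  case True
  hence "card ((f ^^ m) -` {v}) >= 3" using n m v by blast
  then obtain t where "t \<subseteq> (f ^^ m) -` {v}" "card t = 3" using obtain_subset_with_card_n by metis
  thus ?thesis by (intro exI[of _ "{v}"] exI[of _ t]) auto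
 next
  case False
  hence "v \<in> fatou_set f" by (simp add: julia_set_def)
  then obtain V where V: "open V" "connected V" "v \<in> V" "V \<subseteq> fatou_set f"
   using connected_nbhd[OF open_fatou] by metis
  have "open ((f ^^ m) -` V)"
   using continuous_on_funpow_sphere[OF rational_continuous[OF f], of UNIV m] V(1) by (simp add: continuous_on_open_vimage)
  moreover have "(f ^^ m) -` V ~= {}" using rational_funpow_fiber(2)[OF f d1, of m v] V(3) by blast
  ultimately have "infinite ((f ^^ m) -` V)" by (rule infinite_open_sphere)
  then obtain t where "t \<subseteq> (f ^^ m) -` V" "card t = 3" using infinite_arbitrarily_large by metis
  thus ?thesis using V unfolding julia_set_def by (intro exI[of _ V] exI[of _ t]) auto
 qed
 then obtain N t where "!!v. v \<in> crit_values f ==> v \<in> N v & connected (N v) & N v Int julia_set f \<subseteq> {v} &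
   card (t v) = 3 & (f ^^ m) ` t v \<subseteq> N v" by metis
 thus ?thesis using that by blast
qed

section \<open>Analytic tools for the absence of wandering domains\<close>

text \<open>A quarter theorem with an unspecified constant, from Landau's theorem. If
  \<open>ze\<close> is omitted, \<open>H\<close> has no zero and takes the value 1 only at
  \<open>x\<close>; its square root with value -1 at \<open>x\<close> omits 0 and 1, which bounds
  its derivative and so \<open>deriv g x\<close>.\<close>

lemma koebe_weak:
 obtains ka :: real where "ka > 0"
  "!!g x s. s > 0 ==> g holomorphic_on ball x s ==> inj_on g (ball x s) ==>
    ball (g x) (ka * s * cmod (deriv g x)) \<subseteq> g ` ball x s"
proof -
 obtain R where R: "!!z. 0 < R z"
  "!!f. f holomorphic_on cball 0 (R (f 0)) ==> (!!z. norm z <= R (f 0) ==> f z ~= 0 & f z ~= 1) ==> norm (deriv f 0) < 1"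
  using Landau_Picard by metis
 \<comment> \<open>The radius in Landau's theorem for the central value -1. In the constant
   \<open>1 / (4 * R0)\<close> one factor 2 comes from using half the radius \<open>s\<close> and
   one from differentiating a square.\<close>
 define R0 where "R0 = R (- 1)"
 have R0: "R0 > 0" unfolding R0_def by (rule R(1))
 show ?thesis
 proof (rule that[of "1 / (4 * R0)"])
  show "1 / (4 * R0) > 0" using R0 by simp
  fix g :: "complex => complex" and x :: complex and s :: real
  assume s: "s > 0" and hol: "g holomorphic_on ball x s" and inj: "inj_on g (ball x s)"
  show "ball (g x) (1 / (4 * R0) * s * cmod (deriv g x)) \<subseteq> g ` ball x s"
  proof (rule ccontr)
   assume "~ ?thesis"
   then obtain ze where ze: "ze \<in> ball (g x) (1 / (4 * R0) * s * cmod (deriv g x))" "ze ~: g ` ball x s" by blast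
   have xb: "x \<in> ball x s" using s by simp
   have ne: "ze - g x ~= 0" using ze(2) xb by auto
   define H where "H w = 1 - (g w - g x) / (ze - g x)" for w
   have holH: "H holomorphic_on ball x s" unfolding H_def
    by (intro holomorphic_intros hol) (use ne in auto)
   have Hnz: "H w ~= 0" if "w \<in> ball x s" for w using that ze(2) ne unfolding H_def by auto
   have H1: "H w = 1 ==> w = x" if "w \<in> ball x s" for w
    using that inj xb ne unfolding H_def inj_on_def by auto
   obtain h0 where h0: "h0 holomorphic_on ball x s" "!!w. w \<in> ball x s ==> H w = h0 w ^ 2"
    using contractible_imp_holomorphic_sqrt[OF holH convex_imp_contractible[OF convex_ball]] Hnz by blast
   have "(h0 x)\<^sup>2 = 1" using h0(2)[OF xb] by (simp add: H_def)
   \<comment> \<open>The sign gives \<open>h x = -1\<close>; then \<open>h w = 1\<close> would force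
     \<open>H w = 1\<close>, hence \<open>w = x\<close>, where \<open>h\<close> is not 1.\<close>
   define h where "h w = - h0 x * h0 w" for w
   have hx: "h x = - 1" using `(h0 x)\<^sup>2 = 1` by (simp add: h_def power2_eq_square)
   have hH: "(h w)\<^sup>2 = H w" if "w \<in> ball x s" for w
    using h0(2)[OF that] `(h0 x)\<^sup>2 = 1` by (simp add: h_def power_mult_distrib)
   have holh: "h holomorphic_on ball x s" unfolding h_def by (intro holomorphic_intros h0)
   have h01: "h w ~= 0 & h w ~= 1" if "w \<in> ball x s" for w
    using hH[OF that] Hnz[OF that] H1[OF that] hx by auto
   define c :: complex where "c = of_real (s / (2 * R0))"
   define k where "k xi = h (x + c * xi)" for xi
   have k0: "k 0 = - 1" by (simp add: k_def hx)
   have cm: "cmod c = s / (2 * R0)" using s R0 unfolding c_def by (simp only: norm_of_real) simp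
   have mem: "x + c * xi \<in> ball x s" if "cmod xi <= R0" for xi
   proof -
    have "cmod c * cmod xi <= s / (2 * R0) * R0"
     unfolding cm using that s R0 by (intro mult_left_mono) auto
    hence "cmod (c * xi) <= s / 2" using R0 by (simp add: norm_mult)
    thus ?thesis using s by (simp add: dist_norm)
   qed
   have "k holomorphic_on cball 0 R0" unfolding k_def
    by (rule holomorphic_on_compose_gen[OF _ holh, unfolded o_def]) (use mem in "auto intro!: holomorphic_intros")
   hence dk: "cmod (deriv k 0) < 1"
    using R(2)[of k] k0 h01 mem unfolding R0_def[symmetric] k_def by (simp add: R0_def[symmetric])
   have Dh: "(h has_field_derivative deriv h x) (at x)" using holomorphic_derivI[OF holh open_ball xb] .
   have "(k has_field_derivative deriv h x * c) (at 0)" unfolding k_def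
    by (rule DERIV_chain2[where g = "%xi. x + c * xi"]) (use Dh in "auto intro!: derivative_eq_intros")
   hence dk': "cmod (deriv h x) * cmod c < 1" using dk by (simp add: DERIV_imp_deriv norm_mult)
   have Dg: "(g has_field_derivative deriv g x) (at x)" using holomorphic_derivI[OF hol open_ball xb] .
   have "(H has_field_derivative - (deriv g x / (ze - g x))) (at x)"
    unfolding H_def using ne by (auto intro!: derivative_eq_intros Dg)
   moreover have "((%w. (h w)\<^sup>2) has_field_derivative 2 * h x * deriv h x) (at x)"
    using Dh by (auto intro!: derivative_eq_intros)
   hence "(H has_field_derivative 2 * h x * deriv h x) (at x)"
    by (rule has_field_derivative_transform_within_open[OF _ open_ball xb]) (use hH in auto)
   ultimately have "2 * h x * deriv h x = - (deriv g x / (ze - g x))" using DERIV_unique by blast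
   hence "2 * deriv h x = deriv g x / (ze - g x)" by (simp add: hx)
   hence "2 * cmod (deriv h x) = cmod (deriv g x) / cmod (ze - g x)"
    by (metis norm_divide norm_mult norm_numeral)
   moreover have "cmod (deriv h x) < 2 * R0 / s" using dk' s R0 unfolding cm by (simp add: field_simps)
   ultimately have "cmod (deriv g x) / cmod (ze - g x) < 4 * R0 / s" by linarith
   hence "s * cmod (deriv g x) < 4 * R0 * cmod (ze - g x)" using s ne by (simp add: field_simps)
   moreover have "cmod (ze - g x) < s * cmod (deriv g x) / (4 * R0)"
    using ze(1) by (simp add: dist_norm norm_minus_commute)
   hence "4 * R0 * cmod (ze - g x) < s * cmod (deriv g x)" using R0 by (simp add: field_simps)
   ultimately show False by linarith
  qed
 qed
qed

subsection \<open>Packing estimates\<close>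

lemma area_packing:
 fixes s :: "complex => real"
 assumes F: "finite F" and s: "!!y. y \<in> F ==> s y > 0"
  and dj: "!!y y'. y \<in> F ==> y' \<in> F ==> y ~= y' ==> ball (c y) (s y) Int ball (c y') (s y') = {}"
  and sub: "!!y. y \<in> F ==> ball (c y :: complex) (s y) \<subseteq> ball z R" and R: "R >= 0"
 shows "(\<Sum>y\<in>F. (s y)\<^sup>2) <= R\<^sup>2"
proof -
 define V where "V = unit_ball_vol (real (DIM(complex)))"
 have V: "V > 0" unfolding V_def by (rule unit_ball_vol_pos) simp
 have vol: "measure lborel (ball a r) = V * r\<^sup>2" if "r >= 0" for a :: complex and r
  using content_ball[OF that, of a] by (simp add: V_def)
 have "(\<Sum>y\<in>F. V * (s y)\<^sup>2) = (\<Sum>y\<in>F. measure lborel (ball (c y) (s y)))"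
  by (intro sum.cong refl) (use vol s in "simp add: less_imp_le")
 also have "... = measure lborel (\<Union>y\<in>F. ball (c y) (s y))"
  by (rule measure_finite_Union[OF F, symmetric])
   (use dj emeasure_lborel_ball_finite[where 'a = complex] in "auto simp: disjoint_family_on_def less_top[symmetric]")
 also have "... <= measure lborel (ball z R)" by (rule measure_mono_fmeasurable)
   (use sub F emeasure_lborel_ball_finite[of z R] in "auto intro!: borel_open fmeasurableI")
 also have "... = V * R\<^sup>2" using vol R by simp
 finally show ?thesis using V by (simp flip: sum_distrib_left)
qed

text \<open>Discs centred in the shell \<open>eps / 2 < |z - y| <= eps\<close> lie in the disc of
  radius \<open>2 * eps\<close>, so their squared radii sum to at most \<open>4 * eps ^ 2\<close>
  and the shell contributes at most \<open>8 * eps\<close>. Halving \<open>eps\<close> repeatedly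
  gives a series with sum \<open>16 * eps\<close>.\<close>

lemma dyadic_packing:
 fixes s :: "complex => real"
 assumes F: "finite F" and s: "!!y. y \<in> F ==> s y > 0"
  and dj: "!!y y'. y \<in> F ==> y' \<in> F ==> y ~= y' ==> ball y (s y) Int ball y' (s y') = {}"
  and z: "!!y. y \<in> F ==> s y <= cmod (z - y)" and e: "eps > 0"
 shows "(\<Sum>y\<in>{y\<in>F. cmod (z - y) <= eps}. (s y)\<^sup>2 / cmod (z - y)) <= 16 * eps"
proof -
 \<comment> \<open>\<open>n\<close> counts the dyadic shells left; since \<open>F\<close> is finite,
   its distance from \<open>z\<close> is positive and some \<open>n\<close> suffices.\<close>
 have *: "(\<Sum>y\<in>{y\<in>F. cmod (z - y) <= eps}. (s y)\<^sup>2 / cmod (z - y)) <= 16 * eps"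
  if "eps > 0" "!!y. y \<in> F ==> cmod (z - y) > eps / 2 ^ n" for n eps using that
 proof (induction n arbitrary: eps)
  case 0
  hence "{y\<in>F. cmod (z - y) <= eps} = {}" by force
  thus ?case using 0(1) by (simp only: sum.empty)
 next
  case (Suc n)
  let ?A = "{y\<in>F. cmod (z - y) <= eps / 2}"
  let ?B = "{y\<in>F. eps / 2 < cmod (z - y) & cmod (z - y) <= eps}"
  have "(\<Sum>y\<in>?A. (s y)\<^sup>2 / cmod (z - y)) <= 16 * (eps / 2)"
   by (rule Suc.IH) (use Suc.prems in "auto simp: field_simps")
  moreover have "(\<Sum>y\<in>?B. (s y)\<^sup>2 / cmod (z - y)) <= (\<Sum>y\<in>?B. (s y)\<^sup>2 * (2 / eps))"
  proof (rule sum_mono)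
   fix y assume y: "y \<in> ?B"
   have "1 / cmod (z - y) <= 1 / (eps / 2)"
    by (rule divide_left_mono) (use y Suc.prems(1) in "auto intro!: mult_pos_pos")
   hence "1 / cmod (z - y) <= 2 / eps" by simp
   hence "(s y)\<^sup>2 * (1 / cmod (z - y)) <= (s y)\<^sup>2 * (2 / eps)" by (rule mult_left_mono) simp
   thus "(s y)\<^sup>2 / cmod (z - y) <= (s y)\<^sup>2 * (2 / eps)" by simp
  qed
  moreover have "(\<Sum>y\<in>?B. (s y)\<^sup>2) <= (2 * eps)\<^sup>2"
  proof (rule area_packing[where c = "%y. y" and z = z])
   show "ball y (s y) \<subseteq> ball z (2 * eps)" if "y \<in> ?B" for y
   proof
    fix w assume "w \<in> ball y (s y)"
    thus "w \<in> ball z (2 * eps)"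
     using that z[of y] dist_triangle[of z w y] by (auto simp: dist_norm)
   qed
  qed (use F s dj Suc.prems in auto)
  hence "(\<Sum>y\<in>?B. (s y)\<^sup>2 * (2 / eps)) <= (2 * eps)\<^sup>2 * (2 / eps)"
   unfolding sum_distrib_right[symmetric] using Suc.prems(1) by (intro mult_right_mono) auto
  moreover have "(2 * eps)\<^sup>2 * (2 / eps) = 8 * eps" using Suc.prems(1) by (simp add: power2_eq_square)
  moreover have "{y\<in>F. cmod (z - y) <= eps} = ?A Un ?B" using Suc.prems(1) by auto
  moreover have "(\<Sum>y\<in>?A Un ?B. (s y)\<^sup>2 / cmod (z - y)) = (\<Sum>y\<in>?A. (s y)\<^sup>2 / cmod (z - y)) + (\<Sum>y\<in>?B. (s y)\<^sup>2 / cmod (z - y))"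
   by (rule sum.union_disjoint) (use F in auto)
  ultimately show ?case by simp
 qed
 define m where "m = Min (insert 1 ((%y. cmod (z - y)) ` F))"
 have m: "m > 0" "!!y. y \<in> F ==> m <= cmod (z - y)"
 proof -
  have "cmod (z - y) > 0" if "y \<in> F" for y using s z that by (metis less_le_trans)
  thus "m > 0" unfolding m_def using F by auto
 qed (use F in "auto simp: m_def")
 obtain n where "(1/2 :: real) ^ n < m / eps" using real_arch_pow_inv[of "m / eps" "1/2"] m e by auto
 hence "eps / 2 ^ n < m" using e by (simp add: field_simps power_divide)
 hence "cmod (z - y) > eps / 2 ^ n" if "y \<in> F" for y using m(2)[OF that] by linarith
 thus ?thesis using *[OF e] by blast
qed

text \<open>A discrete Cauchy transform whose residues are dominated by the areas of disjoint discs
  about the poles. The poles may accumulate in \<open>outer\<close>, the region off all the discs,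
  where packing alone gives convergence.\<close>

locale pole_sum =
 fixes Gm :: "complex set" and s :: "complex => real" and rho :: "complex => complex" and C R :: real
 assumes s: "!!y. y \<in> Gm ==> s y > 0"
  and dj: "!!y y'. y \<in> Gm ==> y' \<in> Gm ==> y ~= y' ==> ball y (s y) Int ball y' (s y') = {}"
  and sub: "!!y. y \<in> Gm ==> ball y (s y) \<subseteq> ball 0 R" and R: "R > 0"
  and rho: "!!y. y \<in> Gm ==> cmod (rho y) <= C * (s y)\<^sup>2" and C: "C >= 0"
begin

definition "outer = {z. ALL y:Gm. s y <= cmod (z - y)}"

definition "u z = (\<Sum>\<^sub>\<infinity>y\<in>Gm. rho y / (y - z))"

lemma summable_s: "(%y. (s y)\<^sup>2) summable_on Gm"
proof (rule nonneg_bdd_above_summable_on)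
 show "bdd_above (sum (%y. (s y)\<^sup>2) ` {F. F \<subseteq> Gm & finite F})"
 proof (rule bdd_aboveI2)
  fix F assume F: "F \<in> {F. F \<subseteq> Gm & finite F}"
  hence yG: "y \<in> Gm" if "y \<in> F" for y using that by blast
  show "(\<Sum>y\<in>F. (s y)\<^sup>2) <= R\<^sup>2"
   by (rule area_packing[where c = "%y. y" and z = 0]) (use F s dj sub R yG in auto)
 qed
qed simp

lemma abs_summable_rho: "(%y. cmod (rho y)) summable_on Gm"
proof (rule Infinite_Sum.abs_summable_on_comparison_test[where f = rho and g = "%y. C * (s y)\<^sup>2"])
 show "(%y. norm (C * (s y)\<^sup>2)) summable_on Gm"
  using summable_on_cmult_right[OF summable_s, of C] C by (simp add: abs_mult)
qed (use rho C in "simp add: abs_mult")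

text \<open>Poles within \<open>eps\<close> of \<open>z\<close> are handled by dyadic packing, the
  others by the bound \<open>1 / eps\<close> for the kernel.\<close>

lemma tail_bound:
 assumes F: "finite F" "F \<subseteq> Gm" and z: "z \<in> outer" and e: "eps > 0"
 shows "(\<Sum>y\<in>F. cmod (rho y / (y - z))) <= C * (16 * eps + (\<Sum>y\<in>F. (s y)\<^sup>2) / eps)"
proof -
 let ?A = "{y\<in>F. cmod (z - y) <= eps}" and ?B = "{y\<in>F. eps < cmod (z - y)}"
 have "(\<Sum>y\<in>F. cmod (rho y / (y - z))) <= (\<Sum>y\<in>F. C * ((s y)\<^sup>2 / cmod (z - y)))"
 proof (rule sum_mono)
  fix y assume y: "y \<in> F"
  hence "cmod (rho y) / cmod (z - y) <= C * (s y)\<^sup>2 / cmod (z - y)"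
   using rho F by (intro divide_right_mono) auto
  thus "cmod (rho y / (y - z)) <= C * ((s y)\<^sup>2 / cmod (z - y))"
   by (simp add: norm_divide norm_minus_commute)
 qed
 also have "... = C * (\<Sum>y\<in>F. (s y)\<^sup>2 / cmod (z - y))" by (simp add: sum_distrib_left)
 also have "(\<Sum>y\<in>F. (s y)\<^sup>2 / cmod (z - y)) = (\<Sum>y\<in>?A Un ?B. (s y)\<^sup>2 / cmod (z - y))"
  by (intro sum.cong) auto
 also have "... = (\<Sum>y\<in>?A. (s y)\<^sup>2 / cmod (z - y)) + (\<Sum>y\<in>?B. (s y)\<^sup>2 / cmod (z - y))"
  by (rule sum.union_disjoint) (use F in auto)
 also have "(\<Sum>y\<in>?A. (s y)\<^sup>2 / cmod (z - y)) <= 16 * eps"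
 proof (rule dyadic_packing[OF F(1) _ _ _ e])
  show "!!y. y \<in> F ==> s y > 0" using F s by blast
  show "!!y y'. y \<in> F ==> y' \<in> F ==> y ~= y' ==> ball y (s y) Int ball y' (s y') = {}" using F dj by blast
  show "!!y. y \<in> F ==> s y <= cmod (z - y)" using F z unfolding outer_def by blast
 qed
 also have "(\<Sum>y\<in>?B. (s y)\<^sup>2 / cmod (z - y)) <= (\<Sum>y\<in>?B. (s y)\<^sup>2 / eps)"
  by (intro sum_mono divide_left_mono) (use e in "auto intro!: mult_pos_pos")
 also have "... <= (\<Sum>y\<in>F. (s y)\<^sup>2 / eps)" by (intro sum_mono2) (use F e in auto)
 also have "... = (\<Sum>y\<in>F. (s y)\<^sup>2) / eps" by (simp add: sum_divide_distrib)
 finally show ?thesis using C by (simp add: mult_left_mono)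
qed

lemma abs_summable_u:
 assumes z: "z \<in> outer"
 shows "(%y. cmod (rho y / (y - z))) summable_on Gm" "cmod (u z) <= C * (16 + R\<^sup>2)"
proof -
 have b: "(\<Sum>y\<in>F. cmod (rho y / (y - z))) <= C * (16 + R\<^sup>2)" if F: "F \<subseteq> Gm" "finite F" for F
 proof -
  have yG: "y \<in> Gm" if "y \<in> F" for y using that F by blast
  have "(\<Sum>y\<in>F. (s y)\<^sup>2) <= R\<^sup>2"
   by (rule area_packing[where c = "%y. y" and z = 0]) (use F s dj sub R yG in auto)
  hence "C * (16 * 1 + (\<Sum>y\<in>F. (s y)\<^sup>2) / 1) <= C * (16 + R\<^sup>2)"
   using C by (intro mult_left_mono) auto
  thus ?thesis using tail_bound[OF F(2,1) z, of 1] by linarith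
 qed
 thus 1: "(%y. cmod (rho y / (y - z))) summable_on Gm"
  unfolding abs_summable_iff_bdd_above by (intro bdd_aboveI2[where M = "C * (16 + R\<^sup>2)"]) auto
 have "cmod (u z) <= (\<Sum>\<^sub>\<infinity>y\<in>Gm. cmod (rho y / (y - z)))"
  unfolding u_def by (rule norm_infsum_bound[OF 1])
 also have "... <= C * (16 + R\<^sup>2)" by (rule infsum_le_finite_sums[OF 1]) (use b in auto)
 finally show "cmod (u z) <= C * (16 + R\<^sup>2)" .
qed

lemma uniform_limit_u: "uniform_limit outer (%F z. \<Sum>y\<in>F. rho y / (y - z)) u (finite_subsets_at_top Gm)"
proof (rule uniform_limitI)
 fix e :: real assume e: "e > 0"
 \<comment> \<open>\<open>eps\<close> makes the poles near \<open>z\<close> contribute at most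
   \<open>e / 4\<close>, uniformly in \<open>z\<close>; \<open>eta\<close> then bounds the tail of
   the squares so that the far poles contribute at most \<open>e / 8\<close>.\<close>
 define eps where "eps = e / (64 * (C + 1))"
 have eps: "eps > 0" "C * (16 * eps) <= e / 4"
 proof -
  show "eps > 0" using e C by (simp add: eps_def)
  have "C / (C + 1) <= 1" using C by simp
  hence "(e / 4) * (C / (C + 1)) <= (e / 4) * 1" using e by (intro mult_left_mono) auto
  thus "C * (16 * eps) <= e / 4" using C by (simp add: eps_def field_simps)
 qed
 define eta where "eta = e * eps / (8 * (C + 1))"
 have eta: "eta > 0" "C * (eta / eps) <= e / 8"
 proof -
  show "eta > 0" using e C eps by (simp add: eta_def)
  have "C / (C + 1) <= 1" using C by simp
  hence "(e / 8) * (C / (C + 1)) <= (e / 8) * 1" using e by (intro mult_left_mono) auto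
  moreover have "eta / eps = e / (8 * (C + 1))" using eps(1) by (simp add: eta_def)
  hence "C * (eta / eps) = (e / 8) * (C / (C + 1))" by simp
  ultimately show "C * (eta / eps) <= e / 8" by linarith
 qed
 have "((%F. \<Sum>y\<in>F. (s y)\<^sup>2) \<longlongrightarrow> (\<Sum>\<^sub>\<infinity>y\<in>Gm. (s y)\<^sup>2)) (finite_subsets_at_top Gm)"
  using infsum_tendsto[OF summable_s] .
 hence ev: "\<forall>\<^sub>F F in finite_subsets_at_top Gm. dist (\<Sum>y\<in>F. (s y)\<^sup>2) (\<Sum>\<^sub>\<infinity>y\<in>Gm. (s y)\<^sup>2) < eta"
  using eta(1) by (rule tendstoD)
 have ev2: "\<forall>\<^sub>F F in finite_subsets_at_top Gm. finite F & F \<subseteq> Gm"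
  by (rule eventually_finite_subsets_at_top_weakI) auto
 show "\<forall>\<^sub>F F in finite_subsets_at_top Gm. ALL z:outer. dist (\<Sum>y\<in>F. rho y / (y - z)) (u z) < e"
  using eventually_conj[OF ev ev2]
 proof eventually_elim
  case (elim F)
  show ?case
  proof
   fix z assume z: "z \<in> outer"
   have sm: "(%y. cmod (rho y / (y - z))) summable_on (Gm - F)"
    using summable_on_subset_banach[OF abs_summable_u(1)[OF z], of "Gm - F"] by simp
   have "u z = (\<Sum>\<^sub>\<infinity>y\<in>F Un (Gm - F). rho y / (y - z))" unfolding u_def using elim by (simp add: Un_absorb1)
   also have "... = (\<Sum>\<^sub>\<infinity>y\<in>F. rho y / (y - z)) + (\<Sum>\<^sub>\<infinity>y\<in>Gm - F. rho y / (y - z))"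
    by (rule infsum_Un_disjoint) (use elim abs_summable_summable[OF sm] in auto)
   finally have eq: "u z - (\<Sum>y\<in>F. rho y / (y - z)) = (\<Sum>\<^sub>\<infinity>y\<in>Gm - F. rho y / (y - z))"
    using elim by simp
   have "cmod (u z - (\<Sum>y\<in>F. rho y / (y - z))) <= (\<Sum>\<^sub>\<infinity>y\<in>Gm - F. cmod (rho y / (y - z)))"
    unfolding eq by (rule norm_infsum_bound[OF sm])
   moreover have "(\<Sum>\<^sub>\<infinity>y\<in>Gm - F. cmod (rho y / (y - z))) <= C * (16 * eps + eta / eps)"
   proof (rule infsum_le_finite_sums[OF sm])
    fix E assume E: "finite E" "E \<subseteq> Gm - F"
    have "(\<Sum>y\<in>E. (s y)\<^sup>2) + (\<Sum>y\<in>F. (s y)\<^sup>2) = (\<Sum>y\<in>E Un F. (s y)\<^sup>2)"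
     by (rule sum.union_disjoint[symmetric]) (use E elim in auto)
    also have "... <= (\<Sum>\<^sub>\<infinity>y\<in>Gm. (s y)\<^sup>2)"
     by (rule finite_sum_le_infsum[OF summable_s]) (use E elim in auto)
    finally have 1: "(\<Sum>y\<in>E. (s y)\<^sup>2) + (\<Sum>y\<in>F. (s y)\<^sup>2) <= (\<Sum>\<^sub>\<infinity>y\<in>Gm. (s y)\<^sup>2)" .
    have "\<bar>(\<Sum>y\<in>F. (s y)\<^sup>2) - (\<Sum>\<^sub>\<infinity>y\<in>Gm. (s y)\<^sup>2)\<bar> < eta"
     using elim by (simp add: dist_real_def)
    hence "(\<Sum>y\<in>E. (s y)\<^sup>2) <= eta" using 1 by linarith
    hence "C * (16 * eps + (\<Sum>y\<in>E. (s y)\<^sup>2) / eps) <= C * (16 * eps + eta / eps)"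
     using C eps by (intro mult_left_mono add_left_mono divide_right_mono) auto
    moreover have "E \<subseteq> Gm" using E by blast
    ultimately show "(\<Sum>y\<in>E. cmod (rho y / (y - z))) <= C * (16 * eps + eta / eps)"
     using tail_bound[OF E(1) _ z eps(1)] by fastforce
   qed
   moreover have "C * (16 * eps + eta / eps) <= e / 4 + e / 8" using eps(2) eta(2) by (simp add: distrib_left)
   ultimately have "cmod (u z - (\<Sum>y\<in>F. rho y / (y - z))) < e" using e by linarith
   thus "dist (\<Sum>y\<in>F. rho y / (y - z)) (u z) < e"
    by (simp add: dist_norm norm_minus_commute)
  qed
 qed
qed

lemma not_in_outer: "z \<in> outer ==> z ~: Gm" unfolding outer_def using s by fastforce

lemma continuous_on_u: "continuous_on outer u"
proof (rule uniform_limit_theorem[OF _ uniform_limit_u])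
 show "\<forall>\<^sub>F F in finite_subsets_at_top Gm. continuous_on outer (%z. \<Sum>y\<in>F. rho y / (y - z))"
 proof (rule eventually_finite_subsets_at_top_weakI)
  fix F assume "finite F" "F \<subseteq> Gm"
  thus "continuous_on outer (%z. \<Sum>y\<in>F. rho y / (y - z))"
   using not_in_outer by (intro continuous_intros) auto
 qed
qed simp

lemma holomorphic_on_u:
 assumes V: "open V" "V \<subseteq> outer"
 shows "u holomorphic_on V"
proof -
 have "u field_differentiable (at z)" if zV: "z \<in> V" for z
 proof -
  obtain r where r: "r > 0" "cball z r \<subseteq> V" using V zV open_contains_cball by metis
  have "u holomorphic_on ball z r"
  proof (rule holomorphic_uniform_limit)
   show "uniform_limit (cball z r) (%F z. \<Sum>y\<in>F. rho y / (y - z)) u (finite_subsets_at_top Gm)"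
    using uniform_limit_on_subset[OF uniform_limit_u] r V by blast
   show "\<forall>\<^sub>F F in finite_subsets_at_top Gm. continuous_on (cball z r) (%z. \<Sum>y\<in>F. rho y / (y - z)) &
     (%z. \<Sum>y\<in>F. rho y / (y - z)) holomorphic_on ball z r"
   proof (rule eventually_finite_subsets_at_top_weakI)
    fix F assume F: "finite F" "F \<subseteq> Gm"
    have nz: "y - w ~= 0" if "y \<in> F" "w \<in> cball z r" for y w
     using not_in_outer that F r V by (metis eq_iff_diff_eq_0 subsetD)
    have "(%z. \<Sum>y\<in>F. rho y / (y - z)) holomorphic_on cball z r"
     by (intro holomorphic_intros) (use nz in auto)
    thus "continuous_on (cball z r) (%z. \<Sum>y\<in>F. rho y / (y - z)) &
     (%z. \<Sum>y\<in>F. rho y / (y - z)) holomorphic_on ball z r"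
     using holomorphic_on_imp_continuous_on holomorphic_on_subset ball_subset_cball by blast
   qed
  qed (simp, assumption)
  thus ?thesis using r(1) by (simp add: holomorphic_on_open field_differentiable_def)
 qed
 thus ?thesis by (simp add: holomorphic_on_def field_differentiable_at_within)
qed

lemma far_bound:
 assumes z: "cmod z > R"
 shows "cmod (u z) <= (\<Sum>\<^sub>\<infinity>y\<in>Gm. cmod (rho y)) / (cmod z - R)"
proof -
 have yR: "cmod y < R" if "y \<in> Gm" for y
 proof -
  have "y \<in> ball y (s y)" using s[OF that] by simp
  hence "y \<in> ball 0 R" using sub[OF that] by blast
  thus ?thesis by simp
 qed
 have b: "cmod (rho y / (y - z)) <= cmod (rho y) * (1 / (cmod z - R))" if "y \<in> Gm" for y
 proof -
  have "cmod z - R <= cmod (y - z)" using yR[OF that] norm_triangle_ineq3[of y z] by linarith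
  hence "cmod (rho y) / cmod (y - z) <= cmod (rho y) / (cmod z - R)"
   using z by (intro divide_left_mono mult_pos_pos) auto
  thus ?thesis by (simp add: norm_divide)
 qed
 have sm: "(%y. cmod (rho y) * (1 / (cmod z - R))) summable_on Gm"
  using summable_on_cmult_left[OF abs_summable_rho] .
 have sm2: "(%y. cmod (rho y / (y - z))) summable_on Gm"
  by (rule Infinite_Sum.abs_summable_on_comparison_test[where g = "%y. cmod (rho y) * (1 / (cmod z - R))"])
   (use sm b z in "auto simp: abs_mult")
 have "cmod (u z) <= (\<Sum>\<^sub>\<infinity>y\<in>Gm. cmod (rho y / (y - z)))"
  unfolding u_def by (rule norm_infsum_bound[OF sm2])
 also have "... <= (\<Sum>\<^sub>\<infinity>y\<in>Gm. cmod (rho y) * (1 / (cmod z - R)))"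
  by (rule infsum_mono[OF sm2 sm]) (use b in auto)
 also have "... = (\<Sum>\<^sub>\<infinity>y\<in>Gm. cmod (rho y)) * (1 / (cmod z - R))"
  by (rule infsum_cmult_left) (use abs_summable_rho in auto)
 finally show ?thesis by simp
qed

end

subsection \<open>Residues of rational functions\<close>

text \<open>The residues add up to an integral over arbitrarily large circles, on which
  \<open>w\<close> times the integrand tends to 0.\<close>

lemma residue_sum_rational:
 fixes N D :: "complex poly"
 assumes deg: "degree N + 1 < degree D"
 shows "(\<Sum>c | poly D c = 0. residue (%w. poly N w / poly D w) c) = 0"
proof -
 have D0: "D ~= 0" using deg by auto
 define Z where "Z = {c. poly D c = 0}"
 have Z: "finite Z" unfolding Z_def using poly_roots_finite[OF D0] .
 define F where "F w = poly N w / poly D w" for w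
 define S where "S = (\<Sum>c\<in>Z. residue F c)"
 have lim: "((%w. poly (monom 1 1 * N) w / poly D w) \<longlongrightarrow> 0) at_infinity"
 proof (rule poly_divide_tendsto_0_at_infinity)
  show "degree (monom 1 1 * N) < degree D"
   using degree_mult_le[of "monom (1::complex) 1" N] degree_monom_le[of "1::complex" 1] deg by linarith
 qed
 have "cmod S <= e" if e: "e > 0" for e
 proof -
  have "\<forall>\<^sub>F w in at_infinity. cmod (w * F w) < e"
   using tendstoD[OF lim e] by (simp add: F_def poly_monom mult.assoc)
  then obtain R1 where R1: "!!w. R1 <= cmod w ==> cmod (w * F w) < e"
   unfolding eventually_at_infinity by blast
  define R where "R = Max (insert 1 (insert R1 (insert (\<Sum>c\<in>Z. cmod c + 1) {})))"
  have R: "R >= 1" "R >= R1" "R >= (\<Sum>c\<in>Z. cmod c + 1)" unfolding R_def by auto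
  have ZR: "cmod c < R" if c: "c \<in> Z" for c
  proof -
   have "cmod c + 1 <= (\<Sum>c\<in>Z. cmod c + 1)" by (rule member_le_sum[OF c]) (use Z in auto)
   thus ?thesis using R by linarith
  qed
  have hol: "F holomorphic_on UNIV - Z" unfolding F_def Z_def by (intro holomorphic_intros) auto
  have pi: "path_image (circlepath 0 R) \<subseteq> UNIV - Z"
   using ZR R(1) by (force simp: path_image_circlepath)
  have "contour_integral (circlepath 0 R) F = 2 * pi * \<i> * (\<Sum>c\<in>Z. winding_number (circlepath 0 R) c * residue F c)"
   by (rule Residue_theorem[OF open_UNIV connected_UNIV Z hol _ _ pi]) auto
  also have "(\<Sum>c\<in>Z. winding_number (circlepath 0 R) c * residue F c) = S" unfolding S_def
  proof (intro sum.cong refl)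
   fix c assume "c \<in> Z"
   hence "winding_number (circlepath 0 R) c = 1"
    using ZR R by (intro winding_number_circlepath) auto
   thus "winding_number (circlepath 0 R) c * residue F c = residue F c" by simp
  qed
  finally have ci: "contour_integral (circlepath 0 R) F = 2 * pi * \<i> * S" .
  have "cmod (contour_integral (circlepath 0 R) F) <= (e / R) * (2 * pi * R)"
  proof (rule has_contour_integral_bound_circlepath)
   have "continuous_on (path_image (circlepath 0 R)) F"
    using holomorphic_on_imp_continuous_on[OF hol] continuous_on_subset pi by blast
   thus "(F has_contour_integral contour_integral (circlepath 0 R) F) (circlepath 0 R)"
    by (rule has_contour_integral_integral[OF contour_integrable_continuous_circlepath])
   show "cmod (F w) <= e / R" if "cmod (w - 0) = R" for w
    using R1[of w] that R by (simp add: norm_mult field_simps)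
  qed (use e R in auto)
  hence "2 * pi * cmod S <= 2 * pi * e" unfolding ci using R by (simp add: norm_mult)
  thus ?thesis by simp
 qed
 hence "cmod S <= 0" by (metis field_le_epsilon add_0)
 thus ?thesis unfolding S_def F_def Z_def by simp
qed

lemma residue_simple_root:
 fixes N D :: "complex poly"
 assumes D: "D = P * Q" and x: "poly P x = 0" "poly (pderiv P) x ~= 0" "poly Q x ~= 0"
 shows "residue (%w. poly N w / poly D w) x = poly N x / (poly (pderiv P) x * poly Q x)"
proof -
 obtain E where E: "P = [:-x, 1:] * E" using x(1) by (auto simp: poly_eq_0_iff_dvd)
 have Ex: "poly (pderiv P) x = poly E x"
  unfolding E by (simp add: pderiv_mult pderiv_pCons del: mult_pCons_left)
 obtain r where r: "r > 0" "ALL w:ball x r. poly (E * Q) w ~= 0"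
  using poly_nz_nbhd[of "E * Q" x] x Ex by auto
 have "(%w. poly N w / poly (E * Q) w) holomorphic_on ball x r"
  using r by (intro holomorphic_intros) auto
 hence "residue (%w. poly N w / poly (E * Q) w / (w - x)) x = poly N x / poly (E * Q) x"
  using r by (intro residue_simple[OF open_ball]) auto
 moreover have "poly D w = poly (E * Q) w * (w - x)" for w
  unfolding D E by (simp add: algebra_simps)
 hence "(%w. poly N w / poly D w) = (%w. poly N w / poly (E * Q) w / (w - x))"
  by (simp only: divide_divide_eq_left)
 ultimately show ?thesis by (simp add: Ex)
qed

text \<open>At a zero of \<open>P\<close> of order \<open>m\<close> the Wronskian vanishes to order
  exactly \<open>m - 1\<close>, because \<open>E c\<close> is \<open>m * A c * q c\<close> and
  nonzero. Hence \<open>P\<close> divided by the Wronskian is holomorphic at \<open>c\<close> and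
  vanishes there, whatever the multiplicity.\<close>

lemma order_root_pderiv_quotient:
 fixes P q :: "complex poly"
 assumes P0: "P ~= 0" and c: "poly P c = 0" and qc: "poly q c ~= 0"
 obtains A E where "pderiv P * q - P * pderiv q ~= 0" "poly E c ~= 0"
  "P * E = [:-c, 1:] * A * (pderiv P * q - P * pderiv q)"
proof -
 define m where "m = order c P"
 have m: "m ~= 0" using c P0 unfolding m_def by (simp add: order_root)
 obtain A where A: "P = [:-c, 1:] ^ m * A" "~ [:-c, 1:] dvd A"
  using order_decomp[OF P0, of c] unfolding m_def by blast
 have Ac: "poly A c ~= 0" using A(2) by (simp add: poly_eq_0_iff_dvd)
 define L :: "complex poly" where "L = [:-c, 1:]"
 define E where "E = smult (of_nat m) (A * q) + L * (pderiv A * q - A * pderiv q)"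
 have Ec: "poly E c ~= 0" using m Ac qc unfolding E_def L_def by simp
 obtain k where k: "m = Suc k" using m by (cases m) auto
 have dL: "pderiv L = 1" by (simp add: L_def pderiv_pCons)
 have dP: "pderiv P = smult (of_nat m) (L ^ k * A) + L ^ m * pderiv A"
  unfolding A(1) L_def[symmetric] k by (simp only: pderiv_mult pderiv_power_Suc dL) (simp add: algebra_simps)
 have PA: "P = L ^ m * A" using A(1) by (simp add: L_def)
 have "pderiv P * q - P * pderiv q = (smult (of_nat m) (L ^ k * A) + L ^ m * pderiv A) * q - (L ^ m * A) * pderiv q"
  by (subst dP, subst PA, rule refl)
 also have "... = L ^ k * E" unfolding E_def k by (simp add: algebra_simps)
 finally have W: "pderiv P * q - P * pderiv q = L ^ k * E" .
 have "L ^ k ~= 0" unfolding L_def by simp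
 moreover have "E ~= 0" using Ec by auto
 ultimately have "pderiv P * q - P * pderiv q ~= 0" unfolding W by simp
 moreover have "P * E = L * A * (pderiv P * q - P * pderiv q)"
  unfolding W by (subst PA) (simp add: k algebra_simps)
 ultimately show ?thesis using that[of E A] Ec unfolding L_def by blast
qed

text \<open>The push-forward of the quadratic differential \<open>dw^2 / (w - z)\<close> under the map \<open>p / q\<close>: apply
 the residue theorem to \<open>(p - b q)^3 / ((p - y q) W (w - z))\<close>, which decays like \<open>1 / w^2\<close>.\<close>

lemma pushforward_identity:
 fixes p q :: "complex poly" and z :: complex
 assumes pq: "ratl p q d" and d: "d >= 1" and qd: "coeff q d ~= 0"
  and W_def: "W = pderiv p * q - p * pderiv q" and b_def: "b = coeff p d / coeff q d"
  and W0: "W ~= 0"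
  and cq: "!!c. poly W c = 0 ==> poly q c ~= 0"
  and Wz: "poly W z ~= 0"
 obtains al be1 be2 be3 where
  "!!y. y ~= b ==> poly p z ~= y * poly q z ==> (!!c. poly W c = 0 ==> poly p c ~= y * poly q c) ==>
    (\<Sum>w | poly p w = y * poly q w. poly q w ^ 4 / (poly W w ^ 2 * (w - z))) =
    - (poly q z ^ 3 / ((poly p z - y * poly q z) * poly W z))
    + (\<Sum>c | poly W c = 0. al c / (y - poly p c / poly q c))
    + be1 / (b - y) + be2 / (b - y) ^ 2 + be3 / (b - y) ^ 3"
proof -
 note r = pq[unfolded ratl_def]
 \<comment> \<open>\<open>b\<close> is the value of \<open>p / q\<close> at infinity, so
   \<open>Pb\<close> has degree \<open>e < d\<close>; the decay of the rational function below rests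
   on this.\<close>
 define Pb where "Pb = p - smult b q"
 define L where "L = W * [:-z, 1:]"
 define res where "res N c = residue (%w. poly N w / poly L w) c" for N c
 define Zc where "Zc = {c. poly W c = 0}"
 have Zc: "finite Zc" unfolding Zc_def using poly_roots_finite[OF W0] .
 have degq: "degree q = d" using r qd le_degree by (metis le_antisym)
 have Pbd: "coeff Pb d = 0" using qd by (simp add: Pb_def b_def)
 have degPb_le: "degree Pb <= d" unfolding Pb_def by (intro degree_diff_le) (use r in "auto intro: order.trans[OF degree_smult_le]")
 have Pb0: "Pb ~= 0"
 proof
  assume "Pb = 0"
  hence p: "p = smult b q" by (simp add: Pb_def)
  have "W = 0" unfolding W_def p by (simp add: pderiv_smult mult.commute)
  thus False using W0 by simp
 qed
 define e where "e = degree Pb"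
 have ed: "e < d" unfolding e_def using degPb_le Pbd Pb0 by (metis le_neq_implies_less leading_coeff_0_iff)
 have WPb: "W = pderiv Pb * q - Pb * pderiv q"
  unfolding Pb_def W_def by (simp add: pderiv_diff pderiv_smult algebra_simps)
 \<comment> \<open>The coefficient of degree \<open>e + d - 1\<close> is \<open>e - d\<close> times
   the product of the two leading coefficients, and \<open>e < d\<close>.\<close>
 have degW: "degree W >= e + d - 1"
 proof (rule le_degree)
  have "coeff (pderiv Pb * q) (e + d - 1) = of_nat e * lead_coeff Pb * lead_coeff q"
  proof (cases "e = 0")
   case True
   hence "pderiv Pb = 0" unfolding e_def by (simp add: pderiv_eq_0_iff)
   thus ?thesis using True by simp
  next
   case False
   have "coeff (pderiv Pb * q) (e + d - 1) = coeff (pderiv Pb * q) (degree (pderiv Pb) + degree q)"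
    using False degq by (simp add: degree_pderiv e_def)
   also have "... = coeff (pderiv Pb) (e - 1) * lead_coeff q"
    unfolding coeff_mult_degree_sum by (simp add: degree_pderiv e_def)
   also have "coeff (pderiv Pb) (e - 1) = of_nat e * lead_coeff Pb"
    using False by (simp add: coeff_pderiv e_def)
   finally show ?thesis .
  qed
  moreover have "coeff (Pb * pderiv q) (e + d - 1) = of_nat d * lead_coeff Pb * lead_coeff q"
  proof -
   have "coeff (Pb * pderiv q) (e + d - 1) = coeff (Pb * pderiv q) (degree Pb + degree (pderiv q))"
    using d degq by (simp add: degree_pderiv e_def)
   also have "... = lead_coeff Pb * coeff (pderiv q) (d - 1)"
    unfolding coeff_mult_degree_sum using degq by (simp add: degree_pderiv)
   also have "coeff (pderiv q) (d - 1) = of_nat d * lead_coeff q"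
    using d degq by (simp add: coeff_pderiv)
   finally show ?thesis by simp
  qed
  ultimately have "coeff W (e + d - 1) = (of_nat e - of_nat d) * lead_coeff Pb * lead_coeff q"
   unfolding WPb by (simp add: algebra_simps)
  moreover have "of_nat e - of_nat d ~= (0 :: complex)" using ed by simp
  ultimately show "coeff W (e + d - 1) ~= 0" using Pb0 qd degq by auto
 qed
 \<comment> \<open>These coefficients collect residues at \<open>z\<close> and at the zeros of
   \<open>W\<close> of quotients by \<open>L\<close>. None involves \<open>y\<close>; the powers of
   \<open>b - y\<close> appear on division of the residue sum by \<open>t ^ 3\<close>.\<close>
 define al where "al c = res (q ^ 2) c" for c
 define be1 where "be1 = poly (q ^ 2) z / poly W z + (\<Sum>c\<in>Zc. res (q ^ 2) c)"
 define be2 where "be2 = - (poly (Pb * q) z / poly W z + (\<Sum>c\<in>Zc. res (Pb * q) c))"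
 define be3 where "be3 = poly (Pb ^ 2) z / poly W z + (\<Sum>c\<in>Zc. res (Pb ^ 2) c)"
 show ?thesis
 proof (rule that[of al be1 be2 be3])
  fix y assume yb: "y ~= b" and yz: "poly p z ~= y * poly q z"
   and yc: "!!c. poly W c = 0 ==> poly p c ~= y * poly q c"
  define t where "t = b - y"
  have t: "t ~= 0" using yb by (simp add: t_def)
  define Py where "Py = p - smult y q"
  have PyPb: "Py = Pb + smult t q" unfolding Py_def Pb_def t_def by (simp add: smult_diff_left)
  have "coeff Py d = t * coeff q d" unfolding PyPb using Pbd by simp
  hence cPy: "coeff Py d ~= 0" using t qd by simp
  have degPy: "degree Py = d"
   using le_degree[OF cPy] degree_add_le[OF degPb_le, of "smult t q"] degq unfolding PyPb
   by (metis degree_smult_le le_antisym)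
  have Py0: "Py ~= 0" using cPy by auto
  define Zy where "Zy = {w. poly Py w = 0}"
  have Zy: "finite Zy" unfolding Zy_def using poly_roots_finite[OF Py0] .
  have Zy': "Zy = {w. poly p w = y * poly q w}" unfolding Zy_def Py_def by auto
  have Pyz: "poly Py z ~= 0" using yz by (simp add: Py_def)
  have WPy: "W = pderiv Py * q - Py * pderiv q"
   unfolding Py_def W_def by (simp add: pderiv_diff pderiv_smult algebra_simps)
  have Wy: "poly W w ~= 0" if "w \<in> Zy" for w using yc[of w] that unfolding Zy' by auto
  have dPy: "poly (pderiv Py) w * poly q w = poly W w" if "w \<in> Zy" for w
   using that unfolding WPy Zy_def by simp
  have zy: "z ~: Zy" using Pyz by (simp add: Zy_def)
  define D where "D = Py * L"
  let ?R = "%w. poly (Pb ^ 3) w / poly D w"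
  have L0: "L ~= 0" unfolding L_def using W0 by (simp del: mult_pCons_right)
  have rootsD: "{c. poly D c = 0} = Zy Un Zc Un {z}" unfolding D_def L_def Zy_def Zc_def by auto
  have degL: "degree L = degree W + 1" unfolding L_def using W0 by (simp add: degree_mult_eq del: mult_pCons_right)
  \<comment> \<open>The denominator has degree at least \<open>2 * d + e\<close>, which exceeds
    \<open>3 * e + 1\<close> because \<open>e < d\<close>.\<close>
  have degD: "degree (Pb ^ 3) + 1 < degree D"
  proof -
   have "degree (Pb ^ 3) = 3 * e" unfolding e_def by (simp add: degree_power_eq Pb0)
   moreover have "degree D = d + (degree W + 1)"
    unfolding D_def using Py0 L0 degPy degL by (simp add: degree_mult_eq)
   ultimately show ?thesis using degW ed by linarith
  qed
  have "(\<Sum>c | poly D c = 0. residue ?R c) = 0" by (rule residue_sum_rational[OF degD])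
  hence sum0: "(\<Sum>c\<in>Zy. residue ?R c) + (\<Sum>c\<in>Zc. residue ?R c) + residue ?R z = 0"
  proof -
   have "Zy Int Zc = {}" using Wy unfolding Zc_def by blast
   moreover have "z ~: Zy Un Zc" using zy Wz by (simp add: Zc_def)
   ultimately have "(\<Sum>c\<in>Zy Un Zc Un {z}. residue ?R c) = (\<Sum>c\<in>Zy. residue ?R c) +
    (\<Sum>c\<in>Zc. residue ?R c) + residue ?R z" using Zy Zc by (simp add: sum.union_disjoint)
   thus ?thesis using `(\<Sum>c | poly D c = 0. residue ?R c) = 0` unfolding rootsD by simp
  qed
  have resZy: "residue ?R w = - (t ^ 3) * (poly q w ^ 4 / (poly W w ^ 2 * (w - z)))"
   if w: "w \<in> Zy" for w
  proof -
   have Pw: "poly Py w = 0" using w by (simp add: Zy_def)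
   hence Pbw: "poly Pb w = - t * poly q w" unfolding PyPb by (simp add: eq_neg_iff_add_eq_0)
   have d1: "poly (pderiv Py) w ~= 0" using dPy[OF w] Wy[OF w] by auto
   have qw: "poly q w ~= 0" using dPy[OF w] Wy[OF w] by auto
   have wz: "w - z ~= 0" using w zy by auto
   have Lw: "poly L w = poly W w * (w - z)" unfolding L_def by (simp add: algebra_simps)
   have "residue ?R w = poly (Pb ^ 3) w / (poly (pderiv Py) w * poly L w)"
    by (rule residue_simple_root[OF D_def Pw d1]) (use Lw Wy[OF w] wz in simp)
   also have "... = (- t * poly q w) ^ 3 * poly q w / ((poly (pderiv Py) w * poly q w) * poly L w)"
    using qw by (simp add: Pbw)
   also have "... = - (t ^ 3) * (poly q w ^ 4 / (poly W w ^ 2 * (w - z)))"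
    unfolding dPy[OF w] Lw by (simp add: power_mult_distrib power2_eq_square power3_eq_cube power4_eq_xxxx mult_ac)
   finally show ?thesis .
  qed
  have resz: "residue ?R z = poly (Pb ^ 3) z / (poly Py z * poly W z)"
  proof -
   have "D = [:-z, 1:] * (Py * W)" unfolding D_def L_def by (simp only: mult_ac)
   hence "residue ?R z = poly (Pb ^ 3) z / (poly (pderiv [:-z, 1:]) z * poly (Py * W) z)"
    by (rule residue_simple_root) (use Pyz Wz in "auto simp: pderiv_pCons")
   thus ?thesis by (simp add: pderiv_pCons)
  qed
  \<comment> \<open>Sum of two cubes: \<open>Py = Pb + t * q\<close> divides
    \<open>Pb ^ 3 + (t * q) ^ 3\<close>.\<close>
  have key: "Pb ^ 3 = - smult (t ^ 3) (q ^ 3) + Py * (smult (t ^ 2) (q ^ 2) - smult t (Pb * q) + Pb ^ 2)"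
  proof -
   have "poly (Pb ^ 3) w = poly (- smult (t ^ 3) (q ^ 3) + Py * (smult (t ^ 2) (q ^ 2) - smult t (Pb * q) + Pb ^ 2)) w" for w
    unfolding PyPb by (simp add: algebra_simps power2_eq_square power3_eq_cube)
   thus ?thesis by (simp add: poly_eq_poly_eq_iff[symmetric] fun_eq_iff)
  qed
  have resZc: "residue ?R c =
    - (t ^ 3) * (res (q ^ 2) c / (poly p c / poly q c - y)) + t ^ 2 * res (q ^ 2) c - t * res (Pb * q) c + res (Pb ^ 2) c"
   if c: "c \<in> Zc" for c
  proof -
   have Wc: "poly W c = 0" using c by (simp add: Zc_def)
   have qc: "poly q c ~= 0" using cq[OF Wc] .
   define v where "v = poly p c / poly q c"
   define Pv where "Pv = p - smult v q"
   have vy: "v - y ~= 0" using yc[OF Wc] qc unfolding v_def by (auto simp: field_simps)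
   have Pvc: "poly Pv c = 0" using qc by (simp add: Pv_def v_def)
   have WPv: "W = pderiv Pv * q - Pv * pderiv q"
    unfolding Pv_def W_def by (simp add: pderiv_diff pderiv_smult algebra_simps)
   have Pv0: "Pv ~= 0" using W0 WPv by auto
   obtain A E where AE: "poly E c ~= 0" "Pv * E = [:-c, 1:] * A * W"
    using order_root_pderiv_quotient[OF Pv0 Pvc qc] unfolding WPv[symmetric] by metis
   have Pyc: "poly Py c ~= 0" using yc[OF Wc] by (simp add: Py_def)
   have cz: "c ~= z" using Wc Wz by auto
   define M where "M = E * Py * [:-z, 1:]"
   have Mc: "poly M c ~= 0" using AE Pyc cz by (simp add: M_def)
   obtain e0 where e0: "e0 > 0" "ALL w:ball c e0. poly M w ~= 0" using poly_nz_nbhd[OF Mc] by blast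
   obtain e1 where e1: "e1 > 0" "ALL w:ball c e1. w ~= c --> poly W w ~= 0"
   proof -
    have "open (- (Zc - {c}))" using Zc finite_imp_closed by blast
    then obtain e1 where "e1 > 0" "ball c e1 \<subseteq> - (Zc - {c})" using openE by (metis Compl_iff Diff_iff singletonI)
    thus ?thesis using that[of e1] by (auto simp: Zc_def)
   qed
   define V where "V = ball c (min e0 e1)"
   have V: "open V" "c \<in> V" unfolding V_def using e0 e1 by auto
   have nzM: "poly M w ~= 0" if "w \<in> V" for w using that e0 by (simp add: V_def)
   have nzW: "poly W w ~= 0" if "w \<in> V - {c}" for w using that e1 by (auto simp: V_def)
   have nzPy: "poly Py w ~= 0" "w - z ~= 0" "poly E w ~= 0" if "w \<in> V" for w
    using nzM[OF that] by (auto simp: M_def)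
   have nzL: "poly L w ~= 0" if "w \<in> V - {c}" for w using nzW[OF that] nzPy[of w] that by (simp add: L_def)
   have holN: "(%w. poly N w / poly L w) holomorphic_on V - {c}" for N
    by (intro holomorphic_intros) (use nzL in auto)
   \<comment> \<open>The part of the integrand that still contains \<open>1 / Py\<close>; it is
     holomorphic at \<open>c\<close>, because \<open>Pv / W\<close> has no pole there. The rest
     depends on \<open>y\<close> only through \<open>t\<close> and \<open>v - y\<close>.\<close>
   define H where "H w = - (t ^ 3) * (poly (q ^ 2 * [:-c, 1:] * A) w / poly M w / (v - y))" for w
   have holH: "H holomorphic_on V" unfolding H_def by (intro holomorphic_intros) (use nzM vy in auto)
   have expand: "poly (Pb ^ 3) w / poly D w =
     - (t ^ 3 / (v - y)) * (poly (q ^ 2) w / poly L w) + t ^ 2 * (poly (q ^ 2) w / poly L w)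
     - t * (poly (Pb * q) w / poly L w) + poly (Pb ^ 2) w / poly L w - H w"
    if w: "w \<in> V - {c}" for w
   proof -
    note nz = nzPy[of w] nzL[OF w] nzW[OF w]
    have wV: "w \<in> V" using w by blast
    have pv: "poly Pv w * poly E w = poly ([:-c, 1:] * A) w * poly W w"
     using arg_cong[OF AE(2), of "%P. poly P w"] by (simp only: poly_mult)
    have pyv: "poly Py w = poly Pv w + (v - y) * poly q w"
     unfolding Py_def Pv_def by (simp add: algebra_simps)
    have H1: "H w = - (t ^ 3) * (poly (q ^ 2) w * poly Pv w / (poly Py w * poly L w * (v - y)))"
    proof -
     have "poly ([:-c, 1:] * A) w = poly Pv w * poly E w / poly W w" using pv nz(5) by (simp add: field_simps)
     hence "H w = - (t ^ 3) * (poly (q ^ 2) w * (poly Pv w * poly E w / poly W w) / poly M w / (v - y))"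
      unfolding H_def by (simp only: poly_mult mult.assoc)
     also have "poly M w = poly E w * poly Py w * (w - z)" by (simp add: M_def algebra_simps)
     finally show ?thesis using nz(3)[OF wV] by (simp add: L_def mult_ac) (simp add: algebra_simps)
    qed
    have "poly (Pb ^ 3) w / poly D w = (- (t ^ 3) * poly (q ^ 3) w
      + poly Py w * (t ^ 2 * poly (q ^ 2) w - t * poly (Pb * q) w + poly (Pb ^ 2) w)) / (poly Py w * poly L w)"
     unfolding arg_cong[OF key, of "%P. poly P w"] D_def by simp
    also have "... = - (t ^ 3) * (poly (q ^ 3) w / (poly Py w * poly L w))
      + (t ^ 2 * poly (q ^ 2) w - t * poly (Pb * q) w + poly (Pb ^ 2) w) / poly L w"
    proof -
     have "(a * b + P * B) / (P * Q) = a * (b / (P * Q)) + B / Q" if "P ~= 0" for a b B P Q :: complex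
      using that by (simp add: add_divide_distrib)
     thus ?thesis using nz(1)[OF wV] by blast
    qed
    also have "poly (q ^ 3) w / (poly Py w * poly L w) =
      (poly (q ^ 2) w / poly L w) / (v - y) - poly (q ^ 2) w * poly Pv w / (poly Py w * poly L w * (v - y))"
    proof -
     have "poly q w = (poly Py w - poly Pv w) / (v - y)" using pyv vy by simp
     hence "poly (q ^ 3) w = poly (q ^ 2) w * ((poly Py w - poly Pv w) / (v - y))"
      by (simp add: power2_eq_square power3_eq_cube)
     thus ?thesis using nz(1)[OF wV] nz(4) vy by (simp add: divide_simps) (simp add: algebra_simps)
    qed
    finally show ?thesis unfolding H1
     by (simp add: add_divide_distrib diff_divide_distrib algebra_simps)
   qed
   have "residue ?R c = residue (%w.
     - (t ^ 3 / (v - y)) * (poly (q ^ 2) w / poly L w) + t ^ 2 * (poly (q ^ 2) w / poly L w)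
     - t * (poly (Pb * q) w / poly L w) + poly (Pb ^ 2) w / poly L w - H w) c"
   proof (rule residue_cong[OF _ refl])
    have "\<forall>\<^sub>F w in at c. w \<in> V - {c}" using eventually_at_in_open[OF V] .
    thus "\<forall>\<^sub>F w in at c. poly (Pb ^ 3) w / poly D w =
     - (t ^ 3 / (v - y)) * (poly (q ^ 2) w / poly L w) + t ^ 2 * (poly (q ^ 2) w / poly L w)
     - t * (poly (Pb * q) w / poly L w) + poly (Pb ^ 2) w / poly L w - H w"
     by eventually_elim (rule expand)
   qed
   also have "... = - (t ^ 3 / (v - y)) * res (q ^ 2) c + t ^ 2 * res (q ^ 2) c - t * res (Pb * q) c + res (Pb ^ 2) c - 0"
   proof -
    have HV: "H holomorphic_on V - {c}" using holH holomorphic_on_subset by blast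
    have rH: "residue H c = 0" using residue_holo[OF V holH] .
    show ?thesis unfolding res_def
     by (subst residue_diff[OF V] residue_add[OF V] residue_lmul[OF V] | intro holomorphic_intros holN HV | simp only: rH)+
   qed
   finally show ?thesis unfolding v_def by simp
  qed
  define S where "S = (\<Sum>w\<in>Zy. poly q w ^ 4 / (poly W w ^ 2 * (w - z)))"
  define S2 where "S2 = (\<Sum>c\<in>Zc. al c / (y - poly p c / poly q c))"
  have 1: "(\<Sum>c\<in>Zy. residue ?R c) = - (t ^ 3) * S"
   unfolding S_def sum_distrib_left by (rule sum.cong[OF refl resZy])
  have 2: "(\<Sum>c\<in>Zc. residue ?R c) = t ^ 3 * S2
    + t ^ 2 * (\<Sum>c\<in>Zc. res (q ^ 2) c) - t * (\<Sum>c\<in>Zc. res (Pb * q) c) + (\<Sum>c\<in>Zc. res (Pb ^ 2) c)"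
  proof -
   have "(\<Sum>c\<in>Zc. residue ?R c) = (\<Sum>c\<in>Zc. t ^ 3 * (al c / (y - poly p c / poly q c))
     + t ^ 2 * res (q ^ 2) c - t * res (Pb * q) c + res (Pb ^ 2) c)"
   proof (rule sum.cong[OF refl])
    fix c assume c: "c \<in> Zc"
    have "- (t ^ 3) * (res (q ^ 2) c / (poly p c / poly q c - y)) = t ^ 3 * (al c / (y - poly p c / poly q c))"
     unfolding al_def by (metis (no_types, lifting) minus_diff_eq minus_divide_right minus_mult_commute mult_minus_right)
    thus "residue ?R c = t ^ 3 * (al c / (y - poly p c / poly q c))
     + t ^ 2 * res (q ^ 2) c - t * res (Pb * q) c + res (Pb ^ 2) c" unfolding resZc[OF c] by simp
   qed
   thus ?thesis unfolding S2_def by (simp add: sum.distrib sum_subtractf sum_distrib_left)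
  qed
  have 3: "poly (Pb ^ 3) z / (poly Py z * poly W z) = - (t ^ 3) * (poly q z ^ 3 / (poly Py z * poly W z))
    + t ^ 2 * (poly (q ^ 2) z / poly W z) - t * (poly (Pb * q) z / poly W z) + poly (Pb ^ 2) z / poly W z"
  proof -
   have "poly (Pb ^ 3) z = - (t ^ 3) * poly q z ^ 3
      + poly Py z * (t ^ 2 * poly (q ^ 2) z - t * poly (Pb * q) z + poly (Pb ^ 2) z)"
    unfolding arg_cong[OF key, of "%P. poly P z"] by simp
   thus ?thesis using Pyz Wz
    by (simp only: add_divide_distrib) (simp add: add_divide_distrib diff_divide_distrib)
  qed
  have "t ^ 3 * S = t ^ 3 * S2 - t ^ 3 * (poly q z ^ 3 / (poly Py z * poly W z)) + t ^ 2 * be1 + t * be2 + be3"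
   using sum0 unfolding 1 2 resz 3 be1_def be2_def be3_def by (simp add: algebra_simps)
  hence "S = (t ^ 3 * S2 - t ^ 3 * (poly q z ^ 3 / (poly Py z * poly W z)) + t ^ 2 * be1 + t * be2 + be3) / t ^ 3"
   using t by (simp add: field_simps)
  also have "... = S2 - poly q z ^ 3 / (poly Py z * poly W z) + be1 / t + be2 / t ^ 2 + be3 / t ^ 3"
   using t by (simp add: add_divide_distrib diff_divide_distrib power2_eq_square power3_eq_cube)
  finally show "(\<Sum>w | poly p w = y * poly q w. poly q w ^ 4 / (poly W w ^ 2 * (w - z))) =
    - (poly q z ^ 3 / ((poly p z - y * poly q z) * poly W z))
    + (\<Sum>c | poly W c = 0. al c / (y - poly p c / poly q c))
    + be1 / (b - y) + be2 / (b - y) ^ 2 + be3 / (b - y) ^ 3"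
   unfolding S_def S2_def Zy' Zc_def t_def by (simp add: Py_def)
 qed
qed

subsection \<open>Homogeneous linear systems\<close>

text \<open>Induction on the equations: a pivot \<open>k\<close> with \<open>A k j\<close> nonzero
  eliminates one unknown together with equation \<open>j\<close>.\<close>

lemma homogeneous_solution:
 fixes A :: "'i => 'j => 'a :: field"
 assumes "finite J" "finite I" "card J < card I"
 shows "EX c. (EX i:I. c i ~= 0) & (ALL j:J. (\<Sum>i\<in>I. c i * A i j) = 0)" using assms
proof (induction J arbitrary: I A rule: finite_induct)
 case empty
 hence "I ~= {}" by auto
 thus ?case by (intro exI[of _ "%_. 1"]) auto
next
 case (insert j J)
 show ?case
 proof (cases "EX k:I. A k j ~= 0")
  case False
  then obtain c where "EX i:I. c i ~= 0" "ALL j:J. (\<Sum>i\<in>I. c i * A i j) = 0"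
   using insert.IH[of I A] insert.prems insert.hyps by auto
  thus ?thesis using False by (intro exI[of _ c]) auto
 next
  case True
  then obtain k where k: "k \<in> I" "A k j ~= 0" by blast
  define I' where "I' = I - {k}"
  define B where "B i l = A i l - A i j / A k j * A k l" for i l
  have "card J < card I'" using insert k by (simp add: I'_def)
  then obtain c where c: "EX i:I'. c i ~= 0" "ALL l:J. (\<Sum>i\<in>I'. c i * B i l) = 0"
   using insert.IH[of I' B] insert.prems I'_def by auto
  define ck where "ck = - (\<Sum>i\<in>I'. c i * A i j) / A k j"
  define c' where "c' = c(k := ck)"
  have split: "(\<Sum>i\<in>I. c' i * A i l) = ck * A k l + (\<Sum>i\<in>I'. c i * A i l)" for l
  proof -
   have "(\<Sum>i\<in>I. c' i * A i l) = c' k * A k l + (\<Sum>i\<in>I'. c' i * A i l)"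
    unfolding I'_def by (rule sum.remove) (use insert.prems k in auto)
   also have "(\<Sum>i\<in>I'. c' i * A i l) = (\<Sum>i\<in>I'. c i * A i l)"
    by (rule sum.cong) (auto simp: c'_def I'_def)
   finally show ?thesis by (simp add: c'_def)
  qed
  have "(\<Sum>i\<in>I. c' i * A i l) = 0" if l: "l \<in> J" for l
  proof -
   have "0 = (\<Sum>i\<in>I'. c i * B i l)" using c l by simp
   also have "... = (\<Sum>i\<in>I'. c i * A i l - c i * A i j * (A k l / A k j))"
    by (intro sum.cong refl) (simp add: B_def algebra_simps)
   also have "... = (\<Sum>i\<in>I'. c i * A i l) - (\<Sum>i\<in>I'. c i * A i j) * (A k l / A k j)"
    by (simp add: sum_subtractf sum_distrib_right sum_divide_distrib)
   finally show ?thesis unfolding split ck_def by simp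
  qed
  moreover have "(\<Sum>i\<in>I. c' i * A i j) = 0" unfolding split ck_def using k by simp
  moreover have "EX i:I. c' i ~= 0" using c(1) unfolding c'_def I'_def by auto
  ultimately show ?thesis by (intro exI[of _ c']) auto
 qed
qed

section \<open>Absence of wandering domains\<close>

text \<open>At a pole the function \<open>q / p\<close> is used; its Wronskian is the negative of
  the one of \<open>p / q\<close>, so a single polynomial detects all critical points in the
  plane.\<close>

lemma lif_Fin_iff:
 assumes pq: "ratl p q d" and f: "f = rational_map p q"
 shows "lif f (Fin z) \<longleftrightarrow> poly (pderiv p * q - p * pderiv q) z ~= 0"
  "poly q z ~= 0 ==> ((%w. poly p w / poly q w) has_field_derivative
    poly (pderiv p * q - p * pderiv q) z / (poly q z)\<^sup>2) (at z)"
proof -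
 have der: "((%w. poly p w / poly q w) has_field_derivative
    poly (pderiv p * q - p * pderiv q) z / (poly q z)\<^sup>2) (at z)" if "poly q z ~= 0" for p q :: "complex poly"
  using that by (auto intro!: derivative_eq_intros simp: power2_eq_square)
 show "((%w. poly p w / poly q w) has_field_derivative
    poly (pderiv p * q - p * pderiv q) z / (poly q z)\<^sup>2) (at z)" if "poly q z ~= 0"
  using der[OF that] .
 have Fc: "Fin \<in> charts" by (simp add: charts_def)
 show "lif f (Fin z) \<longleftrightarrow> poly (pderiv p * q - p * pderiv q) z ~= 0"
 proof (cases "poly q z = 0")
  case False
  then obtain r where r: "r > 0" "ALL w:ball z r. poly q w ~= 0" using poly_nz_nbhd by blast
  have "lif f (Fin z) \<longleftrightarrow> deriv (%w. poly p w / poly q w) z ~= 0"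
   by (rule lif_chart[OF Fc r(1)]) (use r f in "auto intro!: holomorphic_intros")
  thus ?thesis unfolding DERIV_imp_deriv[OF der[OF False]] using False by simp
 next
  case True
  hence pz: "poly p z ~= 0" using pq by (auto simp: ratl_def)
  then obtain r where r: "r > 0" "ALL w:ball z r. poly p w ~= 0" using poly_nz_nbhd by blast
  have "lif f (Fin z) \<longleftrightarrow> deriv (%w. poly q w / poly p w) z ~= 0"
   by (rule lif_chart[OF Fc r(1)]) (use r f in "auto intro!: holomorphic_intros")
  thus ?thesis unfolding DERIV_imp_deriv[OF der[OF pz]] using True pz by simp
 qed
qed

text \<open>Locally \<open>k\<close> is \<open>g\<close> followed by a holomorphic inverse branch of
  \<open>p / q\<close>; continuity selects the branch.\<close>

lemma lift_holomorphic:
 assumes pq: "ratl p q d" and f: "f = rational_map p q"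
  and S: "open S" and k: "continuous_on S k" and g: "g holomorphic_on S"
  and eq: "!!w. w \<in> S ==> f (Fin (k w)) = Fin (g w)" and lif: "!!w. w \<in> S ==> lif f (Fin (k w))"
 shows "k holomorphic_on S"
proof -
 have "EX V. open V & z \<in> V & k holomorphic_on V" if z: "z \<in> S" for z
 proof -
  define phi where "phi w = poly p w / poly q w" for w
  have nz: "poly q (k w) ~= 0" "g w = phi (k w)" if "w \<in> S" for w
   using eq[OF that] by (auto simp: f phi_def split: if_splits)
  obtain r where r: "r > 0" "ALL w:ball (k z) r. poly q w ~= 0" using poly_nz_nbhd[OF nz(1)[OF z]] by blast
  have hol: "phi holomorphic_on ball (k z) r" unfolding phi_def by (intro holomorphic_intros) (use r in auto)
  have "deriv phi (k z) = poly (pderiv p * q - p * pderiv q) (k z) / (poly q (k z))\<^sup>2"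
   using DERIV_imp_deriv[OF lif_Fin_iff(2)[OF pq f nz(1)[OF z]]] by (simp add: phi_def[abs_def])
  hence "deriv phi (k z) ~= 0" using lif_Fin_iff(1)[OF pq f] lif[OF z] nz(1)[OF z] by simp
  then obtain e where e: "e > 0" "ball (k z) e \<subseteq> ball (k z) r" "inj_on phi (ball (k z) e)"
   using has_complex_derivative_locally_injective[OF hol _ open_ball] r(1) by (metis centre_in_ball)
  have hol': "phi holomorphic_on ball (k z) e" using hol e(2) holomorphic_on_subset by blast
  obtain G where G: "G holomorphic_on phi ` ball (k z) e" "!!w. w \<in> ball (k z) e ==> G (phi w) = w"
   using holomorphic_has_inverse[OF hol' open_ball e(3)] by metis
  define V where "V = S Int k -` ball (k z) e"
  have V: "open V" unfolding V_def using continuous_open_preimage[OF k S] by blast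
  have "(G o g) holomorphic_on V"
   by (rule holomorphic_on_compose_gen[OF _ G(1)]) (use g nz in "auto simp: V_def intro: holomorphic_on_subset")
  hence "k holomorphic_on V" by (rule holomorphic_transform) (use G(2) nz in "auto simp: V_def")
  thus ?thesis using V z e(1) by (intro exI[of _ V]) (auto simp: V_def)
 qed
 hence "!!z. z \<in> S ==> k field_differentiable (at z within S)"
  by (metis at_within_open field_differentiable_at_within holomorphic_onD)
 thus ?thesis by (simp add: holomorphic_on_def)
qed

lemma lif_funpow:
 assumes "continuous_on UNIV f" "!!i. i < n ==> lif f ((f ^^ i) x)"
 shows "lif (f ^^ n) x" using assms(2)
proof (induction n)
 case 0
 show ?case unfolding lif_def by (intro exI[of _ UNIV]) auto
next
 case (Suc n)
 then obtain U where U: "open U" "x \<in> U" "inj_on (f ^^ n) U" unfolding lif_def by (meson less_SucI)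
 obtain V where V: "open V" "(f ^^ n) x \<in> V" "inj_on f V" using Suc.prems[of n] unfolding lif_def by auto
 have "open ((f ^^ n) -` V)"
  using continuous_open_vimage[OF V(1)] continuous_on_funpow_sphere[OF assms(1)]
  by (metis continuous_on_open_vimage open_UNIV inf_top_right V(1))
 hence "open (U Int (f ^^ n) -` V)" using U by blast
 moreover have "inj_on (f ^^ Suc n) (U Int (f ^^ n) -` V)"
  using U(3) V(3) unfolding inj_on_def by simp
 ultimately show ?case unfolding lif_def using U V by (intro exI[of _ "U Int (f ^^ n) -` V"]) auto
qed

section \<open>Grand orbits\<close>

definition go :: "('a => 'a) => 'a => 'a => bool" where
 "go f x y \<longleftrightarrow> (EX n m. (f ^^ n) y = (f ^^ m) x)"

lemma goI: "(f ^^ n) y = (f ^^ m) x ==> go f x y" by (auto simp: go_def)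

lemma go_refl: "go f x x" by (rule goI[of 0 _ _ 0]) simp

lemma go_step: "go f x (f y) \<longleftrightarrow> go f x y"
proof
 assume "go f x (f y)"
 then obtain n m where "(f ^^ n) (f y) = (f ^^ m) x" by (auto simp: go_def)
 thus "go f x y" by (intro goI[of "Suc n" _ _ m]) (simp add: funpow_swap1)
next
 assume "go f x y"
 then obtain n m where "(f ^^ n) y = (f ^^ m) x" by (auto simp: go_def)
 hence "(f ^^ n) (f y) = (f ^^ Suc m) x" by (simp add: funpow_swap1[symmetric])
 thus "go f x (f y)" by (rule goI)
qed

lemma go_funpow: "go f x ((f ^^ n) y) \<longleftrightarrow> go f x y"
 by (induction n) (auto simp: go_step)

text \<open>A wandering open set with univalent iterates, normalised to contain infinity, with no
  critical point in the grand orbit of infinity. Hence the Julia set and the grand orbits of the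
  other points of \<open>U\<close> stay in the finite plane. \<open>U\<close> is just an open set,
  since it will also be the interior of a limit continuum.\<close>

locale wander =
 fixes p q :: "complex poly" and d :: nat and f and U :: "riemann_sphere set"
 assumes pq: "ratl p q d" and f_def: "f = rational_map p q" and d2: "d >= 2"
  and U: "open U" "Infty \<in> U" and inj: "!!l. inj_on (f ^^ l) U"
  and disj: "!!i j. i ~= j ==> (f ^^ i) ` U Int (f ^^ j) ` U = {}"
  and clU: "closure U \<subseteq> U Un julia_set f" and UJ: "U Int julia_set f = {}"
  and crit_Infty: "!!c. ~ lif f c ==> ~ go f Infty c"
begin

lemma rat: "rational_map_of_degree f d" using pq f_def rational_map_of_degree_iff by blast

lemma d1: "d >= 1" using d2 by simp

lemma cont: "continuous_on S f" using rational_continuous[OF rat] .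

text \<open>Injectivity and disjointness of the iterates on \<open>U\<close> make the base point
  unique, and with it the difference of the two iteration counts.\<close>

lemma go_rigid:
 assumes x: "x1 \<in> U" "x2 \<in> U" and g: "(f ^^ n1) y = (f ^^ m1) x1" "(f ^^ n2) y = (f ^^ m2) x2"
 shows "x1 = x2" "m1 + n2 = m2 + n1"
proof -
 have e: "(f ^^ (n2 + m1)) x1 = (f ^^ (n1 + m2)) x2"
 proof -
  have "(f ^^ (n2 + m1)) x1 = (f ^^ n2) ((f ^^ n1) y)" using g by (simp add: funpow_add)
  also have "... = (f ^^ n1) ((f ^^ n2) y)" by (metis add.commute comp_apply funpow_add)
  finally show ?thesis using g by (simp add: funpow_add)
 qed
 hence e2: "n2 + m1 = n1 + m2" using disj[of "n2 + m1" "n1 + m2"] x by (metis IntI empty_iff imageI)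
 thus "m1 + n2 = m2 + n1" by simp
 show "x1 = x2" using e inj[of "n2 + m1"] x unfolding e2 by (auto dest: inj_onD)
qed

lemma go_unique: "x1 \<in> U ==> x2 \<in> U ==> go f x1 y ==> go f x2 y ==> x1 = x2"
 unfolding go_def using go_rigid(1) by blast

lemma go_finite: "x \<in> U ==> x ~= Infty ==> go f x y ==> y ~= Infty"
 using go_unique[OF _ U(2), of x Infty] go_refl[of f Infty] by metis

lemma go_julia: "x \<in> U ==> go f x y ==> y ~: julia_set f"
 unfolding go_def using julia_funpow_invariant[OF rat d1] UJ by (metis IntI empty_iff)

lemma qd: "coeff q d ~= 0"
proof
 assume "coeff q d = 0"
 hence "f Infty = Infty" using rational_map_Infty[OF pq] by (simp add: f_def)
 hence "(f ^^ 1) Infty \<in> (f ^^ 0) ` U" using U by simp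
 thus False using disj[of 1 0] U by auto
qed

definition "b = coeff p d / coeff q d"

lemma f_Infty: "f Infty = Fin b" using rational_map_Infty[OF pq] qd by (simp add: f_def b_def)

definition "W = pderiv p * q - p * pderiv q"

lemma lif_iff: "lif f (Fin z) \<longleftrightarrow> poly W z ~= 0"
 using lif_Fin_iff(1)[OF pq f_def] by (simp add: W_def)

lemma f_Fin_iff: "f (Fin w) = Fin y \<longleftrightarrow> poly p w = y * poly q w"
proof (cases "poly q w = 0")
 case True
 hence "poly p w ~= 0" using pq by (auto simp: ratl_def)
 thus ?thesis using True by (simp add: f_def)
next
 case False
 thus ?thesis by (simp add: f_def field_simps)
qed

lemma f_Fin: "poly q z ~= 0 ==> f (Fin z) = Fin (poly p z / poly q z)" by (simp add: f_def)

lemma f_Fin_Infty: "f (Fin z) = Infty \<longleftrightarrow> poly q z = 0" by (simp add: f_def)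

lemma W_root: "poly W c = 0 ==> poly q c ~= 0"
 using crit_Infty[of "Fin c"] go_step[of f Infty "Fin c"] go_refl[of f Infty] f_Fin_Infty[of c] lif_iff[of c] by auto

lemma W_nz: "W ~= 0"
proof
 assume "W = 0"
 hence "~ lif f (Fin z)" for z using lif_iff by simp
 hence "range Fin \<subseteq> {x. ~ lif f x}" by auto
 hence "finite (range Fin)" using finite_not_lif[OF rat d1] finite_subset by blast
 thus False using finite_imageD[OF _ inj_Fin] infinite_UNIV_char_0 by blast
qed

end

text \<open>The discs about the points of \<open>A\<close> carry the construction: as their grand
  orbits contain no critical point, all inverse branches exist along them.\<close>

locale wander_balls = wander +
 fixes A :: "complex set" and r :: real
 assumes A: "finite A" and r: "r > 0"
  and dballs: "!!a a'. a \<in> A ==> a' \<in> A ==> a ~= a' ==> ball a r Int ball a' r = {}"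
  and ballU: "!!a x. a \<in> A ==> x \<in> ball a r ==> Fin x \<in> U"
  and ball_good: "!!a x c. a \<in> A ==> x \<in> ball a r ==> ~ lif f c ==> ~ go f (Fin x) c"
begin

text \<open>A branch of the grand orbit relation over a whole disc, that is, a holomorphic solution
  \<open>g\<close> of \<open>f^n (g x) = f^m x\<close>. Iterates and inverse branches are treated
  alike.\<close>

definition "brn a g \<longleftrightarrow> g holomorphic_on ball a r & (EX n m. ALL x:ball a r. (f ^^ n) (Fin (g x)) = (f ^^ m) (Fin x))"

lemma brn_go: "brn a g ==> x \<in> ball a r ==> go f (Fin x) (Fin (g x))"
 unfolding brn_def go_def by blast

lemma go_ball_finite:
 assumes "a \<in> A" "x \<in> ball a r" "go f (Fin x) y"
 obtains y' where "y = Fin y'" using go_finite[OF ballU[OF assms(1,2)] _ assms(3)] by (cases y) auto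

lemma go_ball_unique:
 assumes "a \<in> A" "x \<in> ball a r" "go f (Fin x) y" "a' \<in> A" "x' \<in> ball a' r" "go f (Fin x') y"
 shows "x = x'" "a = a'"
proof -
 show "x = x'" using go_unique[OF ballU[OF assms(1,2)] ballU[OF assms(4,5)] assms(3,6)] by simp
 thus "a = a'" using dballs[OF assms(1,4)] assms(2,5) by blast
qed

lemma brn_id: "brn a (%x. x)" unfolding brn_def by (auto intro: exI[of _ 0])

text \<open>Induction on the number \<open>n\<close> of backward steps: forward iterates are
  holomorphic, and each further step lifts through \<open>f\<close> over the disc, where no critical
  value occurs.\<close>

lemma brn_exists:
 assumes a: "a \<in> A" "x0 \<in> ball a r" and y: "go f (Fin x0) (Fin y)"
 shows "EX g. brn a g & g x0 = y"
proof -
 have "EX g. g holomorphic_on ball a r & g x0 = y & (ALL x:ball a r. (f ^^ n) (Fin (g x)) = (f ^^ m) (Fin x))"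
  if "(f ^^ n) (Fin y) = (f ^^ m) (Fin x0)" for n m y using that
 proof (induction n arbitrary: y)
  case 0
  have nI: "(f ^^ m) (Fin x) ~= Infty" if "x \<in> ball a r" for x
   using go_finite[OF ballU[OF a(1) that]] goI[of 0 f "(f ^^ m) (Fin x)" m "Fin x"] by simp
  have "sholo (%x. (f ^^ m) (Fin x)) (ball a r)" by (intro sholo_funpow[OF rat] sholo_Fin_comp) auto
  hence "(%x. fin ((f ^^ m) (Fin x))) holomorphic_on ball a r"
   using sholo_finite_holomorphic nI by blast
  moreover have "fin ((f ^^ m) (Fin x0)) = y" using 0 by (metis fin.simps(1) funpow_0)
  ultimately show ?case using nI by (intro exI[of _ "%x. fin ((f ^^ m) (Fin x))"]) (auto simp: Fin_fin)
 next
  case (Suc n)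
  have fy: "(f ^^ n) (f (Fin y)) = (f ^^ m) (Fin x0)" using Suc.prems by (simp add: funpow_swap1)
  obtain y' where y': "f (Fin y) = Fin y'" using go_ball_finite[OF a goI[OF fy]] .
  obtain g where g: "g holomorphic_on ball a r" "g x0 = y'"
   "!!x. x \<in> ball a r ==> (f ^^ n) (Fin (g x)) = (f ^^ m) (Fin x)"
   using Suc.IH fy unfolding y' by metis
  have gc: "(%x. Fin (g x)) ` ball a r Int crit_values f = {}"
  proof -
   have False if "x \<in> ball a r" "Fin (g x) = f c" "~ lif f c" for x c
    using ball_good[OF a(1) that(1,3)] goI[OF g(3)[OF that(1)]] unfolding that(2) go_step by blast
   thus ?thesis unfolding crit_values_def by auto
  qed
  have gcont: "continuous_on (ball a r) (%x. Fin (g x))"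
   by (rule continuous_on_compose2[OF continuous_on_Fin[of UNIV] holomorphic_on_imp_continuous_on[OF g(1)]]) auto
  obtain h where h: "continuous_on (ball a r) h" "h x0 = Fin y" "!!w. w \<in> ball a r ==> f (h w) = Fin (g w)"
   using lift_exists[OF rat d1 convex_ball a(2) gcont gc, of "Fin y"] y' g(2) by metis
  have hgo: "(f ^^ Suc n) (h x) = (f ^^ m) (Fin x)" if "x \<in> ball a r" for x
   using g(3)[OF that] h(3)[OF that] by (simp add: funpow_swap1)
  have hI: "h x ~= Infty" if "x \<in> ball a r" for x
   using go_finite[OF ballU[OF a(1) that] _ goI[OF hgo[OF that]]] by simp
  have kc: "continuous_on (ball a r) (%x. fin (h x))"
   by (rule continuous_on_compose2[OF continuous_on_fin h(1)]) (use hI in force)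
  have hF: "Fin (fin (h x)) = h x" if "x \<in> ball a r" for x using hI[OF that] by (simp add: Fin_fin)
  have lifh: "lif f (h x)" if "x \<in> ball a r" for x
   using gc h(3)[OF that] that unfolding crit_values_def by (metis (mono_tags) IntI empty_iff imageI mem_Collect_eq)
  have "(%x. fin (h x)) holomorphic_on ball a r"
   by (rule lift_holomorphic[OF pq f_def open_ball kc g(1)]) (simp_all add: hF h(3) lifh)
  thus ?case using h(2) hgo hF by (intro exI[of _ "%x. fin (h x)"]) auto
 qed
 thus ?thesis using y unfolding brn_def go_def by meson
qed

text \<open>Branches that meet have the same difference \<open>m - n\<close> by
  \<open>go_rigid\<close>, so they are lifts of one map through the same iterate of
  \<open>f\<close>, and lifts are unique.\<close>

lemma brn_meet:
 assumes a: "a \<in> A" and g: "brn a g1" "brn a g2" and x: "x1 \<in> ball a r" "x2 \<in> ball a r" "g1 x1 = g2 x2"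
 shows "x1 = x2" "x \<in> ball a r ==> g1 x = g2 x"
proof -
 show x12: "x1 = x2"
  using go_ball_unique(1)[OF a x(1) brn_go[OF g(1) x(1)] a x(2)] brn_go[OF g(2) x(2)] x(3) by simp
 obtain n1 m1 where 1: "!!x. x\<in>ball a r ==> (f ^^ n1) (Fin (g1 x)) = (f ^^ m1) (Fin x)" using g(1) unfolding brn_def by blast
 obtain n2 m2 where 2: "!!x. x\<in>ball a r ==> (f ^^ n2) (Fin (g2 x)) = (f ^^ m2) (Fin x)" using g(2) unfolding brn_def by blast
 have mn: "m1 + n2 = m2 + n1"
  using go_rigid(2)[OF ballU[OF a x(1)] ballU[OF a x(1)] 1[OF x(1)]] 2[OF x(1)] x(3) x12 by simp
 have eq: "(f ^^ (n1 + n2)) (Fin (g1 x)) = (f ^^ (n1 + n2)) (Fin (g2 x))" if "x \<in> ball a r" for x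
 proof -
  have "(f ^^ (n1 + n2)) (Fin (g1 x)) = (f ^^ (n2 + m1)) (Fin x)"
   using 1[OF that] by (simp add: add.commute[of n1] funpow_add)
  also have "n2 + m1 = n1 + m2" using mn by simp
  also have "(f ^^ (n1 + m2)) (Fin x) = (f ^^ (n1 + n2)) (Fin (g2 x))"
   using 2[OF that] by (simp add: funpow_add)
  finally show ?thesis .
 qed
 have lif: "lif (f ^^ (n1 + n2)) (Fin (g1 x))" if "x \<in> ball a r" for x
  using ball_good[OF a that] go_funpow[THEN iffD2, OF brn_go[OF g(1) that]]
  by (intro lif_funpow cont) metis
 have c: "continuous_on (ball a r) (%x. Fin (g x))" if "brn a g" for g
  using continuous_on_compose2[OF continuous_on_Fin[of UNIV] holomorphic_on_imp_continuous_on] that unfolding brn_def by auto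
 show "g1 x = g2 x" if "x \<in> ball a r"
 proof -
  have "Fin (g1 x) = Fin (g2 x)"
   by (rule lift_unique[where f = "f ^^ (n1 + n2)", OF connected_ball c[OF g(1)] c[OF g(2)] eq lif x(1) _ that])
    (use x x12 in auto)
  thus ?thesis by simp
 qed
qed

lemma brn_inj: "a \<in> A ==> brn a g ==> inj_on g (ball a r)"
 by (rule inj_onI) (use brn_meet(1) in blast)

lemma brn_in_U:
 assumes a: "a \<in> A" "brn a g" "x \<in> ball a r" "Fin (g x) \<in> U"
 shows "g x = x" using go_unique[OF ballU[OF a(1,3)] a(4) brn_go[OF a(2,3)] go_refl] by simp

lemma brn_step:
 assumes a: "a \<in> A" "brn a g"
 shows "brn a (%x. poly p (g x) / poly q (g x))" "x \<in> ball a r ==> f (Fin (g x)) = Fin (poly p (g x) / poly q (g x))"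
  "x \<in> ball a r ==> poly q (g x) ~= 0" "x \<in> ball a r ==> poly W (g x) ~= 0"
  "x \<in> ball a r ==> deriv (%x. poly p (g x) / poly q (g x)) x = poly W (g x) / (poly q (g x))\<^sup>2 * deriv g x"
proof -
 have qn: "poly q (g x) ~= 0" if "x \<in> ball a r" for x
  using go_finite[OF ballU[OF a(1) that], of "f (Fin (g x))"] brn_go[OF a(2) that] by (auto simp: go_step f_Fin_Infty)
 thus "x \<in> ball a r ==> poly q (g x) ~= 0" .
 show feq: "f (Fin (g x)) = Fin (poly p (g x) / poly q (g x))" if "x \<in> ball a r" for x using f_Fin qn[OF that] by simp
 show "x \<in> ball a r ==> poly W (g x) ~= 0"
  using ball_good[OF a(1)] brn_go[OF a(2)] lif_iff by blast
 have gh: "g holomorphic_on ball a r" using a(2) unfolding brn_def by blast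
 obtain n m where nm: "!!x. x\<in>ball a r ==> (f ^^ n) (Fin (g x)) = (f ^^ m) (Fin x)" using a(2) unfolding brn_def by blast
 have "(f ^^ n) (Fin (poly p (g x) / poly q (g x))) = (f ^^ Suc m) (Fin x)" if "x \<in> ball a r" for x
  unfolding feq[OF that, symmetric] using nm[OF that] by (simp add: funpow_swap1[symmetric])
 thus "brn a (%x. poly p (g x) / poly q (g x))"
  unfolding brn_def using qn by (intro conjI holomorphic_intros gh exI[of _ n] exI[of _ "Suc m"]) auto
 show "deriv (%x. poly p (g x) / poly q (g x)) x = poly W (g x) / (poly q (g x))\<^sup>2 * deriv g x" if x: "x \<in> ball a r"
 proof -
  have "(g has_field_derivative deriv g x) (at x)" using gh x by (meson holomorphic_derivI open_ball)
  thus ?thesis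
   using DERIV_chain2[where f = "%w. poly p w / poly q w" and g = g, OF lif_Fin_iff(2)[OF pq f_def qn[OF x]]]
   unfolding W_def by (intro DERIV_imp_deriv) blast
 qed
qed

section \<open>The grand orbit of the centres and its canonical branches\<close>

definition "Gm = {y. EX a:A. go f (Fin a) (Fin y)}"
definition "ctr y = (THE a. a \<in> A & go f (Fin a) (Fin y))"
definition "br y = (SOME g. brn (ctr y) g & g (ctr y) = y)"

lemma center: "a \<in> ball a r" using r by simp

lemma ctr_eq: "a \<in> A ==> go f (Fin a) (Fin y) ==> ctr y = a"
 unfolding ctr_def using go_ball_unique(2)[OF _ center _ _ center] by blast

lemma Gamma_I: "a \<in> A ==> go f (Fin a) (Fin y) ==> y \<in> Gm" by (auto simp: Gm_def)

lemma ctr_props: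
 assumes "y \<in> Gm"
 shows "ctr y \<in> A" "go f (Fin (ctr y)) (Fin y)" using assms ctr_eq by (auto simp: Gm_def)

lemma br_props:
 assumes "y \<in> Gm"
 shows "brn (ctr y) (br y)" "br y (ctr y) = y"
proof -
 have "brn (ctr y) (br y) & br y (ctr y) = y"
  unfolding br_def by (rule someI_ex[where P = "%g. brn (ctr y) g & g (ctr y) = y"]) (use brn_exists[OF ctr_props(1)[OF assms] center ctr_props(2)[OF assms]] in blast)
 thus "brn (ctr y) (br y)" "br y (ctr y) = y" by auto
qed

lemma br_eq:
 assumes "a \<in> A" "brn a g" "g a = y" "x \<in> ball a r"
 shows "y \<in> Gm" "ctr y = a" "br y x = g x"
proof -
 have go: "go f (Fin a) (Fin y)" using brn_go[OF assms(2) center] assms(3) by simp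
 show y: "y \<in> Gm" using Gamma_I[OF assms(1) go] .
 show ry: "ctr y = a" using ctr_eq[OF assms(1) go] .
 show "br y x = g x" using brn_meet(2)[OF assms(1) _ assms(2) center center _ assms(4)] br_props[OF y] assms(3) ry by auto
qed

lemma br_meet:
 assumes "y \<in> Gm" "y' \<in> Gm" "x \<in> ball (ctr y) r" "x' \<in> ball (ctr y') r" "br y x = br y' x'"
 shows "y = y'" "x = x'"
proof -
 note y = br_props[OF assms(1)] ctr_props(1)[OF assms(1)] and y' = br_props[OF assms(2)] ctr_props(1)[OF assms(2)]
 have g: "go f (Fin x) (Fin (br y x))" "go f (Fin x') (Fin (br y x))"
  using brn_go[OF y(1) assms(3)] brn_go[OF y'(1) assms(4)] assms(5) by auto
 show "x = x'" using go_ball_unique(1)[OF y(3) assms(3) g(1) y'(3) assms(4) g(2)] .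
 have r: "ctr y = ctr y'" using go_ball_unique(2)[OF y(3) assms(3) g(1) y'(3) assms(4) g(2)] .
 have "brn (ctr y) (br y')" "x' \<in> ball (ctr y) r" using y'(1) assms(4) r by auto
 thus "y = y'" using brn_meet(2)[where x = "ctr y", OF y(3,1) `brn (ctr y) (br y')` assms(3) _ assms(5) center] y(2) y'(2) r by metis
qed

lemma go_in_image:
 assumes "a \<in> A" "x \<in> ball a r" "go f (Fin x) (Fin y)"
 obtains y' where "y' \<in> Gm" "ctr y' = a" "y = br y' x"
 using brn_exists[OF assms] br_eq[OF assms(1)] assms(2) by metis

lemma image_go: "y \<in> Gm ==> x \<in> ball (ctr y) r ==> go f (Fin x) (Fin (br y x))"
 using brn_go br_props by blast

lemma A_Gamma:
 assumes "a \<in> A"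
 shows "a \<in> Gm" "ctr a = a" "x \<in> ball a r ==> br a x = x"
 using br_eq[OF assms brn_id refl] center by blast+

definition "fib y = {w. poly p w = y * poly q w}"

lemma fib_iff: "w \<in> fib y \<longleftrightarrow> f (Fin w) = Fin y"
 by (simp add: fib_def f_Fin_iff)

lemma fib_Gamma:
 assumes "w \<in> fib y"
 shows "w \<in> Gm \<longleftrightarrow> y \<in> Gm" "y \<in> Gm ==> ctr w = ctr y"
proof -
 have e: "go f (Fin a) (Fin w) \<longleftrightarrow> go f (Fin a) (Fin y)" for a
  using go_step[of f "Fin a" "Fin w"] assms by (simp add: fib_iff)
 show "w \<in> Gm \<longleftrightarrow> y \<in> Gm" unfolding Gm_def mem_Collect_eq e by blast
 show "y \<in> Gm ==> ctr w = ctr y" unfolding ctr_def e by blast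
qed

lemma Gamma_fib: "w \<in> Gm ==> EX y:Gm. w \<in> fib y"
 using brn_step(2)[OF ctr_props(1) br_props(1) center] br_props(2) fib_Gamma(1)[of w] fib_iff by metis

lemma finite_fib: "finite (fib y)"
proof -
 have "Fin ` fib y \<subseteq> f -` {Fin y}" by (auto simp: fib_iff)
 thus ?thesis using rational_fiber(1)[OF rat d1] finite_imageD inj_Fin finite_subset
  by (metis inj_on_subset subset_UNIV)
qed

text \<open>Passing to a point of the fibre divides it by the squared derivative of
  \<open>f\<close>: the weight in the push-forward of a quadratic differential.\<close>

definition "tau y = (deriv (br y) (ctr y))\<^sup>2"

lemma tau_fib:
 assumes y: "y \<in> Gm" and w: "w \<in> fib y"
 shows "tau w = tau y * (poly q w ^ 4 / poly W w ^ 2)"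
proof -
 have wG: "w \<in> Gm" and rw: "ctr w = ctr y" using fib_Gamma[OF w] y by auto
 note a = ctr_props(1)[OF wG] and b = br_props[OF wG]
 have qw: "poly q w ~= 0" "poly W w ~= 0" using brn_step(3,4)[OF a b(1) center] b(2) by auto
 have yw: "poly p w / poly q w = y" using w qw by (simp add: fib_def)
 define g where "g x = poly p (br w x) / poly q (br w x)" for x
 have g: "brn (ctr w) g" unfolding g_def using brn_step(1)[OF a b(1)] .
 have eq: "br y x = g x" if "x \<in> ball (ctr y) r" for x
  using br_eq(3)[OF a g _] that rw yw b(2) unfolding g_def by metis
 have "\<forall>\<^sub>F x in nhds (ctr y). x \<in> ball (ctr y) r" using eventually_nhds_in_open[OF open_ball center] .
 hence "\<forall>\<^sub>F x in nhds (ctr y). br y x = g x" by eventually_elim (rule eq)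
 hence "deriv (br y) (ctr y) = deriv g (ctr y)" by (intro deriv_cong_ev refl)
 also have "... = poly W w / (poly q w)\<^sup>2 * deriv (br w) (ctr y)"
  unfolding g_def rw[symmetric] brn_step(5)[OF a b(1) center] b(2) by simp
 finally have "tau y = (poly W w / (poly q w)\<^sup>2)\<^sup>2 * tau w" by (simp add: tau_def rw power_mult_distrib power_divide)
 thus ?thesis using qw by (simp add: power_divide power2_eq_square power4_eq_xxxx)
qed

end

lemma has_sum_sum_finite:
 fixes f :: "'i => 'a => 'b :: topological_comm_monoid_add"
 assumes "finite I" "!!i. i \<in> I ==> (f i has_sum s i) A"
 shows "((%x. \<Sum>i\<in>I. f i x) has_sum (\<Sum>i\<in>I. s i)) A"
 using assms by (induction I rule: finite_induct) (auto intro!: has_sum_add)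

text \<open>\<open>ka\<close> is the constant of \<open>koebe_weak\<close>; \<open>c\<close> assigns
  a still arbitrary weight to each centre.\<close>

locale wander_sum = wander_balls +
 fixes ka :: real and c :: "complex => complex"
 assumes ka: "ka > 0"
  and koebe: "!!g x s. s > 0 ==> g holomorphic_on ball x s ==> inj_on g (ball x s) ==>
    ball (g x) (ka * s * cmod (deriv g x)) \<subseteq> g ` ball x s"
begin

text \<open>Only the images of the discs of radius \<open>r / 4\<close> are removed: their closures
  stay inside the disjoint images of the full discs, and a disc of radius \<open>r / 2\<close> about
  any point of a closed small disc still fits.\<close>

abbreviation "r' \<equiv> r / 4"

lemma r': "0 < r'" "r' < r" using r by auto

definition "s y = ka * r' * cmod (deriv (br y) (ctr y))"
definition "D y = br y ` ball (ctr y) r'"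
definition "rho y = c (ctr y) * tau y"
definition "C = (\<Sum>a\<in>A. cmod (c a)) / (ka * r')\<^sup>2"

lemma cball_r': "cball a r' \<subseteq> ball a r" using r by auto

lemma br_hol:
 assumes "y \<in> Gm"
 shows "br y holomorphic_on ball (ctr y) r" "inj_on (br y) (ball (ctr y) r)" "x \<in> ball (ctr y) r ==> deriv (br y) x ~= 0"
proof -
 show 1: "br y holomorphic_on ball (ctr y) r" "inj_on (br y) (ball (ctr y) r)"
  using br_props[OF assms] brn_inj[OF ctr_props(1)[OF assms]] unfolding brn_def by auto
 show "x \<in> ball (ctr y) r ==> deriv (br y) x ~= 0"
  using holomorphic_injective_imp_regular[OF 1(1) open_ball 1(2)] .
qed

lemma s_pos: "y \<in> Gm ==> s y > 0" unfolding s_def using br_hol(3)[OF _ center] ka r' by simp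

lemma koebe_br:
 assumes y: "y \<in> Gm" and t: "t > 0" "ball x t \<subseteq> ball (ctr y) r"
 shows "ball (br y x) (ka * t * cmod (deriv (br y) x)) \<subseteq> br y ` ball x t"
 using koebe[OF t(1) holomorphic_on_subset[OF br_hol(1)[OF y] t(2)] inj_on_subset[OF br_hol(2)[OF y] t(2)]] .

lemma ball_s: "y \<in> Gm ==> ball y (s y) \<subseteq> D y"
 unfolding s_def D_def using koebe_br[of y r' "ctr y"] r' br_props(2) by (auto simp: subset_ball)

lemma img_disj: "y \<in> Gm ==> y' \<in> Gm ==> y ~= y' ==> br y ` ball (ctr y) r Int br y' ` ball (ctr y') r = {}"
 using br_meet(1) by blast

lemma D_sub: "D y \<subseteq> br y ` ball (ctr y) r"
 unfolding D_def using r' by (intro image_mono subset_ball) simp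

lemma U_far: "EX R. ALL z. cmod z >= R --> Fin z \<in> U"
proof -
 have "iota o Fin \<in> charts" "(iota o Fin) 0 \<in> U" using U(2) by (auto simp: charts_def)
 then obtain e where e: "e > 0" "(iota o Fin) ` cball 0 e \<subseteq> U" using chart_cball_subset[OF _ U(1)] by metis
 have "Fin z \<in> U" if "cmod z >= 1 / e" for z
 proof -
  have z0: "z ~= 0" using that e(1) by (metis divide_pos_pos less_numeral_extra(1) norm_zero not_le)
  have "cmod (1 / z) <= e" using that e(1) z0 by (simp add: norm_divide field_simps)
  hence "(iota o Fin) (1 / z) \<in> U" by (intro subsetD[OF e(2)] imageI) simp
  thus ?thesis using z0 by simp
 qed
 thus ?thesis by blast
qed

text \<open>A branch image reaching far out would enter \<open>U\<close>, where branches are the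
  identity; but the discs themselves are bounded.\<close>

lemma R_ex: "EX R>0. ALL y:Gm. br y ` ball (ctr y) r \<subseteq> ball 0 R"
proof -
 obtain R0 where R0: "!!z. cmod z >= R0 ==> Fin z \<in> U" using U_far by blast
 have "bounded (\<Union>a\<in>A. ball a r)" using A by blast
 then obtain R1 where R1: "!!a x. a \<in> A ==> x \<in> ball a r ==> cmod x <= R1" unfolding bounded_iff by blast
 define R where "R = max 1 (max R0 (R1 + 1))"
 have "cmod (br y x) < R" if y: "y \<in> Gm" "x \<in> ball (ctr y) r" for y x
 proof (rule ccontr)
  assume n: "~ cmod (br y x) < R"
  hence "Fin (br y x) \<in> U" using R0 by (simp add: R_def)
  hence "br y x = x" using brn_in_U[OF ctr_props(1)[OF y(1)] br_props(1)[OF y(1)] y(2)] by blast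
  thus False using n R1[OF ctr_props(1)[OF y(1)] y(2)] by (simp add: R_def)
 qed
 thus ?thesis by (intro exI[of _ R]) (auto simp: R_def)
qed

definition "R = (SOME R. R > 0 & (ALL y:Gm. br y ` ball (ctr y) r \<subseteq> ball 0 R))"

lemma R: "R > 0" "y \<in> Gm ==> br y ` ball (ctr y) r \<subseteq> ball 0 R"
 using someI_ex[OF R_ex[unfolded Bex_def]] unfolding R_def[symmetric] by blast+

lemma sums: "S \<subseteq> Gm ==> pole_sum S s rho C R"
proof
 fix y assume "S \<subseteq> Gm" "y \<in> S"
 hence y: "y \<in> Gm" by blast
 show "s y > 0" by (rule s_pos[OF y])
 show "ball y (s y) \<subseteq> ball 0 R" using ball_s[OF y] D_sub R(2)[OF y] by blast
 have s2: "(s y)\<^sup>2 = (ka * r')\<^sup>2 * cmod (tau y)" unfolding s_def tau_def by (simp add: power_mult_distrib norm_power power_divide)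
 have "cmod (c (ctr y)) <= (\<Sum>a\<in>A. cmod (c a))" using member_le_sum[OF ctr_props(1)[OF y] _ A, of "%a. cmod (c a)"] by auto
 hence "cmod (rho y) <= (\<Sum>a\<in>A. cmod (c a)) * cmod (tau y)" unfolding rho_def by (simp add: norm_mult mult_right_mono)
 also have "... = C * (s y)\<^sup>2" unfolding C_def s2 using ka r' by simp
 finally show "cmod (rho y) <= C * (s y)\<^sup>2" .
next
 fix y y' assume "S \<subseteq> Gm" "y \<in> S" "y' \<in> S" "y ~= y'"
 hence y: "y \<in> Gm" "y' \<in> Gm" "y ~= y'" by auto
 show "ball y (s y) Int ball y' (s y') = {}"
  using order_trans[OF ball_s[OF y(1)] D_sub] order_trans[OF ball_s[OF y(2)] D_sub] img_disj[OF y] by blast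
qed (auto simp: R(1) C_def intro!: divide_nonneg_nonneg sum_nonneg)

sublocale P: pole_sum Gm s rho C R by (rule sums) simp

text \<open>What is left after removing the images of the small discs: completely invariant,
  containing the finite critical points and the Julia set.\<close>

definition "Om = {z. ALL a:A. ALL x:ball a r'. ~ go f (Fin x) (Fin z)}"

lemma ball_r': "x \<in> ball a r' ==> x \<in> ball a r" using r' by auto

lemma not_Omega:
 assumes "z ~: Om"
 obtains y where "y \<in> Gm" "z \<in> D y"
proof -
 obtain a x where a: "a \<in> A" "x \<in> ball a r'" "go f (Fin x) (Fin z)" using assms by (auto simp: Om_def)
 thus ?thesis using go_in_image[OF a(1) ball_r'[OF a(2)] a(3)] that unfolding D_def by (metis image_eqI)
qed

lemma Omega_iff: "z \<in> Om \<longleftrightarrow> (ALL y:Gm. z ~: D y)"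
proof
 assume z: "z \<in> Om"
 show "ALL y:Gm. z ~: D y"
 proof
  fix y assume y: "y \<in> Gm"
  show "z ~: D y"
  proof
   assume "z \<in> D y"
   then obtain x where x: "x \<in> ball (ctr y) r'" "z = br y x" by (auto simp: D_def)
   thus False using z image_go[OF y ball_r'[OF x(1)]] ctr_props(1)[OF y] by (auto simp: Om_def)
  qed
 qed
qed (use not_Omega in blast)

lemma Omega_outer: "Om \<subseteq> P.outer"
proof
 fix z assume z: "z \<in> Om"
 have "s y <= cmod (z - y)" if "y \<in> Gm" for y
 proof -
  have "z ~: ball y (s y)" using z that ball_s[OF that] Omega_iff by blast
  thus ?thesis by (simp add: dist_norm norm_minus_commute)
 qed
 thus "z \<in> P.outer" by (simp add: P.outer_def)
qed

lemma Omega_step: "f (Fin z) = Fin z' ==> z' \<in> Om \<longleftrightarrow> z \<in> Om"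
 unfolding Om_def using go_step[of f _ "Fin z"] by simp

lemma Omega_crit: "poly W v = 0 ==> v \<in> Om"
 using ball_good[OF _ ball_r'] lif_iff unfolding Om_def by blast

lemma Omega_julia: "Fin z \<in> julia_set f ==> z \<in> Om"
 using go_julia[OF ballU[OF _ ball_r']] unfolding Om_def by blast

text \<open>Near \<open>b = f Infty\<close> the grand orbit of \<open>A\<close> contains only images
  under \<open>f\<close> of points of \<open>A\<close>: finitely many, and different from
  \<open>b\<close> by injectivity on \<open>U\<close>.\<close>

lemma b_far: "EX dl>0. ALL y:Gm. dl <= cmod (b - y)"
proof -
 define Z where "Z = {y. Fin y \<in> f ` Fin ` A}"
 have "finite (Fin ` Z)" using finite_subset[of "Fin ` Z" "f ` Fin ` A"] A by (auto simp: Z_def)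
 hence "finite Z" using finite_imageD inj_Fin inj_on_subset by blast
 have bZ: "b ~: Z"
 proof
  assume "b \<in> Z"
  then obtain a where a: "a \<in> A" "f (Fin a) = f Infty" unfolding Z_def f_Infty[symmetric] by (auto simp: f_Infty[symmetric])
  thus False using inj_onD[OF inj[of 1], of "Fin a" Infty] ballU[OF a(1) center] U(2) by simp
 qed
 have "open (Fin -` (f ` U))"
  using continuous_on_Fin[of UNIV] rational_open[OF rat d1 U(1)] open_vimage by blast
 hence "open (Fin -` (f ` U) - Z)" using `finite Z` finite_imp_closed by blast
 moreover have "b \<in> Fin -` (f ` U) - Z" using bZ U(2) f_Infty[symmetric] by auto
 ultimately obtain e where e: "e > 0" "ball b e \<subseteq> Fin -` (f ` U) - Z" by (meson openE)
 have "y ~: ball b e" if y: "y \<in> Gm" for y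
 proof
  assume yb: "y \<in> ball b e"
  then obtain x where x: "x \<in> U" "Fin y = f x" using e by auto
  have "go f (Fin (ctr y)) x" using ctr_props(2)[OF y] unfolding x(2) go_step .
  hence "x = Fin (ctr y)" using go_unique[OF x(1) ballU[OF ctr_props(1)[OF y] center]] go_refl by metis
  hence "y \<in> Z" using x(2) ctr_props(1)[OF y] by (auto simp: Z_def)
  thus False using e(2) yb by blast
 qed
 thus ?thesis using e(1) by (intro exI[of _ e]) (auto simp: dist_norm not_less)
qed

lemma b_sum: "(%y. rho y / (b - y) ^ k) summable_on Gm"
proof -
 obtain dl where dl: "dl > 0" "!!y. y \<in> Gm ==> dl <= cmod (b - y)" using b_far by blast
 have le: "norm (rho y / (b - y) ^ k) <= (1 / dl ^ k) * cmod (rho y)" if "y \<in> Gm" for y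
 proof -
  have "dl ^ k <= cmod (b - y) ^ k" using dl that by (intro power_mono) auto
  hence "cmod (rho y) / cmod (b - y) ^ k <= cmod (rho y) / dl ^ k"
   using dl(1) by (intro divide_left_mono mult_pos_pos) (auto intro: less_le_trans[of 0 "dl ^ k"])
  thus ?thesis by (simp add: norm_divide norm_power)
 qed
 have "(%y. (1 / dl ^ k) * cmod (rho y)) summable_on Gm" by (rule summable_on_cmult_right[OF P.abs_summable_rho])
 hence "(%y. norm (rho y / (b - y) ^ k)) summable_on Gm"
  by (rule summable_on_comparison_test) (use le in auto)
 thus ?thesis by (rule abs_summable_summable)
qed

lemma u_has_sum: "z \<in> P.outer ==> ((%y. rho y / (y - z)) has_sum P.u z) Gm"
 unfolding P.u_def by (rule has_sum_infsum[OF abs_summable_summable[OF P.abs_summable_u(1)]])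

text \<open>Grouping the sum for \<open>u z\<close> by fibres and inserting the push-forward
  identity leaves the term at \<open>f z\<close>; \<open>kv\<close> and \<open>kb\<close> annihilate
  the contributions of the critical values and of \<open>b\<close>.\<close>

lemma functional_equation_aux:
 assumes kv: "!!v. poly W v = 0 ==> P.u (poly p v / poly q v) = 0"
  and kb: "!!k. k \<in> {1, 2, 3} ==> (\<Sum>\<^sub>\<infinity>y\<in>Gm. rho y / (b - y) ^ k) = 0"
  and z: "z \<in> Om" and Wz: "poly W z ~= 0"
 shows "P.u z = (poly q z)\<^sup>2 / poly W z * P.u (poly p z / poly q z)"
proof -
 define v where "v c = poly p c / poly q c" for c
 have vO: "v c \<in> P.outer" if "poly q c ~= 0" "c \<in> Om" for c
  using Omega_step[OF f_Fin[OF that(1)]] Omega_outer that(2) unfolding v_def by blast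
 have fz: "poly p w ~= y * poly q w" if "y \<in> Gm" "w \<in> Om" for y w
 proof
  assume "poly p w = y * poly q w"
  hence "w \<in> Gm" using fib_Gamma(1)[of w y] that(1) by (simp add: fib_def)
  thus False using P.not_in_outer Omega_outer that(2) by blast
 qed
 obtain dl where dl: "dl > 0" "!!y. y \<in> Gm ==> dl <= cmod (b - y)" using b_far by blast
 obtain al be1 be2 be3 where id0: "!!y. y ~= b ==> poly p z ~= y * poly q z ==> (!!c. poly W c = 0 ==> poly p c ~= y * poly q c) ==>
    (\<Sum>w | poly p w = y * poly q w. poly q w ^ 4 / (poly W w ^ 2 * (w - z))) =
    - (poly q z ^ 3 / ((poly p z - y * poly q z) * poly W z))
    + (\<Sum>c | poly W c = 0. al c / (y - poly p c / poly q c))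
    + be1 / (b - y) + be2 / (b - y) ^ 2 + be3 / (b - y) ^ 3"
  using pushforward_identity[OF pq d1 qd W_def b_def W_nz W_root Wz] by blast
 define Zc where "Zc = {c. poly W c = 0}"
 have Zc: "finite Zc" unfolding Zc_def using poly_roots_finite[OF W_nz] .
 have yb: "y ~= b" if "y \<in> Gm" for y using dl(2)[OF that] dl(1) by auto
 have fsum: "(\<Sum>w\<in>fib y. rho w / (w - z)) = (poly q z)\<^sup>2 / poly W z * (rho y / (y - v z))
    + (\<Sum>c\<in>Zc. al c * (rho y / (y - v c)))
    + be1 * (rho y / (b - y) ^ 1) + be2 * (rho y / (b - y) ^ 2) + be3 * (rho y / (b - y) ^ 3)" if y: "y \<in> Gm" for y
 proof -
  have "(\<Sum>w\<in>fib y. rho w / (w - z)) = (\<Sum>w\<in>fib y. rho y * (poly q w ^ 4 / (poly W w ^ 2 * (w - z))))"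
   by (rule sum.cong) (auto simp: rho_def tau_fib[OF y] fib_Gamma(2)[OF _ y])
  also have "... = rho y * (\<Sum>w | poly p w = y * poly q w. poly q w ^ 4 / (poly W w ^ 2 * (w - z)))"
   by (simp add: sum_distrib_left fib_def)
  also have "... = rho y * (- (poly q z ^ 3 / ((poly p z - y * poly q z) * poly W z))
    + (\<Sum>c\<in>Zc. al c / (y - v c)) + be1 / (b - y) + be2 / (b - y) ^ 2 + be3 / (b - y) ^ 3)"
   unfolding Zc_def v_def by (subst id0[OF yb[OF y] fz[OF y z] fz[OF y Omega_crit]]) auto
  also have "- (poly q z ^ 3 / ((poly p z - y * poly q z) * poly W z)) = (poly q z)\<^sup>2 / poly W z * (1 / (y - v z))"
  proof (cases "poly q z = 0")
   case False
   have "poly p z - y * poly q z = - (poly q z * (y - v z))" unfolding v_def using False by (simp add: algebra_simps)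
   thus ?thesis using False by (simp add: power2_eq_square power3_eq_cube)
  qed simp
  finally show ?thesis by (simp add: distrib_left sum_distrib_left mult_ac)
 qed
 \<comment> \<open>The grand orbit is the disjoint union of the fibres over its own points.\<close>
 have bij: "bij_betw snd (Sigma Gm fib) Gm" unfolding bij_betw_def
 proof
  show "inj_on snd (Sigma Gm fib)" by (rule inj_onI) (auto simp: fib_iff)
  show "snd ` Sigma Gm fib = Gm"
  proof
   show "snd ` Sigma Gm fib \<subseteq> Gm" using fib_Gamma(1) by auto
   show "Gm \<subseteq> snd ` Sigma Gm fib"
   proof
    fix w assume "w \<in> Gm"
    then obtain y where "y \<in> Gm" "w \<in> fib y" using Gamma_fib by blast
    thus "w \<in> snd ` Sigma Gm fib" by (intro image_eqI[of _ _ "(y, w)"]) auto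
   qed
  qed
 qed
 have "((%yw. rho (snd yw) / (snd yw - z)) has_sum P.u z) (Sigma Gm fib)"
  by (subst has_sum_reindex_bij_betw[OF bij, where f = "%w. rho w / (w - z)"])
   (rule u_has_sum[OF subsetD[OF Omega_outer z]])
 hence 1: "((%y. \<Sum>w\<in>fib y. rho w / (w - z)) has_sum P.u z) Gm"
  by (rule has_sum_SigmaD) (use finite_fib in "auto intro!: has_sum_finite")
 have hv: "((%y. rho y / (y - v c)) has_sum 0) Gm" if "c \<in> Zc" for c
  using u_has_sum[of "v c"] vO[of c] Omega_crit[of c] W_root[of c] kv[of c] that unfolding Zc_def v_def by simp
 have hb: "((%y. rho y / (b - y) ^ k) has_sum 0) Gm" if "k \<in> {1,2,3}" for k
  using has_sum_infsum[OF b_sum[of k]] kb[OF that] by simp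
 have hz: "((%y. (poly q z)\<^sup>2 / poly W z * (rho y / (y - v z))) has_sum (poly q z)\<^sup>2 / poly W z * P.u (v z)) Gm"
 proof (cases "poly q z = 0")
  case False
  thus ?thesis by (intro has_sum_cmult_right u_has_sum vO z)
 qed simp
 have "((%y. (poly q z)\<^sup>2 / poly W z * (rho y / (y - v z))
    + (\<Sum>c\<in>Zc. al c * (rho y / (y - v c)))
    + be1 * (rho y / (b - y) ^ 1) + be2 * (rho y / (b - y) ^ 2) + be3 * (rho y / (b - y) ^ 3)) has_sum
    (poly q z)\<^sup>2 / poly W z * P.u (v z) + (\<Sum>c\<in>Zc. al c * 0) + be1 * 0 + be2 * 0 + be3 * 0) Gm"
  by (intro has_sum_add hz has_sum_sum_finite has_sum_cmult_right hv hb Zc) auto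
 hence "((%y. (poly q z)\<^sup>2 / poly W z * (rho y / (y - v z))
    + (\<Sum>c\<in>Zc. al c * (rho y / (y - v c)))
    + be1 * (rho y / (b - y) ^ 1) + be2 * (rho y / (b - y) ^ 2) + be3 * (rho y / (b - y) ^ 3)) has_sum
    (poly q z)\<^sup>2 / poly W z * P.u (v z)) Gm"
  by (simp only: mult_zero_right sum.neutral_const add_0_right)
 hence "((%y. \<Sum>w\<in>fib y. rho w / (w - z)) has_sum (poly q z)\<^sup>2 / poly W z * P.u (v z)) Gm"
  by (subst has_sum_cong[OF fsum])
 thus ?thesis using has_sum_unique[OF 1] unfolding v_def by blast
qed

text \<open>A large deviation needs a large derivative, so by Koebe the image of the full disc
  contains a round disc of fixed radius \<open>t\<close>. These are disjoint inside a bounded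
  set.\<close>

lemma finite_large:
 assumes eps: "eps > 0"
 shows "finite {y\<in>Gm. EX x:cball (ctr y) r'. cmod (br y x - y) >= eps}"
proof -
 have "EX x:cball (ctr y) r'. cmod (deriv (br y) x) >= eps / r'"
  if y: "y \<in> Gm" "x \<in> cball (ctr y) r'" "cmod (br y x - y) >= eps" for y x
 proof (rule ccontr)
  assume n: "~ ?thesis"
  have "x ~= ctr y" using y eps br_props(2)[OF y(1)] by auto
  have der: "(br y has_field_derivative deriv (br y) x) (at x within cball (ctr y) r')" if "x \<in> cball (ctr y) r'" for x
   using holomorphic_derivI[OF br_hol(1)[OF y(1)] open_ball subsetD[OF cball_r' that]] by (rule has_field_derivative_at_within)
  have c0: "ctr y \<in> cball (ctr y) r'" using r' by simp
  have cpt: "compact ((%x. cmod (deriv (br y) x)) ` cball (ctr y) r')"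
  proof (intro compact_continuous_image continuous_on_norm compact_cball)
   have "deriv (br y) holomorphic_on ball (ctr y) r" by (rule holomorphic_deriv[OF br_hol(1)[OF y(1)] open_ball])
   thus "continuous_on (cball (ctr y) r') (deriv (br y))"
    using holomorphic_on_imp_continuous_on continuous_on_subset cball_r' by blast
  qed
  then obtain x1 where x1: "x1 \<in> cball (ctr y) r'" "!!x. x \<in> cball (ctr y) r' ==> cmod (deriv (br y) x) <= cmod (deriv (br y) x1)"
   using compact_attains_sup[OF cpt] c0 by blast
  have "cmod (br y x - br y (ctr y)) <= cmod (deriv (br y) x1) * cmod (x - ctr y)"
   by (rule field_differentiable_bound[OF convex_cball der x1(2)]) (use y c0 in auto)
  also have "... <= cmod (deriv (br y) x1) * r'" using y(2) by (intro mult_left_mono) (auto simp: dist_norm norm_minus_commute)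
  also have "... < eps" using n x1(1) r'(1) by (auto simp: field_simps not_le)
  finally show False using y(3) br_props(2)[OF y(1)] by simp
 qed
 hence ex: "EX x. x \<in> cball (ctr y) r' & cmod (deriv (br y) x) >= eps / r'"
  if "y \<in> {y\<in>Gm. EX x:cball (ctr y) r'. cmod (br y x - y) >= eps}" for y
  using that unfolding mem_Collect_eq by metis
 define G where "G = {y\<in>Gm. EX x:cball (ctr y) r'. cmod (br y x - y) >= eps}"
 define xs where "xs y = (SOME x. x \<in> cball (ctr y) r' & cmod (deriv (br y) x) >= eps / r')" for y
 have xs: "xs y \<in> cball (ctr y) r' & cmod (deriv (br y) (xs y)) >= eps / r'" if "y \<in> G" for y
  unfolding xs_def by (rule someI_ex) (rule ex[OF that[unfolded G_def]])
 define t where "t = ka * (r / 2) * (eps / r')"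
 have t: "t > 0" using ka r eps by (simp add: t_def)
 have sub: "ball (br y (xs y)) t \<subseteq> br y ` ball (ctr y) r" if y: "y \<in> G" for y
 proof -
  have x: "xs y \<in> cball (ctr y) r'" "cmod (deriv (br y) (xs y)) >= eps / r'" and yG: "y \<in> Gm"
   using xs[OF y] y by (auto simp: G_def)
  have b: "ball (xs y) (r / 2) \<subseteq> ball (ctr y) r"
  proof
   fix w assume "w \<in> ball (xs y) (r / 2)"
   thus "w \<in> ball (ctr y) r" using x(1) dist_triangle[of "ctr y" w "xs y"] r by (simp add: dist_commute)
  qed
  have "t <= ka * (r / 2) * cmod (deriv (br y) (xs y))" unfolding t_def using x(2) ka r by (intro mult_left_mono) auto
  thus ?thesis using order_trans[OF subset_ball order_trans[OF koebe_br[OF yG _ b] image_mono[OF b]]] r by simp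
 qed
 have card: "real (card F) * t\<^sup>2 <= R\<^sup>2" if F: "finite F" "F \<subseteq> G" for F
 proof -
  have "(\<Sum>y\<in>F. t\<^sup>2) <= R\<^sup>2"
  proof (rule area_packing[where s = "%_. t" and c = "%y. br y (xs y)" and z = 0])
   show "ball (br y (xs y)) t Int ball (br y' (xs y')) t = {}" if "y \<in> F" "y' \<in> F" "y ~= y'" for y y'
    using sub[of y] sub[of y'] img_disj[of y y'] that F(2) unfolding G_def by blast
   show "ball (br y (xs y)) t \<subseteq> ball 0 R" if "y \<in> F" for y using sub[of y] R(2)[of y] that F(2) unfolding G_def by blast
  qed (use F t R in auto)
  thus ?thesis by simp
 qed
 show ?thesis
 proof (rule ccontr)
  assume "infinite {y\<in>Gm. EX x:cball (ctr y) r'. cmod (br y x - y) >= eps}"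
  then obtain F where F: "finite F" "card F = nat \<lceil>R\<^sup>2 / t\<^sup>2\<rceil> + 1" "F \<subseteq> G"
   using infinite_arbitrarily_large unfolding G_def by meson
  have "R\<^sup>2 / t\<^sup>2 < real (card F)" unfolding F(2) by linarith
  thus False using card[OF F(1,3)] t by (simp add: field_simps)
 qed
qed

end

text \<open>The weights solve the finite linear system, which turns the push-forward identity into
  the equation of an invariant vector field.\<close>

locale wander_vanish = wander_sum +
 assumes kv: "!!v. poly W v = 0 ==> P.u (poly p v / poly q v) = 0"
  and kb: "!!k. k \<in> {1, 2, 3} ==> (\<Sum>\<^sub>\<infinity>y\<in>Gm. rho y / (b - y) ^ k) = 0"
begin

lemma functional_equation:
 assumes z: "z \<in> Om"
 shows "poly q z ~= 0 ==> poly W z * P.u z = (poly q z)\<^sup>2 * P.u (poly p z / poly q z)"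
  "poly q z = 0 ==> P.u z = 0"
proof -
 have aux: "P.u z = (poly q z)\<^sup>2 / poly W z * P.u (poly p z / poly q z)" if "poly W z ~= 0"
  using functional_equation_aux[OF kv kb z that] by blast
 show "poly W z * P.u z = (poly q z)\<^sup>2 * P.u (poly p z / poly q z)" if "poly q z ~= 0"
 proof (cases "poly W z = 0")
  case True
  thus ?thesis using kv by simp
 next
  case False
  have "poly W z * P.u z = poly W z * ((poly q z)\<^sup>2 / poly W z * P.u (poly p z / poly q z))" using aux[OF False] by simp
  thus ?thesis using False by simp
 qed
 show "P.u z = 0" if "poly q z = 0" using aux W_root[of z] that by auto
qed

text \<open>An orbit that reaches infinity contains no critical point, so the functional equation
  would keep \<open>u\<close> nonzero along it; but the last point before infinity is a pole of
  \<open>f\<close>, where \<open>u\<close> vanishes.\<close>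

lemma finite_orbit:
 assumes z: "z \<in> Om" and u: "P.u z ~= 0"
 shows "(f ^^ n) (Fin z) ~= Infty"
proof
 assume n: "(f ^^ n) (Fin z) = Infty"
 have nc: "lif f ((f ^^ i) (Fin z))" for i
 proof (rule ccontr)
  assume "~ lif f ((f ^^ i) (Fin z))"
  hence "~ go f Infty (Fin z)" using crit_Infty go_funpow[of f Infty i "Fin z"] by blast
  thus False using goI[of n f "Fin z" 0 Infty] n by simp
 qed
 have "EX w. (f ^^ i) (Fin z) = Fin w & w \<in> Om & P.u w ~= 0" for i
 proof (induction i)
  case 0
  thus ?case using assms by auto
 next
  case (Suc i)
  then obtain w where w: "(f ^^ i) (Fin z) = Fin w" "w \<in> Om" "P.u w ~= 0" by blast
  have qw: "poly q w ~= 0" using functional_equation(2)[OF w(2)] w(3) by blast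
  have Ww: "poly W w ~= 0" using nc[of i] unfolding w(1) lif_iff .
  have "P.u (poly p w / poly q w) ~= 0" using functional_equation(1)[OF w(2) qw] w(3) Ww by auto
  thus ?case using f_Fin[OF qw] Omega_step[OF f_Fin[OF qw]] w by auto
 qed
 thus False using n by (metis riemann_sphere.distinct(1))
qed

lemma orbit_derivative:
 assumes V: "open V" "z \<in> V" "z \<in> Om" and fin: "!!w i. w \<in> V ==> (f ^^ i) (Fin w) ~= Infty"
 shows "EX D. ((%w. fin ((f ^^ n) (Fin w))) has_field_derivative D) (at z) &
  P.u (fin ((f ^^ n) (Fin z))) = D * P.u z & fin ((f ^^ n) (Fin z)) \<in> Om"
proof (induction n)
 case 0
 show ?case using V by (intro exI[of _ 1]) auto
next
 case (Suc n)
 define phi where "phi w = fin ((f ^^ n) (Fin w))" for w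
 obtain D where D: "(phi has_field_derivative D) (at z)" "P.u (phi z) = D * P.u z" "phi z \<in> Om"
  using Suc unfolding phi_def[abs_def] by blast
 have F: "(f ^^ n) (Fin w) = Fin (phi w)" if "w \<in> V" for w using fin[OF that, of n] by (simp add: phi_def Fin_fin)
 have q0: "poly q (phi w) ~= 0" if "w \<in> V" for w using fin[OF that, of "Suc n"] F[OF that] by (auto simp: f_Fin_Infty)
 have st: "fin ((f ^^ Suc n) (Fin w)) = poly p (phi w) / poly q (phi w)" if "w \<in> V" for w
  using F[OF that] f_Fin[OF q0[OF that]] by simp
 define D' where "D' = poly W (phi z) / (poly q (phi z))\<^sup>2 * D"
 have "((%w. poly p (phi w) / poly q (phi w)) has_field_derivative D') (at z)"
  unfolding D'_def W_def by (rule DERIV_chain2[where f = "%w. poly p w / poly q w" and g = phi, OF lif_Fin_iff(2)[OF pq f_def q0[OF V(2)]] D(1)])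
 hence "((%w. fin ((f ^^ Suc n) (Fin w))) has_field_derivative D') (at z)"
  by (rule has_field_derivative_transform_within_open[OF _ V(1,2)]) (rule st[symmetric])
 moreover have "P.u (poly p (phi z) / poly q (phi z)) = D' * P.u z"
  using functional_equation(1)[OF D(3) q0[OF V(2)]] q0[OF V(2)] unfolding D(2) D'_def by (simp add: field_simps)
 moreover have "poly p (phi z) / poly q (phi z) \<in> Om" using Omega_step[OF f_Fin[OF q0[OF V(2)]]] D(3) by simp
 ultimately show ?case unfolding st[OF V(2)] by blast
qed

text \<open>If \<open>u z0\<close> were nonzero, the boundedness of \<open>u\<close> on
  \<open>Om\<close> would bound the derivatives of all iterates on \<open>Om\<close> near
  \<open>z0\<close>. The maximum principle extends the bound across the removed discs, and
  \<open>z0\<close> would be a Fatou point.\<close>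

lemma u_julia:
 assumes z0: "Fin z0 \<in> julia_set f"
 shows "P.u z0 = 0"
proof (rule ccontr)
 assume u0: "P.u z0 ~= 0"
 define eta where "eta = cmod (P.u z0) / 2"
 have eta: "eta > 0" using u0 by (simp add: eta_def)
 define M where "M = C * (16 + R\<^sup>2)"
 have M: "cmod (P.u z) <= M" if "z \<in> Om" for z using P.abs_summable_u(2) Omega_outer that by (auto simp: M_def)
 have zO: "z0 \<in> Om" using Omega_julia[OF z0] .
 obtain e1 where e1: "e1 > 0" "!!w. w \<in> Om ==> w \<in> ball z0 e1 ==> cmod (P.u w) >= eta"
 proof -
  obtain e1 where e1: "e1 > 0" "!!w. w \<in> P.outer ==> dist w z0 < e1 ==> dist (P.u w) (P.u z0) < eta"
   using P.continuous_on_u[unfolded continuous_on_iff] zO Omega_outer eta by (meson subsetD)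
  have "cmod (P.u w) >= eta" if "w \<in> Om" "w \<in> ball z0 e1" for w
   using e1(2)[of w] that Omega_outer norm_triangle_ineq2[of "P.u z0" "P.u w"] unfolding eta_def
   by (auto simp: dist_commute dist_norm norm_minus_commute)
  thus ?thesis using that e1(1) by blast
 qed
 \<comment> \<open>Only finitely many removed discs are large, and their closures avoid
   \<open>z0\<close>; the others met near \<open>z0\<close> are small enough to stay inside
   \<open>V\<close>.\<close>
 define L where "L = {y\<in>Gm. EX x:cball (ctr y) r'. cmod (br y x - y) >= e1 / 4}"
 have L: "finite L" unfolding L_def by (rule finite_large) (use e1(1) in simp)
 define X where "X = (\<Union>y\<in>L. br y ` cball (ctr y) r')"
 have cont_br: "continuous_on (cball (ctr y) r') (br y)" if "y \<in> Gm" for y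
  using holomorphic_on_imp_continuous_on[OF br_hol(1)[OF that]] continuous_on_subset cball_r' by blast
 have "compact X" unfolding X_def using L cont_br
  by (intro compact_UN compact_continuous_image) (auto simp: L_def)
 have z0X: "z0 ~: br y ` ball (ctr y) r" if "y \<in> Gm" for y
  using go_julia[OF ballU[OF ctr_props(1)[OF that]] image_go[OF that]] z0 by blast
 hence "z0 \<in> - X" using cball_r' unfolding X_def L_def by blast
 then obtain e2 where e2: "e2 > 0" "ball z0 e2 \<subseteq> - X" using `compact X` compact_imp_closed openE open_Compl by metis
 define e where "e = min (e1 / 2) e2"
 have e: "e > 0" "e <= e1 / 2" "e <= e2" using e1 e2 by (auto simp: e_def)
 define V where "V = ball z0 e1"
 have finV: "(f ^^ i) (Fin w) ~= Infty" if w: "w \<in> V" for w i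
 proof (cases "w \<in> Om")
  case True
  hence "P.u w ~= 0" using e1(2)[OF True] w eta unfolding V_def by auto
  thus ?thesis using finite_orbit[OF True] by blast
 next
  case False
  then obtain y where y: "y \<in> Gm" "w \<in> D y" using not_Omega by blast
  then obtain x where x: "x \<in> ball (ctr y) r'" "w = br y x" by (auto simp: D_def)
  have "go f (Fin x) ((f ^^ i) (Fin w))" unfolding go_funpow x(2) using image_go[OF y(1) ball_r'[OF x(1)]] .
  thus ?thesis using go_finite[OF ballU[OF ctr_props(1)[OF y(1)] ball_r'[OF x(1)]]] by blast
 qed
 define phi where "phi n w = fin ((f ^^ n) (Fin w))" for n w
 have hol: "phi n holomorphic_on V" for n unfolding phi_def[abs_def] V_def
  by (intro sholo_finite_holomorphic sholo_funpow[OF rat] sholo_Fin_comp holomorphic_on_ident open_ball) (use finV V_def in blast)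
 have dO: "cmod (deriv (phi n) w) <= M / eta" if w: "w \<in> V" "w \<in> Om" for n w
 proof -
  obtain D where D: "(phi n has_field_derivative D) (at w)" "P.u (phi n w) = D * P.u w" "phi n w \<in> Om"
   using orbit_derivative[of V w n, OF _ w finV] unfolding phi_def[abs_def] V_def by auto
  have "cmod D * eta <= cmod D * cmod (P.u w)" using e1(2) w unfolding V_def by (intro mult_left_mono) auto
  also have "... <= M" using M[OF D(3)] unfolding D(2) by (simp add: norm_mult)
  finally show ?thesis unfolding DERIV_imp_deriv[OF D(1)] using eta by (simp add: field_simps)
 qed
 have dB: "cmod (deriv (phi n) w) <= M / eta" if w: "w \<in> ball z0 e" for n w
 proof (cases "w \<in> Om")
  case True
  thus ?thesis using dO w e e1(1) unfolding V_def by simp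
 next
  case False
  then obtain y where y: "y \<in> Gm" "w \<in> D y" using not_Omega by blast
  define Y where "Y = br y ` cball (ctr y) r'"
  have Y: "compact Y" unfolding Y_def using cont_br[OF y(1)] compact_continuous_image compact_cball by blast
  have DY: "D y \<subseteq> Y" unfolding D_def Y_def by (intro image_mono) auto
  have "y ~: L"
  proof
   assume "y \<in> L"
   hence "w \<in> X" using DY y(2) unfolding X_def Y_def by blast
   moreover have "w \<in> ball z0 e2" using w e(3) by simp
   ultimately show False using e2(2) by blast
  qed
  hence small: "cmod (v - y) < e1 / 4" if "v \<in> Y" for v
   using that y(1) unfolding L_def Y_def by (auto simp: not_le)
  have YV: "Y \<subseteq> V"
  proof
   fix v assume v: "v \<in> Y"
   have "cmod (v - w) < e1 / 2"
    using norm_triangle_ineq4[of "v - y" "w - y"] small[OF v] small[of w] DY y(2) by auto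
   hence "dist v w < e1 / 2" by (simp add: dist_norm)
   moreover have "dist z0 w < e1 / 2" using w e(2) by simp
   ultimately show "v \<in> V" unfolding V_def using dist_triangle[of z0 v w] by (simp add: dist_commute)
  qed
  have op: "open (D y)"
   unfolding D_def using r' by (intro open_mapping_thm3[OF holomorphic_on_subset[OF br_hol(1)[OF y(1)]] open_ball inj_on_subset[OF br_hol(2)[OF y(1)]]] subset_ball) auto
  have cl: "closure (D y) \<subseteq> Y" using DY Y by (simp add: closure_minimal compact_imp_closed)
  \<comment> \<open>The frontier lies in the image of the full disc under the same branch, which is
    disjoint from all other branch images.\<close>
  have fr: "ze \<in> Om" if ze: "ze \<in> frontier (D y)" for ze
  proof -
   have zen: "ze ~: D y" and zeY: "ze \<in> Y" using ze op cl by (auto simp: frontier_def interior_open)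
   have "ze \<in> br y ` ball (ctr y) r" using zeY cball_r' unfolding Y_def by blast
   hence "ze ~: D y'" if "y' \<in> Gm" for y'
    using zen img_disj[OF y(1) that] D_sub[of y'] by (cases "y = y'") auto
   thus ?thesis using Omega_iff by blast
  qed
  have derhol: "deriv (phi n) holomorphic_on V" unfolding V_def by (rule holomorphic_deriv[OF hol[unfolded V_def] open_ball])
  show ?thesis
  proof (rule maximum_modulus_frontier[of "deriv (phi n)" "D y"])
   show "deriv (phi n) holomorphic_on interior (D y)"
    by (rule holomorphic_on_subset[OF derhol]) (use DY YV interior_subset in blast)
   show "continuous_on (closure (D y)) (deriv (phi n))"
    by (rule continuous_on_subset[OF holomorphic_on_imp_continuous_on[OF derhol]]) (use cl YV in blast)
   show "bounded (D y)" using DY Y bounded_subset compact_imp_bounded by blast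
   show "cmod (deriv (phi n) ze) <= M / eta" if "ze \<in> frontier (D y)" for ze
    by (rule dO[OF _ fr[OF that]]) (use that cl YV in "auto simp: frontier_def")
  qed (rule y(2))
 qed
 have M0: "M / eta >= 0" using order_trans[OF norm_ge_zero dB[of z0 0]] e(1) by simp
 have lip: "dist ((f ^^ n) (Fin u)) ((f ^^ n) (Fin v)) <= 2 * (M / eta) * dist u v"
  if uv: "u \<in> ball z0 e" "v \<in> ball z0 e" for u v n
 proof -
  have sub: "ball z0 e \<subseteq> V" unfolding V_def using e e1(1) by (intro subset_ball) simp
  have der: "(phi n has_field_derivative deriv (phi n) x) (at x within ball z0 e)" if "x \<in> ball z0 e" for x
   by (rule has_field_derivative_at_within[OF holomorphic_derivI[OF hol[unfolded V_def] open_ball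
      subsetD[OF sub[unfolded V_def] that]]])
  have "cmod (phi n u - phi n v) <= M / eta * cmod (u - v)"
   by (rule field_differentiable_bound[OF convex_ball der dB uv])
  hence "2 * cmod (phi n u - phi n v) <= 2 * (M / eta) * dist u v" by (simp add: dist_norm)
  moreover have "(f ^^ n) (Fin u) = Fin (phi n u)" "(f ^^ n) (Fin v) = Fin (phi n v)"
   using finV uv sub unfolding phi_def by (auto simp: Fin_fin)
  ultimately show ?thesis using dist_Fin_le[of "phi n u" "phi n v"] by simp
 qed
 have "Fin z0 \<in> fatou_set f"
 proof (rule fatou_chartI[OF cont _ e(1)])
  show "Fin \<in> charts" by (simp add: charts_def)
  fix eps :: real assume eps: "eps > 0"
  define dl where "dl = eps / (2 * (M / eta) + 1)"
  have pos: "2 * (M / eta) + 1 > 0" using M0 by linarith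
  have dl: "dl > 0" unfolding dl_def using eps pos by simp
  have "dist ((f ^^ n) (Fin u)) ((f ^^ n) (Fin v)) < eps" if "u \<in> ball z0 e" "v \<in> ball z0 e" "dist u v < dl" for u v n
  proof -
   have "2 * (M / eta) * dist u v <= (2 * (M / eta) + 1) * dist u v" by (simp add: algebra_simps)
   also have "... < (2 * (M / eta) + 1) * dl" using that(3) pos by simp
   also have "... = eps" unfolding dl_def using pos by simp
   finally show ?thesis using lip[OF that(1,2), of n] by linarith
  qed
  thus "EX dl>0. ALL n u v. u \<in> ball z0 e --> v \<in> ball z0 e --> dist u v < dl -->
    dist ((f ^^ n) (Fin u)) ((f ^^ n) (Fin v)) < eps" using dl by blast
 qed
 thus False using z0 by (simp add: julia_set_def)
qed

text \<open>Multiplying \<open>u\<close> by the product of the factors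
  \<open>(a - z) / (z - b)\<close> cancels the poles in \<open>U\<close> and keeps the decay at
  infinity; \<open>b\<close> lies neither in \<open>U\<close> nor in the Julia set. The result
  \<open>G\<close> vanishes on the boundary of \<open>U\<close> and at infinity, hence on
  \<open>U\<close>, and \<open>G a0\<close> is a nonzero multiple of \<open>c a0\<close>.\<close>

lemma weights_zero:
 assumes a0: "a0 \<in> A"
 shows "c a0 = 0"
proof -
 \<comment> \<open>The sum without the poles in \<open>A\<close>, which is holomorphic on the finite
   part of \<open>U\<close>.\<close>
 interpret Q: pole_sum "Gm - A" s rho C R by (rule sums) blast
 define V where "V = Fin -` U"
 have V: "open V" unfolding V_def using U(1) continuous_on_Fin[of UNIV] open_vimage by blast
 have AV: "A \<subseteq> V" using ballU center by (auto simp: V_def)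
 have AG: "A \<subseteq> Gm" using A_Gamma(1) by blast
 have PQ: "P.outer \<subseteq> Q.outer" by (auto simp: P.outer_def Q.outer_def)
 have VQ: "V \<subseteq> Q.outer"
 proof
  fix z assume z: "z \<in> V"
  have "z ~: ball y (s y)" if y: "y \<in> Gm - A" for y
  proof
   assume "z \<in> ball y (s y)"
   then obtain x where x: "x \<in> ball (ctr y) r" "z = br y x" using ball_s[of y] D_sub[of y] y by blast
   have yG: "y \<in> Gm" using y by blast
   note a = ctr_props(1)[OF yG]
   have "br y x = br (ctr y) x"
    using brn_in_U[OF a br_props(1)[OF yG] x(1)] z x(2) A_Gamma(3)[OF a x(1)] by (simp add: V_def)
   hence "y = ctr y" using br_meet(1)[OF yG A_Gamma(1)[OF a] x(1)] x(1) A_Gamma(2)[OF a] by metis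
   thus False using a y by simp
  qed
  thus "z \<in> Q.outer" unfolding Q.outer_def by (auto simp: dist_norm norm_minus_commute not_less)
 qed
 have bU: "Fin b ~: U" using disj[of 1 0] U(2) f_Infty[symmetric] by auto
 have bJ: "Fin b ~: julia_set f" using julia_invariant[OF rat d1, of Infty] U(2) UJ f_Infty by auto
 define G where "G z = (\<Prod>a\<in>A. (a - z) / (z - b)) * Q.u z
   + (\<Sum>a\<in>A. c a / (z - b) * (\<Prod>a'\<in>A - {a}. (a' - z) / (z - b)))" for z
 have tauA: "rho a = c a" if "a \<in> A" for a
 proof -
  have "\<forall>\<^sub>F x in nhds a. x \<in> ball a r" using eventually_nhds_in_open[OF open_ball center] .
  hence "\<forall>\<^sub>F x in nhds a. br a x = x" by eventually_elim (rule A_Gamma(3)[OF that])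
  hence "deriv (br a) a = deriv (%x. x) a" by (intro deriv_cong_ev refl)
  thus ?thesis unfolding rho_def tau_def A_Gamma(2)[OF that] by simp
 qed
 have GP: "G z = (\<Prod>a\<in>A. (a - z) / (z - b)) * P.u z" if z: "z \<in> P.outer" "z ~= b" for z
 proof -
  have "((%y. rho y / (y - z)) has_sum (Q.u z + (\<Sum>a\<in>A. rho a / (a - z)))) ((Gm - A) Un A)"
  proof (rule has_sum_Un_disjoint)
   have "((%y. cmod (rho y / (y - z))) summable_on (Gm - A))" by (rule Q.abs_summable_u(1)[OF subsetD[OF PQ z(1)]])
   thus "((%y. rho y / (y - z)) has_sum Q.u z) (Gm - A)"
    unfolding Q.u_def by (rule has_sum_infsum[OF abs_summable_summable])
  qed (use A in auto)
  moreover have "(Gm - A) Un A = Gm" using AG by blast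
  ultimately have "P.u z = Q.u z + (\<Sum>a\<in>A. rho a / (a - z))" using has_sum_unique[OF u_has_sum[OF z(1)]] by simp
  hence Pu: "P.u z = Q.u z + (\<Sum>a\<in>A. c a / (a - z))" using tauA by simp
  have "(\<Prod>a\<in>A. (a - z) / (z - b)) * (\<Sum>a\<in>A. c a / (a - z)) =
    (\<Sum>a\<in>A. c a / (z - b) * (\<Prod>a'\<in>A - {a}. (a' - z) / (z - b)))"
   unfolding sum_distrib_left
  proof (rule sum.cong[OF refl])
   fix a assume a: "a \<in> A"
   have "a ~= z" using a AG P.not_in_outer[OF z(1)] by blast
   thus "(\<Prod>a\<in>A. (a - z) / (z - b)) * (c a / (a - z)) = c a / (z - b) * (\<Prod>a'\<in>A - {a}. (a' - z) / (z - b))"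
    unfolding prod.remove[OF A a] by simp
  qed
  thus ?thesis unfolding G_def Pu by (simp add: distrib_left)
 qed
 have G_hol: "G holomorphic_on V"
  unfolding G_def by (intro holomorphic_intros Q.holomorphic_on_u V VQ) (use bU in "auto simp: V_def")
 have clV: "Fin z \<in> U Un julia_set f" if "z \<in> closure V" for z
 proof -
  have "closure V \<subseteq> Fin -` closure U"
   using continuous_on_Fin[of UNIV] by (intro closure_minimal closed_vimage) (auto simp: V_def intro: closure_subset[THEN subsetD])
  thus ?thesis using clU that by blast
 qed
 have clQ: "closure V \<subseteq> Q.outer"
 proof
  fix z assume "z \<in> closure V"
  then consider "z \<in> V" | "Fin z \<in> julia_set f" using clV[of z] by (auto simp: V_def)
  thus "z \<in> Q.outer"
  proof cases
   case 1
   thus ?thesis by (rule subsetD[OF VQ])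
  next
   case 2
   show ?thesis by (rule subsetD[OF PQ subsetD[OF Omega_outer Omega_julia[OF 2]]])
  qed
 qed
 have G_cont: "continuous_on (closure V) G"
  unfolding G_def by (intro continuous_intros continuous_on_subset[OF Q.continuous_on_u clQ]) (use clV bU bJ in auto)
 have quot: "((%z. (a - z) / (z - b)) \<longlongrightarrow> -1) at_infinity" for a :: complex
 proof -
  have inv: "((%z. 1 / (z - b)) \<longlongrightarrow> 0) at_infinity"
  proof -
   have "filterlim (%z. - b + z) at_infinity at_infinity"
    by (rule tendsto_add_filterlim_at_infinity[OF tendsto_const filterlim_ident])
   hence "filterlim (%z. z - b) at_infinity at_infinity" by (simp add: add.commute)
   thus ?thesis using tendsto_divide_0[OF tendsto_const] by blast
  qed
  have "((%z. (a - b) * (1 / (z - b)) - 1) \<longlongrightarrow> (a - b) * 0 - 1) at_infinity"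
   by (intro tendsto_intros inv)
  moreover have "\<forall>\<^sub>F z in at_infinity. (a - b) * (1 / (z - b)) - 1 = (a - z) / (z - b)"
  proof -
   have "\<forall>\<^sub>F z in at_infinity. z ~= b"
    unfolding eventually_at_infinity by (intro exI[of _ "cmod b + 1"]) auto
   thus ?thesis by eventually_elim (simp add: field_simps)
  qed
  ultimately show ?thesis using Lim_transform_eventually by force
 qed
 have Q0: "(Q.u \<longlongrightarrow> 0) at_infinity"
 proof -
  define S where "S = (\<Sum>\<^sub>\<infinity>y\<in>Gm - A. cmod (rho y))"
  have 1: "\<forall>\<^sub>F z in at_infinity. norm (Q.u z) <= S / (cmod z - R)"
   unfolding eventually_at_infinity S_def by (intro exI[of _ "R + 1"]) (auto intro!: Q.far_bound)
  have "filterlim (%z. - R + cmod z) at_top (at_infinity :: complex filter)"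
   by (rule filterlim_tendsto_add_at_top[OF tendsto_const filterlim_norm_at_top])
  hence "filterlim (%z. cmod z - R) at_top (at_infinity :: complex filter)" by (simp add: add.commute)
  hence "((%z. S / (cmod z - R)) \<longlongrightarrow> 0) (at_infinity :: complex filter)"
   by (intro tendsto_divide_0[OF tendsto_const] filterlim_at_top_imp_at_infinity)
  thus ?thesis using 1 by (rule Lim_null_comparison[rotated])
 qed
 have inv0: "((%z. k / (z - b)) \<longlongrightarrow> 0) at_infinity" for k
 proof -
  have "filterlim (%z. - b + z) at_infinity at_infinity"
   by (rule tendsto_add_filterlim_at_infinity[OF tendsto_const filterlim_ident])
  hence "filterlim (%z. z - b) at_infinity at_infinity" by (simp add: add.commute)
  thus ?thesis using tendsto_divide_0[OF tendsto_const] by blast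
 qed
 have "(G \<longlongrightarrow> (\<Prod>a\<in>A. -1) * 0 + (\<Sum>a\<in>A. 0 * (\<Prod>a'\<in>A - {a}. -1))) at_infinity"
  unfolding G_def by (intro tendsto_add tendsto_mult tendsto_prod tendsto_sum quot Q0 inv0)
 hence G0: "(G \<longlongrightarrow> 0) at_infinity" by simp
 have GJ: "G z = 0" if "z \<in> closure V - V" for z
 proof -
  have "Fin z \<in> julia_set f" using clV[of z] that by (auto simp: V_def)
  moreover from this have "z ~= b" using bJ by auto
  ultimately show ?thesis using GP[of z] u_julia Omega_julia Omega_outer by auto
 qed
 have GV: "G z = 0" if z: "z \<in> V" for z
 proof (rule ccontr)
  assume "G z ~= 0"
  define eps where "eps = cmod (G z) / 2"
  have eps: "eps > 0" using `G z ~= 0` by (simp add: eps_def)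
  obtain N where N: "!!w. cmod w >= N ==> cmod (G w) < eps"
   using G0 eps unfolding tendsto_iff eventually_at_infinity by auto
  \<comment> \<open>Cut off beyond \<open>z\<close> and beyond the radius from which
    \<open>|G| < eps\<close>, so that the maximum principle applies to a bounded set.\<close>
  define S where "S = V Int ball 0 (max N (cmod z + 1))"
  have zS: "z \<in> S" using z by (simp add: S_def)
  have opS: "open S" unfolding S_def using V by blast
  have clS: "closure S \<subseteq> closure V" unfolding S_def by (intro closure_mono) blast
  have "cmod (G z) <= eps"
  proof (rule maximum_modulus_frontier[of G S])
   show "G holomorphic_on interior S"
    by (rule holomorphic_on_subset[OF G_hol]) (use interior_subset in "auto simp: S_def")
   show "continuous_on (closure S) G" by (rule continuous_on_subset[OF G_cont clS])
   show "bounded S" unfolding S_def by (simp add: bounded_Int)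
   show "cmod (G w) <= eps" if w: "w \<in> frontier S" for w
   proof (cases "w \<in> V")
    case True
    have "w ~: S" using w opS by (auto simp: frontier_def interior_open)
    hence "cmod w >= N" using True by (auto simp: S_def)
    thus ?thesis using N by (simp add: less_imp_le)
   next
    case False
    thus ?thesis using GJ[of w] w clS eps by (auto simp: frontier_def)
   qed
  qed (rule zS)
  thus False using eps by (simp add: eps_def)
 qed
 have "G a0 = c a0 / (a0 - b) * (\<Prod>a'\<in>A - {a0}. (a' - a0) / (a0 - b))"
 proof -
  have 1: "(\<Prod>a\<in>A. (a - a0) / (a0 - b)) = 0" using A a0 by (subst prod_zero_iff) auto
  have 2: "c a / (a0 - b) * (\<Prod>a'\<in>A - {a}. (a' - a0) / (a0 - b)) = 0" if "a \<in> A - {a0}" for a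
  proof -
   have "(\<Prod>a'\<in>A - {a}. (a' - a0) / (a0 - b)) = 0" using A a0 that by (subst prod_zero_iff) auto
   thus ?thesis by simp
  qed
  show ?thesis unfolding G_def 1 sum.remove[OF A a0] using sum.neutral[of "A - {a0}", OF ballI[OF 2]] by simp
 qed
 moreover have "G a0 = 0" using GV a0 AV by blast
 moreover have "a0 ~= b" using bU AV a0 by (auto simp: V_def)
 moreover have "(\<Prod>a'\<in>A - {a0}. (a' - a0) / (a0 - b)) ~= 0" using A `a0 ~= b` by (subst prod_zero_iff) auto
 ultimately show ?thesis by simp
qed

end

text \<open>Separates the weights from the sums, so that the conditions on them become linear
  equations.\<close>

lemma (in wander_balls) weight_split:
 assumes g: "g summable_on Gm"
 shows "(\<Sum>\<^sub>\<infinity>y\<in>Gm. c (ctr y) * g y) = (\<Sum>a\<in>A. c a * (\<Sum>\<^sub>\<infinity>y\<in>{y\<in>Gm. ctr y = a}. g y :: complex))"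
proof -
 have 1: "((%y. if ctr y = a then g y else 0) has_sum (\<Sum>\<^sub>\<infinity>y\<in>{y\<in>Gm. ctr y = a}. g y)) Gm" for a
 proof -
  have "(g has_sum (\<Sum>\<^sub>\<infinity>y\<in>{y\<in>Gm. ctr y = a}. g y)) {y\<in>Gm. ctr y = a}"
   by (rule has_sum_infsum[OF summable_on_subset_banach[OF g]]) auto
  thus ?thesis by (subst has_sum_cong_neutral[where T = "{y\<in>Gm. ctr y = a}" and g = g]) auto
 qed
 have "((%y. \<Sum>a\<in>A. c a * (if ctr y = a then g y else 0)) has_sum
   (\<Sum>a\<in>A. c a * (\<Sum>\<^sub>\<infinity>y\<in>{y\<in>Gm. ctr y = a}. g y))) Gm"
  by (intro has_sum_sum_finite A has_sum_cmult_right 1)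
 hence "infsum (%y. \<Sum>a\<in>A. c a * (if ctr y = a then g y else 0)) Gm =
   (\<Sum>a\<in>A. c a * (\<Sum>\<^sub>\<infinity>y\<in>{y\<in>Gm. ctr y = a}. g y))" by (rule infsumI)
 moreover have "(\<Sum>a\<in>A. c a * (if ctr y = a then g y else 0)) = c (ctr y) * g y" if "y \<in> Gm" for y
  using ctr_props(1)[OF that] A by (simp add: if_distrib[of "%x. _ * x"] cong: if_cong)
 ultimately show ?thesis using infsum_cong[of Gm] by (metis (no_types, lifting))
qed

lemma disjoint_small_balls:
 fixes A :: "'a :: metric_space set"
 assumes A: "finite A" "A \<subseteq> V" and V: "open V"
 obtains r where "r > 0" "!!a. a \<in> A ==> ball a r \<subseteq> V" "!!a a'. a \<in> A ==> a' \<in> A ==> a ~= a' ==> ball a r Int ball a' r = {}"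
proof -
 have 1: "ALL a:A. \<forall>\<^sub>F r in at_right 0. ball a r \<subseteq> V"
 proof
  fix a assume "a \<in> A"
  then obtain e where e: "e > 0" "ball a e \<subseteq> V" using A V by (meson openE subsetD)
  have "\<forall>\<^sub>F r in at_right 0. r \<in> {0<..<e}" using eventually_at_right_real[OF e(1)] .
  thus "\<forall>\<^sub>F r in at_right 0. ball a r \<subseteq> V" by eventually_elim (use e(2) in auto)
 qed
 have 2: "ALL a:A. \<forall>\<^sub>F r in at_right 0. ALL a':A. a ~= a' --> ball a r Int ball a' r = {}"
 proof
  fix a
  have "ALL a':A. \<forall>\<^sub>F r in at_right 0. a ~= a' --> ball a r Int ball a' r = {}"
  proof
   fix a'
   show "\<forall>\<^sub>F r in at_right 0. a ~= a' --> ball a r Int ball a' r = {}"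
   proof (cases "a = a'")
    case False
    hence "dist a a' / 2 > 0" by simp
    hence "\<forall>\<^sub>F r in at_right 0. r \<in> {0<..<dist a a' / 2}" by (rule eventually_at_right_real)
    thus ?thesis
    proof eventually_elim
     case (elim r)
     have False if x: "dist a x < r" "dist a' x < r" for x
      using dist_triangle2[of a a' x] x elim by auto
     thus ?case by auto
    qed
   qed simp
  qed
  thus "\<forall>\<^sub>F r in at_right 0. ALL a':A. a ~= a' --> ball a r Int ball a' r = {}"
   by (rule eventually_ball_finite[OF A(1)])
 qed
 have "\<forall>\<^sub>F r in at_right (0::real). 0 < r" by (rule eventually_at_right_less)
 hence "\<forall>\<^sub>F r in at_right 0. 0 < r & (ALL a:A. ball a r \<subseteq> V) & (ALL a:A. ALL a':A. a ~= a' --> ball a r Int ball a' r = {})"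
  using eventually_ball_finite[OF A(1) 1] eventually_ball_finite[OF A(1) 2] by eventually_elim blast
 from eventually_happens'[OF trivial_limit_at_right_real this] obtain r where r: "0 < r"
  "ALL a:A. ball a r \<subseteq> V" "ALL a:A. ALL a':A. a ~= a' --> ball a r Int ball a' r = {}" by auto
 show thesis by (rule that[of r]) (use r in auto)
qed

lemma (in wander) wandering_False: False
proof -
 define V where "V = Fin -` U"
 have V: "open V" unfolding V_def using U(1) continuous_on_Fin[of UNIV] open_vimage by blast
 \<comment> \<open>Different points of \<open>V\<close> have disjoint grand orbits, so each critical
   point excludes at most one of them.\<close>
 define T where "T = {a\<in>V. EX c. ~ lif f c & go f (Fin a) c}"
 have T: "finite T"
 proof -
  define w where "w a = (SOME c. ~ lif f c & go f (Fin a) c)" for a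
  have w: "~ lif f (w a) & go f (Fin a) (w a)" if "a \<in> T" for a
   unfolding w_def by (rule someI_ex) (use that in "auto simp: T_def")
  have "inj_on w T"
  proof (rule inj_onI)
   fix a a' assume a: "a \<in> T" "a' \<in> T" "w a = w a'"
   have "Fin a = Fin a'"
    using go_unique[of "Fin a" "Fin a'" "w a"] w[OF a(1)] w[OF a(2)] a by (simp add: T_def V_def)
   thus "a = a'" by simp
  qed
  moreover have "w ` T \<subseteq> {c. ~ lif f c}" using w by blast
  ultimately show ?thesis using finite_not_lif[OF rat d1] inj_on_finite by blast
 qed
 have "infinite (U - {Infty})" using infinite_open_sphere[OF U(1)] U(2) by (metis empty_iff infinite_remove)
 moreover have "U - {Infty} \<subseteq> Fin ` V" unfolding V_def by (auto simp: image_iff) (metis riemann_sphere.exhaust)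
 ultimately have "infinite V" using finite_subset by blast
 hence "infinite (V - T)" using T by simp
 define Zc where "Zc = {v. poly W v = 0}"
 have Zc: "finite Zc" unfolding Zc_def using poly_roots_finite[OF W_nz] .
 \<comment> \<open>One unknown more than equations: one equation for each zero of \<open>W\<close>
   and three for the powers of \<open>1 / (b - y)\<close>.\<close>
 obtain A where A: "finite A" "card A = card Zc + 4" "A \<subseteq> V - T"
  using infinite_arbitrarily_large[OF `infinite (V - T)`] by blast
 have "open (V - T)" using V T finite_imp_closed by blast
 then obtain r where r: "r > 0" "!!a. a \<in> A ==> ball a r \<subseteq> V - T"
   "!!a a'. a \<in> A ==> a' \<in> A ==> a ~= a' ==> ball a r Int ball a' r = {}"
  using disjoint_small_balls[OF A(1,3)] by metis
 note cA = A(1,2)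
 interpret wander_balls p q d f U A r
 proof
  fix a x assume a: "a \<in> A" "x \<in> ball a r"
  hence x: "x \<in> V - T" using r(2) by blast
  thus "Fin x \<in> U" by (simp add: V_def)
  show "~ go f (Fin x) c" if "~ lif f c" for c using x that by (auto simp: T_def)
 qed (use A(1) r in auto)
 obtain ka :: real where ka: "ka > 0"
  "!!g x s. s > 0 ==> g holomorphic_on ball x s ==> inj_on g (ball x s) ==>
    ball (g x) (ka * s * cmod (deriv g x)) \<subseteq> g ` ball x s" using koebe_weak by blast
 \<comment> \<open>Weights equal to 1 provide the summability statements before the right weights
   are known.\<close>
 interpret S1: wander_sum p q d f U A r ka "%_. 1" by unfold_locales (use ka in auto)
 define Fv where "Fv v = poly p v / poly q v" for v
 define ker where "ker j y = (case j of Inl v => 1 / (y - Fv v) | Inr k => 1 / (b - y) ^ k)" for j :: "complex + nat" and y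
 define J where "J = Zc <+> {1, 2, 3::nat}"
 have Fv_outer: "Fv v \<in> S1.P.outer" if "v \<in> Zc" for v
  using S1.Omega_step[OF f_Fin[OF W_root]] S1.Omega_crit S1.Omega_outer that unfolding Zc_def Fv_def by blast
 have rho1: "S1.rho y = tau y" for y by (simp add: S1.rho_def)
 have summ: "(%y. tau y * ker j y) summable_on Gm" if "j \<in> J" for j
 proof (cases j)
  case (Inl v)
  hence "v \<in> Zc" using that by (auto simp: J_def)
  from abs_summable_summable[OF S1.P.abs_summable_u(1)[OF Fv_outer[OF this]]]
  show ?thesis unfolding rho1 by (simp add: Inl ker_def)
 next
  case (Inr k)
  thus ?thesis using S1.b_sum[of k] unfolding rho1 by (simp add: ker_def)
 qed
 have Jf: "finite J" "card J = card Zc + 3" unfolding J_def using Zc by (simp_all add: card_Plus)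
 have "EX c. (EX a:A. c a ~= 0) & (ALL j:J. (\<Sum>a\<in>A. c a * (\<Sum>\<^sub>\<infinity>y\<in>{y\<in>Gm. ctr y = a}. tau y * ker j y)) = 0)"
  by (rule homogeneous_solution) (use Jf cA in simp_all)
 then obtain c where c: "EX a:A. c a ~= 0"
  "!!j. j \<in> J ==> (\<Sum>a\<in>A. c a * (\<Sum>\<^sub>\<infinity>y\<in>{y\<in>Gm. ctr y = a}. tau y * ker j y)) = 0" by blast
 have kill: "(\<Sum>\<^sub>\<infinity>y\<in>Gm. c (ctr y) * (tau y * ker j y)) = 0" if "j \<in> J" for j
  using weight_split[OF summ[OF that], of c] c(2)[OF that] by simp
 interpret S: wander_sum p q d f U A r ka c by unfold_locales (use ka in auto)
 interpret V: wander_vanish p q d f U A r ka c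
 proof
  show "S.P.u (poly p v / poly q v) = 0" if "poly W v = 0" for v
  proof -
   have "Inl v \<in> J" using that by (auto simp: J_def Zc_def)
   from kill[OF this] show ?thesis unfolding S.P.u_def S.rho_def by (simp add: ker_def Fv_def mult.assoc)
  qed
  show "(\<Sum>\<^sub>\<infinity>y\<in>Gm. S.rho y / (b - y) ^ k) = 0" if "k \<in> {1, 2, 3}" for k
  proof -
   have "Inr k \<in> J" using that by (auto simp: J_def)
   from kill[OF this] show ?thesis unfolding S.rho_def by (simp add: ker_def mult.assoc)
  qed
 qed
 show False using c(1) V.weights_zero by blast
qed

text \<open>All but finitely many points of \<open>U\<close> have a grand orbit free of critical
  points; a Moebius conjugation puts one of them at infinity.\<close>

theorem no_wandering:
 assumes f: "rational_map_of_degree f d" and d: "d >= 2" and U: "open U" "U ~= {}"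
  and inj: "!!l. inj_on (f ^^ l) U"
  and disj: "!!i j. i ~= j ==> (f ^^ i) ` U Int (f ^^ j) ` U = {}"
  and clU: "closure U \<subseteq> U Un julia_set f" and UJ: "U Int julia_set f = {}"
 shows False
proof -
 have d1: "d >= 1" using d by simp
 define T where "T = {a\<in>U. EX c. ~ lif f c & go f a c}"
 have "finite T"
 proof -
  define w where "w a = (SOME c. ~ lif f c & go f a c)" for a
  have w: "~ lif f (w a) & go f a (w a)" if "a \<in> T" for a
   unfolding w_def by (rule someI_ex) (use that in "auto simp: T_def")
  have "inj_on w T"
  proof (rule inj_onI)
   fix a a' assume a: "a \<in> T" "a' \<in> T" "w a = w a'"
   obtain n m n' m' where e: "(f ^^ n) (w a) = (f ^^ m) a" "(f ^^ n') (w a) = (f ^^ m') a'"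
    using w[OF a(1)] w[OF a(2)] a(3) unfolding go_def by metis
   have e2: "(f ^^ (n' + m)) a = (f ^^ (n + m')) a'"
    unfolding funpow_add comp_apply e[symmetric] by (metis add.commute comp_apply funpow_add)
   hence eq: "n' + m = n + m'" using disj[of "n' + m" "n + m'"] a by (auto simp: T_def)
   show "a = a'" using e2 inj[of "n' + m"] a unfolding eq by (auto dest: inj_onD simp: T_def)
  qed
  moreover have "w ` T \<subseteq> {c. ~ lif f c}" using w by blast
  ultimately show ?thesis using finite_not_lif[OF f d1] inj_on_finite by blast
 qed
 then obtain x where x: "x \<in> U" "!!c. ~ lif f c ==> ~ go f x c"
  using infinite_open_sphere[OF U] finite_subset[of U T] unfolding T_def by blast
 obtain A where A: "mob A" "A x = Infty" using mob_to_Infty by blast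
 obtain B where B: "mob B" "A o B = id" "B o A = id" using mob_inverse[OF A(1)] by blast
 have BA: "B (A y) = y" "A (B y) = y" for y using B by (auto simp: fun_eq_iff)
 define f1 where "f1 = A o f o B"
 have f1: "rational_map_of_degree f1 d"
  unfolding f1_def by (intro rational_mob_pre[OF B(1)] rational_mob_post[OF A(1) f])
 obtain p q where pq: "ratl p q d" "f1 = rational_map p q" using f1 rational_map_of_degree_iff by blast
 have fn: "(f1 ^^ n) y = A ((f ^^ n) (B y))" for n y by (induction n) (auto simp: f1_def BA)
 have cA: "continuous_on S A" and cB: "continuous_on S B" for S
  using rational_continuous[OF mob_rational] A(1) B(1) by blast+
 have im: "A ` S = B -` S" for S using BA unfolding image_def vimage_def by (auto intro: sym)
 have J: "y \<in> julia_set f1 \<longleftrightarrow> B y \<in> julia_set f" for y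
  unfolding f1_def julia_set_def using fatou_conjugate[OF rational_continuous[OF f] cA cB B(2,3)] by simp
 have fnim: "(f1 ^^ n) ` A ` U = A ` (f ^^ n) ` U" for n by (auto simp: fn BA image_iff)
 have "wander p q d f1 (A ` U)"
 proof
  show "open (A ` U)" unfolding im using open_vimage[OF U(1) cB] .
  show "Infty \<in> A ` U" using x(1) A(2) by (metis imageI)
  show "inj_on (f1 ^^ l) (A ` U)" for l
  proof (rule inj_onI)
   fix a a' assume a: "a \<in> A ` U" "a' \<in> A ` U" "(f1 ^^ l) a = (f1 ^^ l) a'"
   hence "(f ^^ l) (B a) = (f ^^ l) (B a')" unfolding fn by (metis BA(1))
   moreover have "B a \<in> U" "B a' \<in> U" using a unfolding im by auto
   ultimately have "B a = B a'" using inj_onD[OF inj[of l]] by blast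
   thus "a = a'" by (metis BA(2))
  qed
  show "(f1 ^^ i) ` A ` U Int (f1 ^^ j) ` A ` U = {}" if "i ~= j" for i j
   unfolding fnim im[of "(f ^^ _) ` _"] vimage_Int[symmetric] disj[OF that] by simp
  show "closure (A ` U) \<subseteq> A ` U Un julia_set f1"
  proof -
   have "closure (A ` U) \<subseteq> B -` closure U"
    unfolding im using closure_subset by (intro closure_minimal closed_vimage cB) auto
   thus ?thesis using clU J unfolding im subset_iff vimage_def by blast
  qed
  show "A ` U Int julia_set f1 = {}" using UJ J unfolding im disjoint_iff vimage_def by blast
  show "~ go f1 Infty c" if c: "~ lif f1 c" for c
  proof
   assume "go f1 Infty c"
   then obtain n m where "(f1 ^^ n) c = (f1 ^^ m) Infty" by (auto simp: go_def)
   hence "(f ^^ n) (B c) = (f ^^ m) x" unfolding fn A(2)[symmetric] BA(1) by (metis BA(1))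
   hence "go f x (B c)" by (rule goI)
   moreover have "~ lif f (B c)" using c lif_mob[OF A(1) B(1)] unfolding f1_def by blast
   ultimately show False using x(2) by blast
  qed
 qed (use pq d in auto)
 thus False by (rule wander.wandering_False)
qed

section \<open>Discs in the complement of a continuum\<close>

text \<open>Invariance of domain in the plane, applied off infinity and, after inversion, off
  0.\<close>

lemma open_injective_image:
 fixes G :: "complex => riemann_sphere"
 assumes G: "continuous_on S G" "inj_on G S" and T: "open T" "T \<subseteq> S"
 shows "open (G ` T)"
proof -
 have *: "open (G ` V)" if V: "open V" "continuous_on V G" "inj_on G V" "Infty ~: G ` V" for V and G :: "complex => riemann_sphere"
 proof -
  have F: "Fin (fin (G z)) = G z" if "z \<in> V" for z using V(4) that by (metis Fin_fin imageI)
  have c: "continuous_on V (%z. fin (G z))"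
   by (rule continuous_on_compose2[OF continuous_on_fin V(2)]) (use V(4) in force)
  have "inj_on (%z. fin (G z)) V" by (rule inj_onI) (metis F V(3) inj_onD)
  hence "open ((%z. fin (G z)) ` V)" using invariance_of_domain[OF c V(1)] by blast
  hence "open (Fin ` (%z. fin (G z)) ` V)" by (rule open_Fin_image)
  moreover have "Fin ` (%z. fin (G z)) ` V = G ` V" unfolding image_image by (rule image_cong[OF refl F])
  ultimately show ?thesis by simp
 qed
 have GT: "continuous_on T G" "inj_on G T" using G T continuous_on_subset inj_on_subset by blast+
 define A where "A = T Int G -` (- {Infty})"
 define B where "B = T Int G -` (- {Fin 0})"
 have A: "open A" "open B" unfolding A_def B_def using continuous_open_preimage[OF GT(1) T(1)] by auto
 have AB: "A \<subseteq> T" "B \<subseteq> T" "T = A Un B" by (auto simp: A_def B_def)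
 have 1: "open (G ` A)"
  by (rule *[OF A(1) continuous_on_subset[OF GT(1) AB(1)] inj_on_subset[OF GT(2) AB(1)]]) (auto simp: A_def)
 have "open ((%z. iota (G z)) ` B)"
 proof (rule *[OF A(2)])
  show "continuous_on B (%z. iota (G z))"
   by (rule continuous_on_compose2[OF continuous_on_iota continuous_on_subset[OF GT(1) AB(2)]]) auto
  show "inj_on (%z. iota (G z)) B" by (rule inj_onI) (metis AB(2) GT(2) inj_onD iota_iota subsetD)
  show "Infty ~: (%z. iota (G z)) ` B" unfolding B_def by (auto simp: image_iff) (metis iota.simps(2) iota_iota)
 qed
 hence "open (iota ` (%z. iota (G z)) ` B)" by (rule open_iota_image)
 hence "open (G ` B)" by (simp add: image_image)
 thus ?thesis using 1 AB(3) by (metis image_Un open_Un)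
qed

text \<open>Purely topological: the discs obtained later by lifting are needed only up to
  homeomorphism.\<close>

definition disc_map :: "(complex => riemann_sphere) => riemann_sphere set => bool" where
 "disc_map th W \<longleftrightarrow> continuous_on (ball 0 1) th & inj_on th (ball 0 1) & th ` ball 0 1 = W"

lemma disc_map_open: "disc_map th W ==> open T ==> T \<subseteq> ball 0 1 ==> open (th ` T)"
 unfolding disc_map_def using open_injective_image by blast

lemma disc_map_inverse:
 assumes "disc_map th W"
 obtains eta where "homeomorphism (ball 0 1) W th eta"
proof -
 have W: "open W" using disc_map_open[OF assms open_ball subset_refl] assms unfolding disc_map_def by simp
 have "EX eta. homeomorphism (ball 0 1) W th eta"
 proof (rule homeomorphism_injective_open_map)
  fix U :: "complex set" assume "openin (top_of_set (ball 0 1)) U"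
  hence "open U" "U \<subseteq> ball 0 1" using openin_open_eq[OF open_ball] by auto
  hence "open (th ` U)" "th ` U \<subseteq> W" using disc_map_open[OF assms] assms unfolding disc_map_def by auto
  thus "openin (top_of_set W) (th ` U)" using openin_open_eq[OF W] by blast
 qed (use assms in "auto simp: disc_map_def")
 thus ?thesis using that by blast
qed

text \<open>Moving \<open>x\<close> to infinity makes \<open>W\<close> a plane domain, and
  \<open>y\<close> makes it proper. An automorphism of the unit disc adjusts the centre.\<close>

lemma riemann_disc:
 assumes W: "open W" "connected W" "v \<in> W" and cW: "connected (- W)" and xy: "x ~: W" "y ~: W" "x ~= y"
 obtains th where "disc_map th W" "th 0 = v"
proof -
 obtain A where A: "mob A" "A x = Infty" using mob_to_Infty by blast
 obtain B where B: "mob B" "A o B = id" "B o A = id" using mob_inverse[OF A(1)] by blast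
 have BA: "B (A z) = z" "A (B z) = z" for z using B by (auto simp: fun_eq_iff)
 have cA: "continuous_on S A" and cB: "continuous_on S B" for S
  using rational_continuous[OF mob_rational] A(1) B(1) by blast+
 define W1 where "W1 = {z. B (Fin z) \<in> W}"
 have cBF: "continuous_on S (%z. B (Fin z))" for S
  by (rule continuous_on_compose2[OF cB[of UNIV] continuous_on_Fin]) auto
 have W1: "open W1" unfolding W1_def using open_vimage[OF W(1) cBF] by (simp add: vimage_def)
 have AW: "A w ~= Infty" if "w \<in> W" for w using that xy(1) A(2) BA(1) by metis
 have W1_im: "W1 = (%w. fin (A w)) ` W"
 proof
  show "W1 \<subseteq> (%w. fin (A w)) ` W"
  proof
   fix z assume "z \<in> W1"
   thus "z \<in> (%w. fin (A w)) ` W" by (intro image_eqI[of _ _ "B (Fin z)"]) (auto simp: BA W1_def)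
  qed
  show "(%w. fin (A w)) ` W \<subseteq> W1" unfolding W1_def using AW by (auto simp: Fin_fin BA)
 qed
 have "continuous_on W (%w. fin (A w))"
  by (rule continuous_on_compose2[OF continuous_on_fin cA]) (use AW in force)
 hence conW1: "connected W1" unfolding W1_im using W(2) connected_continuous_image by blast
 have "A y ~= Infty" using A(2) xy(3) BA(1) by metis
 then obtain y' where y': "A y = Fin y'" by (cases "A y") auto
 hence "y' ~: W1" unfolding W1_def using xy(2) BA(1) by (metis mem_Collect_eq)
 \<comment> \<open>A bounded component of the complement would lie in a compact clopen piece of it,
   against the connectedness of the complement on the sphere.\<close>
 have "inside W1 = {}"
 proof (rule ccontr)
  assume "inside W1 ~= {}"
  then obtain z where z: "z ~: W1" "bounded (connected_component_set (- W1) z)" unfolding inside_def by blast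
  define T where "T = connected_component_set (- W1) z"
  have cl: "closed (- W1)" using W1 by (simp add: closed_Compl)
  have zT: "z \<in> T" unfolding T_def using z(1) by simp
  have T: "T \<in> components (- W1)" unfolding T_def using z(1) by (simp add: componentsI)
  have "closed T" using closed_components[OF cl T] .
  hence cT: "compact T" using z(2) unfolding T_def by (simp add: compact_eq_bounded_closed)
  obtain R where R: "T \<subseteq> ball 0 R" using z(2) bounded_subset_ballD unfolding T_def by blast
  obtain K where K: "openin (top_of_set (- W1)) K" "compact K" "T \<subseteq> K" "K \<subseteq> ball 0 R"
   using Sura_Bura_clopen_subset[OF closed_imp_locally_compact[OF cl] T cT open_ball R] by blast
  obtain V where V: "open V" "K = - W1 Int V" using K(1) by (auto simp: openin_open)
  define Z where "Z = A ` (- W)"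
  have Z: "connected Z" unfolding Z_def using connected_continuous_image[OF cA cW] .
  have ZF: "Fin u \<in> Z \<longleftrightarrow> u ~: W1" for u
  proof -
   have "Fin u \<in> A ` (- W) \<longleftrightarrow> B (Fin u) \<in> - W"
   proof
    assume "B (Fin u) \<in> - W"
    thus "Fin u \<in> A ` (- W)" by (rule image_eqI[rotated]) (simp add: BA)
   qed (auto simp: BA)
   thus ?thesis unfolding Z_def W1_def by simp
  qed
  have "Fin ` K = Z Int Fin ` V" unfolding V(2) using ZF by auto
  hence o: "openin (top_of_set Z) (Fin ` K)" using open_Fin_image[OF V(1)] openin_open by blast
  have "compact (Fin ` K)" using compact_continuous_image[OF continuous_on_Fin K(2)] .
  hence "closed (Fin ` K)" by (rule compact_imp_closed)
  moreover have "Fin ` K = Z Int Fin ` K" using \<open>Fin ` K = Z Int Fin ` V\<close> by blast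
  ultimately have "closedin (top_of_set Z) (Fin ` K)" using closedin_closed by blast
  with o Z have "Fin ` K = {} | Fin ` K = Z" unfolding connected_clopen by blast
  moreover have "Fin z \<in> Fin ` K" using zT K(3) by blast
  moreover have "Infty \<in> Z" unfolding Z_def using xy(1) A(2) by (metis ComplI imageI)
  ultimately show False by auto
 qed
 hence "simply_connected W1" using simply_connected_eq_empty_inside[OF W1] conW1 by blast
 then obtain k g where kg: "k holomorphic_on W1" "g holomorphic_on ball 0 1"
   "ALL z:W1. k z \<in> ball 0 1 & g (k z) = z" "ALL z:ball 0 1. g z \<in> W1 & k (g z) = z"
  using Riemann_mapping_theorem[of W1] W1 W(3) `y' ~: W1` W1_im by blast
 define v' where "v' = fin (A v)"
 have v': "v' \<in> W1" "Fin v' = A v" unfolding v'_def W1_im using W(3) AW by (auto simp: Fin_fin)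
 obtain a b where ab: "a (k v') = 0" "b holomorphic_on ball 0 1" "a ` ball 0 1 \<subseteq> ball 0 1" "b ` ball 0 1 \<subseteq> ball 0 1"
   "!!z. z \<in> ball 0 1 ==> a (b z) = z" "!!z. z \<in> ball 0 1 ==> b (a z) = z"
  using ball_biholomorphism_exists[of "k v'"] kg(3) v'(1) by metis
 define th where "th z = B (Fin (g (b z)))" for z
 have b0: "b 0 = k v'" using ab(1,6) kg(3) v'(1) by metis
 have "th 0 = v" unfolding th_def b0 using kg(3) v' BA(1) by metis
 moreover have "disc_map th W" unfolding disc_map_def
 proof (intro conjI)
  have "continuous_on (ball 0 1) (%z. g (b z))"
   by (rule continuous_on_compose2[OF holomorphic_on_imp_continuous_on[OF kg(2)] holomorphic_on_imp_continuous_on[OF ab(2)] ab(4)])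
  thus "continuous_on (ball 0 1) th" unfolding th_def
   by (rule continuous_on_compose2[OF cBF[of UNIV]]) auto
  show "inj_on th (ball 0 1)"
  proof (rule inj_onI)
   fix z w :: complex assume zw: "z \<in> ball 0 1" "w \<in> ball 0 1" "th z = th w"
   hence "g (b z) = g (b w)" unfolding th_def by (metis BA(2) riemann_sphere.inject)
   moreover have "b z \<in> ball 0 1" "b w \<in> ball 0 1" using ab(4) zw by blast+
   ultimately have "b z = b w" using kg(4) by metis
   thus "z = w" using ab(5) zw by metis
  qed
  show "th ` ball 0 1 = W"
  proof
   show "th ` ball 0 1 \<subseteq> W" unfolding th_def using kg(4) ab(4) W1_def by auto
   show "W \<subseteq> th ` ball 0 1"
   proof
    fix w assume w: "w \<in> W"
    define z where "z = fin (A w)"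
    have z: "z \<in> W1" "Fin z = A w" unfolding z_def W1_im using w AW by (auto simp: Fin_fin)
    have kz: "k z \<in> ball 0 1" "g (k z) = z" using kg(3) z(1) by auto
    have "th (a (k z)) = w" unfolding th_def ab(6)[OF kz(1)] kz(2) z(2) BA(1) ..
    thus "w \<in> th ` ball 0 1" using ab(3) kz(1) by (metis image_eqI image_subset_iff)
   qed
  qed
 qed
 ultimately show ?thesis using that by blast
qed

lemma compact_in_unit_disc:
 assumes "compact Q" "Q \<subseteq> ball (0::complex) 1"
 obtains r where "0 < r" "r < 1" "Q \<subseteq> cball 0 r"
proof (cases "Q = {}")
 case True
 thus ?thesis using that[of "1/2"] by simp
next
 case False
 then obtain x where x: "x \<in> Q" "!!y. y \<in> Q ==> norm y <= norm x"
  using continuous_attains_sup[OF assms(1), of norm] continuous_on_norm_id by blast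
 have "norm x < 1" using x(1) assms(2) by auto
 hence "Q \<subseteq> cball 0 ((norm x + 1) / 2)" using x(2) by force
 moreover have "0 < (norm x + 1) / 2 & (norm x + 1) / 2 < 1" using `norm x < 1` norm_ge_zero[of x] by (simp add: add_nonneg_pos)
 ultimately show ?thesis using that by blast
qed

lemma connected_annulus_disc:
 assumes "disc_map th W" "0 < r" "r < 1"
 shows "connected (th ` (ball 0 1 - cball 0 r))" "th ` (ball 0 1 - cball 0 r) ~= {}"
  "th ` (ball 0 1 - cball 0 r) = W - th ` cball 0 r" "compact (th ` cball 0 r)" "th ` cball 0 r \<subseteq> W"
proof -
 have sub: "cball 0 r \<subseteq> ball (0::complex) 1" using assms by auto
 have "connected {x::complex. r < norm (x - 0) & norm (x - 0) < 1}" by (rule connected_annulus) simp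
 moreover have "{x::complex. r < norm (x - 0) & norm (x - 0) < 1} = ball 0 1 - cball 0 r" by auto
 ultimately have c: "connected (ball 0 1 - cball 0 r :: complex set)" by simp
 show "connected (th ` (ball 0 1 - cball 0 r))"
  by (rule connected_continuous_image[OF continuous_on_subset c]) (use assms in "auto simp: disc_map_def")
 have "complex_of_real ((r + 1) / 2) \<in> ball 0 1 - cball 0 r" using assms by (simp add: norm_divide)
 thus "th ` (ball 0 1 - cball 0 r) ~= {}" by blast
 show "th ` (ball 0 1 - cball 0 r) = W - th ` cball 0 r"
  using assms inj_on_image_set_diff[of th "ball 0 1" "ball 0 1" "cball 0 r"] sub by (auto simp: disc_map_def)
 show "compact (th ` cball 0 r)"
  by (rule compact_continuous_image[OF continuous_on_subset compact_cball]) (use assms sub in "auto simp: disc_map_def")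
 show "th ` cball 0 r \<subseteq> W" using assms sub by (auto simp: disc_map_def)
qed

text \<open>The frontier is the decreasing intersection of the closures of images of thin annuli
  along the boundary of the unit disc.\<close>

lemma connected_frontier_disc:
 assumes h: "disc_map h V"
 shows "connected (frontier V)"
proof -
 have oV: "open V" using disc_map_open[OF h open_ball subset_refl] h by (simp add: disc_map_def)
 define r where "r n = 1 - 1 / real (n + 2)" for n :: nat
 have r: "0 < r n" "r n < 1" for n by (auto simp: r_def field_simps)
 define S where "S n = closure (h ` (ball 0 1 - cball 0 (r n)))" for n
 note an = connected_annulus_disc[OF h r]
 have "connected (\<Inter>n. S n)"
 proof (rule connected_nest_sphere)
  show "connected (S n)" for n unfolding S_def using an(1) by (rule connected_imp_connected_closure)
  show "S n \<subseteq> S m" if "m <= n" for m n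
  proof -
   have "r m <= r n" unfolding r_def using that by (simp add: frac_le)
   thus ?thesis unfolding S_def by (intro closure_mono image_mono Diff_mono) auto
  qed
 qed (simp add: S_def)
 moreover have "(\<Inter>n. S n) = frontier V"
 proof
  show "frontier V \<subseteq> (\<Inter>n. S n)"
  proof
   fix y assume "y \<in> frontier V"
   hence y: "y \<in> closure V" "y ~: V" using oV by (auto simp: frontier_def interior_open)
   have "y \<in> S n" for n
   proof -
    have "V = h ` cball 0 (r n) Un h ` (ball 0 1 - cball 0 (r n))" using an(3,5)[of n] by blast
    hence "closure V = h ` cball 0 (r n) Un S n"
     unfolding S_def by (metis closure_Un closure_closed compact_imp_closed an(4))
    thus ?thesis using y an(5)[of n] by blast
   qed
   thus "y \<in> (\<Inter>n. S n)" by blast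
  qed
  show "(\<Inter>n. S n) \<subseteq> frontier V"
  proof
   fix y assume y: "y \<in> (\<Inter>n. S n)"
   have "S 0 \<subseteq> closure V" unfolding S_def using an(3)[of 0] by (intro closure_mono) blast
   moreover have "y ~: V"
   proof
    assume "y \<in> V"
    then obtain z where z: "z \<in> ball 0 1" "y = h z" using h by (auto simp: disc_map_def)
    obtain n where n: "1 / real (n + 2) < 1 - norm z"
    proof -
     have "0 < 1 - norm z" using z(1) by simp
     then obtain k where "inverse (real (Suc k)) < 1 - norm z" using reals_Archimedean by blast
     moreover have "1 / real (k + 2) <= inverse (real (Suc k))" by (simp add: inverse_eq_divide frac_le)
     ultimately show ?thesis by (intro that[of k]) linarith
    qed
    have "z \<in> ball 0 (r n)" using n by (simp add: r_def)
    hence yU: "y \<in> h ` ball 0 (r n)" using z(2) by blast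
    have "open (h ` ball 0 (r n))" using disc_map_open[OF h open_ball] r(2)[of n] by (simp add: subset_ball)
    moreover have "h ` ball 0 (r n) Int h ` (ball 0 1 - cball 0 (r n)) = {}" using an(3)[of n] ball_subset_cball by blast
    ultimately have "h ` ball 0 (r n) Int S n = {}" unfolding S_def by (simp add: open_Int_closure_eq_empty)
    thus False using yU y by blast
   qed
   ultimately show "y \<in> frontier V" using y oV by (auto simp: frontier_def interior_open)
  qed
 qed
 ultimately show ?thesis by simp
qed

text \<open>A nondegenerate continuum: a complement component then omits two points, as the Riemann
  mapping theorem needs.\<close>

definition cont_set :: "riemann_sphere set => bool" where
 "cont_set K \<longleftrightarrow> closed K & connected K & infinite K"

lemma two_points: "infinite K ==> EX x y. x \<in> K & y \<in> K & x ~= y"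
 by (metis finite.emptyI finite.insertI finite_subset insertCI subsetI ex_in_conv)

lemma disc_of:
 assumes K: "cont_set K" and X: "X \<in> components (- K)"
 shows "open X" "connected X" "X ~= {}" "X Int K = {}" "frontier X \<subseteq> K" "frontier X ~= {}" "closure X \<subseteq> X Un K"
  "connected (- X)" "K \<subseteq> - X" "!!v. v \<in> X ==> EX th. disc_map th X & th 0 = v" "connected (X Un K)" "closed (- X)"
proof -
 have K': "closed K" "connected K" "K ~= {}" using K by (auto simp: cont_set_def)
 note c = complement_component[OF K'(1,3) X]
 show "open X" "connected X" "X ~= {}" "X Int K = {}" "frontier X \<subseteq> K" "frontier X ~= {}" using c by auto
 show "closure X \<subseteq> X Un K" using c(5) closure_Un_frontier[of X] by blast
 show nX: "connected (- X)" using connected_complement_component_sphere[OF K'(1,3,2) X] .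
 show "K \<subseteq> - X" using c(4) by blast
 show "connected (X Un K)" using connected_component_Un[OF K'(1,3,2) X] .
 show "closed (- X)" using c(1) by (simp add: closed_Compl)
 obtain x y where xy: "x \<in> K" "y \<in> K" "x ~= y" using two_points[of K] K unfolding cont_set_def by blast
 show "EX th. disc_map th X & th 0 = v" if "v \<in> X" for v
  using riemann_disc[OF c(1,2) that nX, of x y] xy c(4) by blast
qed

lemma disc_eqI:
 assumes "X \<in> components U" "Y \<in> components U" "x \<in> X" "x \<in> Y"
 shows "X = Y" using components_eq[OF assms(1,2)] assms(3,4) by blast

lemma component_containing:
 assumes "connected S" "S \<subseteq> U" "S ~= {}"
 obtains X where "X \<in> components U" "S \<subseteq> X"
proof -
 obtain x where x: "x \<in> S" using assms(3) by blast
 have "connected_component_set U x \<in> components U" using x assms(2) by (auto simp: componentsI)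
 moreover have "S \<subseteq> connected_component_set U x" using connected_component_maximal[OF x assms(1,2)] .
 ultimately show ?thesis using that by blast
qed

text \<open>Enlarging \<open>Q\<close> to the image of a closed concentric disc leaves a connected
  annulus along the boundary of \<open>X\<close>.\<close>

lemma collar:
 assumes K: "cont_set K" and X: "X \<in> components (- K)" and Q: "compact Q" "Q \<subseteq> X"
 obtains Q' where "compact Q'" "Q \<subseteq> Q'" "Q' \<subseteq> X" "connected (X - Q')" "X - Q' ~= {}"
proof -
 obtain th where th: "disc_map th X" using disc_of(3,10)[OF K X] by blast
 obtain eta where eta: "homeomorphism (ball 0 1) X th eta" using disc_map_inverse[OF th] by blast
 have "compact (eta ` Q)" using compact_continuous_image[OF continuous_on_subset[OF homeomorphism_cont2[OF eta] Q(2)] Q(1)] .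
 moreover have "eta ` Q \<subseteq> ball 0 1" using homeomorphism_image2[OF eta] Q(2) by blast
 ultimately obtain r where r: "0 < r" "r < 1" "eta ` Q \<subseteq> cball 0 r" using compact_in_unit_disc by blast
 note a = connected_annulus_disc[OF th r(1,2)]
 have "Q \<subseteq> th ` cball 0 r"
 proof
  fix x assume "x \<in> Q"
  hence "th (eta x) = x" "eta x \<in> cball 0 r" using homeomorphism_apply2[OF eta] Q(2) r(3) by auto
  thus "x \<in> th ` cball 0 r" by (metis imageI)
 qed
 thus ?thesis using that[of "th ` cball 0 r"] a by auto
qed

section \<open>The map induced on complementary discs\<close>

locale ratd =
 fixes f :: "riemann_sphere => riemann_sphere" and d :: nat
 assumes rat: "rational_map_of_degree f d" and d2: "d >= 2"
begin

lemma d1: "d >= 1" using d2 by simp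

lemma cont: "continuous_on S f" using rational_continuous[OF rat] .

lemma fimage_closed: "closed K ==> closed (f ` K)"
 using compact_continuous_image[OF cont] compact_sphere_iff by blast

lemma fimage_infinite: "infinite K ==> infinite (f ` K)"
proof
 assume "infinite K" "finite (f ` K)"
 hence "finite (\<Union>y\<in>f ` K. f -` {y})" using rational_fiber(1)[OF rat d1] by blast
 moreover have "K \<subseteq> (\<Union>y\<in>f ` K. f -` {y})" by auto
 ultimately show False using `infinite K` finite_subset by blast
qed

lemma cont_set_image: "cont_set K ==> cont_set (f ` K)"
 unfolding cont_set_def using fimage_closed fimage_infinite connected_continuous_image[OF cont] by blast

lemma closed_vimage_f: "closed S ==> closed (f -` S)" using closed_vimage[OF _ cont] by blast

lemma finite_components_preimage:
 assumes "closed L" "connected L" "L ~= {}"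
 shows "finite (components (f -` L))"
proof -
 obtain y where y: "y \<in> L" using assms(3) by blast
 have "EX x. x \<in> C & f x = y" if "C \<in> components (f -` L)" for C
  using component_preimage_onto[OF rat d1 assms(1,2) that] y by (metis imageE)
 then obtain w where w: "!!C. C \<in> components (f -` L) ==> w C \<in> C & f (w C) = y" by metis
 have "inj_on w (components (f -` L))" by (rule inj_onI) (metis disc_eqI w)
 moreover have "w ` components (f -` L) \<subseteq> f -` {y}" using w by auto
 ultimately show ?thesis using rational_fiber(1)[OF rat d1] inj_on_finite by blast
qed

definition "cov K \<longleftrightarrow> cont_set K & K \<in> components (f -` f ` K)"

text \<open>The disc that receives the part of \<open>X\<close> near its boundary. A compact set is
  discarded, because the image of all of \<open>X\<close> may cross the image of
  \<open>K\<close>.\<close>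

definition "star K X W \<longleftrightarrow> W \<in> components (- f ` K) &
  (EX Q. compact Q & Q \<subseteq> X & connected (X - Q) & X - Q ~= {} & f ` (X - Q) \<subseteq> W)"

text \<open>The preimage of the image of \<open>K\<close> has finitely many components, so those
  other than \<open>K\<close> meet \<open>X\<close> in a compact set. A collar avoiding it has a
  connected image off the image of \<open>K\<close>.\<close>

lemma star_exists:
 assumes K: "cov K" and X: "X \<in> components (- K)"
 shows "EX W. star K X W"
proof -
 have cK: "cont_set K" "K \<in> components (f -` f ` K)" using K by (auto simp: cov_def)
 note X' = disc_of[OF cK(1) X]
 define M where "M = f -` f ` K"
 have fK: "closed (f ` K)" "connected (f ` K)" "f ` K ~= {}"
  using cont_set_image[OF cK(1)] by (auto simp: cont_set_def)
 have "closed M" unfolding M_def using closed_vimage_f fK(1) by blast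
 define L where "L = \<Union>(components M - {K})"
 have "closed L" unfolding L_def
  using finite_components_preimage[OF fK] closed_components[OF `closed M`] by (intro closed_Union) (auto simp: M_def)
 have LK: "L Int K = {}" unfolding L_def using components_nonoverlap cK(2) unfolding M_def by blast
 have Meq: "M = L Un K" unfolding L_def using Union_components[of M] cK(2) unfolding M_def by blast
 have "X Int M = closure X Int L" using Meq LK X'(4,7) closure_subset[of X] by blast
 hence "compact (X Int M)" using `closed L` compact_sphere_iff by (simp add: closed_Int)
 then obtain Q where Q: "compact Q" "X Int M \<subseteq> Q" "Q \<subseteq> X" "connected (X - Q)" "X - Q ~= {}"
  using collar[OF cK(1) X] by (metis inf_le1)
 have "connected (f ` (X - Q))" using connected_continuous_image[OF cont Q(4)] .
 moreover have "f ` (X - Q) \<subseteq> - f ` K"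
 proof
  fix y assume "y \<in> f ` (X - Q)"
  then obtain x where x: "x \<in> X - Q" "y = f x" by blast
  hence "x ~: M" using Q(2) by blast
  thus "y \<in> - f ` K" unfolding M_def x(2) by simp
 qed
 ultimately obtain W where "W \<in> components (- f ` K)" "f ` (X - Q) \<subseteq> W"
  using component_containing[of "f ` (X - Q)"] Q(5) by blast
 thus ?thesis unfolding star_def using Q by blast
qed

definition "st K X = (SOME W. star K X W)"

lemma st_star: "cov K ==> X \<in> components (- K) ==> star K X (st K X)"
 unfolding st_def using someI_ex[OF star_exists] .

lemma st_component: "cov K ==> X \<in> components (- K) ==> st K X \<in> components (- f ` K)"
 using st_star[of K X] unfolding star_def by blast

lemma cov_image: "cov K ==> cont_set K" "cov K ==> cont_set (f ` K)"
 unfolding cov_def using cont_set_image by blast+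

lemma st_collar:
 assumes K: "cov K" and X: "X \<in> components (- K)" and Q0: "compact Q0" "Q0 \<subseteq> X"
 obtains Q where "compact Q" "Q0 \<subseteq> Q" "Q \<subseteq> X" "connected (X - Q)" "X - Q ~= {}" "f ` (X - Q) \<subseteq> st K X"
proof -
 obtain Q1 where Q1: "compact Q1" "Q1 \<subseteq> X" "f ` (X - Q1) \<subseteq> st K X" using st_star[OF K X] unfolding star_def by blast
 obtain Q where Q: "compact Q" "Q0 Un Q1 \<subseteq> Q" "Q \<subseteq> X" "connected (X - Q)" "X - Q ~= {}"
  using collar[OF cov_image(1)[OF K] X compact_Un[OF Q0(1) Q1(1)]] Q0(2) Q1(2) by (metis Un_least)
 thus ?thesis using that[of Q] Q1(3) by blast
qed

lemma st_eqI:
 assumes K: "cov K" and X: "X \<in> components (- K)" and W: "W \<in> components (- f ` K)"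
  and Q0: "compact Q0" "Q0 \<subseteq> X" "f ` (X - Q0) \<subseteq> W"
 shows "st K X = W"
proof -
 obtain Q where Q: "Q0 \<subseteq> Q" "X - Q ~= {}" "f ` (X - Q) \<subseteq> st K X" using st_collar[OF K X Q0(1,2)] by metis
 then obtain x where "x \<in> X - Q" "f x \<in> st K X" "f x \<in> W" using Q0(3) by blast
 thus ?thesis using disc_eqI[OF st_component[OF K X] W] by blast
qed

text \<open>The part of the target disc covered by \<open>X\<close> is relatively open, and
  relatively closed because the boundary of \<open>X\<close> is mapped into the image of
  \<open>K\<close>.\<close>

lemma st_subset:
 assumes K: "cov K" and X: "X \<in> components (- K)"
 shows "st K X \<subseteq> f ` X"
proof -
 define W where "W = st K X"
 note W = disc_of[OF cov_image(2)[OF K] st_component[OF K X], folded W_def]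
 note X' = disc_of[OF cov_image(1)[OF K] X]
 have o: "openin (top_of_set W) (W Int f ` X)"
  using rational_open[OF rat d1 X'(1)] by (auto simp: openin_open)
 have "W Int f ` X = W Int f ` closure X" using X'(7) W(4) closure_subset[of X] by blast
 moreover have "closed (f ` closure X)" by (rule fimage_closed) simp
 ultimately have c: "closedin (top_of_set W) (W Int f ` X)" by (metis closedin_closed_Int)
 obtain Q where Q: "X - Q ~= {}" "f ` (X - Q) \<subseteq> W" using st_star[OF K X] unfolding star_def W_def by blast
 hence "W Int f ` X ~= {}" by blast
 with o c have "W Int f ` X = W" using W(2) unfolding connected_clopen by blast
 thus ?thesis unfolding W_def by blast
qed

lemma st_image:
 assumes K: "cov K" and X: "X \<in> components (- K)" and fX: "f ` X Int f ` K = {}"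
 shows "f ` X = st K X"
proof
 show "st K X \<subseteq> f ` X" using st_subset[OF K X] .
 have "connected (f ` X)" "f ` X ~= {}"
  using disc_of(2,3)[OF cov_image(1)[OF K] X] connected_continuous_image[OF cont] by auto
 then obtain W where W: "W \<in> components (- f ` K)" "f ` X \<subseteq> W"
  using component_containing[of "f ` X" "- f ` K"] fX by blast
 hence "st K X = W" using st_eqI[OF K X W(1), of "{}"] by simp
 thus "f ` X \<subseteq> st K X" using W(2) by simp
qed

lemma lift_homeomorphic:
 assumes th: "disc_map th W" and cv: "W Int crit_values f = {}" and x: "f x \<in> W" "f x = th z0" "z0 \<in> ball 0 1"
 obtains h where "disc_map h (h ` ball 0 1)" "h z0 = x" "!!z. z \<in> ball 0 1 ==> f (h z) = th z"
proof -
 have t: "continuous_on (ball 0 1) th" "th ` ball 0 1 Int crit_values f = {}" "inj_on th (ball 0 1)"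
  using th cv by (auto simp: disc_map_def)
 obtain h where h: "continuous_on (ball 0 1) h" "h z0 = x" "!!z. z \<in> ball 0 1 ==> f (h z) = th z"
  using lift_exists[OF rat d1 convex_ball x(3) t(1,2) x(2)] by metis
 have "inj_on h (ball 0 1)" by (rule inj_onI) (metis h(3) t(3) inj_onD)
 hence "disc_map h (h ` ball 0 1)" using h(1) by (simp add: disc_map_def)
 thus ?thesis using that h by blast
qed

text \<open>The target disc is lifted through \<open>f\<close> from a point near the boundary of
  \<open>X\<close>. The lift \<open>V\<close> lies in \<open>X\<close>; its frontier is connected,
  touches \<open>K\<close> and is mapped into the image of \<open>K\<close>, so it lies in the
  component \<open>K\<close>, and \<open>V = X\<close>.\<close>

lemma st_bij:
 assumes K: "cov K" and X: "X \<in> components (- K)" and cv: "st K X Int crit_values f = {}"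
 shows "f ` X = st K X" "inj_on f X"
proof -
 define W where "W = st K X"
 note Wc = st_component[OF K X, folded W_def]
 note W = disc_of[OF cov_image(2)[OF K] Wc]
 note X' = disc_of[OF cov_image(1)[OF K] X]
 obtain Q where Q: "compact Q" "Q \<subseteq> X" "connected (X - Q)" "X - Q ~= {}" "f ` (X - Q) \<subseteq> W"
  using st_star[OF K X] unfolding star_def W_def by blast
 obtain x0 where x0: "x0 \<in> X - Q" using Q(4) by blast
 hence fx0: "f x0 \<in> W" using Q(5) by blast
 obtain th where th: "disc_map th W" "th 0 = f x0" using W(10)[OF fx0] by blast
 obtain eta where eta: "homeomorphism (ball 0 1) W th eta" using disc_map_inverse[OF th(1)] by blast
 obtain h where h: "disc_map h (h ` ball 0 1)" "h 0 = x0" "!!z. z \<in> ball 0 1 ==> f (h z) = th z"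
  using lift_homeomorphic[OF th(1) cv[folded W_def] fx0, of 0] th(2) by auto
 define V where "V = h ` ball 0 1"
 have hc: "continuous_on (ball 0 1) h" using h(1) by (simp add: disc_map_def)
 have V: "open V" "connected V" "x0 \<in> V"
  unfolding V_def using disc_map_open[OF h(1) open_ball subset_refl] connected_continuous_image[OF hc connected_ball] h(2)
  by (auto intro: image_eqI[of _ _ 0])
 have fV: "f ` V = W" using image_cong[OF refl h(3), of "ball 0 1" "%x. x"] th(1) unfolding V_def image_image disc_map_def by simp
 have "V Int K = {}" using fV W(4) by blast
 hence VX: "V \<subseteq> X" using components_maximal[OF X V(2)] V(3) x0 by blast
 have clfV: "f ` closure V \<subseteq> closure W"
  by (rule image_closure_subset[OF cont]) (use fV closure_subset[of W] in auto)
 \<comment> \<open>Properness: a frontier point over the target disc would be a limit of lifted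
   points whose parameters converge, hence itself a lifted point.\<close>
 have fr: "f y \<in> f ` K" if y: "y \<in> frontier V" for y
 proof -
  have y': "y \<in> closure V" "y ~: V" using y V(1) by (auto simp: frontier_def interior_open)
  have "f y ~: W"
  proof
   assume fy: "f y \<in> W"
   define z0 where "z0 = eta (f y)"
   have z0: "z0 \<in> ball 0 1" "th z0 = f y"
    using homeomorphism_image2[OF eta] homeomorphism_apply2[OF eta] fy unfolding z0_def by blast+
   have "y = h z0"
   proof (rule ccontr)
    assume ne: "y ~= h z0"
    obtain A B where AB: "open A" "open B" "y \<in> A" "h z0 \<in> B" "A Int B = {}" using hausdorff[OF ne] by metis
    define T where "T = ball 0 1 Int h -` B"
    have T: "open T" "z0 \<in> T" unfolding T_def using continuous_open_preimage[OF hc open_ball AB(2)] z0 AB(4) by auto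
    have "open (th ` T)" using disc_map_open[OF th(1) T(1)] by (simp add: T_def)
    hence "open (A Int f -` (th ` T))" using AB(1) open_vimage[OF _ cont] by blast
    moreover have "y \<in> A Int f -` (th ` T)" using AB(3) T(2) z0(2)[symmetric] by auto
    ultimately obtain v where v: "v \<in> V" "v \<in> A" "f v \<in> th ` T"
     using y'(1) unfolding closure_iff_nhds_not_empty by blast
    then obtain z t where zt: "z \<in> ball 0 1" "v = h z" "t \<in> T" "f v = th t" unfolding V_def by blast
    have "th z = th t" using h(3)[OF zt(1)] zt by simp
    hence "z = t" using th(1) zt(1,3) unfolding disc_map_def T_def by (auto dest: inj_onD)
    thus False using v(2) zt AB(5) by (auto simp: T_def)
   qed
   thus False using y'(2) z0(1) by (simp add: V_def)
  qed
  moreover have "f y \<in> closure W" using clfV y'(1) by blast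
  ultimately show ?thesis using W(7) by blast
 qed
 have con: "connected (frontier V)" by (rule connected_frontier_disc[OF h(1)[folded V_def]])
 have QV: "X - Q \<subseteq> V"
 proof (rule ccontr)
  assume "~ X - Q \<subseteq> V"
  hence "(X - Q) Int frontier V ~= {}" using connected_Int_frontier[OF Q(3), of V] x0 V(3) by blast
  thus False using fr Q(5) W(4) by blast
 qed
 \<comment> \<open>\<open>k\<close> lies in \<open>K\<close> and is approached from the collar, so
   the frontier of \<open>V\<close> touches \<open>K\<close>.\<close>
 obtain k where k: "k \<in> frontier X" using X'(6) by blast
 have kX: "k \<in> closure X" "k ~: X" "k \<in> K" using k X'(1,5) by (auto simp: frontier_def interior_open)
 have "closure X \<subseteq> Q Un closure (X - Q)"
  by (metis Q(1,2) Un_Diff_cancel closure_Un closure_closed compact_imp_closed order_refl Un_absorb1)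
 hence "k \<in> closure V" using kX Q(2) QV closure_mono[of "X - Q" V] by blast
 hence kV: "k \<in> frontier V" using kX(2) VX V(1) by (auto simp: frontier_def interior_open)
 have "frontier V \<subseteq> K"
  using components_maximal[of K "f -` f ` K" "frontier V"] K con fr kV kX(3) unfolding cov_def by blast
 hence "X Int frontier V = {}" using X'(4) by blast
 hence "V = X" using connected_Int_frontier[OF X'(2), of V] VX x0 V(3) by blast
 thus "f ` X = st K X" using fV W_def by simp
 show "inj_on f X"
 proof (rule inj_onI)
  fix x y assume xy: "x \<in> X" "y \<in> X" "f x = f y"
  then obtain z w where zw: "z \<in> ball 0 1" "x = h z" "w \<in> ball 0 1" "y = h w" using `V = X` unfolding V_def by blast
  hence "th z = th w" using xy(3) h(3) by metis
  thus "x = y" using th(1) zw unfolding disc_map_def by (auto dest: inj_onD)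
 qed
qed

text \<open>Together with \<open>K\<close>, the collars of the finitely many discs form an open
  neighbourhood \<open>N\<close> of \<open>K\<close>; its image is open and meets \<open>W\<close>
  near a frontier point of \<open>W\<close>.\<close>

lemma st_surj:
 assumes K: "cov K" and fin: "finite (components (- K))" and W: "W \<in> components (- f ` K)"
 shows "EX X:components (- K). st K X = W"
proof -
 define Q where "Q X = (SOME Q. compact Q & Q \<subseteq> X & f ` (X - Q) \<subseteq> st K X)" for X
 have Q: "compact (Q X) & Q X \<subseteq> X & f ` (X - Q X) \<subseteq> st K X" if "X \<in> components (- K)" for X
  unfolding Q_def by (rule someI_ex) (use st_star[OF K that] in "auto simp: star_def")
 define N where "N = - (\<Union>X\<in>components (- K). Q X)"
 have "compact (\<Union>X\<in>components (- K). Q X)" using fin Q by blast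
 hence N: "open N" unfolding N_def using compact_imp_closed by blast
 have KN: "K \<subseteq> N" unfolding N_def using Q disc_of(4)[OF cov_image(1)[OF K]] by blast
 note W' = disc_of[OF cov_image(2)[OF K] W]
 obtain y where y: "y \<in> frontier W" using W'(6) by blast
 hence "y \<in> f ` N" "y \<in> closure W" using W'(5) KN by (auto simp: frontier_def)
 then obtain w where "w \<in> W" "w \<in> f ` N" using rational_open[OF rat d1 N] closure_iff_nhds_not_empty by blast
 then obtain x where x: "x \<in> N" "f x \<in> W" by blast
 hence "x ~: K" using W'(4) by blast
 then obtain X where X: "X \<in> components (- K)" "x \<in> X" by (metis ComplI Union_components UnionE)
 hence "f x \<in> st K X" using Q[OF X(1)] x(1) unfolding N_def by blast
 hence "st K X = W" using disc_eqI[OF st_component[OF K X(1)] W] x(2) by blast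
 thus ?thesis using X(1) by blast
qed

end

section \<open>Branched pull-backs\<close>

lemma in_some_component: "x \<in> U ==> EX D:components U. x \<in> D"
 by (metis Union_components UnionE)

lemma sphere_nest:
 fixes F :: "nat => riemann_sphere set"
 assumes F: "!!n. closed (F n)" "!!n. F n ~= {}" "!!m n. m <= n ==> F n \<subseteq> F m"
 shows "(\<Inter>n. F n) ~= {}"
proof -
 have "(\<Inter>n. stereo ` F n) ~= {}"
 proof (rule compact_nest)
  show "compact (stereo ` F n)" for n
   by (rule compact_continuous_image[OF continuous_on_stereo compact_sphere_iff[THEN iffD2, OF F(1)]])
  show "stereo ` F n \<subseteq> stereo ` F m" if "m <= n" for m n using F(3)[OF that] by (rule image_mono)
 qed (use F(2) in simp)
 then obtain y where y: "y \<in> (\<Inter>n. stereo ` F n)" unfolding ex_in_conv[symmetric] by (erule exE)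
 then obtain x where x: "y = stereo x" by (meson INT_D UNIV_I imageE)
 have "x \<in> F n" for n using INT_D[OF y, of n] inj_image_mem_iff[OF inj_stereo] unfolding x by simp
 thus ?thesis by blast
qed

text \<open>The power as a rational map, so that \<open>component_preimage_onto\<close> applies to
  preimages under it.\<close>

lemma pow_map:
 assumes "n >= 1"
 obtains g where "rational_map_of_degree g n" "!!z. g (Fin z) = Fin (z ^ n)" "g Infty = Infty"
proof -
 have r: "ratl (monom 1 n) 1 n" using assms by (auto simp: ratl_def degree_monom_eq)
 have "coeff (1 :: complex poly) n = 0" using assms by (simp add: coeff_eq_0)
 hence "rational_map (monom 1 n) 1 Infty = Infty" using rational_map_Infty[OF r] by simp
 moreover have "rational_map (monom 1 n) 1 (Fin z) = Fin (z ^ n)" for z by (simp add: poly_monom)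
 moreover have "rational_map_of_degree (rational_map (monom 1 n) 1) n" using r rational_map_of_degree_iff by blast
 ultimately show ?thesis using that by blast
qed

text \<open>The composition of \<open>th\<close> with the exponential of the left half plane is
  lifted through \<open>f\<close>. Translations by multiples of \<open>2 * pi * i\<close> that
  preserve the lift form the group generated by \<open>dl\<close> times \<open>2 * pi * i\<close>;
  it is nontrivial because fibres have at most \<open>d\<close> points.\<close>

lemma (in ratd) exp_lift:
 assumes th: "disc_map th W" and cv: "W Int crit_values f \<subseteq> {th 0}" and x: "f x = th z0" "z0 \<in> ball 0 1" "z0 ~= 0"
 shows "EX dl h. dl >= 1 & continuous_on {w. Re w < 0} h & (ALL w. Re w < 0 --> f (h w) = th (exp w)) &
  (EX w. Re w < 0 & h w = x) & (ALL w j. Re w < 0 --> h (w + of_int (int dl * j) * (2 * pi * \<i>)) = h w) &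
  (ALL w1 w2. Re w1 < 0 --> Re w2 < 0 --> h w1 = h w2 --> (EX j. w1 = w2 + of_int (int dl * j) * (2 * pi * \<i>)))"
proof -
 define H where "H = {w::complex. Re w < 0}"
 have H: "convex H" unfolding H_def by (rule convex_halfspace_Re_lt)
 have eb: "exp w \<in> ball 0 1" if "w \<in> H" for w using that by (simp add: H_def)
 have t: "continuous_on (ball 0 1) th" "inj_on th (ball 0 1)" "th ` ball 0 1 = W" using th by (auto simp: disc_map_def)
 have gc: "continuous_on H (%w. th (exp w))"
  by (rule continuous_on_compose2[OF t(1)]) (use eb in "auto intro!: continuous_intros")
 have ncv: "th (exp w) ~: crit_values f" if "w \<in> H" for w
 proof
  assume "th (exp w) \<in> crit_values f"
  hence "th (exp w) = th 0" using cv eb[OF that] t(3) by blast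
  from inj_onD[OF t(2) this eb[OF that]] show False by simp
 qed
 define w0 where "w0 = Ln z0"
 have w0: "exp w0 = z0" "w0 \<in> H" unfolding w0_def H_def using x(2,3) by (simp_all add: Re_Ln)
 obtain h where h: "continuous_on H h" "h w0 = x" "!!w. w \<in> H ==> f (h w) = th (exp w)"
 proof -
  have 1: "(%w. th (exp w)) ` H Int crit_values f = {}" using ncv by auto
  have 2: "f x = th (exp w0)" using w0(1) x(1) by simp
  show thesis using lift_exists[OF rat d1 H w0(2) gc 1 2] that by metis
 qed
 have lifh: "lif f (h w)" if "w \<in> H" for w
 proof (rule ccontr)
  assume "~ lif f (h w)"
  hence "f (h w) \<in> crit_values f" unfolding crit_values_def by blast
  thus False using ncv[OF that] h(3)[OF that] by simp
 qed
 define sh where "sh n w = w + of_int n * (2 * pi * \<i>)" for n :: int and w :: complex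
 have shH: "sh n w \<in> H" "exp (sh n w) = exp w" if "w \<in> H" for n w
  using that exp_integer_2pi[of "of_int n"] unfolding sh_def H_def by (simp_all add: exp_add mult_ac)
 define Pi where "Pi n \<longleftrightarrow> (ALL w:H. h (sh n w) = h w)" for n
 \<comment> \<open>By uniqueness of lifts, a translation that preserves \<open>h\<close> at one
   point preserves it everywhere.\<close>
 have uniq: "Pi n" if "w1 \<in> H" "h (sh n w1) = h w1" for n w1 unfolding Pi_def
 proof
  fix w assume w: "w \<in> H"
  show "h (sh n w) = h w"
  proof (rule lift_unique[where ?h1.0 = "%w. h (sh n w)" and ?h2.0 = h, OF convex_connected[OF H] _ h(1) _ _ that w])
   show "continuous_on H (%w. h (sh n w))"
    by (rule continuous_on_compose2[OF h(1)]) (use shH(1) in "auto simp: sh_def intro!: continuous_intros")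
   show "f (h (sh n w)) = f (h w)" if "w \<in> H" for w using h(3) shH that by metis
   show "lif f (h (sh n w))" if "w \<in> H" for w using lifh shH(1) that by blast
  qed
 qed
 have padd: "Pi (m + n)" if "Pi m" "Pi n" for m n
 proof -
  have "sh (m + n) w = sh m (sh n w)" for w by (simp add: sh_def algebra_simps)
  thus ?thesis using that shH(1) unfolding Pi_def by metis
 qed
 have pneg: "Pi (- m)" if "Pi m" for m
 proof -
  have "sh m (sh (- m) w) = w" for w by (simp add: sh_def)
  thus ?thesis using that shH(1) unfolding Pi_def by metis
 qed
 have p0: "Pi 0" by (simp add: Pi_def sh_def)
 have "EX k>0. Pi (int k)"
 proof -
  have "~ inj_on (%k. h (sh (int k) w0)) {..d}"
  proof
   assume inj: "inj_on (%k. h (sh (int k) w0)) {..d}"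
   have "(%k. h (sh (int k) w0)) ` {..d} \<subseteq> f -` {f x}" using h(2,3) shH w0(2) by auto
   hence "card {..d} <= card (f -` {f x})" using card_inj_on_le[OF inj] rational_fiber(1)[OF rat d1] by blast
   thus False using rational_fiber(2)[OF rat d1, of "f x"] by simp
  qed
  then obtain k l where kl: "k ~= l" "h (sh (int k) w0) = h (sh (int l) w0)" unfolding inj_on_def by blast
  have *: "Pi (int (l - k))" if "k < l" "h (sh (int k) w0) = h (sh (int l) w0)" for k l
  proof (rule uniq)
   show "sh (int k) w0 \<in> H" using shH w0 by blast
   have "sh (int (l - k)) (sh (int k) w0) = sh (int l) w0" using that(1) by (simp add: sh_def of_nat_diff algebra_simps)
   thus "h (sh (int (l - k)) (sh (int k) w0)) = h (sh (int k) w0)" using that(2) by simp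
  qed
  show ?thesis using *[of k l] *[of l k] kl by (metis linorder_neqE_nat zero_less_diff)
 qed
 define dl where "dl = (LEAST k. k > 0 & Pi (int k))"
 have dl: "dl > 0" "Pi (int dl)" "!!k. k > 0 ==> Pi (int k) ==> dl <= k"
  unfolding dl_def using LeastI_ex[OF `EX k>0. Pi (int k)`] Least_le by (auto intro: Least_le)
 have pnat: "Pi (int dl * int k)" for k by (induction k) (auto simp: p0 algebra_simps intro: padd dl(2))
 have pmul: "Pi (int dl * j)" for j
 proof (cases "j >= 0")
  case True
  thus ?thesis using pnat[of "nat j"] by simp
 next
  case False
  thus ?thesis using pneg[OF pnat[of "nat (- j)"]] by simp
 qed
 have pdvd: "int dl dvd n" if "Pi n" for n
 proof -
  have "Pi (n mod int dl)"
   using padd[OF that pmul[of "- (n div int dl)"]] by (simp add: minus_mult_div_eq_mod)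
  hence "Pi (int (nat (n mod int dl)))" using dl(1) by simp
  hence "nat (n mod int dl) = 0" using dl(3)[of "nat (n mod int dl)"] dl(1)
   by (metis gr0I leD of_nat_0_less_iff pos_mod_bound nat_less_iff pos_mod_sign)
  hence "n mod int dl = 0" using dl(1) by (metis nat_0_iff of_nat_0_less_iff order_antisym pos_mod_sign)
  thus ?thesis by presburger
 qed
 show ?thesis
 proof (intro exI[of _ dl] exI[of _ h] conjI allI impI)
  show "dl >= 1" using dl(1) by simp
  show "continuous_on {w. Re w < 0} h" using h(1) by (simp add: H_def)
  show "f (h w) = th (exp w)" if "Re w < 0" for w using h(3) that by (simp add: H_def)
  show "EX w. Re w < 0 & h w = x" using w0(2) h(2) by (auto simp: H_def)
  show "h (w + of_int (int dl * j) * (2 * pi * \<i>)) = h w" if "Re w < 0" for w j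
   using pmul[of j] that unfolding Pi_def sh_def H_def by blast
  show "EX j. w1 = w2 + of_int (int dl * j) * (2 * pi * \<i>)" if w: "Re w1 < 0" "Re w2 < 0" "h w1 = h w2" for w1 w2
  proof -
   have wH: "w1 \<in> H" "w2 \<in> H" using w by (auto simp: H_def)
   have "th (exp w1) = th (exp w2)" using h(3) wH w(3) by metis
   hence "exp w1 = exp w2" using inj_onD[OF t(2)] eb wH by blast
   then obtain n :: int where n: "w1 = w2 + (of_int (2 * n) * pi) * \<i>" unfolding exp_eq by blast
   hence ws: "w1 = sh n w2" by (simp add: sh_def mult_ac)
   hence "Pi n" using uniq[OF wH(2)] w(3) by simp
   then obtain j where "n = int dl * j" using pdvd by blast
   thus ?thesis using ws unfolding sh_def by blast
  qed
 qed
qed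

text \<open>A branched version of the lifting lemma: over a disc with at most one critical value, placed at its
 centre, the map looks like a power.\<close>

lemma (in ratd) branched_lift:
 assumes th: "disc_map th W" and cv: "W Int crit_values f \<subseteq> {th 0}" and x: "f x = th z0" "z0 \<in> ball 0 1"
  and z0: "z0 ~= 0 | W Int crit_values f = {}"
 obtains dl G where "dl >= 1" "disc_map G (G ` ball 0 1)" "!!z. z \<in> ball 0 1 ==> f (G z) = th (z ^ dl)"
  "x \<in> G ` ball 0 1" "W Int crit_values f = {} ==> dl = 1"
proof (cases "W Int crit_values f = {}")
 case True
 have "f x \<in> W" using x th by (auto simp: disc_map_def)
 then obtain h where "disc_map h (h ` ball 0 1)" "h z0 = x" "!!z. z \<in> ball 0 1 ==> f (h z) = th z"
  using lift_homeomorphic[OF th True _ x] by metis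
 thus ?thesis using that[of 1 h] x(2) by auto
next
 case False
 hence "z0 ~= 0" using z0 by blast
 then obtain dl h where dl: "dl >= 1" and h: "continuous_on {w. Re w < 0} h" "!!w. Re w < 0 ==> f (h w) = th (exp w)"
  "EX w. Re w < 0 & h w = x" and per: "!!w j. Re w < 0 ==> h (w + of_int (int dl * j) * (2 * pi * \<i>)) = h w"
  and hinj: "!!w1 w2. Re w1 < 0 ==> Re w2 < 0 ==> h w1 = h w2 ==> EX j. w1 = w2 + of_int (int dl * j) * (2 * pi * \<i>)"
  using exp_lift[OF th cv x `z0 ~= 0`]
  by (elim exE conjE) (rule that, assumption, assumption, blast, blast, blast, blast)
 have t: "continuous_on (ball 0 1) th" "inj_on th (ball 0 1)" "th ` ball 0 1 = W" using th by (auto simp: disc_map_def)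
 \<comment> \<open>Independent of the branch of the logarithm, since changing it moves the argument
   of \<open>h\<close> by a period.\<close>
 define G0 where "G0 z = h (of_nat dl * Ln z)" for z
 have Re: "Re (of_nat dl * Ln z) < 0" if "z \<in> ball 0 1" "z ~= 0" for z
  using that dl by (simp add: Re_Ln mult_less_0_iff)
 have G0e: "G0 z = h (of_nat dl * w)" if "Re w < 0" "exp w = z" for w z
 proof -
  have "exp w = exp (Ln z)" using that(2) by auto
  then obtain n :: int where n: "w = Ln z + (of_int (2 * n) * pi) * \<i>" unfolding exp_eq by blast
  have z: "z \<in> ball 0 1" "z ~= 0" using that by auto
  have "of_nat dl * w = of_nat dl * Ln z + of_int (int dl * n) * (2 * pi * \<i>)" unfolding n by (simp add: algebra_simps)
  thus ?thesis unfolding G0_def using per[OF Re[OF z]] by simp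
 qed
 have fG0: "f (G0 z) = th (z ^ dl)" if "z \<in> ball 0 1" "z ~= 0" for z
  unfolding G0_def h(2)[OF Re[OF that]] exp_of_nat_mult using that by simp
 have G0c: "continuous_on (ball 0 1 - {0}) G0"
 proof -
  \<comment> \<open>Two slit discs cover the punctured disc; on \<open>S2\<close> a logarithm with
    its cut on the positive axis is used.\<close>
  define S1 where "S1 = ball (0::complex) 1 Int - \<real>\<^sub>\<le>\<^sub>0"
  define S2 where "S2 = ball (0::complex) 1 Int - \<real>\<^sub>\<ge>\<^sub>0"
  have "z \<in> ball 0 1 & z ~= 0" if "z \<in> S1" for z using that by (auto simp: S1_def)
  hence "(%z. of_nat dl * Ln z) ` S1 \<subseteq> {w. Re w < 0}" using Re by blast
  moreover have "continuous_on S1 (%z. of_nat dl * Ln z)" by (intro continuous_intros) (auto simp: S1_def)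
  ultimately have 1: "continuous_on S1 G0" unfolding G0_def by (intro continuous_on_compose2[OF h(1)])
  have "continuous_on S2 (%z. h (of_nat dl * (Ln (- z) + \<i> * pi)))"
  proof (rule continuous_on_compose2[OF h(1)])
   have neg: "- z ~: \<real>\<^sub>\<le>\<^sub>0" if "z \<in> S2" for z
    using that complex_nonneg_Reals_iff[of z] complex_nonpos_Reals_iff[of "- z"] by (simp add: S2_def)
   thus "continuous_on S2 (%z. of_nat dl * (Ln (- z) + \<i> * pi))" by (intro continuous_intros) auto
   have "Re (of_nat dl * (Ln (- z) + \<i> * pi)) < 0" if "z \<in> S2" for z
   proof -
    have z: "- z \<in> ball 0 1" "- z ~= 0" using that by (auto simp: S2_def)
    show ?thesis using Re[OF z] z(2) by (simp add: distrib_left)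
   qed
   thus "(%z. of_nat dl * (Ln (- z) + \<i> * pi)) ` S2 \<subseteq> {w. Re w < 0}" by blast
  qed
  moreover have "h (of_nat dl * (Ln (- z) + \<i> * pi)) = G0 z" if "z \<in> S2" for z
  proof -
   have z: "z ~= 0" "z \<in> ball 0 1" using that by (auto simp: S2_def)
   have "Re (Ln (- z) + \<i> * pi) < 0" using z by (simp add: Re_Ln)
   moreover have "exp (Ln (- z) + \<i> * pi) = z" using z by (simp add: exp_add exp_pi_i')
   ultimately show ?thesis by (rule G0e[symmetric])
  qed
  ultimately have 2: "continuous_on S2 G0" by (subst continuous_on_cong[OF refl, of S2 G0, symmetric]) auto
  have op: "open S1" "open S2" unfolding S1_def S2_def
   using open_Int[OF open_ball open_Compl[OF closed_nonpos_Reals_complex]] open_Int[OF open_ball open_Compl[OF closed_nonneg_Reals_complex]] by blast+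
  have "continuous_on (S1 Un S2) G0" by (rule continuous_on_open_Un[OF op 1 2])
  moreover have "ball 0 1 - {0} \<subseteq> S1 Un S2"
   by (auto simp: S1_def S2_def complex_nonpos_Reals_iff complex_nonneg_Reals_iff complex_eq_iff)
  ultimately show ?thesis using continuous_on_subset by blast
 qed
 define rr where "rr n = 1 / real (n + 2)" for n
 have rr: "0 < rr n" "rr n < 1" for n by (auto simp: rr_def)
 \<comment> \<open>The cluster set of \<open>G0\<close> at 0 is a nested intersection of continua,
   hence connected, and lies in the finite fibre over \<open>th 0\<close>; so it is a point, the
   value of the extension at 0.\<close>
 define F where "F n = closure (G0 ` (ball 0 (rr n) - {0}))" for n
 have Fcon: "connected (F n)" for n
 proof -
  have "connected (ball 0 (rr n) - {0} :: complex set)" by (rule connected_punctured_ball) simp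
  thus ?thesis unfolding F_def using rr[of n]
   by (intro connected_imp_connected_closure connected_continuous_image continuous_on_subset[OF G0c] Diff_mono subset_ball) auto
 qed
 have Fne: "F n ~= {}" for n
 proof -
  have "of_real (rr n / 2) \<in> ball 0 (rr n) - {0::complex}" using rr[of n] by auto
  hence "G0 (of_real (rr n / 2)) \<in> F n" unfolding F_def by (rule subsetD[OF closure_subset imageI])
  thus ?thesis by blast
 qed
 have Fmono: "F n \<subseteq> F m" if "m <= n" for m n
  unfolding F_def by (intro closure_mono image_mono Diff_mono subset_ball) (use that in "auto simp: rr_def frac_le")
 have Fcl: "closed (F n)" for n by (simp add: F_def)
 define I where "I = (\<Inter>n. F n)"
 have Icon: "connected I" unfolding I_def by (rule connected_nest_sphere[OF Fcl Fcon Fmono])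
 have Ine: "I ~= {}" unfolding I_def by (rule sphere_nest[OF Fcl Fne Fmono])
 have fI: "f y = th 0" if y: "y \<in> I" for y
 proof -
  have "EX ze:cball 0 (rr n). f y = th ze" for n
  proof -
   have "f ` F n \<subseteq> th ` cball 0 (rr n)" unfolding F_def
   proof (rule image_closure_subset[OF cont])
    have "compact (th ` cball 0 (rr n))" using connected_annulus_disc(4)[OF th rr] .
    thus "closed (th ` cball 0 (rr n))" by (rule compact_imp_closed)
    have "th (z ^ dl) \<in> th ` cball 0 (rr n)" if "z \<in> ball 0 (rr n)" for z
    proof -
     have "norm z <= 1" using that rr(2)[of n] by simp
     hence "norm z ^ dl <= norm z ^ 1" by (intro power_decreasing dl) auto
     thus ?thesis using that by (auto simp: norm_power)
    qed
    thus "f ` G0 ` (ball 0 (rr n) - {0}) \<subseteq> th ` cball 0 (rr n)"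
     using fG0 rr(2)[of n] by (auto simp: image_subset_iff)
   qed
   thus ?thesis using y unfolding I_def by blast
  qed
  then obtain ze where ze: "!!n. ze n \<in> cball 0 (rr n) & f y = th (ze n)" by metis
  have in1: "ze n \<in> ball 0 1" for n using ze[of n] rr(2)[of n] by simp
  have "ze n = ze 0" for n using inj_onD[OF t(2) _ in1 in1] ze by metis
  hence le: "norm (ze 0) <= rr n" for n using ze[of n] by (metis mem_cball_0)
  have "norm (ze 0) <= 0"
  proof (rule ccontr)
   assume "~ norm (ze 0) <= 0"
   then obtain n where "inverse (real (Suc n)) < norm (ze 0)" using reals_Archimedean[of "norm (ze 0)"] by auto
   moreover have "rr n <= inverse (real (Suc n))" unfolding rr_def by (simp add: inverse_eq_divide frac_le)
   ultimately show False using le[of n] by linarith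
  qed
  thus ?thesis using ze[of 0] by simp
 qed
 have "finite I" using finite_subset[OF _ rational_fiber(1)[OF rat d1], of I "th 0"] fI by auto
 then obtain p where p: "I = {p}" using Icon Ine connected_finite_iff_sing by blast
 define G where "G z = (if z = 0 then p else G0 z)" for z
 have Gc: "continuous_on (ball 0 1) G" unfolding continuous_on_eq_continuous_at[OF open_ball]
 proof
  fix z :: complex assume z: "z \<in> ball 0 1"
  show "isCont G z"
  proof (cases "z = 0")
   case False
   have o: "open (ball 0 1 - {0::complex})" by blast
   hence "isCont G0 z" using G0c z False continuous_on_eq_continuous_at by blast
   moreover have "\<forall>\<^sub>F w in nhds z. G w = G0 w"
    by (rule eventually_mono[OF eventually_nhds_in_open[OF o]]) (use z False in "auto simp: G_def")
   ultimately show ?thesis using isCont_cong by blast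
  next
   case True
   have "(G \<longlongrightarrow> p) (at 0)" unfolding tendsto_def
   proof (intro allI impI)
    fix T assume T: "open T" "p \<in> T"
    have "EX n. F n - T = {}"
    proof (rule ccontr)
     assume "\<nexists>n. F n - T = {}"
     have "(\<Inter>n. F n - T) ~= {}"
     proof (rule sphere_nest)
      show "F n - T \<subseteq> F m - T" if "m <= n" for m n using Fmono[OF that] by blast
     qed (use Fcl T(1) `\<nexists>n. F n - T = {}` in "auto intro!: closed_Diff")
     thus False using p T(2) unfolding I_def by auto
    qed
    then obtain n where n: "F n \<subseteq> T" by blast
    have "\<forall>\<^sub>F w in at 0. w \<in> ball 0 (rr n) - {0}" using eventually_at_in_open[of "ball 0 (rr n)" 0] rr(1)[of n] by simp
    thus "\<forall>\<^sub>F w in at 0. G w \<in> T"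
    proof eventually_elim
     case (elim w)
     hence "G0 w \<in> F n" unfolding F_def by (rule subsetD[OF closure_subset imageI])
     thus ?case using n elim by (auto simp: G_def)
    qed
   qed
   thus ?thesis unfolding True isCont_def by (simp add: G_def)
  qed
 qed
 have fG: "f (G z) = th (z ^ dl)" if "z \<in> ball 0 1" for z
 proof (cases "z = 0")
  case True
  thus ?thesis using dl fI[of p] p by (simp add: G_def zero_power)
 next
  case False
  thus ?thesis using fG0[OF that] by (simp add: G_def)
 qed
 have pw: "z ^ dl \<in> ball 0 1" if "z \<in> ball 0 1" for z :: complex
  using that dl by (simp add: norm_power power_less_one_iff)
 have Ginj: "inj_on G (ball 0 1)"
 proof (rule inj_onI)
  fix z w :: complex assume zw: "z \<in> ball 0 1" "w \<in> ball 0 1" "G z = G w"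
  have "th (z ^ dl) = th (w ^ dl)" using fG zw by metis
  hence e: "z ^ dl = w ^ dl" using inj_onD[OF t(2)] pw zw by blast
  show "z = w"
  proof (cases "z = 0 | w = 0")
   case True
   moreover have "dl > 0" using dl by simp
   ultimately show ?thesis using e by (auto simp: zero_power)
  next
   case False
   then obtain j where "of_nat dl * Ln z = of_nat dl * Ln w + of_int (int dl * j) * (2 * pi * \<i>)"
    using hinj[OF Re Re] zw by (auto simp: G_def G0_def)
   hence "of_nat dl * Ln z = of_nat dl * (Ln w + of_int j * (2 * pi * \<i>))" by (simp add: algebra_simps)
   hence "Ln z = Ln w + (of_int (2 * j) * pi) * \<i>" using dl by (simp add: mult_ac)
   hence "exp (Ln z) = exp (Ln w)" unfolding exp_eq by blast
   thus ?thesis using False by simp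
  qed
 qed
 obtain w where w: "Re w < 0" "h w = x" using h(3) by blast
 have "Re (w / of_nat dl) < 0" using w(1) dl by (simp add: divide_less_0_iff)
 hence "G (exp (w / of_nat dl)) = x" "exp (w / of_nat dl) \<in> ball 0 1"
  using G0e[of "w / of_nat dl"] w(2) dl by (simp_all add: G_def)
 hence "x \<in> G ` ball 0 1" by blast
 moreover have "disc_map G (G ` ball 0 1)" using Gc Ginj by (simp add: disc_map_def)
 ultimately show ?thesis using that[OF dl] fG False by blast
qed

text \<open>\<open>Z\<close> is a pull-back of \<open>Z'\<close>, recorded through the complements,
  whose images are under control: \<open>- Z\<close> is a whole component of the preimage of
  \<open>- Z'\<close>.\<close>

definition (in ratd) "link K Z Z' \<longleftrightarrow> Z \<in> components (- K) & Z' \<in> components (- f ` K) &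
  - Z \<in> components (f -` (- Z')) & f ` (- Z - K) \<subseteq> - Z' - f ` K &
  (- Z' Int crit_values f = {} --> inj_on f (- Z))"

text \<open>A collar \<open>A\<close> of \<open>Z'\<close> free of critical values thickens
  \<open>- Z'\<close> to an open disc \<open>W\<close> with at most one critical value. The branched
  lift of \<open>W\<close> carries \<open>- Z'\<close> back to a continuum \<open>C\<close>; the
  work is to show that its complement is connected and a component of \<open>- K\<close>.\<close>

lemma (in ratd) pull:
 assumes K: "cov K" and Z': "Z' \<in> components (- f ` K)" and cv: "- Z' Int crit_values f \<subseteq> {v}"
 shows "EX Z. link K Z Z'"
proof -
 define K' where "K' = f ` K"
 define C' where "C' = - Z'"
 have cK: "cont_set K" "cont_set K'" using cov_image[OF K] by (auto simp: K'_def)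
 have Kc: "K \<in> components (f -` K')" using K by (simp add: cov_def K'_def)
 have K'n: "closed K'" "connected K'" "infinite K'" using cK(2) by (auto simp: cont_set_def)
 note Zd = disc_of[OF cK(2) Z'[folded K'_def]]
 have C': "closed C'" "connected C'" "K' \<subseteq> C'" unfolding C'_def using Zd(8,9,12) by auto
 have opN: "open (C' - K')"
 proof -
  have "closed (Z' Un K')" using Zd(7) K'n(1) by (simp add: closure_subset_eq[symmetric])
  moreover have "C' - K' = - (Z' Un K')" by (auto simp: C'_def)
  ultimately show ?thesis by (simp only: open_Compl)
 qed
 obtain thY where thY: "disc_map thY Z'" using Zd(3,10) by blast
 obtain etaY where etaY: "homeomorphism (ball 0 1) Z' thY etaY" using disc_map_inverse[OF thY] by blast
 obtain r where r: "0 < r" "r < 1" "crit_values f Int Z' \<subseteq> thY ` cball 0 r"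
 proof -
  have fin: "finite (etaY ` (crit_values f Int Z'))" using finite_crit_values[OF rat d1] by blast
  have "etaY ` (crit_values f Int Z') \<subseteq> ball 0 1" using homeomorphism_image2[OF etaY] by blast
  then obtain r where r: "0 < r" "r < 1" "etaY ` (crit_values f Int Z') \<subseteq> cball 0 r"
   using compact_in_unit_disc[OF finite_imp_compact[OF fin]] by blast
  have "crit_values f Int Z' \<subseteq> thY ` cball 0 r"
  proof
   fix x assume x: "x \<in> crit_values f Int Z'"
   hence "x = thY (etaY x)" "etaY x \<in> cball 0 r" using homeomorphism_apply2[OF etaY] r(3) by auto
   thus "x \<in> thY ` cball 0 r" by (rule image_eqI)
  qed
  thus ?thesis using that r by blast
 qed
 note an = connected_annulus_disc[OF thY r(1,2)]
 define Q where "Q = thY ` cball 0 r"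
 define A where "A = Z' - Q"
 define W where "W = - Q"
 have Q: "compact Q" "Q \<subseteq> Z'" using an(4,5) by (auto simp: Q_def)
 have A: "connected A" "A ~= {}" using an(1,2,3) by (simp_all add: A_def Q_def)
 have WCA: "W = C' Un A" "W - C' = A" using Q(2) by (auto simp: W_def C'_def A_def)
 have oW: "open W" unfolding W_def using Q(1) compact_imp_closed by blast
 have cW: "connected W"
 proof -
  obtain k where k: "k \<in> frontier Z'" using Zd(6) by blast
  hence k': "k \<in> closure Z'" "k \<in> C'" using Zd(5) C'(3) by (auto simp: frontier_def)
  have "closure Z' \<subseteq> closure (Q Un A)" by (rule closure_mono) (auto simp: A_def)
  hence "closure Z' \<subseteq> Q Un closure A" unfolding closure_Un closure_closed[OF compact_imp_closed[OF Q(1)]] .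
  with k' Q(2) have kA: "k \<in> closure A" by (auto simp: C'_def)
  have "connected (A Un {k})"
   by (rule connected_intermediate_closure[OF A(1)]) (use kA closure_subset[of A] in auto)
  hence "connected (C' Un (A Un {k}))" using connected_Un[OF C'(2)] k'(2) by blast
  moreover have "C' Un (A Un {k}) = W" using WCA k'(2) by blast
  ultimately show ?thesis by simp
 qed
 have cQ: "connected (- W)" unfolding W_def Q_def double_complement
  by (rule connected_continuous_image[OF continuous_on_subset connected_cball]) (use thY r in "auto simp: disc_map_def")
 \<comment> \<open>The centre of the parametrisation must be the critical value if there is one;
   otherwise any point of \<open>C'\<close> will do.\<close>
 define c where "c = (if C' Int crit_values f = {} then f (SOME x. x \<in> K) else v)"
 have K0: "(SOME x. x \<in> K) \<in> K" using cK(1) some_in_eq[of K] by (auto simp: cont_set_def)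
 have cC: "c \<in> C'"
 proof (cases "C' Int crit_values f = {}")
  case True
  thus ?thesis using K0 C'(3) by (auto simp: c_def K'_def)
 next
  case False
  thus ?thesis using cv by (auto simp: c_def C'_def)
 qed
 have "A Int crit_values f = {}" using r(3) unfolding A_def Q_def by blast
 hence Wcv: "W Int crit_values f = C' Int crit_values f" using WCA(1) by blast
 have "W Int crit_values f \<subseteq> {c}" unfolding Wcv using cv by (auto simp: c_def C'_def)
 moreover obtain th where th: "disc_map th W" "th 0 = c"
 proof -
  have "thY 0 ~: W" "thY (of_real r) ~: W" using r by (auto simp: W_def Q_def)
  moreover have "thY 0 ~= thY (of_real r)"
  proof
   assume "thY 0 = thY (of_real r)"
   hence "0 = complex_of_real r" using thY r unfolding disc_map_def by (auto dest: inj_onD)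
   thus False using r by simp
  qed
  ultimately show ?thesis using riemann_disc[OF oW cW _ cQ, of c] cC WCA(1) that by blast
 qed
 ultimately have cv0: "W Int crit_values f \<subseteq> {th 0}" by simp
 obtain eta where eta: "homeomorphism (ball 0 1) W th eta" using disc_map_inverse[OF th(1)] by blast
 have t: "th ` ball 0 1 = W" "inj_on th (ball 0 1)" using th(1) by (auto simp: disc_map_def)
 have eta1: "eta y \<in> ball 0 1" "th (eta y) = y" if "y \<in> W" for y
  using homeomorphism_image2[OF eta] homeomorphism_apply2[OF eta] that by auto
 have CW: "C' \<subseteq> W" "A \<subseteq> W" using WCA by auto
 define E where "E = eta ` C'"
 have E: "compact E" "connected E" "E \<subseteq> ball 0 1" "0 \<in> E"
 proof -
  have ce: "continuous_on C' eta" using continuous_on_subset[OF homeomorphism_cont2[OF eta] CW(1)] .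
  show "compact E" unfolding E_def using compact_continuous_image[OF ce] C'(1) compact_sphere_iff by blast
  show "connected E" unfolding E_def using connected_continuous_image[OF ce C'(2)] .
  show "E \<subseteq> ball 0 1" unfolding E_def using eta1(1) CW(1) by blast
  have "eta c = 0" using homeomorphism_apply1[OF eta, of 0] th(2) by simp
  thus "0 \<in> E" unfolding E_def using cC by (metis imageI)
 qed
 have Eiff: "z \<in> E \<longleftrightarrow> th z \<in> C'" if "z \<in> ball 0 1" for z
 proof
  assume "z \<in> E"
  thus "th z \<in> C'" unfolding E_def using eta1(2) CW(1) by auto
 next
  assume "th z \<in> C'"
  thus "z \<in> E" unfolding E_def using homeomorphism_apply1[OF eta that] by (metis imageI)
 qed
 have AE: "connected (ball 0 1 - E)"
 proof -
  have "ball 0 1 - E = eta ` A"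
  proof
   show "ball 0 1 - E \<subseteq> eta ` A"
   proof
    fix z assume z: "z \<in> ball 0 1 - E"
    hence "th z \<in> A" using Eiff[of z] t(1) WCA(2) by blast
    thus "z \<in> eta ` A" using homeomorphism_apply1[OF eta, of z] z by (metis DiffD1 imageI)
   qed
   show "eta ` A \<subseteq> ball 0 1 - E"
   proof
    fix z assume "z \<in> eta ` A"
    then obtain y where y: "y \<in> A" "z = eta y" by blast
    hence "z \<in> ball 0 1" "th z = y" using eta1[of y] CW(2) by auto
    thus "z \<in> ball 0 1 - E" using Eiff[of z] y(1) by (auto simp: A_def C'_def)
   qed
  qed
  thus ?thesis
   using connected_continuous_image[OF continuous_on_subset[OF homeomorphism_cont2[OF eta] CW(2)] A(1)] by simp
 qed
 obtain x0 where x0: "x0 \<in> K" "f x0 ~= c"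
 proof -
  have "~ K \<subseteq> f -` {c}" using rational_fiber(1)[OF rat d1, of c] cK(1) finite_subset by (auto simp: cont_set_def)
  thus ?thesis using that by auto
 qed
 have fx0: "f x0 \<in> C'" using x0(1) C'(3) by (auto simp: K'_def)
 define z0 where "z0 = eta (f x0)"
 have z0: "f x0 = th z0" "z0 \<in> ball 0 1" "z0 ~= 0"
  using eta1[of "f x0"] fx0 CW(1) x0(2) th(2) by (auto simp: z0_def)
 obtain dl G where dl: "dl >= 1" and G: "disc_map G (G ` ball 0 1)" "!!z. z \<in> ball 0 1 ==> f (G z) = th (z ^ dl)"
  "x0 \<in> G ` ball 0 1" "W Int crit_values f = {} ==> dl = 1"
  using branched_lift[OF th(1) cv0 z0(1,2)] z0(3) by metis
 have Gc: "continuous_on (ball 0 1) G" and Gi: "inj_on G (ball 0 1)" using G(1) by (auto simp: disc_map_def)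
 define V where "V = G ` ball 0 1"
 have oV: "open V" unfolding V_def using disc_map_open[OF G(1) open_ball subset_refl] .
 have pw: "z ^ dl \<in> ball 0 1 \<longleftrightarrow> z \<in> ball 0 1" for z :: complex
  using dl by (simp add: norm_power power_less_one_iff)
 define E' where "E' = {z. z ^ dl \<in> E}"
 have E'b: "E' \<subseteq> ball 0 1" using E(3) pw by (auto simp: E'_def)
 obtain g where g: "rational_map_of_degree g dl" "!!z. g (Fin z) = Fin (z ^ dl)" "g Infty = Infty"
  using pow_map[OF dl] by blast
 have gonto: "g ` D = Fin ` P" if "compact P" "connected P" "D \<in> components (g -` (Fin ` P))" for D P
  using component_preimage_onto[OF g(1) dl _ _ that(3)] compact_imp_closed[OF compact_continuous_image[OF continuous_on_Fin that(1)]]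
   connected_continuous_image[OF continuous_on_Fin that(2)] by blast
 \<comment> \<open>Each component of the preimage of \<open>E\<close> under the power map is mapped
   onto \<open>E\<close>, so it contains 0, the only point over 0.\<close>
 have E': "connected E'"
 proof -
  define S where "S = g -` (Fin ` E)"
  have S: "S = Fin ` E'"
  proof
   show "S \<subseteq> Fin ` E'"
   proof
    fix x assume "x \<in> S"
    thus "x \<in> Fin ` E'" unfolding S_def E'_def using g(2,3) by (cases x) auto
   qed
   show "Fin ` E' \<subseteq> S" unfolding S_def E'_def using g(2) by auto
  qed
  have F0: "Fin 0 \<in> D" if "D \<in> components S" for D
  proof -
   have "Fin 0 \<in> g ` D" using gonto[OF E(1,2) that[unfolded S_def]] E(4) by blast
   then obtain x where x: "x \<in> D" "g x = Fin 0" by (metis imageE)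
   hence "x = Fin 0" using g(2,3) dl by (cases x) auto
   thus ?thesis using x(1) by simp
  qed
  have "connected S" unfolding connected_component_eq_self[symmetric]
  proof -
   obtain D where D: "D \<in> components S" "Fin 0 \<in> D"
   proof -
    have "Fin 0 \<in> S" unfolding S E'_def using E(4) dl by (auto simp: zero_power)
    thus ?thesis using that F0 Union_components[of S] by blast
   qed
   have "D' = D" if "D' \<in> components S" for D' using disc_eqI[OF that D(1) F0[OF that] D(2)] .
   hence "S = D" using Union_components[of S] D(1) by blast
   thus "connected S" using in_components_connected[OF D(1)] by simp
  qed
  hence "connected (fin ` S)"
   by (intro connected_continuous_image continuous_on_subset[OF continuous_on_fin]) (auto simp: S)
  thus ?thesis unfolding S image_image by simp
 qed
 have cE': "compact E'"
 proof -
  have "closed E'" unfolding E'_def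
   using continuous_closed_vimage[OF compact_imp_closed[OF E(1)], of "%z. z ^ dl"] by (simp add: vimage_def)
  thus ?thesis using E'b bounded_subset[OF bounded_ball] by (simp add: compact_eq_bounded_closed)
 qed
 define C where "C = G ` E'"
 have GE: "G z \<in> C \<longleftrightarrow> z \<in> E'" if "z \<in> ball 0 1" for z
  unfolding C_def using inj_on_image_mem_iff[OF Gi that E'b] .
 have CV: "C = V Int f -` C'"
 proof -
  have "z \<in> E' \<longleftrightarrow> f (G z) \<in> C'" if "z \<in> ball 0 1" for z
   unfolding G(2)[OF that] E'_def using Eiff[of "z ^ dl"] pw that by simp
  thus ?thesis unfolding C_def V_def using E'b by auto
 qed
 have C: "connected C" "closed C" "x0 \<in> C" "C \<subseteq> V"
 proof -
  show "connected C" unfolding C_def by (rule connected_continuous_image[OF continuous_on_subset[OF Gc E'b] E'])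
  show "closed C" unfolding C_def by (rule compact_imp_closed[OF compact_continuous_image[OF continuous_on_subset[OF Gc E'b] cE']])
  show "x0 \<in> C" "C \<subseteq> V" unfolding CV using G(3) fx0 by (auto simp: V_def)
 qed
 \<comment> \<open>\<open>C\<close> is the whole preimage of \<open>C'\<close> in the open set
   \<open>V\<close>, hence open in its component; it is closed by compactness.\<close>
 have Ccomp: "C \<in> components (f -` C')"
 proof -
  obtain D where D: "D \<in> components (f -` C')" "C \<subseteq> D" using component_containing[OF C(1), of "f -` C'"] CV C(3) by blast
  have DV: "C = D Int V" using D in_components_subset[OF D(1)] CV by blast
  have "openin (top_of_set D) C" using oV DV by (metis openin_open_Int)
  moreover have "closedin (top_of_set D) C" using C(2) D(2) by (metis closedin_closed_Int inf.absorb2)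
  ultimately have "C = D" using in_components_connected[OF D(1)] C(3) unfolding connected_clopen by blast
  thus ?thesis using D(1) by simp
 qed
 have KC: "K \<subseteq> C"
  using components_maximal[OF Ccomp, of K] cK(1) C'(3) x0(1) C(3) by (auto simp: cont_set_def K'_def)
 obtain rho where rho: "0 < rho" "rho < 1" "E \<subseteq> cball 0 rho" using compact_in_unit_disc[OF E(1,3)] by blast
 define rho' where "rho' = root dl rho"
 have rho': "0 < rho'" "rho' < 1" "rho' ^ dl = rho" unfolding rho'_def using rho dl by (auto simp: real_root_pow_pos)
 have big: "norm z > rho' \<longleftrightarrow> norm (z ^ dl) > rho" for z :: complex
  unfolding norm_power rho'(3)[symmetric] using power_less_imp_less_base[of rho' dl "norm z"] power_strict_mono[of rho' "norm z" dl] rho'(1) dl by auto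
 define GA where "GA = G ` (ball 0 1 - cball 0 rho')"
 have GA: "connected GA" "GA ~= {}" using connected_annulus_disc(1,2)[OF G(1) rho'(1,2)] by (auto simp: GA_def)
 have GAC: "GA \<subseteq> - C"
 proof
  fix y assume "y \<in> GA"
  then obtain z where z: "z \<in> ball 0 1" "norm z > rho'" "y = G z" by (auto simp: GA_def)
  hence "z ~: E'" using big[of z] rho(3) by (auto simp: E'_def)
  thus "y \<in> - C" using GE[OF z(1)] z(3) by simp
 qed
 \<comment> \<open>Each complementary component of \<open>C\<close> enters \<open>V\<close>. A path
   in \<open>ball 0 1 - E\<close>, lifted through the power map, leads from there to the outer
   annulus \<open>GA\<close>; so there is only one component.\<close>
 have comp: "GA \<subseteq> O'" if O': "O' \<in> components (- C)" for O'
 proof -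
  have "C ~= {}" using C(3) by blast
  note oc = complement_component[OF C(2) this O']
  obtain y where y: "y \<in> frontier O'" using oc(6) by blast
  hence "y \<in> V" "y \<in> closure O'" using oc(5) C(4) by (auto simp: frontier_def)
  hence "V Int O' ~= {}" using oV closure_iff_nhds_not_empty by blast
  then obtain z1 where z1: "z1 \<in> ball 0 1" "G z1 \<in> O'" by (auto simp: V_def)
  hence "z1 ~: E'" using GE[OF z1(1)] oc(4) by blast
  hence e1: "z1 ^ dl \<in> ball 0 1 - E" using z1(1) pw by (auto simp: E'_def)
  define e2 where "e2 = complex_of_real ((rho + 1) / 2)"
  have ne2: "norm e2 > rho" "norm e2 < 1" unfolding e2_def norm_of_real using rho by auto
  hence e2: "e2 \<in> ball 0 1 - E" using rho(3) by auto
  have "path_connected (ball 0 1 - E)"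
   by (rule connected_open_path_connected[OF _ AE]) (use E(1) compact_imp_closed in blast)
  then obtain pa where pa: "path pa" "path_image pa \<subseteq> ball 0 1 - E" "pathstart pa = z1 ^ dl" "pathfinish pa = e2"
   using e1 e2 unfolding path_connected_def by blast
  define P where "P = path_image pa"
  have P: "compact P" "connected P" "z1 ^ dl \<in> P" "e2 \<in> P"
   unfolding P_def using pa compact_path_image connected_path_image pathstart_in_path_image pathfinish_in_path_image by metis+
  have "Fin z1 \<in> g -` (Fin ` P)" using g(2) P(3) by simp
  then obtain D where D: "D \<in> components (g -` (Fin ` P))" "Fin z1 \<in> D" using in_some_component by metis
  have DF: "EX z. x = Fin z & z ^ dl \<in> P" if "x \<in> D" for x
   using in_components_subset[OF D(1)] that g(2,3) by (cases x) auto
  obtain x2 where x2: "x2 \<in> D" "g x2 = Fin e2" using gonto[OF P(1,2) D(1)] P(4) by (metis imageE imageI)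
  then obtain z2 where z2: "Fin z2 \<in> D" "z2 ^ dl = e2" using DF[OF x2(1)] g(2) by auto
  define T where "T = fin ` D"
  have T: "z ^ dl \<in> P" if "z \<in> T" for z using that DF unfolding T_def by force
  have Tb: "T \<subseteq> ball 0 1 - E'" using T pa(2) pw unfolding P_def E'_def by blast
  have "connected T" unfolding T_def
   by (rule connected_continuous_image[OF continuous_on_subset[OF continuous_on_fin] in_components_connected[OF D(1)]]) (use DF in blast)
  hence "connected (G ` T)" using connected_continuous_image[OF continuous_on_subset[OF Gc]] Tb by blast
  moreover have "G ` T \<subseteq> - C" using Tb GE by auto
  moreover have zT: "z1 \<in> T" "z2 \<in> T" unfolding T_def using D(2) z2(1) by force+
  ultimately have GT: "G ` T \<subseteq> O'" using components_maximal[OF O', of "G ` T"] z1(2) by blast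
  have "z2 \<in> ball 0 1 - cball 0 rho'" using Tb zT(2) big[of z2] ne2(1) z2(2) by auto
  hence "G z2 \<in> GA" unfolding GA_def by blast
  thus ?thesis using components_maximal[OF O' GA(1) GAC] GT zT(2) by blast
 qed
 define Y where "Y = - C"
 have "connected Y"
 proof -
  obtain x where x: "x \<in> GA" using GA(2) by blast
  obtain D where D: "D \<in> components (- C)" "x \<in> D" using in_some_component[OF subsetD[OF GAC x]] by blast
  have "D' = D" if "D' \<in> components (- C)" for D' using disc_eqI[OF that D(1) _ D(2)] comp[OF that] x by blast
  hence "- C = D" using Union_components[of "- C"] D(1) by blast
  thus ?thesis unfolding Y_def using in_components_connected[OF D(1)] by simp
 qed
 have oY: "open Y" unfolding Y_def using C(2) by blast
 have Yne: "Y ~= {}" using GA(2) GAC by (auto simp: Y_def)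
 have frY: "frontier Y \<subseteq> C" "frontier Y \<subseteq> f -` K'"
 proof -
  show 1: "frontier Y \<subseteq> C" unfolding Y_def frontier_complement using frontier_subset_closed[OF C(2)] .
  show "frontier Y \<subseteq> f -` K'"
  proof
   fix x assume x: "x \<in> frontier Y"
   hence xC: "x \<in> C" "x ~: interior C" using 1 unfolding Y_def frontier_complement by (auto simp: frontier_def)
   show "x \<in> f -` K'"
   proof (rule ccontr)
    assume "x ~: f -` K'"
    hence "x \<in> V Int f -` (C' - K')" using xC(1) CV by blast
    moreover have "open (V Int f -` (C' - K'))" using oV open_vimage[OF opN cont] by blast
    moreover have "V Int f -` (C' - K') \<subseteq> C" unfolding CV by blast
    ultimately show False using xC(2) interiorI by blast
   qed
  qed
 qed
 have frYcon: "connected (frontier Y)"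
 proof -
  obtain y where y: "y \<in> Y" using Yne by blast
  obtain a b where ab: "a \<in> K" "b \<in> K" "a ~= b" using two_points[of K] cK(1) unfolding cont_set_def by blast
  have "connected (- Y)" using C(1) by (simp add: Y_def)
  then obtain h where "disc_map h Y" using riemann_disc[OF oY `connected Y` y, of a b] ab KC by (auto simp: Y_def)
  thus ?thesis by (rule connected_frontier_disc)
 qed
 \<comment> \<open>A frontier point of \<open>Z'\<close> has a preimage in \<open>K2\<close>, and
   arbitrarily near it there are points over \<open>Z'\<close> in \<open>V\<close>, that is, points
   of \<open>Y\<close>.\<close>
 have meets: "K2 Int frontier Y ~= {}" if K2: "K2 \<in> components (f -` K')" "K2 Int C ~= {}" for K2
 proof -
  have K2C: "K2 \<subseteq> C"
   using components_maximal[OF Ccomp in_components_connected[OF K2(1)]] in_components_subset[OF K2(1)] C'(3) K2(2) by blast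
  obtain y where y: "y \<in> frontier Z'" using Zd(6) by blast
  hence y': "y \<in> K'" "y \<in> closure Z'" using Zd(5) by (auto simp: frontier_def)
  obtain x where x: "x \<in> K2" "f x = y" using component_preimage_onto[OF rat d1 K'n(1,2) K2(1)] y'(1) by blast
  have "x \<in> closure Y" unfolding closure_iff_nhds_not_empty
  proof (intro allI impI)
   fix B T assume T: "T \<subseteq> B" "open T" "x \<in> T"
   have "open (f ` (T Int V))" using rational_open[OF rat d1] T(2) oV by blast
   moreover have "y \<in> f ` (T Int V)" using x T(3) K2C C(4) by blast
   ultimately obtain x' where x': "x' \<in> T" "f x' \<in> Z'" using y'(2) unfolding closure_iff_nhds_not_empty by blast
   hence "x' \<in> Y" unfolding Y_def CV C'_def by blast
   thus "Y Int B ~= {}" using x'(1) T(1) by blast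
  qed
  hence "x \<in> frontier Y" using x(1) K2C oY by (auto simp: frontier_def interior_open Y_def)
  thus ?thesis using x(1) by blast
 qed
 have frK: "frontier Y \<subseteq> K"
  using components_maximal[OF Kc frYcon frY(2)] meets[OF Kc] KC x0(1) by blast
 have CK: "C Int f -` K' \<subseteq> K"
 proof
  fix x assume x: "x \<in> C Int f -` K'"
  then obtain K2 where K2: "K2 \<in> components (f -` K')" "x \<in> K2" using in_some_component[of x "f -` K'"] by blast
  hence "K2 Int frontier Y ~= {}" using meets x by blast
  then obtain y where "y \<in> K2" "y \<in> K" using frK by blast
  thus "x \<in> K" using disc_eqI[OF K2(1) Kc] K2(2) by blast
 qed
 have YK: "Y \<in> components (- K)"
 proof -
  obtain D where D: "D \<in> components (- K)" "Y \<subseteq> D"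
   using component_containing[OF `connected Y`, of "- K"] KC Yne by (auto simp: Y_def)
  have "D Int frontier Y = {}" using frK in_components_subset[OF D(1)] by blast
  hence "D \<subseteq> Y" using connected_Int_frontier[OF in_components_connected[OF D(1)], of Y] D(2) Yne by blast
  thus ?thesis using D by (metis subset_antisym)
 qed
 have "link K Y Z'" unfolding link_def
 proof (intro conjI impI)
  show "- Y \<in> components (f -` (- Z'))" using Ccomp by (simp add: Y_def C'_def)
  show "f ` (- Y - K) \<subseteq> - Z' - f ` K"
  proof
   fix y assume "y \<in> f ` (- Y - K)"
   then obtain x where x: "x \<in> C" "x ~: K" "y = f x" by (auto simp: Y_def)
   thus "y \<in> - Z' - f ` K" using CV CK by (auto simp: C'_def K'_def)
  qed
  show "inj_on f (- Y)" if "- Z' Int crit_values f = {}"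
  proof (rule inj_onI)
   have 1: "dl = 1" using G(4) Wcv that by (simp add: C'_def)
   fix x y assume xy: "x \<in> - Y" "y \<in> - Y" "f x = f y"
   then obtain z w where zw: "z \<in> ball 0 1" "x = G z" "w \<in> ball 0 1" "y = G w" using C(4) unfolding Y_def V_def double_complement by blast
   hence "th z = th w" using G(2)[OF zw(1)] G(2)[OF zw(3)] xy(3) 1 by simp
   thus "x = y" using inj_onD[OF t(2)] zw by blast
  qed
 qed (use YK Z' in auto)
 thus ?thesis by blast
qed

section \<open>Wandering Julia components\<close>

context ratd
begin

text \<open>Otherwise a collar of \<open>Z\<close> would be mapped into \<open>- Z'\<close>, and
  joining it to \<open>- Z\<close> would enlarge a component of the preimage.\<close>

lemma link_st:
 assumes K: "cov K" and l: "link K Z Z'"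
 shows "st K Z = Z'"
proof (rule ccontr)
 have Z: "Z \<in> components (- K)" "Z' \<in> components (- f ` K)" "- Z \<in> components (f -` (- Z'))"
  using l by (auto simp: link_def)
 assume ne: "st K Z ~= Z'"
 obtain Q where Q: "compact Q" "Q \<subseteq> Z" "connected (Z - Q)" "Z - Q ~= {}" "f ` (Z - Q) \<subseteq> st K Z"
  using st_star[OF K Z(1)] unfolding star_def by blast
 note Zd = disc_of[OF cov_image(1)[OF K] Z(1)]
 have "st K Z Int Z' = {}" using disc_eqI[OF st_component[OF K Z(1)] Z(2)] ne by blast
 hence sub: "Z - Q \<subseteq> f -` (- Z')" using Q(5) by blast
 obtain k where k: "k \<in> frontier Z" using Zd(6) by blast
 hence k': "k \<in> closure Z" "k \<in> - Z" using Zd(5,9) by (auto simp: frontier_def)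
 have "closure Z \<subseteq> closure (Q Un (Z - Q))" by (rule closure_mono) auto
 hence "closure Z \<subseteq> Q Un closure (Z - Q)" unfolding closure_Un closure_closed[OF compact_imp_closed[OF Q(1)]] .
 hence kc: "k \<in> closure (Z - Q)" using k' Q(2) by blast
 have "connected (insert k (Z - Q))"
  by (rule connected_intermediate_closure[OF Q(3)]) (use kc closure_subset[of "Z - Q"] in auto)
 moreover have "insert k (Z - Q) \<subseteq> f -` (- Z')" using sub k'(2) in_components_subset[OF Z(3)] by blast
 ultimately have "insert k (Z - Q) \<subseteq> - Z" using components_maximal[OF Z(3)] k'(2) by blast
 thus False using Q(4) by blast
qed

lemma link_image: "link K Z Z' ==> cov K ==> f ` (- Z) = - Z'"
 using component_preimage_onto[OF rat d1, of "- Z'" "- Z"] disc_of(8,12)[OF cov_image(2)] unfolding link_def by blast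

text \<open>The other discs lie in \<open>- Z - K\<close>, whose image misses that of
  \<open>K\<close>; for them the induced map is the actual image.\<close>

lemma link_other:
 assumes K: "cov K" and l: "link K Z Z'" and X: "X \<in> components (- K)" "X ~= Z"
 shows "f ` X = st K X" "st K X ~= Z'" "X \<subseteq> - Z - K"
proof -
 have Z: "Z \<in> components (- K)" "f ` (- Z - K) \<subseteq> - Z' - f ` K" using l by (auto simp: link_def)
 have "X Int Z = {}" using disc_eqI[OF X(1) Z(1)] X(2) by blast
 thus XZ: "X \<subseteq> - Z - K" using disc_of(4)[OF cov_image(1)[OF K] X(1)] by blast
 have fX: "f ` X \<subseteq> - Z' - f ` K" using XZ Z(2) by blast
 thus e: "f ` X = st K X" by (intro st_image[OF K X(1)]) blast
 have "X ~= {}" using disc_of(3)[OF cov_image(1)[OF K] X(1)] .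
 thus "st K X ~= Z'" using fX e by blast
qed

end

text \<open>Each continuum lies inside or outside the disc of the other; the four combinations give
  the four cases.\<close>

lemma disc_complements_cases:
 assumes K: "cont_set K" "cont_set K'" "K Int K' = {}" and Y: "Y \<in> components (- K)" "Y' \<in> components (- K')"
 shows "- Y Int - Y' = {} | - Y \<subseteq> - Y' - K' | - Y' \<subseteq> - Y - K | - Y Un - Y' = UNIV"
proof -
 note d = disc_of[OF K(1) Y(1)] and d' = disc_of[OF K(2) Y(2)]
 have Kc: "connected K" "connected K'" "K ~= {}" "K' ~= {}" using K by (auto simp: cont_set_def)
 have sep: "S \<subseteq> Z | S Int Z = {}" if "Z \<in> components (- L)" "connected S" "S Int L = {}" for S Z L :: "riemann_sphere set"
  using components_maximal[OF that(1,2)] that(3) by blast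
 have 1: "K' \<subseteq> Y | K' Int Y = {}" using sep[OF Y(1) Kc(2)] K(3) by blast
 have 2: "K \<subseteq> Y' | K Int Y' = {}" using sep[OF Y(2) Kc(1)] K(3) by blast
 have A: "- Y Int - Y' = {}" if "K' \<subseteq> Y" "K \<subseteq> Y'"
 proof -
  have "- Y \<subseteq> Y' | - Y Int Y' = {}" using sep[OF Y(2) d(8)] that(1) by blast
  thus ?thesis using d(9) that(2) Kc(3) by blast
 qed
 have B: "- Y \<subseteq> - Y' - K'" if "K' \<subseteq> Y" "K Int Y' = {}"
 proof -
  have "- Y \<subseteq> Y' | - Y Int Y' = {}" using sep[OF Y(2) d(8)] that(1) by blast
  thus ?thesis using d(9) that Kc(3) by blast
 qed
 have C: "- Y' \<subseteq> - Y - K" if "K' Int Y = {}" "K \<subseteq> Y'"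
 proof -
  have "- Y' \<subseteq> Y | - Y' Int Y = {}" using sep[OF Y(1) d'(8)] that(2) by blast
  thus ?thesis using d'(9) that Kc(4) by blast
 qed
 have D: "- Y Un - Y' = UNIV" if "K' Int Y = {}" "K Int Y' = {}"
 proof -
  have "Y Un K \<subseteq> Y' | (Y Un K) Int Y' = {}" using sep[OF Y(2) d(11)] that(1) K(3) by blast
  hence "Y Int Y' = {}" using that(2) Kc(3) by blast
  thus ?thesis by blast
 qed
 show ?thesis using 1 2 A B C D by blast
qed

section \<open>Orbits with at least three complementary discs\<close>

definition many :: "riemann_sphere set => bool" where
 "many K \<longleftrightarrow> ~ (finite (components (- K)) & card (components (- K)) <= 2)"

lemma many_infinite:
 assumes "many K"
 shows "infinite K"
proof
 assume "finite K"
 hence c: "connected (- K)" using connected_delete_finite[OF connected_UNIV_sphere open_UNIV] by (simp add: Compl_eq_Diff_UNIV)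
 have "components (- K) \<subseteq> {- K}"
 proof
  fix X assume X: "X \<in> components (- K)"
  hence "- K ~= {}" using in_components_nonempty in_components_subset by blast
  hence "components (- K) = {- K}" using c by (simp add: components_eq_sing_iff)
  thus "X \<in> {- K}" using X by blast
 qed
 from finite_subset[OF this] card_mono[OF _ this]
 have "finite (components (- K))" "card (components (- K)) <= card {- K}" by simp_all
 thus False using assms by (simp add: many_def)
qed

lemma many_third:
 assumes "many K"
 shows "EX X:components (- K). X ~= A & X ~= B"
proof (rule ccontr)
 assume "~ ?thesis"
 hence s: "components (- K) \<subseteq> {A, B}" by blast
 from finite_subset[OF this] card_mono[OF _ this]
 have "finite (components (- K))" "card (components (- K)) <= card {A, B}" by simp_all
 moreover have "card {A, B} <= 2" by (simp add: card_insert_if)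
 ultimately show False using assms by (simp add: many_def)
qed

lemma image_funpow_Suc: "(f ^^ Suc n) ` S = f ` (f ^^ n) ` S" by (simp add: image_comp)

locale wandering_orbit = ratd +
 fixes K0 :: "riemann_sphere set"
 assumes wand: "wandering_julia_component f K0"
begin

definition "K n = (f ^^ n) ` K0"

lemma K_Suc: "K (Suc n) = f ` K n" by (simp add: K_def image_comp)

lemma K_add: "K (n + m) = (f ^^ m) ` K n" by (induction m) (simp_all add: K_Suc image_comp)

text \<open>Let \<open>M\<close> be the Julia component containing the image of \<open>L\<close>.
  The component of its preimage around \<open>L\<close> consists of Julia points, so it is
  \<open>L\<close>, and it is mapped onto \<open>M\<close>.\<close>

lemma julia_image:
 assumes L: "L \<in> components (julia_set f)"
 shows "f ` L \<in> components (julia_set f)" "L \<in> components (f -` f ` L)"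
proof -
 have pre: "f -` S \<subseteq> julia_set f" if "S \<subseteq> julia_set f" for S using julia_invariant[OF rat d1] that by blast
 have Lc: "connected L" "L \<subseteq> julia_set f" "L ~= {}"
  using in_components_connected[OF L] in_components_subset[OF L] in_components_nonempty[OF L] by auto
 have "connected (f ` L)" "f ` L \<subseteq> julia_set f"
  using connected_continuous_image[OF cont Lc(1)] julia_invariant[OF rat d1] Lc(2) by auto
 then obtain M where M: "M \<in> components (julia_set f)" "f ` L \<subseteq> M" using component_containing[of "f ` L"] Lc(3) by blast
 obtain C where C: "C \<in> components (f -` M)" "L \<subseteq> C"
  using component_containing[OF Lc(1), of "f -` M"] M(2) Lc(3) by blast
 have "C \<subseteq> julia_set f" using in_components_subset[OF C(1)] pre[OF in_components_subset[OF M(1)]] by blast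
 hence CL: "C = L" using components_maximal[OF L in_components_connected[OF C(1)]] C(2) Lc(3) by blast
 have "f ` C = M" using component_preimage_onto[OF rat d1 closed_components[OF closed_julia M(1)] in_components_connected[OF M(1)] C(1)] .
 thus "f ` L \<in> components (julia_set f)" "L \<in> components (f -` f ` L)" using M(1) C(1) CL by auto
qed

lemma K_julia: "K n \<in> components (julia_set f)"
proof (induction n)
 case 0
 thus ?case using wand by (simp add: K_def wandering_julia_component_def julia_component_def)
next
 case (Suc n)
 thus ?case unfolding K_Suc by (rule julia_image(1))
qed

lemma K_sub: "K n \<subseteq> julia_set f" and K_ne: "K n ~= {}"
 using in_components_subset[OF K_julia] in_components_nonempty[OF K_julia] by auto

lemma K_disjoint: "i ~= j ==> K i Int K j = {}"
proof -
 have *: "K i ~= K j" if "i < j" for i j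
 proof
  assume e: "K i = K j"
  have "EX m<=j. K n = K m" for n
  proof (induction n rule: less_induct)
   case (less n)
   show ?case
   proof (cases "n <= j")
    case False
    hence "K n = K (i + (n - j))" unfolding K_add e by (subst K_add[symmetric]) simp
    thus ?thesis using less[of "i + (n - j)"] False that by auto
   qed blast
  qed
  hence "range K \<subseteq> K ` {..j}" by auto
  hence "finite (range K)" using finite_subset by blast
  hence "eventually_periodic f K0" unfolding eventually_periodic_def K_def[abs_def] .
  thus False using wand by (simp add: wandering_julia_component_def)
 qed
 assume "i ~= j"
 hence "K i ~= K j" using *[of i j] *[of j i] by (metis linorder_neqE_nat)
 thus ?thesis using components_eq[OF K_julia K_julia] by blast
qed

lemma K_cov: "infinite (K n) ==> cov (K n)" unfolding cov_def cont_set_def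
 using closed_components[OF closed_julia K_julia] in_components_connected[OF K_julia] julia_image(2)[OF K_julia] by blast

text \<open>The induced map is surjective, so two discs or fewer cannot produce more.\<close>

lemma many_pre:
 assumes "many (K (Suc n))"
 shows "many (K n)"
proof (rule ccontr)
 assume "~ many (K n)"
 hence f: "finite (components (- K n))" "card (components (- K n)) <= 2" by (auto simp: many_def)
 have "infinite (K n)" using many_infinite[OF assms] by (auto simp: K_Suc)
 hence c: "cov (K n)" by (rule K_cov)
 have "components (- K (Suc n)) \<subseteq> st (K n) ` components (- K n)"
  using st_surj[OF c f(1)] unfolding K_Suc by blast
 from finite_subset[OF this finite_imageI[OF f(1)]] card_mono[OF finite_imageI[OF f(1)] this]
 have "finite (components (- K (Suc n)))" "card (components (- K (Suc n))) <= card (st (K n) ` components (- K n))" .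
 moreover have "card (st (K n) ` components (- K n)) <= 2" using card_image_le[OF f(1), of "st (K n)"] f(2) by simp
 ultimately show False using assms by (simp add: many_def)
qed

lemma many_all:
 assumes "!!N. EX n>=N. many (K n)"
 shows "many (K n)"
proof -
 obtain m where m: "m >= n" "many (K m)" using assms by blast
 thus ?thesis by (induction rule: inc_induct[OF m(1)]) (auto intro: many_pre)
qed

lemma K_avoid: "finite P ==> EX N. ALL n>=N. K n Int P = {}"
proof -
 assume P: "finite P"
 have "finite {n. K n Int P ~= {}}"
 proof -
  define w where "w n = (SOME x. x \<in> K n Int P)" for n
  have w: "w n \<in> K n Int P" if "n \<in> {n. K n Int P ~= {}}" for n using that some_in_eq[of "K n Int P"] by (simp add: w_def)
  have "inj_on w {n. K n Int P ~= {}}" by (rule inj_onI) (metis w IntD1 K_disjoint disjoint_iff)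
  moreover have "w ` {n. K n Int P ~= {}} \<subseteq> P" using w by blast
  ultimately show ?thesis using P inj_on_finite by blast
 qed
 then obtain N where "!!n. n \<in> {n. K n Int P ~= {}} ==> n < N" unfolding finite_nat_set_iff_bounded by blast
 thus ?thesis by (metis (mono_tags) mem_Collect_eq not_le)
qed

end

locale bad_orbit = wandering_orbit +
 assumes many: "!!n. many (K n)"
begin

abbreviation "CV \<equiv> crit_values f"
abbreviation "discs n \<equiv> components (- K n)"

lemma covK: "cov (K n)" using K_cov[OF many_infinite[OF many]] .

lemma contK: "cont_set (K n)" using cov_image(1)[OF covK] .

lemmas disc = disc_of[OF contK]

definition "nxt n X = st (K n) X"

lemma nxt: "X \<in> discs n ==> nxt n X \<in> discs (Suc n)" "X \<in> discs n ==> nxt n X \<subseteq> f ` X"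
 unfolding nxt_def K_Suc using st_component[OF covK] st_subset[OF covK] by blast+

lemma disc_disjoint: "X \<in> discs n ==> Y \<in> discs n ==> X ~= Y ==> X Int Y = {}"
 using disc_eqI by blast

lemma in_disc: "x ~: K n ==> EX X:discs n. x \<in> X" using in_some_component[of x "- K n"] by simp

lemma CV: "finite CV" "!!v. ~ CV \<subseteq> {v}"
 using finite_crit_values[OF rat d1] two_crit_values[OF rat d2] by auto

text \<open>A triple of points is separated into three discs by at most one of the disjoint
  continua: a second one misses two of the three discs, and these, joined by the first continuum,
  lie in one of its discs.\<close>

lemma separation:
 assumes P: "finite P"
 shows "EX N. ALL n>=N. ALL X:discs n. ALL Y:discs n. ALL Z:discs n.
  X Int P ~= {} --> Y Int P ~= {} --> Z Int P ~= {} --> X = Y | Y = Z | X = Z"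
proof -
 define sep where "sep n t \<longleftrightarrow> (EX X:discs n. EX Y:discs n. EX Z:discs n. X ~= Y & Y ~= Z & X ~= Z &
   fst t \<in> X & fst (snd t) \<in> Y & snd (snd t) \<in> Z)" for n and t :: "riemann_sphere \<times> riemann_sphere \<times> riemann_sphere"
 have uniq: "n = m" if n: "sep n t" and m: "sep m t" for n m t
 proof (rule ccontr)
  assume ne: "n ~= m"
  obtain X Y Z where X: "X \<in> discs n" "Y \<in> discs n" "Z \<in> discs n" "X ~= Y" "Y ~= Z" "X ~= Z"
   "fst t \<in> X" "fst (snd t) \<in> Y" "snd (snd t) \<in> Z" using n unfolding sep_def by blast
  obtain X' Y' Z' where X': "X' \<in> discs m" "Y' \<in> discs m" "Z' \<in> discs m" "X' ~= Y'" "Y' ~= Z'" "X' ~= Z'"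
   "fst t \<in> X'" "fst (snd t) \<in> Y'" "snd (snd t) \<in> Z'" using m unfolding sep_def by blast
  have Km: "K m Int K n = {}" "connected (K m)" "K m ~= {}" "connected (K n)" "K n ~= {}"
   using K_disjoint[OF ne] contK[of m] contK[of n] K_ne by (auto simp: cont_set_def)
  have hit: "K m \<subseteq> A" if "A \<in> discs n" "A Int K m ~= {}" for A
   using components_maximal[OF that(1) Km(2)] Km(1) that(2) by blast
  have two: False if A: "A \<in> discs n" "B \<in> discs n" "A Int K m = {}" "B Int K m = {}"
   and x: "x \<in> A" "y \<in> B" and A': "A' \<in> discs m" "B' \<in> discs m" "x \<in> A'" "y \<in> B'" "A' ~= B'" for A B x y A' B'
  proof -
   have "connected ((A Un K n) Un (B Un K n))"
    by (rule connected_Un[OF disc(11)[OF A(1)] disc(11)[OF A(2)]]) (use Km(5) in blast)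
   moreover have "(A Un K n) Un (B Un K n) \<subseteq> - K m" using A(3,4) Km(1) by blast
   ultimately have "(A Un K n) Un (B Un K n) \<subseteq> A'" using components_maximal[OF A'(1)] x(1) A'(3) by blast
   thus False using x(2) A' disc_disjoint[OF A'(1,2)] by blast
  qed
  have d: "X Int Y = {}" "Y Int Z = {}" "X Int Z = {}" using disc_disjoint X by auto
  consider "X Int K m = {}" "Y Int K m = {}" | "Y Int K m = {}" "Z Int K m = {}" | "X Int K m = {}" "Z Int K m = {}"
   using hit[OF X(1)] hit[OF X(2)] hit[OF X(3)] d Km(3) by blast
  thus False
  proof cases
   case 1
   show False using two[OF X(1,2) 1 X(7,8) X'(1,2,7,8,4)] .
  next
   case 2
   show False using two[OF X(2,3) 2 X(8,9) X'(2,3,8,9,5)] .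
  next
   case 3
   show False using two[OF X(1,3) 3 X(7,9) X'(1,3,7,9,6)] .
  qed
 qed
 define bad where "bad = {n. EX t:P \<times> P \<times> P. sep n t}"
 have "finite bad"
 proof -
  define w where "w n = (SOME t. t \<in> P \<times> P \<times> P & sep n t)" for n
  have w: "w n \<in> P \<times> P \<times> P & sep n (w n)" if "n \<in> bad" for n
   unfolding w_def using that by (intro someI_ex[of "%t. t \<in> P \<times> P \<times> P & sep n t"]) (auto simp: bad_def)
  have "inj_on w bad" by (rule inj_onI) (metis w uniq)
  moreover have "w ` bad \<subseteq> P \<times> P \<times> P" using w by blast
  ultimately show ?thesis using P inj_on_finite by (metis finite_cartesian_product)
 qed
 then obtain N where N: "!!n. n \<in> bad ==> n < N" unfolding finite_nat_set_iff_bounded by blast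
 show ?thesis
 proof (intro exI[of _ N] allI impI ballI)
  fix n X Y Z assume n: "n >= N" and X: "X \<in> discs n" "Y \<in> discs n" "Z \<in> discs n"
   and P: "X Int P ~= {}" "Y Int P ~= {}" "Z Int P ~= {}"
  show "X = Y | Y = Z | X = Z"
  proof (rule ccontr)
   assume ne: "~ ?thesis"
   obtain x y z where xyz: "x \<in> X Int P" "y \<in> Y Int P" "z \<in> Z Int P" using P by blast
   have "sep n (x, y, z)" unfolding sep_def fst_conv snd_conv using X ne xyz by blast
   hence "n \<in> bad" unfolding bad_def using xyz by blast
   thus False using N n by (metis not_le)
  qed
 qed
qed

text \<open>The omitted disc contains a critical value \<open>v\<close> and hence
  \<open>N v\<close>, so the iterates of \<open>Q\<close> omit one of finitely many triples.\<close>

lemma omitting_fatou: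
 assumes Q: "open Q"
  and om: "!!n. n >= l ==> EX i. EX Z:discs i. K i Int CV = {} & Z Int CV ~= {} & (f ^^ n) ` Q Int Z = {}"
 shows "Q Int julia_set f = {}"
proof -
 obtain m t N where t: "!!v. v \<in> CV ==> v \<in> N v & connected (N v) & N v Int julia_set f \<subseteq> {v} &
   card (t v) = 3 & (f ^^ m) ` t v \<subseteq> N v" using omitted_triples[OF rat d2] by metis
 have op: "open ((f ^^ n) ` Q)" for n
  by (induction n) (use Q in simp, unfold image_funpow_Suc, rule rational_open[OF rat d1])
 have "(f ^^ l) ` Q \<subseteq> fatou_set f"
 proof (rule montel_three_points[OF rat op])
  show "finite (t ` CV)" using CV(1) by blast
  show "card T = 3" if "T \<in> t ` CV" for T using that t by auto
  fix n
  obtain i Z where Z: "Z \<in> discs i" "K i Int CV = {}" "Z Int CV ~= {}" "(f ^^ (m + (n + l))) ` Q Int Z = {}"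
   using om[of "m + (n + l)"] by auto
  then obtain v where v: "v \<in> CV" "v \<in> Z" by blast
  have "N v \<subseteq> - K i" using t[OF v(1)] v Z(2) K_sub[of i] by blast
  hence NZ: "N v \<subseteq> Z" using components_maximal[OF Z(1)] t[OF v(1)] v by blast
  have "(f ^^ n) ` (f ^^ l) ` Q Int t v = {}"
  proof (rule ccontr)
   assume "(f ^^ n) ` (f ^^ l) ` Q Int t v ~= {}"
   then obtain x where x: "x \<in> Q" "(f ^^ n) ((f ^^ l) x) \<in> t v" by auto
   hence "(f ^^ m) ((f ^^ n) ((f ^^ l) x)) \<in> N v" using t[OF v(1)] by blast
   hence "(f ^^ (m + (n + l))) x \<in> Z" using NZ by (auto simp: funpow_add)
   thus False using Z(4) x(1) by blast
  qed
  thus "EX t:t ` CV. (f ^^ n) ` (f ^^ l) ` Q Int t = {}" using v(1) by blast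
 qed
 hence "(f ^^ l) x ~: julia_set f" if "x \<in> Q" for x using that by (auto simp: julia_set_def)
 thus ?thesis using julia_funpow_invariant[OF rat d1] by blast
qed

text \<open>Such an orbit would be a wandering domain: two of the discs that met would coincide and
  share frontier points, which lie in disjoint continua.\<close>

lemma no_bubble:
 assumes X: "!!j. X j \<in> discs (n + j)" and f: "!!j. f ` X j = X (Suc j)" "!!j. inj_on f (X j)"
  and J: "X 0 Int julia_set f = {}"
 shows False
proof -
 have im: "(f ^^ j) ` X 0 = X j" for j by (induction j) (simp, simp only: image_funpow_Suc f)
 have inj: "inj_on (f ^^ j) (X 0)" for j
 proof (induction j)
  case (Suc j)
  hence "inj_on (f o (f ^^ j)) (X 0)" using f(2)[of j] by (intro comp_inj_on) (simp_all add: im)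
  thus ?case by (simp only: funpow.simps)
 qed simp
 have XJ: "X j Int julia_set f = {}" for j
 proof -
  have "(f ^^ j) ` X 0 Int julia_set f = {}" using J julia_funpow_invariant[OF rat d1] by auto
  thus ?thesis by (simp only: im)
 qed
 have dj: "X i Int X j = {}" if "i ~= j" for i j
 proof (rule ccontr)
  assume ne: "X i Int X j ~= {}"
  have sub: "X i \<subseteq> X j" if "X i Int X j ~= {}" for i j
  proof -
   have "X i \<subseteq> - K (n + j)" using XJ[of i] K_sub[of "n + j"] by blast
   thus ?thesis using components_maximal[OF X[of j] disc(2)[OF X[of i]]] that by blast
  qed
  have "X j Int X i ~= {}" using ne unfolding Int_commute[of "X i"] .
  from subset_antisym[OF sub[OF ne] sub[OF this]] have "X i = X j" .
  moreover obtain x where "x \<in> frontier (X i)" using disc(6)[OF X[of i]] by blast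
  ultimately have "x \<in> K (n + i) Int K (n + j)" using disc(5)[OF X[of i]] disc(5)[OF X[of j]] by auto
  thus False using K_disjoint[of "n + i" "n + j"] that by simp
 qed
 show False
 proof (rule no_wandering[OF rat d2 disc(1)[OF X[of 0]] disc(3)[OF X[of 0]] inj])
  show "(f ^^ i) ` X 0 Int (f ^^ j) ` X 0 = {}" if "i ~= j" for i j unfolding im using dj[OF that] .
  show "closure (X 0) \<subseteq> X 0 Un julia_set f" using disc(7)[OF X[of 0]] K_sub by blast
 qed (rule J)
qed

section \<open>Orbits of discs and chains of pull-backs\<close>

fun itr :: "nat => nat => riemann_sphere set => riemann_sphere set" where
 "itr n 0 X = X"
| "itr n (Suc j) X = nxt (n + j) (itr n j X)"

lemma itr_disc: "X \<in> discs n ==> itr n j X \<in> discs (n + j)"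
 by (induction j) (use nxt(1) in fastforce)+

text \<open>Otherwise \<open>f\<close> is injective along the orbit, and late images omit a disc
  that contains a critical value. The orbit would lie in the Fatou set, against
  \<open>no_bubble\<close>.\<close>

lemma meets_CV:
 assumes X: "X \<in> discs n"
 shows "EX j>=1. itr n j X Int CV ~= {}"
proof (rule ccontr)
 assume "~ ?thesis"
 hence "~ (1 <= Suc j & itr n (Suc j) X Int CV ~= {})" for j by blast
 hence nc: "itr n (Suc j) X Int CV = {}" for j by simp
 define Xj where "Xj j = itr n j X" for j
 have Xd: "Xj j \<in> discs (n + j)" for j unfolding Xj_def using itr_disc[OF X] .
 have bij: "f ` Xj j = Xj (Suc j)" "inj_on f (Xj j)" for j
  using st_bij[OF covK Xd[of j]] nc[of j] by (simp_all add: Xj_def nxt_def)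
 have im: "(f ^^ j) ` X = Xj j" for j
  by (induction j) (simp add: Xj_def, simp only: image_funpow_Suc bij)
 obtain N where N: "!!n. n >= N ==> K n Int CV = {}" using K_avoid[OF CV(1)] by blast
 have "X Int julia_set f = {}"
 proof (rule omitting_fatou[OF disc(1)[OF X], of "Suc N"])
  fix j assume j: "Suc N <= j"
  obtain v where v: "v \<in> CV" using CV(2) by blast
  have Kj: "K (n + j) Int CV = {}" using N j by simp
  then obtain Z where Z: "Z \<in> discs (n + j)" "v \<in> Z" using in_disc v by blast
  have "Xj j Int CV = {}" using nc[of "j - 1"] j by (simp add: Xj_def)
  hence "Z ~= Xj j" using Z(2) v by blast
  hence "Xj j Int Z = {}" using disc_disjoint[OF Xd Z(1)] by blast
  thus "EX i. EX Z:discs i. K i Int CV = {} & Z Int CV ~= {} & (f ^^ j) ` X Int Z = {}"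
   unfolding im using Z v Kj by blast
 qed
 thus False using no_bubble[OF Xd bij] by (simp add: Xj_def)
qed

text \<open>A chain of pull-backs from time \<open>s\<close> down to \<open>n0\<close>. The bound on
  critical values, needed for each pull-back, is not imposed at \<open>n0\<close>, since its failure
  may be what stops the chain there.\<close>

definition "run n0 s Y \<longleftrightarrow> n0 <= s & (ALL i>=n0. i < s --> link (K i) (Y i) (Y (Suc i))) &
  (ALL i. n0 < i & i <= s --> (EX v. - Y i Int CV \<subseteq> {v})) & Y s \<in> discs s & CV \<subseteq> Y s"

lemma run_disc:
 assumes "run n0 s Y" "n0 <= i" "i <= s"
 shows "Y i \<in> discs i" "i < s ==> link (K i) (Y i) (Y (Suc i))" "i < s ==> nxt i (Y i) = Y (Suc i)"
  "i < s ==> f ` (- Y i) = - Y (Suc i)"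
proof -
 show l: "link (K i) (Y i) (Y (Suc i))" if "i < s" using assms that by (auto simp: run_def)
 show "Y i \<in> discs i" using l assms unfolding link_def by (cases "i = s") (auto simp: run_def)
 show "nxt i (Y i) = Y (Suc i)" if "i < s" unfolding nxt_def using link_st[OF covK l[OF that]] .
 show "f ` (- Y i) = - Y (Suc i)" if "i < s" using link_image[OF l[OF that] covK] .
qed

lemma run_meets:
 assumes "run n0 s Y" "n0 < i" "i <= s"
 shows "Y i Int CV ~= {}"
proof
 assume e: "Y i Int CV = {}"
 obtain v where "- Y i Int CV \<subseteq> {v}" using assms by (auto simp: run_def)
 hence "CV \<subseteq> {v}" using e by blast
 thus False using CV(2) by blast
qed

lemma run_image:
 assumes "run n0 s Y" "n0 <= i"
 shows "i + l <= s ==> (f ^^ l) ` (- Y i) = - Y (i + l)"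
  "i + l <= s ==> (f ^^ l) ` (- Y i - K i) \<subseteq> - Y (i + l) - K (i + l)"
proof (induction l)
 case (Suc l)
 {
  case 1
  thus ?case using Suc(1) run_disc(4)[OF assms(1), of "i + l"] assms(2)
   by (simp only: image_funpow_Suc) simp
 next
  case 2
  have "f ` (- Y (i + l) - K (i + l)) \<subseteq> - Y (Suc (i + l)) - K (Suc (i + l))"
   using run_disc(2)[OF assms(1), of "i + l"] assms(2) 2 by (simp add: link_def K_Suc)
  moreover have "(f ^^ l) ` (- Y i - K i) \<subseteq> - Y (i + l) - K (i + l)" using Suc(2) 2 by simp
  ultimately show ?case unfolding image_funpow_Suc add_Suc_right using image_mono by (meson order_trans)
 }
qed auto

lemma run_exists:
 assumes Y: "Ys \<in> discs s" "CV \<subseteq> Ys" and L: "L <= s"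
 shows "EX n0 Y. L <= n0 & run n0 s Y & (n0 = L | ~ (EX v. - Y n0 Int CV \<subseteq> {v}))" using L
proof (induction rule: inc_induct)
 case base
 have "run s s (%_. Ys)" using Y by (auto simp: run_def)
 thus ?case by blast
next
 case (step t)
 then obtain n0 Y where Y: "Suc t <= n0" "run n0 s Y" "n0 = Suc t | ~ (EX v. - Y n0 Int CV \<subseteq> {v})" by blast
 show ?case
 proof (cases "EX v. - Y n0 Int CV \<subseteq> {v}")
  case False
  thus ?thesis using Y(1,2) by (metis Suc_leD)
 next
  case True
  hence n0: "n0 = Suc t" using Y(3) by blast
  obtain v where "- Y n0 Int CV \<subseteq> {v}" using True by blast
  moreover have "Y n0 \<in> components (- f ` K t)"
   using run_disc(1)[OF Y(2), of n0] Y(2) n0 by (simp add: run_def K_Suc)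
  ultimately obtain Z where Z: "link (K t) Z (Y (Suc t))" using pull[OF covK, of "Y n0" t] n0 by blast
  have "run t s (Y(t := Z))" unfolding run_def
  proof (intro conjI allI impI)
   fix i assume "t <= i" "i < s"
   thus "link (K i) ((Y(t := Z)) i) ((Y(t := Z)) (Suc i))" using Z Y(2) n0 by (cases "i = t") (auto simp: run_def)
  next
   fix i assume i: "t < i & i <= s"
   thus "EX v. - (Y(t := Z)) i Int CV \<subseteq> {v}" using True Y(2) n0 by (cases "i = n0") (auto simp: run_def)
  qed (use step Y n0 in "auto simp: run_def")
  thus ?thesis by blast
 qed
qed

text \<open>Both complements are pushed forward until one chain ends. They would still cover the
  sphere, but then one contains no critical value and the other at most one, while \<open>f\<close>
  has two.\<close>

lemma no_cover:
 assumes r: "run n0 s Y" "run n0' s' Y'" and i: "n0 <= i" "n0' <= i'" and l: "l = min (s - i) (s' - i')"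
  and b: "n0 < i + l" "n0' < i' + l" and "i <= s" "i' <= s'"
 shows "- Y i Un - Y' i' ~= UNIV"
proof
 assume c: "- Y i Un - Y' i' = UNIV"
 have le: "i + l <= s" "i' + l <= s'" using l assms(8,9) by auto
 have "(f ^^ l) ` UNIV = UNIV" using rational_surj[OF rat d1] by (induction l) (simp, simp only: image_funpow_Suc)
 hence u: "- Y (i + l) Un - Y' (i' + l) = UNIV"
  unfolding c[symmetric] image_Un using run_image(1)[OF r(1) i(1) le(1)] run_image(1)[OF r(2) i(2) le(2)] by simp
 obtain v where v: "- Y (i + l) Int CV \<subseteq> {v}" using r(1) b(1) le(1) by (auto simp: run_def)
 obtain v' where v': "- Y' (i' + l) Int CV \<subseteq> {v'}" using r(2) b(2) le(2) by (auto simp: run_def)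
 consider "i + l = s" | "i' + l = s'" using l assms(8,9) by (cases "s - i <= s' - i'") auto
 thus False
 proof cases
  case 1
  hence "CV \<subseteq> Y (i + l)" using r(1) by (simp add: run_def)
  hence "CV \<subseteq> {v'}" using u v' by blast
  thus False using CV(2) by blast
 next
  case 2
  hence "CV \<subseteq> Y' (i' + l)" using r(2) by (simp add: run_def)
  hence "CV \<subseteq> {v}" using u v by blast
  thus False using CV(2) by blast
 qed
qed

lemma finite_meeting: "finite {X\<in>discs n. X Int CV ~= {}}"
proof -
 define w where "w X = (SOME v. v \<in> X Int CV)" for X
 have w: "w X \<in> X Int CV" if "X \<in> {X\<in>discs n. X Int CV ~= {}}" for X
  using that some_in_eq[of "X Int CV"] by (simp add: w_def)
 have "inj_on w {X\<in>discs n. X Int CV ~= {}}"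
 proof (rule inj_onI)
  fix X Y assume X: "X \<in> {X\<in>discs n. X Int CV ~= {}}" "Y \<in> {X\<in>discs n. X Int CV ~= {}}" "w X = w Y"
  thus "X = Y" using w[OF X(1)] w[OF X(2)] disc_disjoint[of X n Y] by auto
 qed
 moreover have "w ` {X\<in>discs n. X Int CV ~= {}} \<subseteq> CV" using w by blast
 ultimately show ?thesis using CV(1) inj_on_finite by blast
qed

end

section \<open>Chains of complements of discs\<close>

context bad_orbit
begin

definition "hot n X \<longleftrightarrow> X Int CV ~= {} | nxt n X Int CV ~= {}"

text \<open>The chain \<open>Y\<close> cannot be prolonged backwards beyond time \<open>n0\<close>, while some third disc \<open>X\<close> avoids the
 critical values between times \<open>a\<close> and \<open>s\<close>.\<close>

definition "wit k L n0 s Y a X \<longleftrightarrow> run n0 s Y & L <= n0 & (n0 = L | ~ (EX v. - Y n0 Int CV \<subseteq> {v})) &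
 n0 + k <= s & a <= s & k <= a & (ALL i>=a. i <= s --> X i \<in> discs i & X i Int CV = {}) &
 (ALL i>=a. i < s --> nxt i (X i) = X (Suc i)) & nxt s (X s) Int CV ~= {} &
 (EX A:discs a. EX B:discs a. A ~= B & X a ~= A & X a ~= B & hot a A & hot a B)"

lemma hot_meets: "X \<in> discs n ==> hot n X ==> X Int (CV Un f -` CV) ~= {}"
 using nxt(2)[of X n] unfolding hot_def by blast

lemma finite_pre: "finite P ==> finite ((f ^^ n) -` P)"
proof -
 assume "finite P"
 moreover have "(f ^^ n) -` P = (\<Union>y\<in>P. (f ^^ n) -` {y})" by auto
 ultimately show ?thesis using rational_funpow_fiber(1)[OF rat d1] by simp
qed

lemma chain_image:
 assumes c: "!!i. a <= i ==> i < s ==> nxt i (X i) = X (Suc i)" and X: "!!i. a <= i ==> i <= s ==> X i \<in> discs i"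
  and i: "a <= i" "i <= s"
 shows "nxt s (X s) \<subseteq> (f ^^ (Suc s - i)) ` X i" using i(2,1)
proof (induction rule: inc_induct)
 case base
 thus ?case using nxt(2)[OF X[of s]] i by simp
next
 case (step i)
 have "X (Suc i) \<subseteq> f ` X i" using nxt(2)[OF X[of i]] c[of i] step by simp
 hence "(f ^^ (Suc s - Suc i)) ` X (Suc i) \<subseteq> (f ^^ (Suc s - Suc i)) ` f ` X i" by (rule image_mono)
 also have "... = (f ^^ Suc (Suc s - Suc i)) ` X i" unfolding funpow_Suc_right by (simp only: image_comp)
 also have "Suc (Suc s - Suc i) = Suc s - i" using step by simp
 finally show ?case using step by simp
qed

text \<open>Separation is applied to the points that reach critical values within
  \<open>Suc k\<close> steps. A third disc besides two hot ones avoids these points, so its way to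
  the critical values is long. On arrival it is one of the two discs allowed, and all critical
  values lie in a single other disc, where the chain starts.\<close>

lemma wit_exists:
 assumes L: "!!n. n >= L ==> K n Int CV = {}"
 shows "EX n0 s Y a X. wit k L n0 s Y a X"
proof -
 define P where "P = (\<Union>i\<le>Suc k. (f ^^ i) -` CV)"
 have Pf: "finite P" unfolding P_def using finite_pre[OF CV(1)] by blast
 have PCV: "CV Un f -` CV \<subseteq> P"
 proof -
  have "(f ^^ 0) -` CV \<subseteq> P" "(f ^^ 1) -` CV \<subseteq> P" unfolding P_def by (rule UN_upper; simp)+
  thus ?thesis by simp
 qed
 from separation[OF Pf] obtain N where N0: "ALL n>=N. ALL X:discs n. ALL Y:discs n. ALL Z:discs n.
  X Int P ~= {} --> Y Int P ~= {} --> Z Int P ~= {} --> X = Y | Y = Z | X = Z" by (erule exE)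
 note N = N0[rule_format]
 define M where "M = max (max N L) k"
 have NM: "N <= M" by (simp add: M_def)
 text \<open>A time at which two discs are about to meet the critical values.\<close>
 obtain a A B where a: "M <= a" and AB: "A \<in> discs a" "B \<in> discs a" "A ~= B" "hot a A" "hot a B"
 proof -
  obtain T where T: "T \<in> discs M" "T Int CV = {}"
  proof -
   obtain T1 where T1: "T1 \<in> discs M" using many_third[OF many] by blast
   obtain T2 where T2: "T2 \<in> discs M" "T2 ~= T1" using many_third[OF many] by blast
   obtain T3 where T3: "T3 \<in> discs M" "T3 ~= T1" "T3 ~= T2" using many_third[OF many] by blast
   have "T1 Int P = {} | T2 Int P = {} | T3 Int P = {}" using N[OF NM T1 T2(1) T3(1)] T2(2) T3(2,3) by metis
   thus ?thesis using that T1 T2(1) T3(1) PCV by blast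
  qed
  define j where "j = (LEAST j. j >= 1 & itr M j T Int CV ~= {})"
  have j: "j >= 1" "itr M j T Int CV ~= {}" and jl: "!!i. i >= 1 ==> itr M i T Int CV ~= {} ==> j <= i"
   using LeastI_ex[OF meets_CV[OF T(1)]] unfolding j_def by (auto intro: Least_le)
  obtain i where i: "j = Suc i" using j(1) by (cases j) auto
  have A: "itr M i T \<in> discs (M + i)" by (rule itr_disc[OF T(1)])
  have A2: "itr M i T Int CV = {}"
  proof (cases "i = 0")
   case False
   hence "~ j <= i" "1 <= i" using i by auto
   thus ?thesis using jl[of i] by blast
  qed (use T(2) in simp)
  obtain v where v: "v \<in> CV" using CV(2) by blast
  have "K (M + i) Int CV = {}" using L[of "M + i"] by (simp add: M_def)
  then obtain B where B: "B \<in> discs (M + i)" "v \<in> B" using in_disc v by blast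
  have hA: "hot (M + i) (itr M i T)" using j(2) by (simp add: i hot_def)
  have hB: "hot (M + i) B" using B(2) v by (auto simp: hot_def)
  have "itr M i T ~= B" using A2 B(2) v by blast
  thus ?thesis using that[OF _ A B(1) _ hA hB] by simp
 qed
 have aN: "N <= a" "L <= a" "k <= a" using a by (auto simp: M_def)
 have AP: "A Int P ~= {}" "B Int P ~= {}" using hot_meets[OF AB(1,4)] hot_meets[OF AB(2,5)] PCV by blast+
 obtain Xa where Xa: "Xa \<in> discs a" "Xa ~= A" "Xa ~= B" using many_third[OF many] by blast
 have XaP: "Xa Int P = {}" using N[OF aN(1) Xa(1) AB(1,2)] Xa AB(3) AP by blast
 define j where "j = (LEAST j. j >= 1 & itr a j Xa Int CV ~= {})"
 have j: "j >= 1" "itr a j Xa Int CV ~= {}" and jl: "!!i. i >= 1 ==> itr a i Xa Int CV ~= {} ==> j <= i"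
  using LeastI_ex[OF meets_CV[OF Xa(1)]] unfolding j_def by (auto intro: Least_le)
 define s where "s = a + j - 1"
 define X where "X i = itr a (i - a) Xa" for i
 have Xd: "X i \<in> discs i" if "a <= i" for i using itr_disc[OF Xa(1), of "i - a"] that by (simp add: X_def)
 have Xn: "nxt i (X i) = X (Suc i)" if "a <= i" for i using that by (simp add: X_def Suc_diff_le)
 have XCV: "X i Int CV = {}" if "a <= i" "i <= s" for i
 proof (cases "i = a")
  case True
  thus ?thesis using XaP PCV by (auto simp: X_def)
 next
  case False
  hence "1 <= i - a" "~ j <= i - a" using that j(1) by (auto simp: s_def)
  thus ?thesis using jl[of "i - a"] unfolding X_def by blast
 qed
 have as: "a <= s" using j(1) by (simp add: s_def)
 have last: "nxt s (X s) Int CV ~= {}" unfolding Xn[OF as] using j by (simp add: X_def s_def)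
 have Xhit: "X i Int (f ^^ (Suc s - i)) -` CV ~= {}" if "a <= i" "i <= s" for i
  using chain_image[of a s X i] Xn Xd that last by blast
 have long: "a + k <= s"
 proof (rule ccontr)
  assume "~ a + k <= s"
  hence "(f ^^ (Suc s - a)) -` CV \<subseteq> P" unfolding P_def by (intro UN_upper) simp
  thus False using Xhit[of a] as XaP by (auto simp: X_def)
 qed
 have sN: "N <= s" "L <= s" using as aN by auto
 obtain v0 where v0: "v0 \<in> CV" using CV(2) by blast
 obtain Ys where Ys: "Ys \<in> discs s" "v0 \<in> Ys" using in_disc[of v0 s] L[OF sN(2)] v0 by blast
 have "X s Int f -` CV ~= {}" using Xhit[of s] as by simp
 hence XsP: "X s Int P ~= {}" using PCV by blast
 have "CV \<subseteq> Ys"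
 proof
  fix v assume v: "v \<in> CV"
  obtain D where D: "D \<in> discs s" "v \<in> D" using in_disc[of v s] L[OF sN(2)] v by blast
  have ne: "X s ~= D" "X s ~= Ys" using XCV[of s] as v v0 D(2) Ys(2) by auto
  have "D Int P ~= {}" "Ys Int P ~= {}" using v v0 D(2) Ys(2) PCV by auto
  hence "D = Ys" using N[OF sN(1) D(1) Ys(1) Xd[OF as] _ _ XsP] ne by metis
  thus "v \<in> Ys" using D(2) by simp
 qed
 then obtain n0 Y where Y: "L <= n0" "run n0 s Y" "n0 = L | ~ (EX v. - Y n0 Int CV \<subseteq> {v})"
  using run_exists[OF Ys(1) _ sN(2)] by blast
 have n0s: "n0 <= s" using Y(2) by (simp add: run_def)
 have XY: "X i ~= Y i" if "a <= i" "n0 <= i" "i <= s" for i using that(3,1,2)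
 proof (induction rule: inc_induct)
  case base
  have "v0 \<in> Y s" using Y(2) v0 by (auto simp: run_def)
  thus ?case using XCV[of s] as v0 by auto
 next
  case (step i)
  thus ?case using Xn[of i] run_disc(3)[OF Y(2), of i] by auto
 qed
 \<comment> \<open>If the chain stopped too soon, \<open>Y n0\<close>, \<open>X n0\<close> and the
   disc of a critical value outside \<open>Y n0\<close> would be three discs meeting
   \<open>P\<close>.\<close>
 have "n0 + k <= s"
 proof (rule ccontr)
  assume n: "~ n0 + k <= s"
  hence n0a: "a < n0" using long by simp
  hence "n0 ~= L" using aN by simp
  then obtain v where v: "v \<in> CV" "v \<in> - Y n0" using Y(3) by blast
  have n0N: "N <= n0" "L <= n0" using n0a aN by auto
  obtain B' where B': "B' \<in> discs n0" "v \<in> B'" using in_disc[of v n0] L[OF n0N(2)] v(1) by blast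
  have Yd: "Y n0 \<in> discs n0" using run_disc(1)[OF Y(2) order_refl n0s] .
  have "Y n0 Int P ~= {}"
  proof -
   have "surj (f ^^ (s - n0))" using rational_surj[OF rat d1] by (rule surj_fn)
   then obtain x where x: "(f ^^ (s - n0)) x = v0" by (metis surjD)
   have "x ~: - Y n0"
   proof
    assume "x \<in> - Y n0"
    hence "v0 \<in> - Y s" using run_image(1)[OF Y(2) order_refl, of "s - n0"] n0s x by (metis image_eqI le_add_diff_inverse order_refl)
    thus False using Y(2) v0 by (auto simp: run_def)
   qed
   moreover have "x \<in> P" unfolding P_def using x v0 n by (intro UN_I[of "s - n0"]) auto
   ultimately show ?thesis by blast
  qed
  moreover have "X n0 Int P ~= {}"
  proof -
   have "(f ^^ (Suc s - n0)) -` CV \<subseteq> P" unfolding P_def using n n0s by (intro UN_upper) simp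
   thus ?thesis using Xhit[of n0] n0a n0s by auto
  qed
  moreover have "B' Int P ~= {}" using B'(2) v(1) PCV by blast
  moreover have "X n0 ~= Y n0" using XY[of n0] n0a n0s by simp
  moreover have "B' ~= Y n0" using B'(2) v(2) by blast
  moreover have "X n0 ~= B'" using XCV[of n0] n0a n0s B'(2) v(1) by auto
  ultimately show False using N[OF n0N(1) Xd[of n0] Yd B'(1)] n0a by auto
 qed
 moreover have "X a = Xa" by (simp add: X_def)
 ultimately have "wit k L n0 s Y a X"
  unfolding wit_def using Y as aN(3) Xd XCV Xn last AB Xa(2,3) by (intro conjI) blast+
 thus ?thesis by blast
qed

lemma run_interior:
 assumes Z: "Z \<in> discs i"
 shows "open (- Z - K i)"
proof -
 have "closed (Z Un K i)" using disc(7)[OF Z] contK[of i] by (simp add: cont_set_def closure_subset_eq[symmetric])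
 moreover have "- Z - K i = - (Z Un K i)" by auto
 ultimately show ?thesis by (simp only: open_Compl)
qed

text \<open>At each time only finitely many discs meet the critical values, so a diagonal choice
  among ever longer chains gives an infinite one. Its complements are pairwise disjoint, finally
  free of critical values, and another disc inside them wanders univalently.\<close>

lemma bounded_runs_False:
 assumes L: "!!n. n >= L ==> K n Int CV = {}" and T: "infinite (T :: nat set)"
  and r: "!!k. k \<in> T ==> run n0 (s k) (Y k)" "!!k. k \<in> T ==> k <= s k" and n0: "L <= n0"
 shows False
proof -
 \<comment> \<open>The bound on critical values begins only after time \<open>n0\<close>.\<close>
 define i0 where "i0 = Suc n0"
 define good where "good j S \<longleftrightarrow> infinite S & S \<subseteq> T & (ALL k:S. i0 + j <= s k) & (ALL k:S. ALL k':S. Y k (i0 + j) = Y k' (i0 + j))"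
  for j and S :: "nat set"
 have refine: "\<exists>S'\<subseteq>S. good j S'" if S: "infinite S" "S \<subseteq> T" for S j
 proof -
  define S1 where "S1 = {k\<in>S. i0 + j <= s k}"
  have "S - S1 \<subseteq> {..<i0 + j}" using r(2) S(2) by (force simp: S1_def)
  hence "finite (S - S1)" using finite_subset by blast
  moreover have "S = S1 Un (S - S1)" by (auto simp: S1_def)
  ultimately have "infinite S1" using S(1) by (metis finite_UnI)
  moreover have "S1 \<subseteq> S" by (auto simp: S1_def)
  ultimately have S1: "infinite S1" "S1 \<subseteq> S" by auto
  have "(%k. Y k (i0 + j)) ` S1 \<subseteq> {X\<in>discs (i0 + j). X Int CV ~= {}}"
  proof
   fix Z assume "Z \<in> (%k. Y k (i0 + j)) ` S1"
   then obtain k where k: "k \<in> S1" "Z = Y k (i0 + j)" by blast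
   hence "k \<in> T" "i0 + j <= s k" using S(2) by (auto simp: S1_def)
   thus "Z \<in> {X\<in>discs (i0 + j). X Int CV ~= {}}"
    using run_disc(1)[OF r(1), of k "i0 + j"] run_meets[OF r(1), of k "i0 + j"] k(2) by (simp add: i0_def)
  qed
  from finite_subset[OF this finite_meeting] have "finite ((%k. Y k (i0 + j)) ` S1)" .
  then obtain k0 where k0: "k0 \<in> S1" "infinite {k\<in>S1. Y k (i0 + j) = Y k0 (i0 + j)}"
   using pigeonhole_infinite[OF S1(1)] by blast
  define S' where "S' = {k\<in>S1. Y k (i0 + j) = Y k0 (i0 + j)}"
  have "good j S'" unfolding good_def using k0 S1 S(2) by (auto simp: S1_def S'_def)
  moreover have "S' \<subseteq> S" using S1(2) by (auto simp: S'_def)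
  ultimately show ?thesis by (intro exI[of _ S'] conjI)
 qed
 obtain S0 where "good 0 S0" using refine[OF T order_refl] by blast
 moreover have "EX S'. good (Suc j) S' & S' \<subseteq> S" if "good j S" for j S
 proof -
  have "infinite S" "S \<subseteq> T" using that by (auto simp: good_def)
  from refine[OF this, of "Suc j"] show ?thesis by blast
 qed
 ultimately have "EX S. ALL j. good j (S j) & S (Suc j) \<subseteq> S j"
  by (intro dependent_nat_choice) blast+
 then obtain S where S: "!!j. good j (S j)" "!!j. S (Suc j) \<subseteq> S j" by blast
 have Smono: "S j' \<subseteq> S j" if "j <= j'" for j j' using lift_Suc_antimono_le[of S, OF S(2) that] .
 define kk where "kk j = (SOME k. k \<in> S j)" for j
 have kk: "kk j \<in> S j" for j
  using S(1)[of j] some_in_eq[of "S j"] unfolding good_def kk_def by (metis finite.emptyI)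
 have ST: "k \<in> T" "i0 + j <= s k" if "k \<in> S j" for k j using S(1)[of j] that unfolding good_def by auto
 define Z where "Z j = Y (kk j) (i0 + j)" for j
 have ZY: "Z j = Y k (i0 + j)" if "k \<in> S j'" "j <= j'" for k j j'
  using S(1)[of j] kk[of j] Smono[OF that(2)] that(1) unfolding good_def Z_def by blast
 have run_k: "run n0 (s (kk j)) (Y (kk j))" "i0 + j <= s (kk j)" for j using r(1) ST kk by blast+
 have Zd: "Z j \<in> discs (i0 + j)" for j
  unfolding Z_def using run_disc(1)[OF run_k(1), of "i0 + j" j] run_k(2)[of j] by (simp add: i0_def)
 have Zcv: "EX v. - Z j Int CV \<subseteq> {v}" for j
  unfolding Z_def using run_k[of j] by (auto simp: run_def i0_def)
 have Zmeet: "Z j Int CV ~= {}" for j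
  unfolding Z_def using run_meets[OF run_k(1)] run_k(2) by (simp add: i0_def)
 have Zlink: "link (K (i0 + j)) (Z j) (Z (Suc j))" for j
 proof -
  have "link (K (i0 + j)) (Y (kk (Suc j)) (i0 + j)) (Y (kk (Suc j)) (Suc (i0 + j)))"
   using run_disc(2)[OF run_k(1)[of "Suc j"], of "i0 + j"] run_k(2)[of "Suc j"] by (simp add: i0_def)
  thus ?thesis using ZY[OF kk, of j "Suc j"] by (simp add: Z_def)
 qed
 have Zim: "(f ^^ l) ` (- Z j - K (i0 + j)) \<subseteq> - Z (j + l)" for j l
 proof -
  have "(f ^^ l) ` (- Y (kk (j + l)) (i0 + j) - K (i0 + j)) \<subseteq> - Y (kk (j + l)) (i0 + j + l)"
   using run_image(2)[OF run_k(1)[of "j + l"], of "i0 + j" l] run_k(2)[of "j + l"] by (auto simp: i0_def)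
  thus ?thesis using ZY[OF kk, of j "j + l"] by (simp add: Z_def add.assoc)
 qed
 have ZJ: "(- Z j - K (i0 + j)) Int julia_set f = {}" for j
 proof (rule omitting_fatou[OF run_interior[OF Zd]])
  fix n :: nat
  have "Z (j + n) \<in> discs (i0 + (j + n))" "K (i0 + (j + n)) Int CV = {}" "Z (j + n) Int CV ~= {}"
   "(f ^^ n) ` (- Z j - K (i0 + j)) Int Z (j + n) = {}"
   using Zd L n0 Zmeet Zim[of n j] by (auto simp: i0_def)
  thus "EX i. EX Z':discs i. K i Int CV = {} & Z' Int CV ~= {} & (f ^^ n) ` (- Z j - K (i0 + j)) Int Z' = {}" by blast
 qed
 \<comment> \<open>Nesting would put a Julia component into a set that lies in the Fatou set, and
   covering is excluded by \<open>no_cover\<close>.\<close>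
 have dj: "- Z i Int - Z j = {}" if ij: "i < j" for i j
 proof -
  have Kd: "K (i0 + i) Int K (i0 + j) = {}" using K_disjoint ij by simp
  have nest: "~ - Z i' \<subseteq> - Z j' - K (i0 + j')" for i' j'
  proof
   assume "- Z i' \<subseteq> - Z j' - K (i0 + j')"
   hence "K (i0 + i') \<subseteq> - Z j' - K (i0 + j')" using disc(9)[OF Zd[of i']] by blast
   thus False using ZJ[of j'] K_sub[of "i0 + i'"] K_ne[of "i0 + i'"] by blast
  qed
  have "- Z i Un - Z j ~= UNIV"
  proof -
   have 1: "Z i = Y (kk j) (i0 + i)" "Z j = Y (kk j) (i0 + j)" using ZY[OF kk, of i j] ij by (simp_all add: Z_def)
   show ?thesis unfolding 1 using run_k(2)[of j] ij
    by (intro no_cover[OF run_k(1)[of j] run_k(1)[of j] _ _ refl]) (auto simp: i0_def)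
  qed
  thus ?thesis using disc_complements_cases[OF contK contK Kd Zd Zd] nest by blast
 qed
 have "finite {j. - Z j Int CV ~= {}}"
 proof -
  define w where "w j = (SOME v. v \<in> - Z j Int CV)" for j
  have w: "w j \<in> - Z j Int CV" if "j \<in> {j. - Z j Int CV ~= {}}" for j
   using that some_in_eq[of "- Z j Int CV"] by (simp add: w_def)
  have "inj_on w {j. - Z j Int CV ~= {}}"
  proof (rule inj_onI)
   fix i j assume ij: "i \<in> {j. - Z j Int CV ~= {}}" "j \<in> {j. - Z j Int CV ~= {}}" "w i = w j"
   hence "w i \<in> - Z i Int - Z j" using w[OF ij(1)] w[OF ij(2)] by auto
   thus "i = j" using dj[of i j] dj[of j i] by (cases i j rule: linorder_cases) auto
  qed
  moreover have "w ` {j. - Z j Int CV ~= {}} \<subseteq> CV" using w by blast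
  ultimately show ?thesis using CV(1) inj_on_finite by blast
 qed
 then obtain N where N: "!!j. j \<in> {j. - Z j Int CV ~= {}} ==> j < N" unfolding finite_nat_set_iff_bounded by blast
 hence Ncv: "- Z j Int CV = {}" if "j >= N" for j using that by (metis (mono_tags) mem_Collect_eq not_le)
 have inj: "inj_on f (- Z j)" if "j >= N" for j
  using Zlink[of j] Ncv[of "Suc j"] that unfolding link_def by simp
 obtain X0 where X0: "X0 \<in> discs (i0 + N)" "X0 ~= Z N" using many_third[OF many] by blast
 define X where "X j = itr (i0 + N) j X0" for j
 have Xd: "X j \<in> discs (i0 + N + j)" for j unfolding X_def using itr_disc[OF X0(1)] .
 have XZ: "X j ~= Z (N + j)" for j
 proof (induction j)
  case 0
  thus ?case using X0 by (simp add: X_def)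
 next
  case (Suc j)
  have "st (K (i0 + (N + j))) (X j) ~= Z (Suc (N + j))"
   by (rule link_other(2)[OF covK Zlink _ Suc]) (use Xd[of j] in "simp add: add.assoc")
  thus ?case by (simp add: X_def nxt_def add.assoc)
 qed
 have X1: "X j \<in> discs (i0 + (N + j))" for j using Xd[of j] by (simp add: add.assoc)
 show False
 proof (rule no_bubble[OF Xd])
  fix j
  have "f ` X j = st (K (i0 + (N + j))) (X j)" by (rule link_other(1)[OF covK Zlink X1 XZ])
  thus "f ` X j = X (Suc j)" by (simp add: X_def nxt_def add.assoc)
  have "X j \<subseteq> - Z (N + j)" using link_other(3)[OF covK Zlink X1 XZ] by blast
  thus "inj_on f (X j)" using inj[of "N + j"] inj_on_subset by auto
  have "X 0 \<subseteq> - Z (N + 0) - K (i0 + (N + 0))" by (rule link_other(3)[OF covK Zlink X1 XZ])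
  thus "X 0 Int julia_set f = {}" using ZJ[of "N + 0"] by blast
 qed
qed

end

section \<open>Nested complements and their limit\<close>

lemma (in bad_orbit) wit_mono: "wit k L n0 s Y a X ==> l <= k ==> wit l L n0 s Y a X"
 unfolding wit_def by (elim conjE, intro conjI) (assumption | linarith)+

locale nested_runs = bad_orbit +
 fixes L :: nat and n s a :: "nat => nat" and Y X and u v :: riemann_sphere
 assumes L: "!!i. i >= L ==> K i Int crit_values f = {}"
  and wit: "!!q. wit q L (n q) (s q) (Y q) (a q) (X q)" and n: "strict_mono n"
  and uv: "u ~= v" "u \<in> crit_values f" "v \<in> crit_values f" "!!q. u \<in> - Y q (n q)" "!!q. v \<in> - Y q (n q)"
  and nest: "!!q q'. q < q' ==> - Y q' (n q') \<subseteq> - Y q (n q) - K (n q)"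
begin

lemma run: "run (n q) (s q) (Y q)" and long: "n q + q <= s q" and nL: "L <= n q" and aq: "q <= a q" "a q <= s q"
 using wit[of q] unfolding wit_def by blast+

lemma nq: "q <= n q" using seq_suble[OF n] .

definition "c q j = - Y q (n q + j)"
definition "E j = (f ^^ j) ` (\<Inter>q. c q 0)"

lemma Yd: "n q + j <= s q ==> Y q (n q + j) \<in> discs (n q + j)"
 using run_disc(1)[OF run, of q "n q + j"] by simp

lemma c_image: "n q + j <= s q ==> (f ^^ j) ` c q 0 = c q j"
 using run_image(1)[OF run order_refl, of q j] by (simp add: c_def)

lemma c_image_interior: "n q + j <= s q ==> (f ^^ j) ` (c q 0 - K (n q)) \<subseteq> c q j - K (n q + j)"
 using run_image(2)[OF run order_refl, of q j] by (simp add: c_def)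

lemma c_nest: "q < q' ==> j <= q ==> c q' j \<subseteq> c q j - K (n q + j)"
proof -
 assume q: "q < q'" "j <= q"
 have "c q' j = (f ^^ j) ` c q' 0" using c_image[of q' j] long[of q'] q by simp
 also have "... \<subseteq> (f ^^ j) ` (c q 0 - K (n q))" using nest[OF q(1)] by (intro image_mono) (simp add: c_def)
 also have "... \<subseteq> c q j - K (n q + j)" using c_image_interior[of q j] long[of q] q by simp
 finally show ?thesis .
qed

lemma c_mono: "q <= q' ==> j <= q ==> c q' j \<subseteq> c q j"
 using c_nest[of q q' j] by (cases "q = q'") auto

lemma c_closed: "n q + j <= s q ==> closed (c q j)" "n q + j <= s q ==> connected (c q j)"
 unfolding c_def using disc(8,12)[OF Yd] by blast+

lemma E_add: "(f ^^ l) ` E j = E (j + l)"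
 unfolding E_def by (simp add: image_comp funpow_add[symmetric] add.commute)

lemma E_sub: "n q + j <= s q ==> E j \<subseteq> c q j - K (n q + j)"
proof -
 assume q: "n q + j <= s q"
 have "(\<Inter>q. c q 0) \<subseteq> c q 0 - K (n q)" using c_nest[of q "Suc q" 0] by auto
 hence "E j \<subseteq> (f ^^ j) ` (c q 0 - K (n q))" unfolding E_def by (rule image_mono)
 thus ?thesis using c_image_interior[OF q] by blast
qed

text \<open>By compactness the image of a nested intersection is the intersection of the images;
  only chains that last \<open>j\<close> steps are used.\<close>

lemma E_I:
 assumes y: "!!q. q >= j ==> y \<in> c q j"
 shows "y \<in> E j"
proof -
 have cf: "continuous_on UNIV (f ^^ j)" using continuous_on_funpow_sphere[OF cont] .
 have "(\<Inter>q. c (q + j) 0 Int (f ^^ j) -` {y}) ~= {}"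
 proof (rule sphere_nest)
  fix q
  show "closed (c (q + j) 0 Int (f ^^ j) -` {y})"
   using c_closed(1)[of "q + j" 0] long[of "q + j"] closed_vimage[OF closed_singleton cf] by (intro closed_Int) auto
  have "y \<in> (f ^^ j) ` c (q + j) 0" using y[of "q + j"] c_image[of "q + j" j] long[of "q + j"] by simp
  thus "c (q + j) 0 Int (f ^^ j) -` {y} ~= {}" by blast
  show "c (q + j) 0 Int (f ^^ j) -` {y} \<subseteq> c (m + j) 0 Int (f ^^ j) -` {y}" if "m <= q" for m
   using c_mono[of "m + j" "q + j" 0] that by auto
 qed
 then obtain x where x: "x \<in> (\<Inter>q. c (q + j) 0 Int (f ^^ j) -` {y})" unfolding ex_in_conv[symmetric] by (erule exE)
 have "x \<in> c q 0" for q using x c_mono[of q "q + j" 0] by auto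
 thus ?thesis unfolding E_def using x by auto
qed

lemma E_closed: "closed (E j)" and E_connected: "connected (E j)" and u_E: "u \<in> E 0" "v \<in> E 0" and E_ne: "E j ~= {}"
proof -
 have cf: "continuous_on S (f ^^ j)" for S using continuous_on_funpow_sphere[OF cont] .
 have cl: "closed (c q 0)" "connected (c q 0)" for q using c_closed[of q 0] long[of q] by auto
 have "closed (\<Inter>q. c q 0)" using cl by auto
 thus "closed (E j)" unfolding E_def
  using compact_continuous_image[OF cf] compact_sphere_iff by blast
 have "connected (\<Inter>q. c q 0)" by (rule connected_nest_sphere[OF cl]) (rule c_mono, auto)
 thus "connected (E j)" unfolding E_def by (rule connected_continuous_image[OF cf])
 show "u \<in> E 0" "v \<in> E 0" using uv by (auto simp: E_def c_def)
 thus "E j ~= {}" by (auto simp: E_def)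
qed

lemma E_interior: "interior (E j) Int julia_set f = {}"
proof (rule omitting_fatou[OF open_interior, of 1])
 fix l :: nat assume l: "1 <= l"
 define q where "q = j + l"
 have le: "n q + (j + l) <= s q" using long[of q] by (simp add: q_def)
 have "(f ^^ l) ` interior (E j) \<subseteq> E (j + l)" unfolding E_add[symmetric] using interior_subset by blast
 hence "(f ^^ l) ` interior (E j) Int Y q (n q + (j + l)) = {}" using E_sub[OF le] by (auto simp: c_def)
 moreover have "Y q (n q + (j + l)) Int CV ~= {}" using run_meets[OF run[of q], of "n q + (j + l)"] le l by simp
 moreover have "K (n q + (j + l)) Int CV = {}" using L nL[of q] by simp
 ultimately show "EX i. EX Z:discs i. K i Int CV = {} & Z Int CV ~= {} & (f ^^ l) ` interior (E j) Int Z = {}"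
  using Yd[OF le] by blast
qed

text \<open>Near a point of \<open>E j\<close> that is not interior there are points outside some
  \<open>c q j\<close>, so a connected neighbourhood crosses the frontier of a disc, which consists
  of Julia points.\<close>

lemma E_boundary: "E j - interior (E j) \<subseteq> julia_set f"
proof
 fix x assume x: "x \<in> E j - interior (E j)"
 have "x \<in> closure (julia_set f)" unfolding closure_iff_nhds_not_empty
 proof (intro allI impI)
  fix A V assume V: "V \<subseteq> A" "open V" "x \<in> V"
  obtain T where T: "open T" "connected T" "x \<in> T" "T \<subseteq> V" using connected_nbhd[OF V(2,3)] by blast
  have "~ T \<subseteq> E j" using x T interior_maximal[OF _ T(1), of "E j"] by blast
  then obtain y where y: "y \<in> T" "y ~: E j" by blast
  then obtain q where q: "j <= q" "y ~: c q j" using E_I by blast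
  have le: "n q + j <= s q" using long[of q] q by simp
  have "x ~: Y q (n q + j)" "y \<in> Y q (n q + j)" using E_sub[OF le] x q by (auto simp: c_def)
  hence "T Int frontier (Y q (n q + j)) ~= {}" using connected_Int_frontier[OF T(2)] T(3) y(1) by blast
  hence "T Int K (n q + j) ~= {}" using disc(5)[OF Yd[OF le]] by blast
  thus "julia_set f Int A ~= {}" using K_sub[of "n q + j"] T(4) V(1) by blast
 qed
 thus "x \<in> julia_set f" using closed_julia by (simp add: closure_closed)
qed

text \<open>For late \<open>q'\<close> the complements in the two chains meet and do not cover,
  hence are nested; \<open>i\<close> and \<open>j\<close> are positive so that
  \<open>no_cover\<close> applies. If \<open>c q j\<close> were always the smaller one, it would lie
  in \<open>E i\<close>, and a Julia component in its interior would contradict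
  \<open>E_interior\<close>.\<close>

lemma E_subset:
 assumes ij: "i >= 1" "j >= 1" and m: "E i Int E j ~= {}"
 shows "E i \<subseteq> E j"
proof
 fix x assume x: "x \<in> E i"
 show "x \<in> E j"
 proof (rule E_I)
  fix q assume q: "q >= j"
  have le: "n q + j <= s q" using long[of q] q by simp
  define M where "M = Suc (n q + j + i)"
  have ex: "EX q'>=M. c q' i \<subseteq> c q j"
  proof (rule ccontr)
   assume no: "~ ?thesis"
   have sub: "c q j \<subseteq> c q' i" if q': "q' >= M" for q'
   proof -
    have le': "n q' + i <= s q'" "n q' + i ~= n q + j" using long[of q'] nq[of q'] q' by (auto simp: M_def)
    have "c q' i Un c q j ~= UNIV" unfolding c_def
     by (rule no_cover[OF run run _ _ refl]) (use le le' ij in auto)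
    moreover have "c q' i Int c q j ~= {}" using m E_sub[OF le] E_sub[OF le'(1)] by blast
    ultimately show ?thesis
     using disc_complements_cases[OF contK contK K_disjoint[OF le'(2)] Yd[OF le'(1)] Yd[OF le]] no q'
     unfolding c_def by blast
   qed
   have "c q j \<subseteq> E i"
   proof
    fix y assume y: "y \<in> c q j"
    show "y \<in> E i"
    proof (rule E_I)
     fix q' assume "q' >= i"
     thus "y \<in> c q' i" using sub[of "max M q'"] c_mono[of q' "max M q'" i] y by auto
    qed
   qed
   hence "c q j - K (n q + j) \<subseteq> interior (E i)"
    using interior_maximal[OF _ run_interior[OF Yd[OF le]]] unfolding c_def by blast
   moreover have "K (n (Suc q) + j) \<subseteq> c q j - K (n q + j)"
   proof -
    have "K (n (Suc q) + j) \<subseteq> c (Suc q) j" unfolding c_def using disc(9)[OF Yd] long[of "Suc q"] q by simp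
    thus ?thesis using c_nest[of q "Suc q" j] q by blast
   qed
   ultimately show False using E_interior[of i] K_sub[of "n (Suc q) + j"] K_ne[of "n (Suc q) + j"] by blast
  qed
  then obtain q' where q': "q' >= M" "c q' i \<subseteq> c q j" by blast
  have "n q' + i <= s q'" using long[of q'] q'(1) by (simp add: M_def)
  thus "x \<in> c q j" using E_sub[of q' i] x q'(2) by blast
 qed
qed

text \<open>If the sets \<open>E j\<close> repeated, finitely many points would meet them all. In a
  late chain the disc around \<open>E\<close> and the disc \<open>Y'\<close> are then the two discs
  allowed by \<open>separation\<close>, which forces \<open>X'\<close> to be the disc around
  \<open>E\<close>, back to the later of the times \<open>a'\<close> and \<open>n'\<close>. There,
  either two hot discs are one too many or \<open>X'\<close> contains the critical value
  \<open>u\<close>.\<close>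

lemma E_periodic_False:
 assumes ij: "i < j" "E i = E j"
 shows False
proof -
 define pt where "pt l = (SOME x. x \<in> E l)" for l
 have pt: "pt l \<in> E l" for l unfolding pt_def using E_ne[of l] some_in_eq by blast
 have red: "EX l'<j. E l = E l'" for l
 proof (induction l rule: less_induct)
  case (less l)
  show ?case
  proof (cases "l < j")
   case False
   have "E l = (f ^^ (l - j)) ` E j" unfolding E_add using False by simp
   also have "... = E (i + (l - j))" unfolding ij(2)[symmetric] E_add ..
   finally show ?thesis using less[of "i + (l - j)"] False ij(1) by auto
  qed blast
 qed
 define PT where "PT = pt ` {..<j}"
 have hit: "E l Int PT ~= {}" for l using red[of l] pt unfolding PT_def by blast
 define P where "P = PT Un f -` PT Un (CV Un f -` CV)"
 have "finite PT" by (simp add: PT_def)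
 hence "finite P" unfolding P_def using finite_pre[of _ 1] CV(1) by simp
 from separation[OF this] obtain N where N0: "ALL n>=N. ALL X:discs n. ALL Y:discs n. ALL Z:discs n.
  X Int P ~= {} --> Y Int P ~= {} --> Z Int P ~= {} --> X = Y | Y = Z | X = Z" by (erule exE)
 note N = N0[rule_format]
 define n' s' a' Y' X' where defs: "n' = n N" "s' = s N" "a' = a N" "Y' = Y N" "X' = X N"
 have r: "run n' s' Y'" and w: "wit N L n' s' Y' a' X'" using run wit by (auto simp: defs)
 have nN: "N <= n'" "N <= a'" "a' <= s'" "n' <= s'" using nq[of N] aq[of N] long[of N] by (auto simp: defs)
 have X: "X' i \<in> discs i" "X' i Int CV = {}" if "a' <= i" "i <= s'" for i using w that unfolding wit_def by blast+
 have Xn: "nxt i (X' i) = X' (Suc i)" if "a' <= i" "i < s'" for i using w that unfolding wit_def by blast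
 have Xl: "nxt s' (X' s') Int CV ~= {}" using w unfolding wit_def by blast
 define B where "B i = (SOME D. D \<in> discs i & E (i - n') \<subseteq> D)" for i
 have Esub: "E (i - n') \<subseteq> - Y' i - K i" if "n' <= i" "i <= s'" for i
  using E_sub[of N "i - n'"] that by (simp add: defs c_def)
 have B: "B i \<in> discs i" "E (i - n') \<subseteq> B i" if i: "n' <= i" "i <= s'" for i
 proof -
  have "EX D. D \<in> discs i & E (i - n') \<subseteq> D"
   using component_containing[OF E_connected _ E_ne, of "i - n'" "- K i"] Esub[OF i] by blast
  from someI_ex[OF this] show "B i \<in> discs i" "E (i - n') \<subseteq> B i" by (auto simp: B_def)
 qed
 have BP: "B i Int P ~= {}" if "n' <= i" "i <= s'" for i using B(2)[OF that] hit[of "i - n'"] unfolding P_def by blast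
 have BY: "B i ~= Y' i" if "n' <= i" "i <= s'" for i using B(2)[OF that] Esub[OF that] E_ne[of "i - n'"] by blast
 have Y: "Y' i \<in> discs i" "Y' i Int P ~= {}" if i: "n' <= i" "i <= s'" for i
 proof -
  show d: "Y' i \<in> discs i" using run_disc(1)[OF r i] .
  show "Y' i Int P ~= {}"
  proof (cases "i = s'")
   case True
   hence "CV \<subseteq> Y' i" using r by (simp add: run_def)
   moreover have "CV ~= {}" using uv(2) by blast
   ultimately show ?thesis unfolding P_def by blast
  next
   case False
   hence "i < s'" using i by simp
   have "Y' (Suc i) \<subseteq> f ` Y' i" using nxt(2)[OF d] run_disc(3)[OF r i `i < s'`] by simp
   moreover have "Y' (Suc i) Int CV ~= {}" using run_meets[OF r, of "Suc i"] i `i < s'` by simp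
   ultimately show ?thesis unfolding P_def by blast
  qed
 qed
 obtain v0 where v0: "v0 \<in> CV" using uv(2) by blast
 have XY: "X' i ~= Y' i" if "a' <= i" "n' <= i" "i <= s'" for i using that(3,1,2)
 proof (induction rule: inc_induct)
  case base
  have "v0 \<in> Y' s'" using r v0 by (auto simp: run_def)
  thus ?case using X(2)[of s'] nN v0 by auto
 next
  case (step i)
  thus ?case using Xn[of i] run_disc(3)[OF r, of i] by auto
 qed
 have key: "X' i = B i" if i: "a' <= i" "n' <= i" "i <= s'" and m: "X' i Int P ~= {}" for i
 proof -
  have "N <= i" using nN i by simp
  from N[OF this X(1)[OF i(1,3)] Y(1)[OF i(2,3)] B(1)[OF i(2,3)] m Y(2)[OF i(2,3)] BP[OF i(2,3)]]
  show ?thesis using XY[OF i] BY[OF i(2,3)] by metis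
 qed
 \<comment> \<open>Backwards in time: the image of \<open>X' i\<close> is the disc around the next
   \<open>E\<close>, so \<open>X' i\<close> contains a preimage of a point of
   \<open>PT\<close>.\<close>
 have XB: "X' i = B i" if "a' <= i" "n' <= i" "i <= s'" for i using that(3,1,2)
 proof (induction rule: inc_induct)
  case base
  have "nxt s' (X' s') \<subseteq> f ` X' s'" using nxt(2)[OF X(1)[of s']] nN by simp
  hence "X' s' Int P ~= {}" using Xl unfolding P_def by blast
  thus ?case using key nN by simp
 next
  case (step i)
  have eq: "X' (Suc i) = B (Suc i)" using step by simp
  have fX: "f ` X' i = X' (Suc i)"
   using link_other(1)[OF covK run_disc(2)[OF r, of i] X(1)[of i] XY[of i]] Xn[of i] step by (simp add: nxt_def)
  obtain y where y: "y \<in> E (Suc i - n')" "y \<in> PT" using hit[of "Suc i - n'"] by blast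
  hence "y \<in> f ` X' i" using B(2)[of "Suc i"] step unfolding fX eq by auto
  then obtain x where "x \<in> X' i" "f x \<in> PT" using y(2) by auto
  hence "X' i Int P ~= {}" unfolding P_def by blast
  thus ?case using key[of i] step by simp
 qed
 show False
 proof (cases "n' <= a'")
  case True
  obtain A1 A2 where A: "A1 \<in> discs a'" "A2 \<in> discs a'" "A1 ~= A2" "X' a' ~= A1" "X' a' ~= A2" "hot a' A1" "hot a' A2"
   using w unfolding wit_def by blast
  have m: "A1 Int P ~= {}" "A2 Int P ~= {}" using hot_meets[OF A(1,6)] hot_meets[OF A(2,7)] unfolding P_def by blast+
  have "X' a' Int P ~= {}" using XB[of a'] BP[of a'] True nN by simp
  from N[OF nN(2) X(1)[OF order_refl nN(3)] A(1,2) this m] show False using A by metis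
 next
  case False
  hence "u \<in> X' n'" using XB[of n'] B(2)[of n'] u_E nN by auto
  thus False using X(2)[of n'] False nN uv(2) by auto
 qed
qed

lemma E_disjoint: "1 <= i ==> 1 <= j ==> i ~= j ==> E i Int E j = {}"
proof (rule ccontr)
 assume ij: "1 <= i" "1 <= j" "i ~= j" "E i Int E j ~= {}"
 hence e: "E i = E j" using E_subset[of i j] E_subset[of j i] by (simp add: Int_commute subset_antisym)
 thus False using E_periodic_False[of i j] E_periodic_False[of j i] ij(3) by (cases i j rule: linorder_cases) auto
qed

text \<open>The disjoint sets \<open>E j\<close> finally miss the critical values, so
  \<open>f\<close> is injective on them, and an interior would be a wandering open set.\<close>

lemma E_interior_empty: "interior (E 0) = {}"
proof -
 have "finite {j. E (Suc j) Int CV ~= {}}"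
 proof -
  define w where "w j = (SOME x. x \<in> E (Suc j) Int CV)" for j
  have w: "w j \<in> E (Suc j) Int CV" if "j \<in> {j. E (Suc j) Int CV ~= {}}" for j
   using that some_in_eq[of "E (Suc j) Int CV"] by (simp add: w_def)
  have "inj_on w {j. E (Suc j) Int CV ~= {}}"
  proof (rule inj_onI)
   fix i j assume ij: "i \<in> {j. E (Suc j) Int CV ~= {}}" "j \<in> {j. E (Suc j) Int CV ~= {}}" "w i = w j"
   thus "i = j" using w[OF ij(1)] w[OF ij(2)] E_disjoint[of "Suc i" "Suc j"] by auto
  qed
  moreover have "w ` {j. E (Suc j) Int CV ~= {}} \<subseteq> CV" using w by blast
  ultimately show ?thesis using CV(1) inj_on_finite by blast
 qed
 then obtain M where M: "!!j. j \<in> {j. E (Suc j) Int CV ~= {}} ==> j < M" unfolding finite_nat_set_iff_bounded by blast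
 define j0 where "j0 = Suc M"
 have ncv: "E (Suc j) Int CV = {}" if "j >= j0" for j
 proof (rule ccontr)
  assume "E (Suc j) Int CV ~= {}"
  thus False using M[of j] that by (simp add: j0_def)
 qed
 have inj1: "inj_on f (E j)" if j: "j >= j0" for j
 proof -
  \<comment> \<open>The finitely many critical values already miss some \<open>c q (Suc j)\<close>
    in the nested intersection, and there the link provides injectivity.\<close>
  have "EX q>=Suc j. x ~: c q (Suc j)" if "x \<in> CV" for x using ncv[OF j] E_I[of "Suc j" x] that by blast
  then obtain qf where qf: "!!x. x \<in> CV ==> Suc j <= qf x & x ~: c (qf x) (Suc j)" by metis
  define q where "q = Max (qf ` CV)"
  have qge: "qf x <= q" if "x \<in> CV" for x unfolding q_def using CV(1) that by simp
  have qj: "Suc j <= q" using qge[OF uv(2)] qf[OF uv(2)] by simp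
  have "c q (Suc j) Int CV = {}"
  proof (rule ccontr)
   assume "c q (Suc j) Int CV ~= {}"
   then obtain x where "x \<in> c q (Suc j)" "x \<in> CV" by blast
   thus False using c_mono[of "qf x" q "Suc j"] qf[of x] qge[of x] by blast
  qed
  moreover have "link (K (n q + j)) (Y q (n q + j)) (Y q (Suc (n q + j)))"
   using run_disc(2)[OF run[of q], of "n q + j"] long[of q] qj by simp
  ultimately have "inj_on f (c q j)" unfolding link_def c_def by simp
  thus ?thesis using E_sub[of q j] long[of q] qj inj_on_subset by (metis Diff_subset add_left_mono order_trans Suc_leD)
 qed
 have injl: "inj_on (f ^^ l) (E j0)" for l
 proof (induction l)
  case (Suc l)
  hence "inj_on (f o (f ^^ l)) (E j0)" using inj1[of "j0 + l"] by (intro comp_inj_on) (simp_all add: E_add)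
  thus ?case by (simp only: funpow.simps)
 qed simp
 have "interior (E j0) = {}"
 proof (rule ccontr)
  assume ne: "interior (E j0) ~= {}"
  show False
  proof (rule no_wandering[OF rat d2 open_interior ne])
   show "inj_on (f ^^ l) (interior (E j0))" for l using injl interior_subset inj_on_subset by blast
   show "(f ^^ i) ` interior (E j0) Int (f ^^ j) ` interior (E j0) = {}" if "i ~= j" for i j
   proof -
    have *: "(f ^^ l) ` interior (E j0) \<subseteq> E (j0 + l)" for l unfolding E_add[symmetric] by (intro image_mono interior_subset)
    have "E (j0 + i) Int E (j0 + j) = {}" using E_disjoint[of "j0 + i" "j0 + j"] that by (simp add: j0_def)
    thus ?thesis using *[of i] *[of j] by blast
   qed
   have "closure (interior (E j0)) \<subseteq> E j0" using closure_minimal[OF interior_subset E_closed] .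
   thus "closure (interior (E j0)) \<subseteq> interior (E j0) Un julia_set f" using E_boundary[of j0] by blast
  qed (rule E_interior)
 qed
 moreover have "open ((f ^^ j0) ` interior (E 0))"
 proof -
  have "open ((f ^^ l) ` interior (E 0))" for l
   by (induction l) (simp, unfold image_funpow_Suc, rule rational_open[OF rat d1])
  thus ?thesis .
 qed
 moreover have "(f ^^ j0) ` interior (E 0) \<subseteq> E j0" using E_add[of j0 0] interior_subset[of "E 0"] by auto
 ultimately have "(f ^^ j0) ` interior (E 0) = {}" using interior_maximal by blast
 thus ?thesis by blast
qed

text \<open>The Julia component around \<open>E 0\<close> would, on leaving some
  \<open>c q 0\<close>, cross the frontier of a disc and be one of the \<open>K n\<close>, which are
  disjoint from \<open>E 0\<close>. The complement is connected as a union of discs that share the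
  initial one.\<close>

lemma full_limit: "wandering_julia_component f (E 0)" "full (E 0)"
proof -
 have EJ: "E 0 \<subseteq> julia_set f" using E_boundary[of 0] E_interior_empty by simp
 obtain D where D: "D \<in> components (julia_set f)" "E 0 \<subseteq> D"
  using component_containing[OF E_connected EJ E_ne] by blast
 have "D \<subseteq> c q 0" for q
 proof (rule ccontr)
  assume n: "~ D \<subseteq> c q 0"
  have le: "n q + 0 <= s q" using long[of q] by simp
  have "D Int frontier (Y q (n q + 0)) ~= {}"
   using connected_Int_frontier[OF in_components_connected[OF D(1)], of "Y q (n q + 0)"] n D(2) E_sub[OF le] E_ne[of 0]
   unfolding c_def by blast
  then obtain x where "x \<in> D" "x \<in> K (n q + 0)" using disc(5)[OF Yd[OF le]] by blast
  hence "D = K (n q + 0)" using disc_eqI[OF D(1) K_julia] by blast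
  thus False using D(2) E_sub[OF le] E_ne[of 0] by blast
 qed
 hence "D = E 0" using D(2) unfolding E_def by auto
 hence comp: "julia_component f (E 0)" using D(1) by (simp add: julia_component_def)
 have "~ finite (range (%n. (f ^^ n) ` E 0))"
 proof
  assume fin: "finite (range (%n. (f ^^ n) ` E 0))"
  have "inj (%j. E (Suc j))"
  proof (rule injI)
   fix i j assume "E (Suc i) = E (Suc j)"
   thus "i = j" using E_disjoint[of "Suc i" "Suc j"] E_ne[of "Suc i"] by auto
  qed
  moreover have "range (%j. E (Suc j)) \<subseteq> range (%n. (f ^^ n) ` E 0)" using E_add[of _ 0] by auto
  ultimately show False using finite_subset[OF _ fin] finite_imageD[of "%j. E (Suc j)" UNIV] by auto
 qed
 thus "wandering_julia_component f (E 0)" using comp by (simp add: wandering_julia_component_def eventually_periodic_def)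
 have "- E 0 = (\<Union>q. Y q (n q))" unfolding E_def c_def by auto
 moreover have "connected (\<Union>q. Y q (n q))"
 proof (rule connected_Union)
  have le: "n q + 0 <= s q" for q using long[of q] by simp
  show "connected T" if "T \<in> range (%q. Y q (n q))" for T using that disc(2)[OF Yd[OF le]] by auto
  have "Y 0 (n 0) \<subseteq> Y q (n q)" for q using c_mono[of 0 q 0] by (auto simp: c_def)
  moreover have "Y 0 (n 0) ~= {}" using disc(3)[OF Yd[OF le[of 0]]] by simp
  ultimately show "\<Inter> (range (%q. Y q (n q))) ~= {}" by blast
 qed
 ultimately show "full (E 0)" unfolding full_def using compact_sphere_iff E_closed by simp
qed

end

section \<open>Choice of subsequences and the final contradiction\<close>

lemma increasing_subsequence:
 fixes n :: "nat => nat"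
 assumes G: "infinite G" and n: "!!M. finite {k\<in>G. n k <= M}"
 shows "EX r :: nat => nat. strict_mono r & (ALL i. r i \<in> G) & strict_mono (%i. n (r i))"
proof -
 have "EX k'. k' \<in> G & k < k' & n k < n k'" for k
 proof -
  have "finite ({k'\<in>G. n k' <= n k} Un {..k})" using n by simp
  hence "~ G \<subseteq> {k'\<in>G. n k' <= n k} Un {..k}" using G finite_subset by blast
  thus ?thesis by auto
 qed
 moreover obtain k0 where "k0 \<in> G" using G by (metis finite.emptyI ex_in_conv)
 ultimately have "EX r :: nat => nat. ALL i. r i \<in> G & (r i < r (Suc i) & n (r i) < n (r (Suc i)))"
  by (intro dependent_nat_choice) blast+
 then obtain r where r: "!!i. r i \<in> G" "!!i. r i < r (Suc i)" "!!i. n (r i) < n (r (Suc i))" by blast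
 show ?thesis by (rule exI[of _ r]) (use r in "auto simp: strict_mono_Suc_iff")
qed

text \<open>Ramsey's theorem for pairs, coloured by whether \<open>D\<close> holds from the smaller
  to the larger element.\<close>

lemma monochromatic_subsequence:
 obtains e :: "nat => nat" where "strict_mono e" "(ALL i j. i < j --> D (e i) (e j)) | (ALL i j. i < j --> ~ D (e i) (e j))"
proof -
 define col where "col S = (if D (Min S) (Max S) then 0 else 1::nat)" for S :: "nat set"
 have "EX H t. H \<subseteq> UNIV & infinite H & t < 2 & (ALL x:H. ALL y:H. x ~= y --> col {x, y} = t)"
  by (rule Ramsey2) (auto simp: col_def)
 then obtain H t where "H \<subseteq> UNIV & infinite H & t < 2 & (ALL x:H. ALL y:H. x ~= y --> col {x, y} = t)"
  by (elim exE)
 hence H: "infinite H" "ALL x:H. ALL y:H. x ~= y --> col {x, y} = t" by auto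
 define e where "e = enumerate H"
 have e: "strict_mono e" "!!i. e i \<in> H" unfolding e_def using H(1) by (auto simp: strict_mono_enumerate enumerate_in_set)
 have "D (e i) (e j) \<longleftrightarrow> t = 0" if "i < j" for i j
 proof -
  have lt: "e i < e j" using e(1) that by (simp add: strict_monoD)
  hence "Min {e i, e j} = e i" "Max {e i, e j} = e j" by auto
  moreover have "col {e i, e j} = t" using H(2) e(2) lt by simp
  ultimately show ?thesis by (auto simp: col_def split: if_splits)
 qed
 hence "(ALL i j. i < j --> D (e i) (e j)) | (ALL i j. i < j --> ~ D (e i) (e j))"
  by (cases "t = 0") auto
 thus ?thesis using that[OF e(1)] by simp
qed

text \<open>By \<open>bounded_runs_False\<close> the initial times tend to infinity, so almost all
  chains stop because of two critical values. Some pair \<open>u\<close>, \<open>v\<close> recurs;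
  complements containing it are nested, and Ramsey makes the nesting monotone. Decreasing
  complements give the forbidden full component, increasing ones a Julia component in the Fatou
  set.\<close>

lemma (in bad_orbit) impossible:
 assumes full: "!!K. wandering_julia_component f K ==> full K ==> (\<exists>\<^sub>\<le>\<^sub>1 v. v \<in> K & critical_value f v)"
 shows False
proof -
 obtain L where L: "!!i. i >= L ==> K i Int CV = {}" using K_avoid[OF CV(1)] by blast
 have "ALL k. EX n0 s Y a X. wit k L n0 s Y a X" using wit_exists[OF L] by blast
 then obtain n s Y a X where w: "!!k. wit k L (n k) (s k) (Y k) (a k) (X k)" by metis
 have r: "run (n k) (s k) (Y k)" "n k + k <= s k" "L <= n k" "n k = L | ~ (EX v. - Y k (n k) Int CV \<subseteq> {v})" for k
  using w[of k] unfolding wit_def by blast+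
 have fin: "finite {k. n k <= M}" for M
 proof (rule ccontr)
  assume inf: "infinite {k. n k <= M}"
  have "n ` {k. n k <= M} \<subseteq> {..M}" by auto
  hence "finite (n ` {k. n k <= M})" using finite_subset by blast
  then obtain k0 where k0: "infinite {k\<in>{k. n k <= M}. n k = n k0}" using pigeonhole_infinite[OF inf] by blast
  show False
  proof (rule bounded_runs_False[where L = L, OF _ k0])
   fix k assume k: "k \<in> {k\<in>{k. n k <= M}. n k = n k0}"
   thus "run (n k0) (s k) (Y k)" using r(1)[of k] by simp
   show "k <= s k" using r(2)[of k] by simp
  qed (use L r(3) in blast)+
 qed
 \<comment> \<open>Excluding \<open>n k = L\<close> ensures that the chain stopped with two critical
   values; \<open>k >= 1\<close> gives it the positive length that \<open>no_cover\<close>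
   needs.\<close>
 define G where "G = {k. k >= 1 & n k ~= L}"
 have "- G \<subseteq> {0} Un {k. n k <= L}" by (auto simp: G_def)
 hence "finite (- G)" using fin[of L] finite_subset by blast
 hence G: "infinite G" by (metis finite_compl infinite_UNIV_nat)
 have two: "EX z. fst z ~= snd z & fst z \<in> - Y k (n k) Int CV & snd z \<in> - Y k (n k) Int CV" if "k \<in> G" for k
 proof -
  have n: "~ - Y k (n k) Int CV \<subseteq> {v}" for v using r(4)[of k] that by (auto simp: G_def)
  obtain x where x: "x \<in> - Y k (n k) Int CV" using n by blast
  obtain y where "y \<in> - Y k (n k) Int CV" "y ~= x" using n[of x] by blast
  thus ?thesis using x by (intro exI[of _ "(x, y)"]) auto
 qed
 define z where "z k = (SOME z. fst z ~= snd z & fst z \<in> - Y k (n k) Int CV & snd z \<in> - Y k (n k) Int CV)" for k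
 have z: "fst (z k) ~= snd (z k)" "fst (z k) \<in> - Y k (n k) Int CV" "snd (z k) \<in> - Y k (n k) Int CV" if "k \<in> G" for k
  using someI_ex[OF two[OF that]] unfolding z_def[symmetric] by auto
 have "z k \<in> CV \<times> CV" if "k \<in> G" for k using z[OF that] by (simp add: mem_Times_iff)
 hence "z ` G \<subseteq> CV \<times> CV" by blast
 hence "finite (z ` G)" using CV(1) finite_subset by (metis finite_cartesian_product)
 then obtain k0 where k0: "k0 \<in> G" "infinite {k\<in>G. z k = z k0}" using pigeonhole_infinite[OF G] by blast
 define u where "u = fst (z k0)"
 define v where "v = snd (z k0)"
 define G' where "G' = {k\<in>G. z k = z k0}"
 have G': "infinite G'" "!!k. k \<in> G' ==> k \<in> G" using k0 by (auto simp: G'_def)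
 have uv: "u ~= v" "u \<in> CV" "v \<in> CV" using z[OF k0(1)] by (auto simp: u_def v_def)
 have uvY: "u \<in> - Y k (n k)" "v \<in> - Y k (n k)" if "k \<in> G'" for k
  using z[of k] that by (auto simp: G'_def u_def v_def)
 obtain g :: "nat => nat" where g: "strict_mono g" "!!i. g i \<in> G'" "strict_mono (%i. n (g i))"
 proof -
  have "finite {k\<in>G'. n k <= M}" for M by (rule finite_subset[OF _ fin[of M]]) auto
  from increasing_subsequence[OF G'(1) this] show ?thesis using that by blast
 qed
 define C where "C i = - Y (g i) (n (g i))" for i
 have Yd: "Y (g i) (n (g i)) \<in> discs (n (g i))" for i using run_disc(1)[OF r(1) order_refl] r(1)[of "g i"] by (simp add: run_def)
 have dich: "C j \<subseteq> C i - K (n (g i)) | C i \<subseteq> C j - K (n (g j))" if ij: "i < j" for i j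
 proof -
  have ne: "n (g i) ~= n (g j)" using strict_monoD[OF g(3) ij] by simp
  have pos: "g i >= 1" "g j >= 1" using G'(2)[OF g(2)] by (auto simp: G_def)
  have "C i Un C j ~= UNIV" unfolding C_def
   by (rule no_cover[OF r(1) r(1) order_refl order_refl refl]) (use r(2)[of "g i"] r(2)[of "g j"] pos in auto)
  moreover have "C i Int C j ~= {}" using uvY(1)[OF g(2)] by (auto simp: C_def)
  ultimately show ?thesis using disc_complements_cases[OF contK contK K_disjoint[OF ne] Yd Yd] unfolding C_def by blast
 qed
 obtain e :: "nat => nat" where e: "strict_mono e"
  "(ALL i j. i < j --> C (e j) \<subseteq> C (e i) - K (n (g (e i)))) | (ALL i j. i < j --> ~ C (e j) \<subseteq> C (e i) - K (n (g (e i))))"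
  using monochromatic_subsequence[of "%i j. C j \<subseteq> C i - K (n (g i))"] by metis
 define h where "h i = g (e i)" for i
 have h: "strict_mono h" "strict_mono (%i. n (h i))" "!!i. h i \<in> G'" "!!i. i <= h i"
 proof -
  show "strict_mono h" unfolding h_def using strict_mono_o[OF g(1) e(1)] by (simp add: o_def)
  thus "!!i. i <= h i" by (rule seq_suble)
  show "strict_mono (%i. n (h i))" unfolding h_def using strict_mono_o[OF g(3) e(1)] by (simp add: o_def)
  show "!!i. h i \<in> G'" unfolding h_def using g(2) by blast
 qed
 from e(2) show False
 proof
  assume dec: "ALL i j. i < j --> C (e j) \<subseteq> C (e i) - K (n (g (e i)))"
  interpret N: nested_runs f d K0 L "%i. n (h i)" "%i. s (h i)" "%i. a (h i)" "%i. Y (h i)" "%i. X (h i)" u v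
  proof
   show "wit q L (n (h q)) (s (h q)) (Y (h q)) (a (h q)) (X (h q))" for q using wit_mono[OF w h(4)] .
   show "- Y (h q') (n (h q')) \<subseteq> - Y (h q) (n (h q)) - K (n (h q))" if "q < q'" for q q'
    using dec that by (simp add: C_def h_def)
  qed (use L h uv uvY in auto)
  have "\<exists>\<^sub>\<le>\<^sub>1 v. v \<in> N.E 0 & critical_value f v" using full N.full_limit by blast
  thus False using uv N.u_E critical_value_iff[OF rat] unfolding Uniq_def by blast
 next
  assume "ALL i j. i < j --> ~ C (e j) \<subseteq> C (e i) - K (n (g (e i)))"
  hence inc: "C (e i) \<subseteq> C (e j) - K (n (h j))" if "i < j" for i j
   using dich[OF strict_monoD[OF e(1) that]] that unfolding h_def by blast
  define Q where "Q = C (e 1) - K (n (h 1))"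
  have Qo: "open Q" unfolding Q_def C_def h_def using run_interior[OF Yd] .
  have "Q Int julia_set f = {}"
  proof (rule omitting_fatou[OF Qo, of 1])
   fix l :: nat assume l: "1 <= l"
   define k where "k = h (Suc l)"
   have lk: "l <= k" using h(4)[of "Suc l"] by (simp add: k_def)
   have le: "n k + l <= s k" using r(2)[of k] lk by simp
   have "Q \<subseteq> - Y k (n k)" using inc[of 1 "Suc l"] l unfolding Q_def by (auto simp: C_def k_def h_def)
   hence "(f ^^ l) ` Q \<subseteq> - Y k (n k + l)"
    using run_image(1)[OF r(1) order_refl le] by blast
   moreover have "Y k (n k + l) \<in> discs (n k + l)" using run_disc(1)[OF r(1) _ le] by simp
   moreover have "Y k (n k + l) Int CV ~= {}" using run_meets[OF r(1) _ le] l by simp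
   moreover have "K (n k + l) Int CV = {}" using L r(3)[of k] by simp
   ultimately show "EX i. EX Z:discs i. K i Int CV = {} & Z Int CV ~= {} & (f ^^ l) ` Q Int Z = {}" by blast
  qed
  moreover have "K (n (h 0)) \<subseteq> Q"
   using inc[of 0 1] disc(9)[OF Yd[of "e 0"]] unfolding Q_def C_def h_def by auto
  ultimately show False using K_sub[of "n (h 0)"] K_ne[of "n (h 0)"] by blast
 qed
qed

theorem theorem2p1:
  fixes f :: "riemann_sphere \<Rightarrow> riemann_sphere" and d :: nat
  assumes "rational_map_of_degree f d" and "d \<ge> 2"
    and "\<not> connected (julia_set f)"
    and "\<And>K. wandering_julia_component f K \<Longrightarrow> full K \<Longrightarrow>
           (\<exists>\<^sub>\<le>\<^sub>1 v. v \<in> K \<and> critical_value f v)"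
  shows "\<forall>K. wandering_julia_component f K \<longrightarrow>
           (\<forall>\<^sub>F n in sequentially.
              finite (components (- (f ^^ n) ` K)) \<and> card (components (- (f ^^ n) ` K)) \<le> 2)"
proof (intro allI impI)
 fix K0 assume w: "wandering_julia_component f K0"
 interpret W: wandering_orbit f d K0 by unfold_locales (use assms(1,2) w in auto)
 show "\<forall>\<^sub>F n in sequentially.
   finite (components (- (f ^^ n) ` K0)) & card (components (- (f ^^ n) ` K0)) <= 2"
 proof (rule ccontr)
  assume "~ ?thesis"
  \<comment> \<open>Three discs at arbitrarily late times give three discs at all times.\<close>
  hence "!!N. EX n>=N. many (W.K n)" unfolding eventually_sequentially many_def W.K_def by blast
  hence "bad_orbit f d K0" by unfold_locales (rule W.many_all)
  thus False using assms(4) by (rule bad_orbit.impossible)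
 qed
qed

end
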